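(* Let $p>0$ be a prime and let $R$ be a Noetherian, $F$-finite, normal local domain of characteristic $p$ and dimension $d$. Let $\Delta$ be an effective $\mathbb{Q}$-divisor on $X=\operatorname{Spec} R$, and let $D$ be an irreducible, reduced $\mathbb{Q}$-Cartier divisor on $X$ which is not a component of $\Delta$. Assume that the pair $(R,\Delta+D)$ is log $\mathbb{Q}$-Gorenstein, i.e. $K_X+\Delta+D$ is $\mathbb{Q}$-Cartier. Then $$s(R,\Delta)\ \geq\ s(\mathcal{O}_D,\operatorname{Diff}_D(\Delta)),$$ with equality if and only if the function $t\mapsto s(R,\Delta+tD)$ is linear on the interval $[0,1]$ with slope $-s(R,\Delta)$. Here $s$ denotes the $F$-signature and $\operatorname{Diff}_D(\Delta)$ is the different of $\Delta$ on $D$.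
   Context: Notation. $F^e_*M$ is the restriction of scalars of an $R$-module $M$ along the $e$-th Frobenius $F^e:R\to R$, $r\mapsto r^{p^e}$. $R$ is $F$-finite if $F_*R$ is a finite $R$-module. $K_X$ is a canonical divisor of $X$. $\mathcal{O}_D=R/\mathfrak{p}$, where $\mathfrak{p}$ is the height one prime defining $D$. A (real or rational) divisor is $\mathbb{Q}$-Cartier if some positive integer multiple is an integral Cartier divisor. $F$-signature. Let $(S,\mathfrak{n})$ be an $F$-finite normal local domain of characteristic $p$ and dimension $\delta$, and let $B$ be an effective divisor on $\operatorname{Spec} S$ with rational or real coefficients. For $e\ge 1$ put $$I_e^{B}=\{r\in S:\ \phi(F^e_*r)\in\mathfrak{n}\ \text{ for all } \phi\in \operatorname{Hom}_S(F^e_*S(\lceil (p^e-1)B\rceil),S)\},$$ where such $\phi$ are regarded as maps $F^e_*S\to S$ by restriction. The $F$-signature is $s(S,B)=\lim_{e\to\infty} p^{-e\delta}\,\ell_S(S/I_e^{B})$; the limit exists. If $D$ is normal, $s(\mathcal{O}_D,\operatorname{Diff}_D(\Delta))$ is the $F$-signature just defined, with $S=\mathcal{O}_D$ and $B=\operatorname{Diff}_D(\Delta)$. If $D$ is not normal, $s(\mathcal{O}_D,\operatorname{Diff}_D(\Delta))$ is $0$: positive $F$-signature characterizes strong $F$-regularity, and strongly $F$-regular rings are normal. The different. Let $m\ge1$ be such that $m(K_X+\Delta+D)$ is Cartier, and let $\nu:D'\to D$ be the normalization (so $D'=D$ if $D$ is normal). Let $Z\subsetneq D$ be the union of the non-regular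 locus of $D$, the intersection of $D$ with the non-regular locus of $X$, and $D\cap\operatorname{Supp}\Delta$. On $D\setminus Z$ the Poincaré residue gives an isomorphism $\omega_X(D)|_{D\setminus Z}\cong\omega_D|_{D\setminus Z}$. Since $\nu$ is an isomorphism over $D\setminus Z$, taking reflexive $m$-th powers gives an isomorphism $$\mathcal{R}^m_D:\ \nu^*\big(\omega_X^{[m]}(mD+m\Delta)\big)\big|_{D'\setminus \nu^{-1}(Z)}\ \cong\ \omega_{D'}^{[m]}\big|_{D'\setminus \nu^{-1}(Z)},$$ where $\mathcal{F}^{[m]}=(\mathcal{F}^{\otimes m})^{**}$. On the regular locus $D'_{reg}$ of $D'$ both $\nu^*(\omega_X^{[m]}(mD+m\Delta))$ and $\omega_{D'}^{[m]}$ are invertible, so there is a unique divisor $\Delta_{D'_{reg}}$ on $D'_{reg}$ such that $\mathcal{R}_D^m$ extends to an isomorphism $\nu^*(\omega_X^{[m]}(mD+m\Delta))|_{D'_{reg}}\cong\omega_{D'}^{[m]}(\Delta_{D'_{reg}})$ on $D'_{reg}$. Since $D'$ is normal, $\Delta_{D'_{reg}}$ extends uniquely to a divisor $\Delta_{D'}$ on $D'$, and the different of $\Delta$ on $D$ is $\operatorname{Diff}_D(\Delta):=\frac1m\Delta_{D'}$, a $\mathbb{Q}$-divisor on $D'$. It satisfies $(K_X+\Delta+D)|_{D'}\sim_{\mathbb{Q}}K_{D'}+\operatorname{Diff}_D(\Delta)$. When $D$ is normal and the index of $K_X+\Delta+D$ (the least $m\geq 1$ with $m(K_X+\Delta+D)$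 Cartier) is prime to $p$, this coincides with the following. For an $F$-finite normal local domain $S$ there is a bijection between effective $\mathbb{Q}$-divisors $B$ with $(p^e-1)(K_S+B)$ Cartier and nonzero elements of $\operatorname{Hom}_S(F^e_*S,S)$ modulo pre-multiplication by units: via $\operatorname{Hom}_S(F^e_*S,S)\cong F^e_*S((1-p^e)K_S)$ a map $\phi$ gives an effective divisor $D_\phi\sim(1-p^e)K_S$, and $B=\frac{1}{p^e-1}D_\phi$. If $(p^e-1)(K_X+\Delta+D)$ is Cartier and $\phi:F^e_*R\to R$ corresponds to $\Delta+D$, then $\phi(F^e_*\mathfrak{p})\subseteq\mathfrak{p}$, and $\operatorname{Diff}_D(\Delta)$ is the divisor on $D$ corresponding to the induced map $F^e_*\mathcal{O}_D\to\mathcal{O}_D$. *)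

theory Defs
  imports
    Complex_Main
    "HOL-Library.Extended_Nat"
    "HOL-Algebra.Ring_Divisibility"
    "Jordan_Normal_Form.Determinant"
begin

text \<open>
  Domains are represented as subrings S of a field type whose elements are all fractions of
  elements of S, so that the type is the fraction field of S. Localizations of S, the modules
  S(E) and the integral closure of S are then subsets of the same type.
\<close>

definition ring_of :: "'k::field set \<Rightarrow> 'k ring" where
  "ring_of S = \<lparr>carrier = S, monoid.mult = (*), one = 1, ring.zero = 0, add = (+)\<rparr>"

definition localization :: "'k::field set \<Rightarrow> 'k set \<Rightarrow> 'k set" where
  "localization S q = {a / b | a b. a \<in> S \<and> b \<in> S \<and> b \<notin> q}"

definition localization_max :: "'k::field set \<Rightarrow> 'k set \<Rightarrow> 'k set" where
  "localization_max S q = {a / b | a b. a \<in> q \<and> b \<in> S \<and> b \<notin> q}"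

definition has_fraction_field_UNIV :: "'k::field set \<Rightarrow> bool" where
  "has_fraction_field_UNIV S \<longleftrightarrow> localization S {0} = UNIV"

definition local_ring :: "'k::field set \<Rightarrow> bool" where
  "local_ring S \<longleftrightarrow> (\<exists>!M. maximalideal M (ring_of S))"

definition max_ideal :: "'k::field set \<Rightarrow> 'k set" where
  "max_ideal S = (THE M. maximalideal M (ring_of S))"

definition integral_closure :: "'k::field set \<Rightarrow> 'k set" where
  "integral_closure S = {x. \<exists>n c. (\<forall>i<n. c i \<in> S) \<and> x ^ n + (\<Sum>i<n. c i * x ^ i) = 0}"

definition normal_domain :: "'k::field set \<Rightarrow> bool" where
  "normal_domain S \<longleftrightarrow> integral_closure S = S"

definition F_finite :: "nat \<Rightarrow> 'k::field set \<Rightarrow> bool" where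
  "F_finite p S \<longleftrightarrow>
     (\<exists>G. finite G \<and> G \<subseteq> S \<and> (\<forall>x\<in>S. \<exists>c. c ` G \<subseteq> S \<and> x = (\<Sum>g\<in>G. c g ^ p * g)))"

definition chain_sup :: "('a set \<Rightarrow> bool) \<Rightarrow> enat" where
  "chain_sup P = Sup {enat n | n. \<exists>C :: nat \<Rightarrow> 'a set.
     (\<forall>i\<le>n. P (C i)) \<and> (\<forall>i<n. C i \<subset> C (Suc i))}"

definition krull_dim :: "('a, 'b) ring_scheme \<Rightarrow> enat" where
  "krull_dim A = chain_sup (\<lambda>I. primeideal I A)"

text \<open>The length of a ring as a module over itself. The submodules over S of a quotient ring
  S/I are its ideals, so this is also the length of S/I over S.\<close>

definition ring_length :: "('a, 'b) ring_scheme \<Rightarrow> enat" where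
  "ring_length A = chain_sup (\<lambda>I. ideal I A)"


section \<open>Divisors\<close>

definition height_one_prime :: "'k::field set \<Rightarrow> 'k set \<Rightarrow> bool" where
  "height_one_prime S q \<longleftrightarrow> primeideal q (ring_of S) \<and> q \<noteq> {0} \<and>
     (\<forall>q'. primeideal q' (ring_of S) \<and> q' \<subseteq> q \<longrightarrow> q' = {0} \<or> q' = q)"

definition uniformizer :: "'k::field set \<Rightarrow> 'k set \<Rightarrow> 'k \<Rightarrow> bool" where
  "uniformizer S q t \<longleftrightarrow> localization_max S q = {t * x | x. x \<in> localization S q}"

text \<open>The normalized valuation of the discrete valuation ring at a height one prime of a normal
  Noetherian domain, for nonzero f.\<close>

definition ord_at :: "'k::field set \<Rightarrow> 'k set \<Rightarrow> 'k \<Rightarrow> int" where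
  "ord_at S q f = (THE k. \<exists>t u. uniformizer S q t \<and>
     u \<in> localization S q - localization_max S q \<and> f = u * t powi k)"

text \<open>A divisor is given by its coefficients at the height one primes, and is zero at every
  other set.\<close>

definition real_divisor :: "'k::field set \<Rightarrow> ('k set \<Rightarrow> real) \<Rightarrow> bool" where
  "real_divisor S B \<longleftrightarrow> finite {q. B q \<noteq> 0} \<and> (\<forall>q. B q \<noteq> 0 \<longrightarrow> height_one_prime S q)"

definition Q_divisor :: "'k::field set \<Rightarrow> ('k set \<Rightarrow> real) \<Rightarrow> bool" where
  "Q_divisor S B \<longleftrightarrow> real_divisor S B \<and> range B \<subseteq> \<rat>"

definition effective :: "('k set \<Rightarrow> real) \<Rightarrow> bool" where
  "effective B \<longleftrightarrow> (\<forall>q. B q \<ge> 0)"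

definition prime_divisor :: "'k set \<Rightarrow> 'k set \<Rightarrow> real" where
  "prime_divisor P = (\<lambda>q. if q = P then 1 else 0)"

definition Cartier :: "'k::field set \<Rightarrow> ('k set \<Rightarrow> real) \<Rightarrow> bool" where
  "Cartier S E \<longleftrightarrow> real_divisor S E \<and>
     (\<forall>P. primeideal P (ring_of S) \<longrightarrow>
        (\<exists>f. f \<noteq> 0 \<and> (\<forall>q. height_one_prime S q \<and> q \<subseteq> P \<longrightarrow> E q = of_int (ord_at S q f))))"

definition Q_Cartier :: "'k::field set \<Rightarrow> ('k set \<Rightarrow> real) \<Rightarrow> bool" where
  "Q_Cartier S B \<longleftrightarrow> (\<exists>m::nat. m \<ge> 1 \<and> Cartier S (\<lambda>q. real m * B q))"


section \<open>The F-signature\<close>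

definition div_module :: "'k::field set \<Rightarrow> ('k set \<Rightarrow> int) \<Rightarrow> 'k set" where
  "div_module S E = {f. f = 0 \<or> (\<forall>q. height_one_prime S q \<longrightarrow> ord_at S q f + E q \<ge> 0)}"

text \<open>The maps on M that are linear over S when M carries the S-module structure obtained by
  restriction of scalars along the e-th Frobenius.\<close>

definition frobenius_hom :: "nat \<Rightarrow> nat \<Rightarrow> 'k::field set \<Rightarrow> 'k set \<Rightarrow> ('k \<Rightarrow> 'k) set" where
  "frobenius_hom p e S M = {\<phi>. \<phi> ` M \<subseteq> S \<and>
     (\<forall>x\<in>M. \<forall>y\<in>M. \<phi> (x + y) = \<phi> x + \<phi> y) \<and>
     (\<forall>r\<in>S. \<forall>x\<in>M. \<phi> (r ^ (p ^ e) * x) = r * \<phi> x)}"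

definition splitting_ideal :: "nat \<Rightarrow> nat \<Rightarrow> 'k::field set \<Rightarrow> ('k set \<Rightarrow> real) \<Rightarrow> 'k set" where
  "splitting_ideal p e S B =
     {r \<in> S. \<forall>\<phi> \<in> frobenius_hom p e S (div_module S (\<lambda>q. \<lceil>(real (p ^ e) - 1) * B q\<rceil>)).
        \<phi> r \<in> max_ideal S}"

definition F_signature :: "nat \<Rightarrow> 'k::field set \<Rightarrow> ('k set \<Rightarrow> real) \<Rightarrow> real" where
  "F_signature p S B = lim (\<lambda>e. real (the_enat (ring_length (ring_of S Quot splitting_ideal p e S B)))
                              / real p ^ (e * the_enat (krull_dim (ring_of S))))"


section \<open>Differential forms and canonical divisors\<close>

definition derivations :: "'k::field set \<Rightarrow> ('k \<Rightarrow> 'k) set" where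
  "derivations A = {\<delta>. (\<forall>x y. \<delta> (x + y) = \<delta> x + \<delta> y) \<and>
     (\<forall>x y. \<delta> (x * y) = x * \<delta> y + y * \<delta> x) \<and> \<delta> ` A \<subseteq> A}"

text \<open>
  The derivations of a field are the dual of its absolute Kaehler differentials. So the condition
  below says that the differentials of y1,...,yn form a basis of the Kaehler differentials;
  in characteristic p this means that y1,...,yn is a p-basis of the field.
\<close>

definition differential_basis :: "'k::field list \<Rightarrow> bool" where
  "differential_basis ys \<longleftrightarrow>
     (\<forall>vs. length vs = length ys \<longrightarrow> (\<exists>!\<delta>. \<delta> \<in> derivations UNIV \<and> map \<delta> ys = vs))"

text \<open>The value of the form dy1 \<open>\<and>\<close> ... \<open>\<and>\<close> dyn on n derivations.\<close>

definition dwedge :: "'k::field list \<Rightarrow> ('k \<Rightarrow> 'k) list \<Rightarrow> 'k" where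
  "dwedge ys \<delta>s = det (mat (length ys) (length ys) (\<lambda>(i, j). (\<delta>s ! i) (ys ! j)))"

text \<open>
  The order of dy1 \<open>\<and>\<close> ... \<open>\<and>\<close> dyn at a height one prime q of S, for a differential basis. When S is
  F-finite and normal, the localization A at q is regular and F-finite, so its Kaehler
  differentials are free of rank n, with dual the derivations of the field preserving A. If
  dx1,...,dxn is a basis of them and the given form is g dx1 \<open>\<and>\<close> ... \<open>\<and>\<close> dxn, then its values on
  derivations of A form the ideal gA, so the infimum below is the valuation of g.
\<close>

definition ord_dwedge :: "'k::field set \<Rightarrow> 'k set \<Rightarrow> 'k list \<Rightarrow> int" where
  "ord_dwedge S q ys = Inf {ord_at S q (dwedge ys \<delta>s) | \<delta>s.
     length \<delta>s = length ys \<and> set \<delta>s \<subseteq> derivations (localization S q) \<and> dwedge ys \<delta>s \<noteq> 0}"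

text \<open>The divisor on Spec S of the rational section a (dy1 \<open>\<and>\<close> ... \<open>\<and>\<close> dyn)^m of the m-th
  reflexive power of the canonical sheaf.\<close>

definition form_divisor :: "'k::field set \<Rightarrow> nat \<Rightarrow> 'k \<Rightarrow> 'k list \<Rightarrow> 'k set \<Rightarrow> real" where
  "form_divisor S m a ys = (\<lambda>q. if height_one_prime S q
     then of_int (ord_at S q a + int m * ord_dwedge S q ys) else 0)"

text \<open>
  On the regular locus of an F-finite normal scheme the canonical sheaf is the top exterior power
  of the absolute Kaehler differentials, so the canonical divisors are the divisors of nonzero
  rational top forms.
\<close>

definition canonical_divisor :: "'k::field set \<Rightarrow> ('k set \<Rightarrow> real) \<Rightarrow> bool" where
  "canonical_divisor S K \<longleftrightarrow>
     (\<exists>a ys. a \<noteq> 0 \<and> differential_basis ys \<and> K = form_divisor S 1 a ys)"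

definition log_Q_Gorenstein :: "'k::field set \<Rightarrow> ('k set \<Rightarrow> real) \<Rightarrow> bool" where
  "log_Q_Gorenstein S B \<longleftrightarrow> (\<exists>K. canonical_divisor S K \<and> Q_Cartier S (\<lambda>q. K q + B q))"


section \<open>The different\<close>

text \<open>
  A residue map exhibits the type of its values as the residue field of R at P, that is, as the
  fraction field of R/P. Its restriction to R has kernel P, so its image on R is R/P.
\<close>

definition residue_map :: "'k::field set \<Rightarrow> 'k set \<Rightarrow> ('k \<Rightarrow> 'l::field) \<Rightarrow> bool" where
  "residue_map R P \<pi> \<longleftrightarrow> \<pi> \<in> Ring.ring_hom (ring_of (localization R P)) (ring_of UNIV) \<and>
     \<pi> ` localization R P = UNIV \<and> {x \<in> localization R P. \<pi> x = 0} = localization_max R P"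

text \<open>
  Let A be the localization of R at the prime P of D, let t be a uniformizer of A, and let
  y2,...,yn in A have residues z2,...,zn such that dz2,...,dzn is a basis of the Kaehler
  differentials of the residue field; then t,y2,...,yn is a p-basis of A. The m-th power of the
  Poincare residue maps c (dt/t \<open>\<and>\<close> dy2 \<open>\<and>\<close> ... \<open>\<and>\<close> dyn)^m, for c in A, to
  \<pi>(c) (dz2 \<open>\<and>\<close> ... \<open>\<and>\<close> dzn)^m. The first of these sections is (c/t^m) (dt \<open>\<and>\<close> dy2 \<open>\<and>\<close> ... \<open>\<and>\<close> dyn)^m,
  and it generates the m-th reflexive power of the canonical sheaf twisted by mD + m\<Delta> iff its
  divisor is -mD - m\<Delta>; then c is a unit of A. The residue extends to an isomorphism onto the
  m-th reflexive power of the canonical sheaf of D' twisted by a divisor E iff the image of a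
  generator has divisor -E, and the different is E/m. Here D' is the spectrum of the integral
  closure of R/P. The result does not depend on the choices of m, t, c and y2,...,yn.
\<close>

definition different ::
  "'k::field set \<Rightarrow> ('k set \<Rightarrow> real) \<Rightarrow> 'k set \<Rightarrow> ('k \<Rightarrow> 'l::field) \<Rightarrow> 'l set \<Rightarrow> real" where
  "different R \<Delta> P \<pi> = (THE B. \<exists>m t c ys. m \<ge> 1 \<and> uniformizer R P t \<and>
     c \<in> localization R P \<and> c \<noteq> 0 \<and>
     set ys \<subseteq> localization R P \<and> differential_basis (map \<pi> ys) \<and>
     (\<forall>q. form_divisor R m (c / t ^ m) (t # ys) q = - real m * (prime_divisor P q + \<Delta> q)) \<and>
     B = (\<lambda>Q. - form_divisor (integral_closure (\<pi> ` R)) m (\<pi> c) (map \<pi> ys) Q / real m))"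

text \<open>Positive F-signature forces strong F-regularity, hence normality, so the value is 0 by
  convention when D is not normal.\<close>

definition F_signature_different ::
  "nat \<Rightarrow> 'k::field set \<Rightarrow> ('k set \<Rightarrow> real) \<Rightarrow> 'k set \<Rightarrow> ('k \<Rightarrow> 'l::field) \<Rightarrow> real" where
  "F_signature_different p R \<Delta> P \<pi> =
     (if normal_domain (\<pi> ` R) then F_signature p (\<pi> ` R) (different R \<Delta> P \<pi>) else 0)"

end

theory Submission
  imports Defs
begin

text \<open>
  The proof compares colengths. For \<open>q = p\<^sup>e\<close> let \<open>J(e,j)\<close> be the splitting ideal of the divisor \<open>\<lceil>(q-1)\<Delta>\<rceil> + jP\<close>, where \<open>P\<close> is the
  prime of \<open>D\<close>, and let \<open>\<lambda>(e,j)\<close> be its colength (\<open>la\<close> below). Then \<open>s(R, \<Delta>+tP)\<close> is the limit of \<open>\<lambda>(e,\<lceil>(q-1)t\<rceil>)/q\<^sup>d\<close>, and the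
  F-signature of the different turns out to be the limit \<open>A\<close> of \<open>\<lambda>(e,q-1)/q\<^sup>d\<^sup>-\<^sup>1\<close>.

  Let \<open>f\<close> have divisor \<open>rP\<close>. As \<open>J(e,j) : f = J(e,j+r)\<close>, the difference \<open>\<lambda>(e,j) - \<lambda>(e,j+r)\<close> is the colength of \<open>J(e,j) + fR\<close>,
  which decreases in \<open>j\<close>. So \<open>\<lambda>\<close> is convex in \<open>j\<close>; it vanishes for \<open>j \<ge> q\<close>, hence \<open>s(R, \<Delta>+tP) \<le> (1-t) s(R,\<Delta>)\<close> (\<open>sg_upper\<close>). Its
  last differences, which are the smallest, are about \<open>r \<lambda>(e,q-1)\<close> (\<open>la_steps\<close>), hence \<open>(1-t) A \<le> s(R, \<Delta>+tP)\<close> (\<open>sg_lower\<close>).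
  For \<open>t = 0\<close> this is the inequality, and in the case of equality both bounds agree, which forces linearity. Conversely, the slope
  of a linear function can be read off near \<open>t = 1\<close>: by \<open>sg_near_1\<close>, \<open>s(R, \<Delta>+(1-1/q)P) \<le> \<lambda>(e,q-1)/q\<^sup>d + C/q\<^sup>2\<close> with \<open>C\<close> independent
  of \<open>e\<close>, and multiplying by \<open>q\<close> shows \<open>s(R,\<Delta>) \<le> A\<close>. That bound compares ideals of consecutive levels through Frobenius. Since \<open>R\<close> is
  free over its p-th powers at \<open>P\<close> (\<open>frobenius_compare_ht1\<close>), the errors are colengths of ideals of codimension two, which are
  estimated by \<open>hilbert_kunz_bound\<close>.

  The identification of \<open>A\<close> is adjunction. The field has a trace \<open>Tr\<close> for each p-basis, a root of the product of the operators
  \<open>\<partial>\<^sup>p\<^sup>-\<^sup>1/(p-1)!\<close>, and the maps that define splitting ideals are \<open>x \<mapsto> Tr\<^sup>e(hx)\<close> (\<open>frobenius_hom_trace\<close>). A change of the p-basis multiplies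
  the argument by the \<open>(1-p)\<close>-th power of the Jacobian (\<open>dual_change\<close>), so the conditions on the multiplier \<open>h\<close> are orders of
  differential forms. For a p-basis consisting of a uniformizer \<open>t\<close> at \<open>P\<close> and lifts of a p-basis of the residue field, the residue
  of \<open>Tr\<^sup>e(t\<^sup>q\<^sup>-\<^sup>1 x)\<close> is the trace of the residue of \<open>x\<close> (\<open>residue_trace\<close>). Therefore the images of \<open>J(e,q-1)\<close> in \<open>R/P\<close> agree, up to a
  factor independent of \<open>e\<close>, with the splitting ideals of the different if \<open>R/P\<close> is normal (\<open>lim_normal\<close>). Otherwise the
  induced maps preserve the conductor of an integral element, the images of \<open>J(e,q-1)\<close> contain a fixed nonzero element, and \<open>A = 0\<close>
  (\<open>lim_not_normal\<close>).
\<close>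

section \<open>Lengths of subquotients of a field\<close>

text \<open>Rings, ideals and modules are subsets of one field, so that localizations, p-th powers and the ring itself can be
 compared by inclusion; quotients never appear, \<open>len A N M\<close> being the length of \<open>M/N\<close>.\<close>

definition subdom :: "'k::field set => bool" where
 "subdom A \<longleftrightarrow> 1 \<in> A & (\<forall>x\<in>A. \<forall>y\<in>A. x - y \<in> A & x * y \<in> A)"

definition smod :: "'k::field set => 'k set => bool" where
 "smod A M \<longleftrightarrow> 0 \<in> M & (\<forall>x\<in>M. \<forall>y\<in>M. x + y \<in> M) & (\<forall>a\<in>A. \<forall>x\<in>M. a * x \<in> M)"

definition len :: "'k::field set => 'k set => 'k set => enat" where
 "len A N M = chain_sup (%I. smod A I & N <= I & I <= M)"

lemma subdomD:
 assumes "subdom A"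
 shows "1 \<in> A" "0 \<in> A" "x \<in> A ==> y \<in> A ==> x - y \<in> A" "x \<in> A ==> y \<in> A ==> x * y \<in> A"
  "x \<in> A ==> - x \<in> A" "x \<in> A ==> y \<in> A ==> x + y \<in> A" "x \<in> A ==> x ^ n \<in> A"
proof -
 show 1: "1 \<in> A" and d: "x \<in> A ==> y \<in> A ==> x - y \<in> A" and m: "x \<in> A ==> y \<in> A ==> x * y \<in> A" for x y
  using assms by (auto simp: subdom_def)
 show z: "0 \<in> A" using d[OF 1 1] by simp
 show n: "x \<in> A ==> - x \<in> A" for x using d[OF z, of x] by simp
 show "x \<in> A ==> y \<in> A ==> x + y \<in> A" using d[of x "- y"] n[of y] by simp
 show "x \<in> A ==> x ^ n \<in> A" by (induction n) (auto simp: 1 m)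
qed

lemma smodD:
 assumes "smod A M"
 shows "0 \<in> M" "x \<in> M ==> y \<in> M ==> x + y \<in> M" "a \<in> A ==> x \<in> M ==> a * x \<in> M"
  "a \<in> A ==> x \<in> M ==> x * a \<in> M" using assms by (auto simp: smod_def mult.commute)

lemma smod_uminus: "subdom A ==> smod A M ==> x \<in> M ==> - x \<in> M" using smodD(3)[of A M "- 1" x] subdomD(1,5)[of A] by force

lemma smod_diff: "subdom A ==> smod A M ==> x \<in> M ==> y \<in> M ==> x - y \<in> M" using smodD(2)[of A M x "- y"] smod_uminus[of A M y] by simp

lemma smod_sum: "smod A M ==> (!!i. i \<in> I ==> f i \<in> M) ==> sum f I \<in> M" by (induction I rule: infinite_finite_induct) (auto dest: smodD)

lemma subdom_sum: "subdom A ==> (!!i. i \<in> I ==> f i \<in> A) ==> sum f I \<in> A"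
 by (induction I rule: infinite_finite_induct) (auto dest: subdomD)

lemma subdom_smod: "subdom A ==> smod A A" by (auto simp: smod_def dest: subdomD)

lemma smod_restrict: "smod A M ==> B <= A ==> smod B M" by (auto simp: smod_def)

lemma smod_Int: "smod A M ==> smod A N ==> smod A (M \<inter> N)" by (auto simp: smod_def)

definition chain :: "('a set => bool) => nat => bool" where
 "chain P n \<longleftrightarrow> (\<exists>C. (\<forall>i\<le>n. P (C i)) & (\<forall>i<n. C i < C (Suc i)))"

lemma chain_less: "chain P n ==> k <= n ==> chain P k" unfolding chain_def by (meson le_trans less_le_trans)

lemma chain_sup_ge: "enat n <= chain_sup P \<longleftrightarrow> n = 0 | chain P n"
proof
 assume "n = 0 | chain P n"
 thus "enat n <= chain_sup P"
 proof
  assume "chain P n"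
  thus ?thesis unfolding chain_sup_def chain_def by (intro Sup_upper) auto
 qed (simp add: zero_enat_def[symmetric])
next
 assume a: "enat n <= chain_sup P"
 show "n = 0 | chain P n"
 proof (rule ccontr)
  assume n: "~ (n = 0 | chain P n)"
  have "chain_sup P <= enat (n - 1)" unfolding chain_sup_def
  proof (rule Sup_least)
   fix x assume "x \<in> {enat n |n. \<exists>C. (\<forall>i\<le>n. P (C i)) & (\<forall>i<n. C i < C (Suc i))}"
   then obtain k where "x = enat k" "chain P k" unfolding chain_def by blast
   thus "x <= enat (n - 1)" using n chain_less[of P k n] by force
  qed
  with a have "enat n <= enat (n - 1)" by (rule order_trans)
  thus False using n by auto
 qed
qed

lemma enat_leI: "(!!n. enat n <= x ==> enat n <= y) ==> x <= y"
 by (metis enat_ord_simps(4) enat_ord_code(4) enat.exhaust linorder_not_le order_refl Suc_ile_eq enat_iless less_irrefl)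

lemma chain_sup_leI: "(!!n. chain P n ==> enat n <= y) ==> chain_sup P <= y" by (rule enat_leI) (auto simp: chain_sup_ge zero_enat_def[symmetric])

lemma chain_sup_map:
 assumes "!!I. P I ==> Q (F I)" "!!I J. P I ==> P J ==> I < J ==> F I < F J"
 shows "chain_sup P <= chain_sup Q"
proof (rule chain_sup_leI)
 fix n assume "chain P n"
 then obtain C where "\<forall>i\<le>n. P (C i)" "\<forall>i<n. C i < C (Suc i)" by (auto simp: chain_def)
 hence "chain Q n" unfolding chain_def using assms by (intro exI[of _ "%i. F (C i)"]) auto
 thus "enat n <= chain_sup Q" by (simp add: chain_sup_ge)
qed

text \<open>Removing repetitions from a weakly increasing chain.\<close>

lemma weak_chain:
 assumes "\<forall>i\<le>n. P (C i)" "\<forall>i<n. C i <= C (Suc i)"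
 shows "enat (card {i. i < n & C i ~= C (Suc i)}) <= chain_sup P"
proof -
 have "\<exists>D. (\<forall>i\<le>card {i. i < n & C i ~= C (Suc i)}. P (D i)) &
   (\<forall>i<card {i. i < n & C i ~= C (Suc i)}. D i < D (Suc i)) & D (card {i. i < n & C i ~= C (Suc i)}) = C n" using assms
 proof (induction n)
  case 0
  thus ?case by (intro exI[of _ "%i. C 0"]) auto
 next
  case (Suc n)
  define k where "k = card {i. i < n & C i ~= C (Suc i)}"
  have "\<forall>i\<le>n. P (C i)" "\<forall>i<n. C i <= C (Suc i)" using Suc.prems by auto
  from Suc.IH[OF this, folded k_def]
  obtain D where D: "\<forall>i\<le>k. P (D i)" "\<forall>i<k. D i < D (Suc i)" "D k = C n" by blast
  show ?case
  proof (cases "C n = C (Suc n)")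
   case True
   hence "{i. i < Suc n & C i ~= C (Suc i)} = {i. i < n & C i ~= C (Suc i)}" using less_Suc_eq by auto
   hence "card {i. i < Suc n & C i ~= C (Suc i)} = k" by (simp add: k_def)
   thus ?thesis using D True by auto
  next
   case False
   hence "{i. i < Suc n & C i ~= C (Suc i)} = insert n {i. i < n & C i ~= C (Suc i)}" using less_Suc_eq by auto
   hence c: "card {i. i < Suc n & C i ~= C (Suc i)} = Suc k" by (simp add: k_def)
   have sub: "C n < C (Suc n)" using False Suc.prems(2) by blast
   show ?thesis unfolding c
   proof (intro exI[of _ "D(Suc k := C (Suc n))"] conjI allI impI)
    fix i assume "i <= Suc k"
    thus "P ((D(Suc k := C (Suc n))) i)" using D(1) Suc.prems(1) by (auto simp: le_Suc_eq)
   next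
    fix i assume "i < Suc k"
    thus "(D(Suc k := C (Suc n))) i < (D(Suc k := C (Suc n))) (Suc i)" using D(2,3) sub by (cases "i = k") auto
   qed simp
  qed
 qed
 thus ?thesis by (auto simp: chain_sup_ge chain_def)
qed

text \<open>The module \<open>N + Ax\<close>. Its length over \<open>N\<close> is that of \<open>A\<close> modulo a colon module, the source of all
 recursions below.\<close>

definition adj :: "'k::field set => 'k => 'k set => 'k set" where
 "adj N x A = {n + a * x | n a. n \<in> N & a \<in> A}"

lemma smod_adj:
 assumes "smod B N" "smod B A"
 shows "smod B (adj N x A)" unfolding smod_def
proof (intro conjI ballI)
 show "0 \<in> adj N x A" unfolding adj_def using smodD(1)[OF assms(1)] smodD(1)[OF assms(2)] by force
next
 fix u v assume "u \<in> adj N x A" "v \<in> adj N x A"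
 then obtain n a n' a' where "u = n + a * x" "n \<in> N" "a \<in> A" "v = n' + a' * x" "n' \<in> N" "a' \<in> A" by (auto simp: adj_def)
 hence "u + v = (n + n') + (a + a') * x" "n + n' \<in> N" "a + a' \<in> A"
  using smodD(2)[OF assms(1)] smodD(2)[OF assms(2)] by (auto simp: algebra_simps)
 thus "u + v \<in> adj N x A" by (auto simp: adj_def)
next
 fix b v assume "b \<in> B" "v \<in> adj N x A"
 then obtain n a where "v = n + a * x" "n \<in> N" "a \<in> A" by (auto simp: adj_def)
 hence "b * v = (b * n) + (b * a) * x" "b * n \<in> N" "b * a \<in> A"
  using smodD(3)[OF assms(1)] smodD(3)[OF assms(2)] \<open>b \<in> B\<close> by (auto simp: distrib_left mult.assoc)
 thus "b * v \<in> adj N x A" by (auto simp: adj_def)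
qed

lemma adj_supset: "0 \<in> A ==> N <= adj N x A" unfolding adj_def by force

lemma adj_mem: "0 \<in> N ==> 1 \<in> A ==> x \<in> adj N x A" unfolding adj_def by force

lemma adj_mult_mem: "0 \<in> N ==> a \<in> A ==> a * x \<in> adj N x A" unfolding adj_def by force

lemma adj_subset: "smod A M ==> N <= M ==> x \<in> M ==> adj N x A <= M" unfolding adj_def by (auto dest: smodD)

lemma len_mono: "N <= N' ==> M' <= M ==> len A N' M' <= len A N M" unfolding len_def by (rule chain_sup_map[where F = "%I. I"]) auto

lemma len_mono_ring: "B <= A ==> len A N M <= len B N M" unfolding len_def by (rule chain_sup_map[where F = "%I. I"]) (auto intro: smod_restrict)

lemma len_refl: "len A N N = 0"
proof -
 have "len A N N <= enat 0" unfolding len_def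
 proof (rule chain_sup_leI)
  fix n assume "chain (%I. smod A I & N <= I & I <= N) n"
  then obtain C where C: "\<forall>i\<le>n. N = C i" "\<forall>i<n. C i < C (Suc i)" by (auto simp: chain_def)
  have "n = 0"
  proof (rule ccontr)
   assume "n ~= 0"
   hence "C 0 < C (Suc 0)" "N = C 0" "N = C (Suc 0)" using C by auto
   thus False by auto
  qed
  thus "enat n <= enat 0" by simp
 qed
 thus ?thesis by (simp add: zero_enat_def[symmetric])
qed

lemma len_pos: "smod A N ==> smod A M ==> N < M ==> 1 <= len A N M"
proof -
 assume "smod A N" "smod A M" "N < M"
 hence "chain (%I. smod A I & N <= I & I <= M) 1" unfolding chain_def by (intro exI[of _ "%i. if i = 0 then N else M"]) auto
 thus ?thesis unfolding len_def one_enat_def chain_sup_ge by simp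
qed

lemma len_0D: "smod A N ==> smod A M ==> N <= M ==> len A N M = 0 ==> N = M" using len_pos[of A N M] by auto

lemma enat_le_addD:
 assumes "enat n <= x + y"
 obtains a b where "n = a + b" "enat a <= x" "enat b <= y"
proof (cases x)
 case (enat k)
 show ?thesis
 proof (cases "n <= k")
  case True
  thus ?thesis using that[of n 0] enat by (simp add: zero_enat_def[symmetric])
 next
  case False
  hence "enat (n - k) <= y" using assms enat by (cases y) auto
  thus ?thesis using that[of k "n - k"] enat False by simp
 qed
next
 case infinity
 thus ?thesis using that[of n 0] by (simp add: zero_enat_def[symmetric])
qed

text \<open>Additivity of the length: intersecting a chain with the middle module and adding that module to
 it gives two weak chains, and by the modular law each strict step stays strict in one of them.\<close>

lemma len_add:
 assumes A: "subdom A" and N: "smod A N" and L: "smod A L" and M: "smod A M" and NL: "N <= L" and LM: "L <= M"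
 shows "len A N M = len A N L + len A L M"
proof (rule antisym)
 let ?P = "%I. smod A I & N <= I & I <= L" and ?Q = "%I. smod A I & L <= I & I <= M"
 show "len A N M <= len A N L + len A L M" unfolding len_def[of A N M]
 proof (rule chain_sup_leI)
  fix n assume "chain (%I. smod A I & N <= I & I <= M) n"
  then obtain C where C: "\<forall>i\<le>n. smod A (C i) & N <= C i & C i <= M" "\<forall>i<n. C i < C (Suc i)" by (auto simp: chain_def)
  define X where "X = (%i. C i \<inter> L)"
  define Y where "Y = (%i. {l + c | l c. l \<in> L & c \<in> C i})"
  have Ysm: "smod A (Y i)" if "i <= n" for i
  proof -
   have "Y i = adj L 1 (C i)" by (simp add: Y_def adj_def)
   thus ?thesis using smod_adj[OF L] C(1) that by simp
  qed
  have Y0: "L <= Y i" if "i <= n" for i using C(1) that smodD(1) unfolding Y_def by force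
  have YM: "Y i <= M" if "i <= n" for i using C(1) that LM smodD(2)[OF M] unfolding Y_def by blast
  have 1: "enat (card {i. i < n & X i ~= X (Suc i)}) <= len A N L" unfolding len_def
   by (rule weak_chain) (use C NL L in "auto simp: X_def intro: smod_Int")
  have Ymono: "\<forall>i<n. Y i <= Y (Suc i)" using C(2) unfolding Y_def by blast
  have 2: "enat (card {i. i < n & Y i ~= Y (Suc i)}) <= len A L M" unfolding len_def by (rule weak_chain) (use Ysm Y0 YM Ymono in auto)
  have "i \<in> {i. i < n & X i ~= X (Suc i)} \<union> {i. i < n & Y i ~= Y (Suc i)}" if i: "i < n" for i
  proof (rule ccontr)
   assume "~ ?thesis"
   hence e: "X i = X (Suc i)" "Y i = Y (Suc i)" using i by auto
   have "C (Suc i) <= C i"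
   proof
    fix x assume x: "x \<in> C (Suc i)"
    have "0 + x \<in> Y (Suc i)" using x smodD(1)[OF L] unfolding Y_def by blast
    hence "x \<in> Y i" using e by simp
    then obtain l c where lc: "x = l + c" "l \<in> L" "c \<in> C i" unfolding Y_def by blast
    have "l = x - c" using lc by simp
    moreover have "c \<in> C (Suc i)" "smod A (C (Suc i))" using C i lc(3) by auto
    ultimately have "l \<in> C (Suc i)" using x smod_diff[OF A, of "C (Suc i)" x c] by simp
    hence "l \<in> X i" using lc e by (auto simp: X_def)
    thus "x \<in> C i" using lc C(1) i smodD(2)[of A "C i" l c] by (auto simp: X_def)
   qed
   thus False using C(2) i by blast
  qed
  hence "{..<n} <= {i. i < n & X i ~= X (Suc i)} \<union> {i. i < n & Y i ~= Y (Suc i)}" by blast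
  hence "card {..<n} <= card ({i. i < n & X i ~= X (Suc i)} \<union> {i. i < n & Y i ~= Y (Suc i)})" by (rule card_mono[rotated]) auto
  also have "\<dots> <= card {i. i < n & X i ~= X (Suc i)} + card {i. i < n & Y i ~= Y (Suc i)}" by (rule card_Un_le)
  finally have "enat n <= enat (card {i. i < n & X i ~= X (Suc i)}) + enat (card {i. i < n & Y i ~= Y (Suc i)})" by simp
  also have "\<dots> <= len A N L + len A L M" using 1 2 by (rule add_mono)
  finally show "enat n <= len A N L + len A L M" .
 qed
 show "len A N L + len A L M <= len A N M"
 proof (rule enat_leI)
  fix n assume "enat n <= len A N L + len A L M"
  then obtain a b where ab: "n = a + b" "enat a <= len A N L" "enat b <= len A L M" by (rule enat_le_addD)
  show "enat n <= len A N M"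
  proof (cases "a = 0 | b = 0")
   case True
   thus ?thesis using ab len_mono[OF order_refl LM, of A N] len_mono[OF NL order_refl, of A M] by (auto intro: order_trans)
  next
   case False
   hence "chain ?P a" "chain ?Q b" using ab by (auto simp: len_def chain_sup_ge)
   obtain C where C: "\<forall>i\<le>a. ?P (C i)" "\<forall>i<a. C i < C (Suc i)" using \<open>chain ?P a\<close> unfolding chain_def by auto
   obtain D where D: "\<forall>i\<le>b. ?Q (D i)" "\<forall>i<b. D i < D (Suc i)" using \<open>chain ?Q b\<close> unfolding chain_def by auto
   have PQ: "smod A I & N <= I & I <= M" if "?P I | ?Q I" for I using that NL LM by blast
   have "chain (%I. smod A I & N <= I & I <= M) n" unfolding chain_def ab(1)
   proof (intro exI[of _ "%i. if i <= a then C i else D (i - a)"] conjI[OF allI allI] impI)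
    fix i assume i: "i <= a + b"
    show "smod A (if i <= a then C i else D (i - a)) & N <= (if i <= a then C i else D (i - a)) &
      (if i <= a then C i else D (i - a)) <= M" by (rule PQ) (use C(1) D(1) i in auto)
   next
    fix i assume i: "i < a + b"
    consider "i < a" | "i = a" | "i > a" by linarith
    thus "(if i <= a then C i else D (i - a)) < (if Suc i <= a then C (Suc i) else D (Suc i - a))"
    proof cases
     case 1 thus ?thesis using C by auto
    next
     case 2
     have "C a <= L" "L <= D 0" "D 0 < D (Suc 0)" using C(1) D False by auto
     thus ?thesis using 2 by auto
    next
     case 3
     thus ?thesis using D(2) i by (auto simp: Suc_diff_le)
    qed
   qed
   thus ?thesis unfolding len_def chain_sup_ge by simp
  qed
 qed
qed

lemma len_cyclic:
 assumes B: "subdom B" and N: "smod B N" and A: "smod B A"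
 shows "len B N (adj N x A) = len B {a \<in> A. a * x \<in> N} A"
proof (rule antisym)
 show "len B N (adj N x A) <= len B {a \<in> A. a * x \<in> N} A" unfolding len_def
 proof (rule chain_sup_map[where F = "%I. {a \<in> A. a * x \<in> I}"], goal_cases)
  case (1 I)
  thus ?case using A by (auto simp: smod_def mult.assoc distrib_right)
 next
  case (2 I J)
  then obtain j where j: "j \<in> J" "j ~: I" by blast
  hence "j \<in> adj N x A" using 2 by blast
  then obtain n a where na: "j = n + a * x" "n \<in> N" "a \<in> A" by (auto simp: adj_def)
  have "a * x = j - n" using na by simp
  hence "a * x \<in> J" using j na 2 smod_diff[OF B, of J j n] by auto
  moreover have "a * x ~: I" using j na 2 smodD(2)[of B I n "a * x"] by auto
  ultimately show ?case using 2 na by blast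
 qed
 show "len B {a \<in> A. a * x \<in> N} A <= len B N (adj N x A)" unfolding len_def
 proof (rule chain_sup_map[where F = "%I. adj N x I"], goal_cases)
  case (1 I)
  hence "adj N x I <= adj N x A" by (auto simp: adj_def)
  thus ?case using 1 smod_adj[OF N, of I x] adj_supset[of I N x] smodD(1)[of B I] by auto
 next
  case (2 I J)
  then obtain a where a: "a \<in> J" "a ~: I" by blast
  have "a * x \<in> adj N x J" by (rule adj_mult_mem[OF smodD(1)[OF N] a(1)])
  moreover have "a * x ~: adj N x I"
  proof
   assume "a * x \<in> adj N x I"
   then obtain n b where nb: "a * x = n + b * x" "n \<in> N" "b \<in> I" by (auto simp: adj_def)
   hence "(a - b) * x \<in> N" by (simp add: algebra_simps)
   moreover have "a - b \<in> A" using a nb 2 smod_diff[OF B A] by blast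
   ultimately have "a - b \<in> I" using 2 by blast
   hence "(a - b) + b \<in> I" using nb 2 smodD(2)[of B I "a - b" b] by blast
   thus False using a by simp
  qed
  moreover have "adj N x I <= adj N x J" using 2 by (auto simp: adj_def)
  ultimately show ?case by blast
 qed
qed

lemma len_image:
 fixes f :: "'k::field => 'k"
 assumes f: "!!x y. f (x + y) = f x + f y" "!!x y. f (x * y) = f x * f y" "inj f" "f 0 = 0"
  and A: "N <= M"
 shows "len (f ` A) (f ` N) (f ` M) = len A N M"
proof (rule antisym)
 show "len A N M <= len (f ` A) (f ` N) (f ` M)" unfolding len_def
 proof (rule chain_sup_map[where F = "%I. f ` I"], goal_cases)
  case (1 I)
  hence "smod (f ` A) (f ` I)" unfolding smod_def by (auto simp: f(1)[symmetric] f(2)[symmetric]) (use f(4) in "metis imageI")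
  thus ?case using 1 by auto
 next
  case (2 I J)
  thus ?case using inj_image_subset_iff[OF f(3)] by blast
 qed
 show "len (f ` A) (f ` N) (f ` M) <= len A N M" unfolding len_def
 proof (rule chain_sup_map[where F = "%I. f -` I"], goal_cases)
  case (1 I)
  hence "smod A (f -` I)" unfolding smod_def by (auto simp: f)
  moreover have "N <= f -` I" using 1 by blast
  moreover have "f -` I <= M" using 1 f(3) by (auto dest: injD)
  ultimately show ?case by blast
 next
  case (2 I J)
  then obtain y where y: "y \<in> J" "y ~: I" by blast
  then obtain x where "y = f x" using 2 by blast
  thus ?case using y 2 by auto
 qed
qed

text \<open>Every composition factor over a local ring is the residue field, which has a fixed length over
 the smaller ring.\<close>

lemma len_restrict_scalars:
 assumes A: "subdom A" and B: "subdom B" "B <= A" and m: "smod A m" "m < A" "!!x. x \<in> A ==> x ~: m ==> 1 / x \<in> A"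
  and N: "smod A N" and M: "smod A M" and NM: "N <= M"
 shows "len B N M = len B m A * len A N M"
proof (cases "len A N M")
 case infinity
 have "1 <= len B m A" using len_pos[of B m A] m A B subdom_smod[OF A] smod_restrict by blast
 hence "len B m A ~= 0" by auto
 moreover have "len B N M = \<infinity>" using infinity len_mono_ring[OF B(2), of N M] by simp
 ultimately show ?thesis using infinity by (simp add: imult_infinity_right)
next
 case (enat n)
 thus ?thesis using N NM
 proof (induction n arbitrary: N)
  case 0
  hence "N = M" using len_0D[OF _ M] by (simp add: zero_enat_def)
  thus ?case by (simp add: len_refl)
 next
  case (Suc n)
  have "enat (Suc n) <= len A N M" using Suc by simp
  then obtain C where C: "\<forall>i\<le>Suc n. smod A (C i) & N <= C i & C i <= M" "\<forall>i<Suc n. C i < C (Suc i)"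
   unfolding len_def chain_sup_ge chain_def by auto
  define N' where "N' = C 1"
  have N': "smod A N'" "N < N'" "N' <= M" using C unfolding N'_def by auto
  have "chain (%I. smod A I & N' <= I & I <= M) n" unfolding chain_def
  proof (intro exI[of _ "%i. C (Suc i)"] conjI allI impI)
   fix i assume "i <= n"
   thus "N' <= C (Suc i)"
   proof (induction i)
    case 0 thus ?case by (simp add: N'_def)
   next
    case (Suc i) thus ?case using C(2)[rule_format, of "Suc i"] by auto
   qed
  qed (use C in auto)
  hence ge: "enat n <= len A N' M" unfolding len_def chain_sup_ge by simp
  have ge1: "1 <= len A N N'" using len_pos[OF Suc.prems(2) N'(1,2)] .
  have sum: "len A N M = len A N N' + len A N' M" using len_add[OF A Suc.prems(2) N'(1) M] N' by blast
  have l: "len A N N' = 1" "len A N' M = enat n" using ge ge1 sum Suc.prems(1) by (cases "len A N N'"; cases "len A N' M"; auto simp: one_enat_def)+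
  obtain x where x: "x \<in> N'" "x ~: N" using N' by blast
  have sub: "adj N x A <= N'" using adj_subset[OF N'(1)] N' x by blast
  have sa: "smod A (adj N x A)" using smod_adj[OF Suc.prems(2) subdom_smod[OF A]] .
  have Na: "N < adj N x A" using x adj_mem[OF smodD(1)[OF Suc.prems(2)] subdomD(1)[OF A]] adj_supset[OF subdomD(2)[OF A]] by blast
  have "len A N N' = len A N (adj N x A) + len A (adj N x A) N'" using len_add[OF A Suc.prems(2) sa N'(1)] Na sub by blast
  hence "len A (adj N x A) N' = 0" "len A N (adj N x A) = 1" using l(1) len_pos[OF Suc.prems(2) sa Na]
   by (cases "len A N (adj N x A)"; cases "len A (adj N x A) N'"; auto simp: one_enat_def zero_enat_def)+
  hence N'eq: "N' = adj N x A" and l1: "len A {a \<in> A. a * x \<in> N} A = 1"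
   using len_0D[OF sa N'(1) sub] len_cyclic[OF A Suc.prems(2) subdom_smod[OF A], of x] by auto
  let ?K = "{a \<in> A. a * x \<in> N}"
  have sK: "smod A ?K" using Suc.prems(2) A by (auto simp: smod_def mult.assoc distrib_right dest: subdomD)
  have Km: "?K <= m"
  proof
   fix a assume a: "a \<in> ?K"
   show "a \<in> m"
   proof (rule ccontr)
    assume "a ~: m"
    hence "1 / a \<in> A" "a ~= 0" using m(3) a smodD(1)[OF m(1)] by auto
    hence "(1/a) * (a * x) \<in> N" using a smodD(3)[OF Suc.prems(2)] by blast
    thus False using x \<open>a ~= 0\<close> by simp
   qed
  qed
  have "len A ?K A = len A ?K m + len A m A" using len_add[OF A sK m(1) subdom_smod[OF A] Km] m(2) by blast
  moreover have "1 <= len A m A" using len_pos[OF m(1) subdom_smod[OF A] m(2)] .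
  ultimately have "len A ?K m = 0" using l1 by (cases "len A ?K m"; cases "len A m A"; auto simp: one_enat_def zero_enat_def)
  hence Keq: "?K = m" using len_0D[OF sK m(1) Km] by simp
  have "len B N N' = len B m A" using len_cyclic[OF B(1), of N A x] smod_restrict[OF _ B(2)] Suc.prems(2) subdom_smod[OF A] N'eq Keq by auto
  moreover have "len B N' M = len B m A * enat n" using Suc.IH[OF l(2) N'(1,3)] l by simp
  moreover have "len B N M = len B N N' + len B N' M" using len_add[OF B(1), of N N' M] smod_restrict[OF _ B(2)] Suc.prems(2) N' M by blast
  ultimately have "len B N M = len B m A * (1 + enat n)" by (simp add: distrib_left)
  thus ?case using Suc.prems(1) by (simp add: one_enat_def)
 qed
qed

definition gens :: "'k::field set => 'k set => 'k set => 'k set" where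
 "gens X B G = {x + (\<Sum>g\<in>G. c g * g) | x c. x \<in> X & (\<forall>g\<in>G. c g \<in> B)}"

lemma gens_insert:
 assumes "finite G" "g ~: G"
 shows "gens X B (insert g G) = adj (gens X B G) g B"
proof -
 have "x + (\<Sum>h\<in>insert g G. c h * h) = (x + (\<Sum>h\<in>G. c h * h)) + c g * g" for x c using assms by (simp add: algebra_simps)
 hence 1: "gens X B (insert g G) <= adj (gens X B G) g B"
 proof (intro subsetI, goal_cases)
  case (1 v)
  then obtain x c where v: "v = x + (\<Sum>h\<in>insert g G. c h * h)" "x \<in> X" "\<forall>h\<in>insert g G. c h \<in> B"
   unfolding gens_def by blast
  have "x + (\<Sum>h\<in>G. c h * h) \<in> gens X B G" unfolding gens_def using v by blast
  thus ?case unfolding adj_def v(1) \<open>!!x c. x + (\<Sum>h\<in>insert g G. c h * h) = (x + (\<Sum>h\<in>G. c h * h)) + c g * g\<close>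
   using v by blast
 qed
 have "(x + (\<Sum>h\<in>G. c h * h)) + b * g = x + (\<Sum>h\<in>insert g G. (c(g := b)) h * h)" for x c b
 proof -
  have "(\<Sum>h\<in>G. (c(g := b)) h * h) = (\<Sum>h\<in>G. c h * h)" using assms by (intro sum.cong) auto
  thus ?thesis using assms by (simp add: algebra_simps)
 qed
 hence 2: "adj (gens X B G) g B <= gens X B (insert g G)" unfolding adj_def
 proof (clarsimp, goal_cases)
  case (1 n b)
  then obtain x c where "n = x + (\<Sum>h\<in>G. c h * h)" "x \<in> X" "\<forall>h\<in>G. c h \<in> B" by (auto simp: gens_def)
  thus ?case unfolding gens_def using 1 by (intro CollectI exI[of _ x] exI[of _ "c(g := b)"]) auto
 qed
 show ?thesis using 1 2 by blast
qed

lemma gens_empty: "gens X B {} = X" by (auto simp: gens_def)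

lemma smod_gens: "finite G ==> subdom B ==> smod B X ==> smod B (gens X B G)"
 by (induction G rule: finite_induct) (auto simp: gens_empty gens_insert smod_adj subdom_smod)

lemma gens_supset: "subdom B ==> X <= gens X B G" unfolding gens_def by (auto intro!: exI[of _ "%_. 0"] dest: subdomD)

lemma gens_mem: assumes "finite G" "subdom B" "g \<in> G" "0 \<in> X" shows "g \<in> gens X B G" unfolding gens_def
 by (intro CollectI exI[of _ 0] exI[of _ "%h. if h = g then 1 else 0"]) (use assms subdomD(1,2)[of B] in \<open>auto simp: if_distrib[of "%c. c * _"] cong: if_cong\<close>)

lemma gens_subset: assumes M: "smod B M" and "X <= M" "G <= M" shows "gens X B G <= M"
proof
 fix u assume "u \<in> gens X B G"
 then obtain x c where u: "u = x + (\<Sum>g\<in>G. c g * g)" "x \<in> X" "\<forall>g\<in>G. c g \<in> B" by (auto simp: gens_def)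
 have "(\<Sum>g\<in>G. c g * g) \<in> M" by (rule smod_sum[OF M]) (use u(3) assms smodD(3)[OF M] in blast)
 thus "u \<in> M" unfolding u(1) using smodD(2)[OF M] u(2) assms(2) by blast
qed

lemma len_gens_le:
 assumes "finite G" "subdom B" "smod B X" "smod B b" "!!g u. g \<in> G ==> u \<in> b ==> u * g \<in> X" "b <= B"
 shows "len B X (gens X B G) <= of_nat (card G) * len B b B" using assms
proof (induction G rule: finite_induct)
 case empty thus ?case by (simp add: gens_empty len_refl)
next
 case (insert g G)
 have s: "smod B (gens X B G)" using smod_gens insert by blast
 have s2: "smod B (gens X B (insert g G))" using smod_gens insert by blast
 have e: "gens X B (insert g G) = adj (gens X B G) g B" using gens_insert insert by blast
 have "len B X (gens X B (insert g G)) = len B X (gens X B G) + len B (gens X B G) (gens X B (insert g G))"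
  by (rule len_add[OF insert.prems(1,2) s s2])
   (use gens_supset[OF insert.prems(1)] adj_supset[OF subdomD(2)[OF insert.prems(1)]] e in auto)
 also have "len B (gens X B G) (gens X B (insert g G)) = len B {u \<in> B. u * g \<in> gens X B G} B"
  unfolding e by (rule len_cyclic[OF insert.prems(1) s subdom_smod[OF insert.prems(1)]])
 also have "\<dots> <= len B b B" by (rule len_mono) (use insert.prems gens_supset[OF insert.prems(1), of X G] in auto)
 also have "len B X (gens X B G) <= of_nat (card G) * len B b B" using insert by auto
 finally have "len B X (gens X B (insert g G)) <= of_nat (card G) * len B b B + len B b B" by (simp add: add_mono)
 thus ?case using insert by (simp add: distrib_right add.commute)
qed

text \<open>If the relations between the generators have coefficients in an ideal \<open>b\<close>, the module is free over \<open>B/b\<close>.\<close>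

lemma len_gens:
 assumes "finite G" "subdom B" "smod B X" "smod B b" "!!g u. g \<in> G ==> u \<in> b ==> u * g \<in> X" "b <= B"
  and "!!c g. (\<forall>g\<in>G. c g \<in> B) ==> (\<Sum>g\<in>G. c g * g) \<in> X ==> g \<in> G ==> c g \<in> b"
 shows "len B X (gens X B G) = of_nat (card G) * len B b B" using assms
proof (induction G rule: finite_induct)
 case empty thus ?case by (simp add: gens_empty len_refl)
next
 case (insert g G)
 have s: "smod B (gens X B G)" using smod_gens insert by blast
 have s2: "smod B (gens X B (insert g G))" using smod_gens insert by blast
 have e: "gens X B (insert g G) = adj (gens X B G) g B" using gens_insert insert by blast
 have 1: "len B X (gens X B (insert g G)) = len B X (gens X B G) + len B (gens X B G) (gens X B (insert g G))"
  by (rule len_add[OF insert.prems(1,2) s s2])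
   (use gens_supset[OF insert.prems(1)] adj_supset[OF subdomD(2)[OF insert.prems(1)]] e in auto)
 have "len B (gens X B G) (gens X B (insert g G)) = len B {u \<in> B. u * g \<in> gens X B G} B"
  unfolding e by (rule len_cyclic[OF insert.prems(1) s subdom_smod[OF insert.prems(1)]])
 also have "{u \<in> B. u * g \<in> gens X B G} = b"
 proof (intro equalityI subsetI)
  fix u assume "u \<in> {u \<in> B. u * g \<in> gens X B G}"
  then obtain x c where u: "u \<in> B" "u * g = x + (\<Sum>h\<in>G. c h * h)" "x \<in> X" "\<forall>h\<in>G. c h \<in> B" by (auto simp: gens_def)
  define c' where "c' = (%h. if h = g then u else - c h)"
  have "(\<Sum>h\<in>G. c' h * h) = - (\<Sum>h\<in>G. c h * h)" unfolding sum_negf[symmetric]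
   using insert.hyps by (intro sum.cong) (auto simp: c'_def)
  hence "(\<Sum>h\<in>insert g G. c' h * h) = x" using insert.hyps u by (simp add: c'_def)
  moreover have "\<forall>h\<in>insert g G. c' h \<in> B" using u subdomD[OF insert.prems(1)] by (auto simp: c'_def)
  ultimately have "c' g \<in> b" using insert.prems(6)[of c' g] u by auto
  thus "u \<in> b" by (simp add: c'_def)
 next
  fix u assume "u \<in> b"
  thus "u \<in> {u \<in> B. u * g \<in> gens X B G}" using insert.prems gens_supset[OF insert.prems(1), of X G] by auto
 qed
 finally have 2: "len B (gens X B G) (gens X B (insert g G)) = len B b B" .
 have "len B X (gens X B G) = of_nat (card G) * len B b B"
 proof (rule insert.IH)
  fix c h assume c: "\<forall>g\<in>G. c g \<in> B" "(\<Sum>g\<in>G. c g * g) \<in> X" "h \<in> G"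
  have "(\<Sum>h\<in>G. (c(g := 0)) h * h) = (\<Sum>h\<in>G. c h * h)" using insert.hyps by (intro sum.cong) auto
  hence "(\<Sum>h\<in>insert g G. (c(g := 0)) h * h) \<in> X" using c insert.hyps by simp
  hence "(c(g := 0)) h \<in> b" using insert.prems(6)[of "c(g := 0)" h] c subdomD(2)[OF insert.prems(1)] by auto
  thus "c h \<in> b" using c insert.hyps by (auto split: if_splits)
 qed (use insert in auto)
 thus ?case using 1 2 insert.hyps by (simp add: distrib_right add.commute)
qed

section \<open>Subrings of a field and their ideals\<close>

lemma ring_of_simps [simp]:
 "carrier (ring_of R) = R" "monoid.mult (ring_of R) = (*)" "one (ring_of R) = 1"
 "ring.zero (ring_of R) = 0" "add (ring_of R) = (+)" by (auto simp: ring_of_def)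

lemma subdom_imp_domain: "subdom R ==> domain (ring_of R)"
proof -
 assume R: "subdom R"
 note [simp] = subdomD[OF R]
 have "cring (ring_of R)"
 proof (rule cringI)
  show "abelian_group (ring_of R)" by (rule abelian_groupI) (auto simp: add_ac intro!: bexI[of _ "- x" for x])
  show "Group.comm_monoid (ring_of R)" by (rule Group.comm_monoidI) (auto simp: mult_ac)
 qed (auto simp: distrib_right)
 thus ?thesis by (auto simp: domain_def domain_axioms_def)
qed

lemma ring_imp_subdom: "ring (ring_of R) ==> subdom R"
proof -
 assume "ring (ring_of R)"
 then interpret ring "ring_of R" .
 have n: "- x \<in> R" if "x \<in> R" for x :: 'a
 proof -
  have "\<ominus>\<^bsub>ring_of R\<^esub> x \<in> R" "x + \<ominus>\<^bsub>ring_of R\<^esub> x = 0" using a_inv_closed[of x] r_neg[of x] that by auto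
  thus ?thesis by (metis add_eq_0_iff)
 qed
 show ?thesis unfolding subdom_def
 proof (intro conjI ballI)
  fix x y assume "x \<in> R" "y \<in> R"
  thus "x - y \<in> R" "x * y \<in> R" using a_closed[of x "- y"] n[of y] m_closed[of x y] by auto
 qed (use one_closed in simp)
qed

lemma ideal_ring_of: "subdom R ==> ideal I (ring_of R) \<longleftrightarrow> smod R I & I <= R"
proof
 assume R: "subdom R" and "ideal I (ring_of R)"
 then interpret ideal I "ring_of R" by simp
 show "smod R I & I <= R" using additive_subgroup.a_closed[OF is_additive_subgroup]
   additive_subgroup.zero_closed[OF is_additive_subgroup] I_l_closed a_subset by (auto simp: smod_def)
next
 assume R: "subdom R" and I: "smod R I & I <= R"
 interpret domain "ring_of R" by (rule subdom_imp_domain[OF R])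
 have "subgroup I (add_monoid (ring_of R))"
 proof (rule add.subgroupI)
  fix a assume "a \<in> I"
  moreover have "\<ominus>\<^bsub>ring_of R\<^esub> a = - a" using \<open>a \<in> I\<close> I R by (intro minus_equality) (auto simp: subdomD)
  ultimately show "\<ominus>\<^bsub>ring_of R\<^esub> a \<in> I" using smod_uminus[OF R, of I a] I by simp
 qed (use I smodD in auto)
 thus "ideal I (ring_of R)" by (intro idealI ring_axioms) (use I smodD in auto)
qed

definition prime_in :: "'k::field set => 'k set => bool" where
 "prime_in R Q \<longleftrightarrow> smod R Q & Q < R & (\<forall>x\<in>R. \<forall>y\<in>R. x * y \<in> Q --> x \<in> Q | y \<in> Q)"

lemma prime_inD:
 assumes "prime_in R Q"
 shows "smod R Q" "Q <= R" "Q ~= R" "x \<in> R ==> y \<in> R ==> x * y \<in> Q ==> x \<in> Q | y \<in> Q" using assms by (auto simp: prime_in_def)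

lemma primeideal_ring_of: "subdom R ==> primeideal Q (ring_of R) \<longleftrightarrow> prime_in R Q"
proof -
 assume R: "subdom R"
 interpret domain "ring_of R" by (rule subdom_imp_domain[OF R])
 have c: "cring (ring_of R)" by (rule is_cring)
 show ?thesis unfolding primeideal_def primeideal_axioms_def prime_in_def ideal_ring_of[OF R] using c by (simp, blast)
qed

lemma maximalideal_ring_of:
 "subdom R ==> maximalideal Q (ring_of R) \<longleftrightarrow>
  smod R Q & Q < R & (\<forall>J. smod R J & J <= R & Q <= J --> J = Q | J = R)"
 using ideal_ring_of[of R] by (auto simp: maximalideal_def maximalideal_axioms_def)

lemma prime_one_notin: "subdom R ==> prime_in R Q ==> 1 ~: Q" using smodD(3)[of R Q _ 1] by (fastforce simp: prime_in_def)

lemma prime_power_notin: "subdom R ==> prime_in R Q ==> x \<in> R ==> x ~: Q ==> x ^ n ~: Q"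
proof (induction n)
 case 0 thus ?case using prime_one_notin by simp
next
 case (Suc n) thus ?case using prime_inD(4)[of R Q x "x ^ n"] subdomD(7)[of R x n] by auto
qed

lemma prime_prod_notin:
 "subdom R ==> prime_in R Q ==> (!!i. i \<in> I ==> f i \<in> R - Q) ==> prod f I \<in> R - Q"
proof (induction I rule: infinite_finite_induct)
 case (insert x F)
 thus ?case using prime_inD(4)[of R Q "f x" "prod f F"] subdomD(4)[of R "f x" "prod f F"] by auto
qed (auto simp: prime_one_notin subdomD)

lemma zero_prime: "subdom R ==> prime_in R {0}" using subdomD(1,2)[of R] by (auto simp: prime_in_def smod_def)

text \<open>The length of a quotient ring, as used in the F-signature, is a length of subquotients.\<close>

lemma ring_length_Quot:
 assumes R: "subdom R" and I: "smod R I" "I <= R"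
 shows "ring_length (ring_of R Quot I) = len R I R"
proof -
 interpret domain "ring_of R" by (rule subdom_imp_domain[OF R])
 have id: "ideal I (ring_of R)" using ideal_ring_of[OF R] I by simp
 let ?f = "%J. (+>\<^bsub>ring_of R\<^esub>) I ` J"
 have b: "bij_betw ?f {J. ideal J (ring_of R) & I <= J} {J. ideal J (ring_of R Quot I)}" by (rule quot_ideal_correspondence[OF id])
 have w: "\<Union> (?f J) = J" if "ideal J (ring_of R)" "I <= J" for J using ideal_incl_iff[OF id that(1)] that(2) by auto
 show ?thesis
 proof (rule antisym)
  show "len R I R <= ring_length (ring_of R Quot I)" unfolding len_def ring_length_def
  proof (rule chain_sup_map[where F = ?f], goal_cases)
   case (1 J)
   thus ?case using b ideal_ring_of[OF R, of J] by (auto simp: bij_betw_def)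
  next
   case (2 J J')
   have i: "ideal J (ring_of R)" "ideal J' (ring_of R)" "I <= J" "I <= J'" using 2 ideal_ring_of[OF R] by auto
   have "?f J ~= ?f J'"
   proof
    assume "?f J = ?f J'"
    hence "\<Union> (?f J) = \<Union> (?f J')" by (rule arg_cong)
    hence "J = J'" unfolding w[OF i(1,3)] w[OF i(2,4)] .
    thus False using 2(3) by blast
   qed
   moreover have "?f J <= ?f J'" by (rule image_mono) (use 2 in auto)
   ultimately show ?case by (simp only: psubset_eq) simp
  qed
  show "ring_length (ring_of R Quot I) <= len R I R" unfolding len_def ring_length_def
  proof (rule chain_sup_map[where F = "%J. \<Union> J"], goal_cases)
   case (1 J)
   hence "J \<in> ?f ` {J. ideal J (ring_of R) & I <= J}" using b by (auto simp: bij_betw_def)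
   then obtain J' where J': "J = ?f J'" "ideal J' (ring_of R)" "I <= J'" by auto
   thus ?case using w[of J'] ideal_ring_of[OF R, of J'] by auto
  next
   case (2 J J')
   hence "J \<in> ?f ` {J. ideal J (ring_of R) & I <= J}" "J' \<in> ?f ` {J. ideal J (ring_of R) & I <= J}" using b by (auto simp: bij_betw_def)
   then obtain K K' where K: "J = ?f K" "ideal K (ring_of R)" "I <= K" "J' = ?f K'" "ideal K' (ring_of R)" "I <= K'" by auto
   have "\<Union> J ~= \<Union> J'"
   proof
    assume "\<Union> J = \<Union> J'"
    hence "K = K'" using w[of K] w[of K'] K by metis
    thus False using 2(3) K by blast
   qed
   moreover have "\<Union> J <= \<Union> J'" by (rule Union_mono) (use 2 in auto)
   ultimately show ?case by simp
  qed
 qed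
qed

text \<open>The maximum condition, which transfers to localizations and residue rings by pulling back ideals.\<close>

definition noeth :: "'k::field set => bool" where
 "noeth R \<longleftrightarrow> (\<forall>F. F ~= {} & (\<forall>I\<in>F. smod R I & I <= R) --> (\<exists>I\<in>F. \<forall>J\<in>F. ~ I < J))"

lemma noethD:
 assumes "noeth R" "F ~= {}" "!!I. I \<in> F ==> smod R I & I <= R"
 obtains I where "I \<in> F" "!!J. J \<in> F ==> ~ I < J" using assms unfolding noeth_def by metis

lemma noetherian_imp_noeth:
 assumes "noetherian_ring (ring_of R)"
 shows "noeth R" unfolding noeth_def
proof (intro allI impI)
 interpret noetherian_ring "ring_of R" by fact
 have R: "subdom R" by (rule ring_imp_subdom) (rule ring_axioms)
 fix F :: "'a set set" assume F: "F ~= {} & (\<forall>I\<in>F. smod R I & I <= R)"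
 have "\<exists>M\<in>F. \<forall>X\<in>F. M <= X --> X = M"
 proof (rule subset_Zorn_nonempty)
  fix C assume ne: "C ~= {}" and C: "subset.chain F C"
  have "subset.chain {I. ideal I (ring_of R)} C" using C F by (auto simp: subset.chain_def ideal_ring_of[OF R])
  hence "\<Union>C \<in> C" using ideal_chain_is_trivial[OF ne] by simp
  thus "\<Union>C \<in> F" using C unfolding subset.chain_def by blast
 qed (use F in auto)
 thus "\<exists>I\<in>F. \<forall>J\<in>F. ~ I < J" by blast
qed

text \<open>Noetherian induction for ideals, reduced to prime ideals: if \<open>ab \<in> I\<close> with \<open>a, b \<notin> I\<close>, the
 properties of interest pass from \<open>I + aR\<close> and \<open>I + bR\<close> to \<open>I\<close>.\<close>

lemma noeth_prime_induct [consumes 4, case_names whole prime split]: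
 assumes R: "subdom R" and "noeth R" and I: "smod R I" "I <= R"
  and whole: "P R"
  and prime: "!!Q. prime_in R Q ==> (!!J. smod R J ==> J <= R ==> Q < J ==> P J) ==> P Q"
  and split: "!!I a b. smod R I ==> I <= R ==> a \<in> R ==> b \<in> R ==> a * b \<in> I ==>
   P (adj I a R) ==> P (adj I b R) ==> P I"
 shows "P I"
proof (rule ccontr)
 assume "~ P I"
 let ?F = "{I. smod R I & I <= R & ~ P I}"
 obtain I where "I \<in> ?F" and max: "!!J. J \<in> ?F ==> ~ I < J"
  by (rule noethD[OF \<open>noeth R\<close>, of ?F]) (use I \<open>~ P I\<close> in auto)
 hence I: "smod R I" "I <= R" "~ P I" by auto
 have bigger: "P (adj I a R)" if "a \<in> R" "a ~: I" for a
 proof (rule ccontr)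
  assume "~ P (adj I a R)"
  moreover have "smod R (adj I a R)" using smod_adj[OF I(1) subdom_smod[OF R]] .
  moreover have "adj I a R <= R" using adj_subset[OF subdom_smod[OF R] I(2) that(1)] .
  moreover have "I < adj I a R" using adj_supset[OF subdomD(2)[OF R]] adj_mem[OF smodD(1)[OF I(1)] subdomD(1)[OF R]] that(2) by blast
  ultimately show False using max by blast
 qed
 show False
 proof (cases "prime_in R I")
  case True
  thus False using prime[OF True] I(3) max by blast
 next
  case False
  moreover have "I ~= R" using whole I by blast
  ultimately obtain a b where "a \<in> R" "b \<in> R" "a * b \<in> I" "a ~: I" "b ~: I" using I unfolding prime_in_def by blast
  thus False using split[OF I(1,2), of a b] bigger I(3) by blast
 qed
qed

text \<open>The extension of an ideal to the localization at a prime \<open>Q\<close>.\<close>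

definition ext :: "'k::field set => 'k set => 'k set => 'k set" where
 "ext R Q I = {a / b | a b. a \<in> I & b \<in> R & b ~: Q}"

lemma localization_ext: "localization R Q = ext R Q R" "localization_max R Q = ext R Q Q"
 by (auto simp: localization_def localization_max_def ext_def)

lemma extI: "a \<in> I ==> b \<in> R ==> b ~: Q ==> a / b \<in> ext R Q I" by (auto simp: ext_def)

lemma extE:
 assumes "x \<in> ext R Q I"
 obtains a b where "x = a / b" "a \<in> I" "b \<in> R" "b ~: Q" using assms by (auto simp: ext_def)

lemma ext_mono: "I <= J ==> ext R Q I <= ext R Q J" by (auto simp: ext_def)

context
 fixes R Q :: "'k::field set"
 assumes R: "subdom R" and Q: "prime_in R Q"
begin

lemma ext_denom: "b \<in> R ==> b ~: Q ==> b ~= 0" "b \<in> R ==> b ~: Q ==> c \<in> R ==> c ~: Q ==> b * c \<in> R & b * c ~: Q"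
 using smodD(1)[OF prime_inD(1)[OF Q]] prime_inD(4)[OF Q, of b c] subdomD(4)[OF R] by auto

lemma ext_superset: "I <= ext R Q I"
proof
 fix x assume "x \<in> I"
 hence "x / 1 \<in> ext R Q I" using subdomD(1)[OF R] prime_one_notin[OF R Q] by (intro extI)
 thus "x \<in> ext R Q I" by simp
qed

lemma ext_add:
 assumes "smod R I" "x \<in> ext R Q I" "y \<in> ext R Q I"
 shows "x + y \<in> ext R Q I"
proof -
 obtain a b c d where x: "x = a / b" "a \<in> I" "b \<in> R" "b ~: Q" and y: "y = c / d" "c \<in> I" "d \<in> R" "d ~: Q"
  using assms(2,3) by (metis extE)
 have "x + y = (d * a + b * c) / (b * d)" using x y ext_denom(1)[of b] ext_denom(1)[of d] by (simp add: field_simps)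
 moreover have "d * a + b * c \<in> I" using x y smodD[OF assms(1)] by auto
 ultimately show ?thesis using ext_denom(2)[of b d] x y by (auto intro: extI)
qed

lemma ext_mult:
 assumes "smod R I" "x \<in> ext R Q R" "y \<in> ext R Q I"
 shows "x * y \<in> ext R Q I"
proof -
 obtain a b c d where x: "x = a / b" "a \<in> R" "b \<in> R" "b ~: Q" and y: "y = c / d" "c \<in> I" "d \<in> R" "d ~: Q"
  using assms(2,3) by (metis extE)
 have "x * y = (a * c) / (b * d)" using x y by simp
 moreover have "a * c \<in> I" using x y smodD[OF assms(1)] by auto
 ultimately show ?thesis using ext_denom(2)[of b d] x y by (auto intro: extI)
qed

lemma subdom_ext: "subdom (ext R Q R)" unfolding subdom_def
proof (intro conjI ballI)
 show "1 \<in> ext R Q R" using ext_superset[of R] subdomD(1)[OF R] by blast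
 fix x y assume x: "x \<in> ext R Q R" and y: "y \<in> ext R Q R"
 show "x * y \<in> ext R Q R" by (rule ext_mult[OF subdom_smod[OF R] x y])
 have "- 1 \<in> ext R Q R" using ext_superset[of R] subdomD(5)[OF R subdomD(1)[OF R]] by blast
 hence "- 1 * y \<in> ext R Q R" using ext_mult[OF subdom_smod[OF R] _ y] by blast
 thus "x - y \<in> ext R Q R" using ext_add[OF subdom_smod[OF R] x, of "- y"] by simp
qed

lemma smod_ext: "smod R I ==> smod (ext R Q R) (ext R Q I)"
 unfolding smod_def[of "ext R Q R"] using ext_add ext_mult ext_superset[of I] smodD(1) by blast

lemma smod_contr: "smod (ext R Q R) I ==> smod R (I \<inter> R)"
 using ext_superset[of R] smod_restrict[of "ext R Q R" I R] subdom_smod[OF R] smod_Int by blast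

lemma ext_contr:
 assumes "smod (ext R Q R) I" "I <= ext R Q R"
 shows "ext R Q (I \<inter> R) = I"
proof (intro equalityI subsetI)
 fix x assume "x \<in> ext R Q (I \<inter> R)"
 then obtain a b where x: "x = a / b" "a \<in> I" "b \<in> R" "b ~: Q" by (auto elim: extE)
 hence "(1 / b) * a \<in> I" using smodD(3)[OF assms(1)] extI[of 1 R b] subdomD(1)[OF R] by blast
 thus "x \<in> I" using x by simp
next
 fix x assume x: "x \<in> I"
 then obtain a b where ab: "x = a / b" "a \<in> R" "b \<in> R" "b ~: Q" using assms(2) by (meson extE subsetD)
 have "b * x \<in> I" using smodD(3)[OF assms(1), of b x] ext_superset[of R] ab x by blast
 moreover have "b * x = a" using ab ext_denom(1)[of b] by simp
 ultimately show "x \<in> ext R Q (I \<inter> R)" using ab by (auto intro: extI)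
qed

lemma contr_ext_prime:
 assumes "prime_in R q" "q <= Q"
 shows "ext R Q q \<inter> R = q"
proof (intro equalityI subsetI)
 fix x assume "x \<in> ext R Q q \<inter> R"
 then obtain a b where x: "x = a / b" "a \<in> q" "b \<in> R" "b ~: Q" "x \<in> R" by (auto elim: extE)
 hence "b * x \<in> q" "b ~: q" using ext_denom(1)[of b] assms by auto
 thus "x \<in> q" using prime_inD(4)[OF assms(1), of b x] x by auto
qed (use ext_superset[of q] prime_inD(2)[OF assms(1)] in auto)

lemma prime_ext:
 assumes "prime_in R q" "q <= Q"
 shows "prime_in (ext R Q R) (ext R Q q)" unfolding prime_in_def
proof (intro conjI ballI impI)
 show "smod (ext R Q R) (ext R Q q)" by (rule smod_ext[OF prime_inD(1)[OF assms(1)]])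
 have "1 ~: ext R Q q" using contr_ext_prime[OF assms] subdomD(1)[OF R] prime_one_notin[OF R assms(1)] by blast
 thus "ext R Q q < ext R Q R" using ext_mono[OF prime_inD(2)[OF assms(1)]] subdomD(1)[OF subdom_ext] by blast
 fix x y assume "x \<in> ext R Q R" "y \<in> ext R Q R" and xy: "x * y \<in> ext R Q q"
 then obtain a b c d where x: "x = a / b" "a \<in> R" "b \<in> R" "b ~: Q" and y: "y = c / d" "c \<in> R" "d \<in> R" "d ~: Q" by (metis extE)
 have "(b * d) * (x * y) \<in> ext R Q q"
  using smodD(3)[OF smod_ext[OF prime_inD(1)[OF assms(1)]] _ xy] ext_superset[of R] subdomD(4)[OF R, of b d] x y by blast
 moreover have "(b * d) * (x * y) = a * c" using x y ext_denom(1)[of b] ext_denom(1)[of d] by simp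
 ultimately have "a * c \<in> q" using contr_ext_prime[OF assms] subdomD(4)[OF R, of a c] x y by auto
 hence "a \<in> q | c \<in> q" using prime_inD(4)[OF assms(1)] x y by blast
 thus "x \<in> ext R Q q | y \<in> ext R Q q" using x y by (auto intro: extI)
qed

lemma prime_contr:
 assumes "prime_in (ext R Q R) q"
 shows "prime_in R (q \<inter> R)" "q \<inter> R <= Q"
proof -
 have 1: "1 ~: q" using prime_one_notin[OF subdom_ext assms] .
 show "prime_in R (q \<inter> R)" unfolding prime_in_def
 proof (intro conjI ballI impI)
  show "q \<inter> R < R" using 1 subdomD(1)[OF R] by blast
  fix x y assume "x \<in> R" "y \<in> R" "x * y \<in> q \<inter> R"
  thus "x \<in> q \<inter> R | y \<in> q \<inter> R" using prime_inD(4)[OF assms, of x y] ext_superset[of R] by blast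
 qed (use smod_contr[OF prime_inD(1)[OF assms]] in auto)
 show "q \<inter> R <= Q"
 proof
  fix x assume x: "x \<in> q \<inter> R"
  show "x \<in> Q"
  proof (rule ccontr)
   assume "x ~: Q"
   hence "1 / x \<in> ext R Q R" "x ~= 0" using x subdomD(1)[OF R] ext_denom(1) by (auto intro: extI)
   hence "(1 / x) * x \<in> q" using smodD(3)[OF prime_inD(1)[OF assms], of "1 / x" x] x by blast
   thus False using 1 \<open>x ~= 0\<close> by simp
  qed
 qed
qed

lemma noeth_ext:
 assumes "noeth R"
 shows "noeth (ext R Q R)" unfolding noeth_def
proof (intro allI impI)
 fix F assume F: "F ~= {} & (\<forall>I\<in>F. smod (ext R Q R) I & I <= ext R Q R)"
 obtain J where J: "J \<in> (%I. I \<inter> R) ` F" "!!K. K \<in> (%I. I \<inter> R) ` F ==> ~ J < K"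
  by (rule noethD[OF assms, of "(%I. I \<inter> R) ` F"]) (use F smod_contr in auto)
 then obtain I where I: "I \<in> F" "J = I \<inter> R" by blast
 have "~ I < K" if K: "K \<in> F" for K
 proof
  assume IK: "I < K"
  have "~ I \<inter> R < K \<inter> R" using J(2)[of "K \<inter> R"] K I by blast
  hence "I \<inter> R = K \<inter> R" using IK by blast
  hence "I = K" using ext_contr[of I] ext_contr[of K] F I K by metis
  thus False using IK by blast
 qed
 thus "\<exists>I\<in>F. \<forall>J\<in>F. ~ I < J" using I by blast
qed

end

section \<open>F-finite local domains\<close>

locale pchar =
 fixes p :: nat and ty :: "'k::field itself"
 assumes prime_p: "Factorial_Ring.prime p" and char_p: "CHAR('k) = p"
begin

lemma p_gt1: "p > 1" "p >= 2" "p > 0" "p ~= 0" using prime_gt_1_nat[OF prime_p] by auto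

lemma fadd: "((x::'k) + y) ^ p = x ^ p + y ^ p" by (rule freshmans_dream) (use prime_p char_p in auto)

lemma fsum: "(sum f A :: 'k) ^ p = (\<Sum>i\<in>A. f i ^ p)" by (rule freshmans_dream_sum) (use prime_p char_p in auto)

lemma fdiff: "((x::'k) - y) ^ p = x ^ p - y ^ p" using fadd[of "x - y" y] by (simp add: algebra_simps)

lemma fminus: "(- (x::'k)) ^ p = - (x ^ p)" using fdiff[of 0 x] p_gt1 by simp

lemma finj: "(x::'k) ^ p = y ^ p \<longleftrightarrow> x = y" using fdiff[of x y] p_gt1 by auto

lemma fzero: "(0::'k) ^ p = 0" using p_gt1 by simp

end

text \<open>A Noetherian F-finite local domain with maximal ideal \<open>m\<close> and fraction field the whole type.\<close>

locale fring = pchar p "TYPE('k)" for p :: nat and R m :: "'k::field set" +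
 assumes R: "subdom R" and frac: "!!x. \<exists>a\<in>R. \<exists>b\<in>R. b ~= 0 & x = a / b" and noeth: "noeth R"
  and m: "smod R m" "m < R" and units: "!!x. x \<in> R ==> x ~: m ==> 1 / x \<in> R"
  and ffin: "\<exists>G. finite G & G <= R & (\<forall>x\<in>R. \<exists>c. (\<forall>g\<in>G. c g \<in> R) & x = (\<Sum>g\<in>G. c g ^ p * g))"
begin

lemmas Rs = subdomD[OF R]
lemmas RR = subdom_smod[OF R]

lemma prime_m: "prime_in R m" unfolding prime_in_def
proof (intro conjI ballI impI)
 fix x y assume xy: "x \<in> R" "y \<in> R" "x * y \<in> m"
 show "x \<in> m | y \<in> m"
 proof (rule ccontr)
  assume "~ ?thesis"
  hence "1 / x \<in> R" "x ~: m" "y ~: m" using units xy by auto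
  hence "(1 / x) * (x * y) \<in> m" using smodD(3)[OF m(1) _ xy(3)] by blast
  moreover have "x ~= 0" using smodD(1)[OF m(1)] \<open>x ~: m\<close> by auto
  ultimately show False using \<open>y ~: m\<close> by simp
 qed
qed (use m in auto)

lemma one_notin_m: "1 ~: m" using prime_one_notin[OF R prime_m] .

lemma proper_le_m:
 assumes "smod R I" "I <= R" "1 ~: I"
 shows "I <= m"
proof
 fix x assume x: "x \<in> I"
 show "x \<in> m"
 proof (rule ccontr)
  assume "x ~: m"
  hence "(1 / x) * x \<in> I" using units[of x] smodD(3)[OF assms(1) _ x] x assms(2) by blast
  moreover have "x ~= 0" using smodD(1)[OF m(1)] \<open>x ~: m\<close> by auto
  ultimately show False using assms(3) by simp
 qed
qed

lemma prime_le_m: "prime_in R Q ==> Q <= m" using proper_le_m[of Q] prime_inD[of R Q] prime_one_notin[OF R] by blast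

lemma one_in_imp: "smod R I ==> I <= R ==> 1 \<in> I ==> I = R" using smodD(3)[of R I _ 1] by auto

lemma fring_loc:
 assumes Q: "prime_in R Q"
 shows "fring p (ext R Q R) (ext R Q Q)"
proof
 note S = subdom_ext[OF R Q]
 show "subdom (ext R Q R)" by fact
 show "noeth (ext R Q R)" by (rule noeth_ext[OF R Q noeth])
 show "smod (ext R Q R) (ext R Q Q)" "ext R Q Q < ext R Q R" using prime_ext[OF R Q Q] by (auto simp: prime_in_def)
 show "\<exists>a\<in>ext R Q R. \<exists>b\<in>ext R Q R. b ~= 0 & x = a / b" for x using frac[of x] ext_superset[OF R Q, of R] by blast
 show "1 / x \<in> ext R Q R" if x: "x \<in> ext R Q R" "x ~: ext R Q Q" for x
 proof -
  obtain a b where ab: "x = a / b" "a \<in> R" "b \<in> R" "b ~: Q" using x(1) by (rule extE)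
  hence "a ~: Q" using x(2) by (auto intro: extI)
  thus ?thesis using ab extI[of b R a R Q] by simp
 qed
 obtain G where G: "finite G" "G <= R" "!!x. x \<in> R ==> \<exists>c. (\<forall>g\<in>G. c g \<in> R) & x = (\<Sum>g\<in>G. c g ^ p * g)"
  using ffin by blast
 show "\<exists>G. finite G & G <= ext R Q R &
   (\<forall>x\<in>ext R Q R. \<exists>c. (\<forall>g\<in>G. c g \<in> ext R Q R) & x = (\<Sum>g\<in>G. c g ^ p * g))"
 proof (intro exI[of _ G] conjI ballI)
  fix x assume "x \<in> ext R Q R"
  then obtain a b where ab: "x = a / b" "a \<in> R" "b \<in> R" "b ~: Q" by (rule extE)
  have b0: "b ~= 0" using ab ext_denom(1)[OF R Q] by blast
  have "a * b ^ (p - 1) \<in> R" using ab Rs by auto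
  then obtain c where c: "\<forall>g\<in>G. c g \<in> R" "a * b ^ (p - 1) = (\<Sum>g\<in>G. c g ^ p * g)" using G(3) by blast
  have bp: "b ^ p = b * b ^ (p - 1)" using p_gt1 by (cases p) auto
  have "x = a * b ^ (p - 1) / b ^ p" unfolding bp using ab b0 by simp
  also have "\<dots> = (\<Sum>g\<in>G. (c g / b) ^ p * g)" unfolding c(2) by (simp add: sum_divide_distrib power_divide)
  finally show "\<exists>c. (\<forall>g\<in>G. c g \<in> ext R Q R) & x = (\<Sum>g\<in>G. c g ^ p * g)"
   using c(1) ab by (intro exI[of _ "%g. c g / b"]) (auto intro: extI)
 qed (use G ext_superset[OF R Q, of R] in auto)
qed

end

section \<open>Degrees of residue fields over their p-th powers\<close>

definition pgen :: "nat => 'k::field set => 'k set => 'k set => 'k => bool" where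
 "pgen p R Q G s \<longleftrightarrow> finite G & G <= R & s \<in> R & s ~: Q &
  (\<forall>x\<in>R. \<exists>c. (\<forall>g\<in>G. c g \<in> R) & s ^ p * x - (\<Sum>g\<in>G. c g ^ p * g) \<in> Q)"

definition pindep :: "nat => 'k::field set => 'k set => 'k set => bool" where
 "pindep p R Q G \<longleftrightarrow> (\<forall>c. (\<forall>g\<in>G. c g \<in> R) --> (\<Sum>g\<in>G. c g ^ p * g) \<in> Q --> (\<forall>g\<in>G. c g \<in> Q))"

text \<open>The degree of the residue field at \<open>Q\<close> over its p-th powers, expressed by a basis in \<open>R\<close> and a common denominator
 \<open>s\<close> instead of the residue field itself.\<close>

definition pdegree :: "nat => 'k::field set => 'k set => nat => bool" where
 "pdegree p R Q N \<longleftrightarrow> (\<exists>G s. pgen p R Q G s & pindep p R Q G & card G = N)"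

context fring
begin

text \<open>Over the subring of p-th powers, \<open>R\<close> is a finite module, and the length over it is \<open>kap\<close> times the length over \<open>R\<close>; by
 \<open>kap_pdegree\<close>, \<open>kap\<close> is the degree of the residue field over its p-th powers.\<close>

definition pw :: "'k set => 'k set" where "pw A = (%x. x ^ p) ` A"

definition kap :: enat where "kap = len (pw R) m R"

lemma pw_le: "pw R <= R" using Rs(7) by (auto simp: pw_def)

lemma subdom_pw: "subdom A ==> subdom (pw A)" unfolding subdom_def pw_def
 by (auto simp: fdiff[symmetric] power_mult_distrib[symmetric] intro: image_eqI[of _ _ 1])

lemma smod_pw: "smod A I ==> smod (pw A) (pw I)" unfolding smod_def pw_def
 by (auto simp: fadd[symmetric] power_mult_distrib[symmetric] p_gt1 intro!: image_eqI[of 0 _ 0])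

lemma smod_pw_restrict: "smod R I ==> smod (pw R) I" by (rule smod_restrict[OF _ pw_le])

lemma len_pw: "N <= M ==> len (pw A) (pw N) (pw M) = len A N M" unfolding pw_def
 by (rule len_image) (auto simp: fadd power_mult_distrib finj p_gt1 inj_def)

lemma len_pw_restrict:
 assumes "smod R N" "smod R M" "N <= M"
 shows "len (pw R) N M = kap * len R N M" unfolding kap_def by (rule len_restrict_scalars[OF R subdom_pw[OF R] pw_le m units assms])

lemma len_m: "len R m R = 1"
proof (rule antisym)
 show "1 <= len R m R" by (rule len_pos[OF m(1) RR m(2)])
 show "len R m R <= 1"
 proof (rule ccontr)
  assume "~ len R m R <= 1"
  hence "enat 2 <= len R m R" by (cases "len R m R") (auto simp: one_enat_def)
  then obtain C where C: "\<forall>i\<le>2. smod R (C i) & m <= C i & C i <= R" "\<forall>i<2. C i < C (Suc i)"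
   unfolding len_def chain_sup_ge chain_def by auto
  have c: "C 0 < C 1" "C 1 < C 2" using C(2) by (auto simp: numeral_2_eq_2)
  have "1 ~: C 1"
  proof
   assume "1 \<in> C 1"
   hence "C 1 = R" using one_in_imp[of "C 1"] C(1) by auto
   thus False using c(2) C(1) by auto
  qed
  hence "C 1 <= m" using proper_le_m[of "C 1"] C(1) by auto
  thus False using c(1) C(1) by auto
 qed
qed

text \<open>A generating family of least size is independent, since a relation with a coefficient outside \<open>Q\<close> would make
 one generator superfluous after enlarging the denominator.\<close>

lemma pdegree_exists:
 assumes Q: "prime_in R Q"
 shows "\<exists>N. pdegree p R Q N"
proof -
 obtain G0 where G0: "finite G0" "G0 <= R" "!!x. x \<in> R ==> \<exists>c. (\<forall>g\<in>G0. c g \<in> R) & x = (\<Sum>g\<in>G0. c g ^ p * g)"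
  using ffin by blast
 have "pgen p R Q G0 1" unfolding pgen_def
 proof (intro conjI ballI)
  show "1 ~: Q" by (rule prime_one_notin[OF R Q])
  fix x assume "x \<in> R"
  then obtain c where "\<forall>g\<in>G0. c g \<in> R" "x = (\<Sum>g\<in>G0. c g ^ p * g)" using G0(3) by blast
  thus "\<exists>c. (\<forall>g\<in>G0. c g \<in> R) & 1 ^ p * x - (\<Sum>g\<in>G0. c g ^ p * g) \<in> Q"
   using smodD(1)[OF prime_inD(1)[OF Q]] by (intro exI[of _ c]) auto
 qed (use G0 Rs in auto)
 hence ex: "\<exists>n G s. pgen p R Q G s & card G = n" by blast
 define n where "n = (LEAST n. \<exists>G s. pgen p R Q G s & card G = n)"
 obtain G s where G: "pgen p R Q G s" "card G = n" using LeastI_ex[OF ex] unfolding n_def by blast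
 have least: "n <= card G'" if "pgen p R Q G' s'" for G' s' unfolding n_def by (rule Least_le) (use that in blast)
 note Qs = prime_inD(1)[OF Q]
 have "pindep p R Q G" unfolding pindep_def
 proof (intro allI impI ballI, rule ccontr)
  fix c g0 assume c: "\<forall>g\<in>G. c g \<in> R" "(\<Sum>g\<in>G. c g ^ p * g) \<in> Q" and g0: "g0 \<in> G" "c g0 ~: Q"
  have fG: "finite G" "G <= R" "s \<in> R" "s ~: Q" using G(1) by (auto simp: pgen_def)
  have "pgen p R Q (G - {g0}) (s * c g0)" unfolding pgen_def
  proof (intro conjI ballI)
   show "s * c g0 \<in> R" using fG c g0 Rs by auto
   show "s * c g0 ~: Q" using prime_inD(4)[OF Q, of s "c g0"] fG c g0 by auto
   fix x assume "x \<in> R"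
   then obtain e where e: "\<forall>g\<in>G. e g \<in> R" "s ^ p * x - (\<Sum>g\<in>G. e g ^ p * g) \<in> Q" using G(1) by (auto simp: pgen_def)
   let ?c = "%g. c g0 * e g - e g0 * c g"
   have "(\<Sum>g\<in>G - {g0}. ?c g ^ p * g) = (\<Sum>g\<in>G. ?c g ^ p * g)"
    using fG g0 p_gt1 by (subst sum.remove[of G g0]) (auto simp: mult.commute)
   also have "\<dots> = c g0 ^ p * (\<Sum>g\<in>G. e g ^ p * g) - e g0 ^ p * (\<Sum>g\<in>G. c g ^ p * g)"
    by (simp add: fdiff power_mult_distrib sum_distrib_left sum_subtractf algebra_simps)
   finally have "(s * c g0) ^ p * x - (\<Sum>g\<in>G - {g0}. ?c g ^ p * g) =
     c g0 ^ p * (s ^ p * x - (\<Sum>g\<in>G. e g ^ p * g)) + e g0 ^ p * (\<Sum>g\<in>G. c g ^ p * g)" by (simp add: power_mult_distrib algebra_simps)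
   moreover have "\<dots> \<in> Q" using smodD[OF Qs] Rs(7) c e g0 by auto
   moreover have "\<forall>g\<in>G - {g0}. ?c g \<in> R" using c e g0 Rs by auto
   ultimately show "\<exists>c'. (\<forall>g\<in>G - {g0}. c' g \<in> R) & (s * c g0) ^ p * x - (\<Sum>g\<in>G - {g0}. c' g ^ p * g) \<in> Q"
    by (intro exI[of _ ?c]) auto
  qed (use fG in auto)
  hence "n <= card (G - {g0})" by (rule least)
  moreover have "card (G - {g0}) < card G" using fG(1) g0(1) by (rule card_Diff1_less)
  ultimately show False using G(2) by simp
 qed
 thus ?thesis using G unfolding pdegree_def by blast
qed

lemma common_denominator:
 assumes Q: "prime_in R Q" and "finite G" "\<forall>g\<in>G. c g \<in> ext R Q R"
 shows "\<exists>b\<in>R. b ~: Q & (\<forall>g\<in>G. b * c g \<in> R)" using assms(2,3)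
proof (induction G rule: finite_induct)
 case empty
 thus ?case using Rs(1) prime_one_notin[OF R Q] by auto
next
 case (insert g G)
 then obtain b where b: "b \<in> R" "b ~: Q" "\<forall>g\<in>G. b * c g \<in> R" by auto
 obtain a d where ad: "c g = a / d" "a \<in> R" "d \<in> R" "d ~: Q" using insert.prems by (meson extE insertI1)
 have "d ~= 0" using ext_denom(1)[OF R Q ad(3,4)] .
 have "b * d * c h \<in> R" if "h \<in> G" for h using Rs(4)[of d "b * c h"] ad b that by (simp add: ac_simps)
 moreover have "b * d * c g \<in> R" using ad b \<open>d ~= 0\<close> Rs by simp
 ultimately show ?case using ext_denom(2)[OF R Q, of b d] ad b by (intro bexI[of _ "b * d"]) auto
qed

lemma pgen_loc:
 assumes Q0: "prime_in R Q0" and Q: "prime_in R Q" and le: "Q0 <= Q" and G: "pgen p R Q0 G s"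
 shows "pgen p (ext R Q R) (ext R Q Q0) G s"
proof -
 note sup = ext_superset[OF R Q]
 have fG: "finite G" "G <= R" "s \<in> R" "s ~: Q0" using G by (auto simp: pgen_def)
 show ?thesis unfolding pgen_def
 proof (intro conjI ballI)
  show "s ~: ext R Q Q0" using contr_ext_prime[OF R Q Q0 le] fG by blast
  fix x assume "x \<in> ext R Q R"
  then obtain a b where ab: "x = a / b" "a \<in> R" "b \<in> R" "b ~: Q" by (rule extE)
  have b0: "b ~= 0" using ab ext_denom(1)[OF R Q] by blast
  have "a * b ^ (p - 1) \<in> R" using ab Rs by auto
  then obtain c where c: "\<forall>g\<in>G. c g \<in> R" "s ^ p * (a * b ^ (p - 1)) - (\<Sum>g\<in>G. c g ^ p * g) \<in> Q0"
   using G by (auto simp: pgen_def)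
  have bp: "b ^ p = b * b ^ (p - 1)" using p_gt1 by (cases p) auto
  have bpQ: "b ^ p \<in> R" "b ^ p ~: Q" using ab Rs(7) prime_power_notin[OF R Q] by auto
  have xe: "x = a * b ^ (p - 1) / b ^ p" unfolding bp using ab b0 by simp
  have "s ^ p * x - (\<Sum>g\<in>G. (c g / b) ^ p * g) = (s ^ p * (a * b ^ (p - 1)) - (\<Sum>g\<in>G. c g ^ p * g)) / b ^ p"
   unfolding xe by (simp add: sum_divide_distrib power_divide diff_divide_distrib)
  also have "\<dots> \<in> ext R Q Q0" using c(2) bpQ by (rule extI)
  finally show "\<exists>c. (\<forall>g\<in>G. c g \<in> ext R Q R) & s ^ p * x - (\<Sum>g\<in>G. c g ^ p * g) \<in> ext R Q Q0"
   using c(1) ab by (intro exI[of _ "%g. c g / b"]) (auto intro: extI)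
 qed (use fG sup in auto)
qed

lemma pdegree_loc:
 assumes Q0: "prime_in R Q0" and Q: "prime_in R Q" and le: "Q0 <= Q" and N: "pdegree p R Q0 N"
 shows "pdegree p (ext R Q R) (ext R Q Q0) N"
proof -
 obtain G s where G: "pgen p R Q0 G s" "pindep p R Q0 G" "card G = N" using N by (auto simp: pdegree_def)
 note S = subdom_ext[OF R Q]
 note sup = ext_superset[OF R Q]
 have fG: "finite G" "G <= R" "s \<in> R" "s ~: Q0" using G(1) by (auto simp: pgen_def)
 have "pgen p (ext R Q R) (ext R Q Q0) G s" by (rule pgen_loc[OF Q0 Q le G(1)])
 moreover have "pindep p (ext R Q R) (ext R Q Q0) G" unfolding pindep_def
 proof (intro allI impI)
  fix c assume c: "\<forall>g\<in>G. c g \<in> ext R Q R" "(\<Sum>g\<in>G. c g ^ p * g) \<in> ext R Q Q0"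
  obtain b where b: "b \<in> R" "b ~: Q" "\<forall>g\<in>G. b * c g \<in> R" using common_denominator[OF Q fG(1) c(1)] by blast
  have b0: "b ~= 0" using b ext_denom(1)[OF R Q] by blast
  have "(\<Sum>g\<in>G. (b * c g) ^ p * g) = b ^ p * (\<Sum>g\<in>G. c g ^ p * g)" by (simp add: power_mult_distrib sum_distrib_left ac_simps)
  also have "\<dots> \<in> ext R Q Q0" using smodD(3)[OF smod_ext[OF R Q prime_inD(1)[OF Q0]] _ c(2)] sup[of R] Rs(7) b(1) by blast
  finally have "(\<Sum>g\<in>G. (b * c g) ^ p * g) \<in> ext R Q Q0" .
  moreover have "(\<Sum>g\<in>G. (b * c g) ^ p * g) \<in> R" using b fG Rs by (intro subdom_sum[OF R]) auto
  ultimately have "(\<Sum>g\<in>G. (b * c g) ^ p * g) \<in> Q0" using contr_ext_prime[OF R Q Q0 le] by blast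
  hence "\<forall>g\<in>G. b * c g \<in> Q0" using G(2) b(3) unfolding pindep_def by (meson)
  hence "\<forall>g\<in>G. (b * c g) / b \<in> ext R Q Q0" using b extI[of _ Q0 b R Q] by blast
  thus "\<forall>g\<in>G. c g \<in> ext R Q Q0" using b0 by simp
 qed
 ultimately show ?thesis using G(3) by (auto simp: pdegree_def)
qed

lemma pw_choice:
 assumes "\<forall>g\<in>G. c g \<in> pw A"
 obtains c' where "\<forall>g\<in>G. c' g \<in> A" "\<forall>g\<in>G. c g = c' g ^ p"
proof -
 have "\<forall>g\<in>G. \<exists>y. y \<in> A & c g = y ^ p" using assms by (auto simp: pw_def)
 then obtain c' where "\<forall>g\<in>G. c' g \<in> A & c g = c' g ^ p" by (rule bchoice[THEN exE])
 thus ?thesis using that[of c'] by simp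
qed

lemma pgen_gens:
 assumes G: "pgen p R Q G s" and Q: "Q <= J" and J: "smod R J" "J <= R"
 defines "M0 \<equiv> gens J (pw R) G"
 shows "smod (pw R) M0" "J <= M0" "M0 <= R" "adj J (s ^ p) R <= M0" "G <= M0"
proof -
 have fG: "finite G" "G <= R" "s \<in> R" using G by (auto simp: pgen_def)
 note B = subdom_pw[OF R]
 show "smod (pw R) M0" unfolding M0_def by (rule smod_gens[OF fG(1) B smod_pw_restrict[OF J(1)]])
 show "J <= M0" unfolding M0_def by (rule gens_supset[OF B])
 show "M0 <= R" unfolding M0_def by (rule gens_subset[OF smod_pw_restrict[OF RR] J(2) fG(2)])
 show "G <= M0" unfolding M0_def using gens_mem[OF fG(1) B _ smodD(1)[OF J(1)]] by blast
 show "adj J (s ^ p) R <= M0"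
 proof
  fix u assume "u \<in> adj J (s ^ p) R"
  then obtain q a where u: "u = q + a * s ^ p" "q \<in> J" "a \<in> R" by (auto simp: adj_def)
  obtain c where c: "\<forall>g\<in>G. c g \<in> R" "s ^ p * a - (\<Sum>g\<in>G. c g ^ p * g) \<in> Q" using G(1) u by (auto simp: pgen_def)
  have "u = (q + (s ^ p * a - (\<Sum>g\<in>G. c g ^ p * g))) + (\<Sum>g\<in>G. c g ^ p * g)" using u by (simp add: algebra_simps)
  moreover have "q + (s ^ p * a - (\<Sum>g\<in>G. c g ^ p * g)) \<in> J" using smodD(2)[OF J(1)] u c Q by blast
  ultimately show "u \<in> M0" unfolding M0_def gens_def using c(1)
   by (intro CollectI exI[of _ "q + (s ^ p * a - (\<Sum>g\<in>G. c g ^ p * g))"] exI[of _ "%g. c g ^ p"]) (auto simp: pw_def)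
 qed
qed

lemma kap_pdegree:
 assumes "pdegree p R m N"
 shows "kap = enat N"
proof -
 obtain G s where G: "pgen p R m G s" "pindep p R m G" "card G = N" using assms by (auto simp: pdegree_def)
 have fG: "finite G" "G <= R" "s \<in> R" "s ~: m" using G(1) by (auto simp: pgen_def)
 have s: "1 / s \<in> R" "s ~= 0" using units fG smodD(1)[OF m(1)] by auto
 note M0 = pgen_gens[OF G(1) order_refl m(1) psubset_imp_subset[OF m(2)]]
 have "s ^ p * (1 / s) ^ p = 1" using s by (simp flip: power_mult_distrib)
 hence "x = 0 + (x * (1 / s) ^ p) * s ^ p" for x by (simp add: ac_simps)
 hence "x \<in> adj m (s ^ p) R" if "x \<in> R" for x unfolding adj_def using smodD(1)[OF m(1)] Rs(4)[OF that Rs(7)[OF s(1)]] by blast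
 hence "gens m (pw R) G = R" using M0(3,4) by blast
 moreover have "len (pw R) m (gens m (pw R) G) = of_nat (card G) * len (pw R) (pw m) (pw R)"
 proof (rule len_gens[OF fG(1) subdom_pw[OF R] smod_pw_restrict[OF m(1)] smod_pw[OF m(1)]])
  show "u * g \<in> m" if "g \<in> G" and "u \<in> pw m" for g u
  proof -
   obtain v where "v \<in> m" "u = v ^ p" using \<open>u \<in> pw m\<close> unfolding pw_def by blast
   hence "u = v ^ (p - 1) * v" using p_gt1 by (cases p) auto
   hence "u \<in> m" using \<open>v \<in> m\<close> Rs(7) m smodD(3)[OF m(1)] by auto
   thus ?thesis using that fG smodD(4)[OF m(1)] by blast
  qed
  show "pw m <= pw R" using m(2) by (auto simp: pw_def)
  fix c g assume c: "\<forall>g\<in>G. c g \<in> pw R" "(\<Sum>g\<in>G. c g * g) \<in> m" "g \<in> G"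
  obtain c' where c': "\<forall>g\<in>G. c' g \<in> R" "\<forall>g\<in>G. c g = c' g ^ p" using c(1) by (rule pw_choice)
  have "(\<Sum>g\<in>G. c' g ^ p * g) = (\<Sum>g\<in>G. c g * g)" using c' by (intro sum.cong) auto
  hence "c' g \<in> m" using G(2) c' c unfolding pindep_def by metis
  thus "c g \<in> pw m" using c' c(3) by (auto simp: pw_def)
 qed
 ultimately have "kap = of_nat (card G) * len R m R" unfolding kap_def using m(2) by (simp add: len_pw)
 thus ?thesis using len_m G(3) by (simp add: of_nat_eq_enat)
qed

lemma kap_finite: obtains k where "kap = enat k" "k > 0"
proof -
 obtain N where "pdegree p R m N" using pdegree_exists[OF prime_m] by blast
 hence "kap = enat N" by (rule kap_pdegree)
 moreover have "1 <= kap" unfolding kap_def using len_pos[OF smod_pw_restrict[OF m(1)] smod_pw_restrict[OF RR] m(2)] .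
 ultimately show ?thesis using that[of N] by (simp add: one_enat_def)
qed

lemma len_colon:
 assumes "smod R I" "I <= R" "a \<in> R"
 shows "len R I R = len R {x \<in> R. x * a \<in> I} R + len R (adj I a R) R"
proof -
 have "len R I R = len R I (adj I a R) + len R (adj I a R) R"
  by (rule len_add[OF R assms(1) smod_adj[OF assms(1) RR] RR adj_supset[OF Rs(2)] adj_subset[OF RR assms(2,3)]])
 thus ?thesis using len_cyclic[OF R assms(1) RR, of a] by simp
qed

lemma len_split:
 assumes "smod R I" "I <= R" "a \<in> R" "b \<in> R" "a * b \<in> I"
 shows "len R I R <= len R (adj I b R) R + len R (adj I a R) R"
proof -
 have "adj I b R <= {x \<in> R. x * a \<in> I}"
 proof
  fix x assume x: "x \<in> adj I b R"
  then obtain i r where ir: "x = i + r * b" "i \<in> I" "r \<in> R" by (auto simp: adj_def)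
  have "x * a = a * i + r * (a * b)" using ir by (simp add: algebra_simps)
  moreover have "a * i + r * (a * b) \<in> I" by (rule smodD(2)[OF assms(1)]) (use smodD(3)[OF assms(1)] ir assms in auto)
  ultimately show "x \<in> {x \<in> R. x * a \<in> I}" using x adj_subset[OF RR assms(2,4)] by auto
 qed
 hence "len R {x \<in> R. x * a \<in> I} R <= len R (adj I b R) R" by (rule len_mono) simp
 thus ?thesis using len_colon[OF assms(1-3)] by (simp add: add_mono)
qed

lemma len_finite:
 assumes "smod R I" "I <= R" "!!Q. prime_in R Q ==> I <= Q ==> Q = m"
 shows "len R I R ~= \<infinity>"
proof -
 have "(\<forall>Q. prime_in R Q --> I <= Q --> Q = m) --> len R I R ~= \<infinity>" using R noeth assms(1,2)
 proof (induction rule: noeth_prime_induct)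
  case whole
  thus ?case by (simp add: len_refl)
 next
  case (prime Q)
  thus ?case using len_m by (auto simp: one_enat_def)
 next
  case (split I a b)
  have "I <= adj I x R" for x by (rule adj_supset[OF Rs(2)])
  thus ?case using len_split[OF split(1-5)] split(6,7) by (cases "len R I R") (auto dest: order_trans)
 qed
 thus ?thesis using assms(3) by blast
qed

lemma adj_prime_power:
 assumes Q: "prime_in R Q" and x: "x \<in> R" "x ~: Q"
 shows "len R (adj Q (x ^ k) R) R = of_nat k * len R (adj Q x R) R"
proof (induction k)
 case 0
 have "adj Q (x ^ 0) R = R" using one_in_imp[OF smod_adj[OF prime_inD(1)[OF Q] RR, of 1] adj_subset[OF RR prime_inD(2)[OF Q] Rs(1)]]
   adj_mem[OF smodD(1)[OF prime_inD(1)[OF Q]] Rs(1), of 1] by simp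
 thus ?case by (simp add: len_refl)
next
 case (Suc k)
 let ?A = "adj Q (x ^ Suc k) R" and ?B = "adj Q (x ^ k) R"
 note Qs = prime_inD(1)[OF Q]
 have A: "smod R ?A" "?A <= R" by (rule smod_adj[OF Qs RR], rule adj_subset[OF RR prime_inD(2)[OF Q] Rs(7)[OF x(1)]])
 have "len R ?A R = len R {a \<in> R. a * x ^ k \<in> ?A} R + len R (adj ?A (x ^ k) R) R" by (rule len_colon[OF A Rs(7)[OF x(1)]])
 also have "adj ?A (x ^ k) R = ?B"
 proof (intro equalityI subsetI)
  fix u assume "u \<in> adj ?A (x ^ k) R"
  then obtain q r r' where u: "u = q + r * x ^ Suc k + r' * x ^ k" "q \<in> Q" "r \<in> R" "r' \<in> R" by (auto simp: adj_def)
  hence "u = q + (r * x + r') * x ^ k" by (simp add: algebra_simps)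
  thus "u \<in> ?B" unfolding adj_def using u x Rs(4,6) by blast
 next
  fix u assume "u \<in> ?B"
  thus "u \<in> adj ?A (x ^ k) R" using adj_supset[OF Rs(2), of Q "x ^ Suc k"] by (auto simp: adj_def[of _ "x ^ k"])
 qed
 also have "{a \<in> R. a * x ^ k \<in> ?A} = adj Q x R"
 proof (intro equalityI subsetI)
  fix a assume "a \<in> {a \<in> R. a * x ^ k \<in> ?A}"
  then obtain q r where a: "a \<in> R" "a * x ^ k = q + r * x ^ Suc k" "q \<in> Q" "r \<in> R" by (auto simp: adj_def)
  hence "(a - r * x) * x ^ k = q" by (simp add: algebra_simps)
  hence "a - r * x \<in> Q" using prime_inD(4)[OF Q, of "a - r * x" "x ^ k"] prime_power_notin[OF R Q x] a x Rs by auto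
  moreover have "a = (a - r * x) + r * x" by simp
  ultimately show "a \<in> adj Q x R" using a unfolding adj_def by blast
 next
  fix a assume aa: "a \<in> adj Q x R"
  then obtain q r where a: "a = q + r * x" "q \<in> Q" "r \<in> R" by (auto simp: adj_def)
  have "a * x ^ k = q * x ^ k + r * x ^ Suc k" using a by (simp add: algebra_simps)
  hence "a * x ^ k \<in> ?A" unfolding adj_def using a smodD(4)[OF Qs, of "x ^ k" q] Rs(7)[OF x(1)] by blast
  thus "a \<in> {a \<in> R. a * x ^ k \<in> ?A}" using aa adj_subset[OF RR prime_inD(2)[OF Q] x(1)] by blast
 qed
 finally show ?case using Suc by (simp add: distrib_right)
qed

text \<open>Kunz: the degree grows by the factor \<open>p\<close> from a prime to an adjacent smaller prime. The ring modulo
 the smaller prime has dimension one, where \<open>x \<mapsto>\<close> length of \<open>M/xM\<close> sees only the rank of a torsion free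
 module \<open>M\<close>; it is evaluated on the ring as a module over its p-th powers.\<close>

lemma kunz_dim1:
 assumes Q: "prime_in R Q" and ne: "Q ~= m" and adjacent: "!!Q'. prime_in R Q' ==> Q < Q' ==> Q' = m"
  and N: "pdegree p R Q N"
 shows "enat N = of_nat p * kap"
proof -
 obtain G s where G: "pgen p R Q G s" "pindep p R Q G" "card G = N" using N by (auto simp: pdegree_def)
 have fG: "finite G" "G <= R" "s \<in> R" "s ~: Q" using G(1) by (auto simp: pgen_def)
 obtain k where k: "kap = enat k" "k > 0" by (rule kap_finite)
 obtain x where x: "x \<in> m" "x ~: Q" using prime_le_m[OF Q] ne by blast
 have xR: "x \<in> R" using x m by blast
 define y where "y = x ^ p"
 have yR: "y \<in> R" "y ~: Q" "y \<in> pw R" using xR x Rs(7) prime_power_notin[OF R Q] by (auto simp: y_def pw_def)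
 note Qs = prime_inD(1)[OF Q]
 note B = subdom_pw[OF R]
 define M0 where "M0 = gens Q (pw R) G"
 note M0 = pgen_gens[OF G(1) order_refl Qs prime_inD(2)[OF Q], folded M0_def]
 note QM0 = M0(2) and M0R = M0(3) and M0s = M0(4) and GM0 = M0(5) and M0 = M0(1)
 have fin: "len R (adj Q z R) R ~= \<infinity>" if z: "z \<in> R" "z ~: Q" for z
 proof (rule len_finite[OF smod_adj[OF Qs RR] adj_subset[OF RR prime_inD(2)[OF Q] z(1)]])
  fix Q' assume Q': "prime_in R Q'" "adj Q z R <= Q'"
  have "Q <= Q'" "z \<in> Q'" using Q'(2) adj_supset[OF Rs(2), of Q z] adj_mem[OF smodD(1)[OF Qs] Rs(1), of z] by auto
  thus "Q' = m" using adjacent[OF Q'(1)] z by blast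
 qed
 have M0fin: "len (pw R) M0 R ~= \<infinity>"
 proof -
  have sp: "s ^ p \<in> R" "s ^ p ~: Q" using fG Rs(7) prime_power_notin[OF R Q] by auto
  have "len (pw R) M0 R <= len (pw R) (adj Q (s ^ p) R) R" by (rule len_mono[OF M0s]) simp
  also have "\<dots> = kap * len R (adj Q (s ^ p) R) R" by (rule len_pw_restrict[OF smod_adj[OF Qs RR] RR adj_subset[OF RR prime_inD(2)[OF Q] sp(1)]])
  finally show ?thesis using fin[OF sp] k by (cases "len R (adj Q (s ^ p) R) R"; cases "len (pw R) M0 R") auto
 qed
 \<comment> \<open>\<open>M\<^sub>0 \<subseteq> R\<close> has finite colength, so \<open>M\<^sub>0/yM\<^sub>0\<close> and \<open>R/yR\<close> modulo \<open>Q\<close> have the same length. Since \<open>y = x\<^sup>p\<close>, over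
  the p-th powers the first is \<open>N\<close> times and the second \<open>p kap\<close> times the length of \<open>R/(Q + xR)\<close>.\<close>
 define N' where "N' = adj Q y M0"
 have N': "smod (pw R) N'" unfolding N'_def by (rule smod_adj[OF smod_pw_restrict[OF Qs] M0])
 have QN': "Q <= N'" unfolding N'_def by (rule adj_supset) (use M0 smodD in blast)
 have N'M0: "N' <= M0" unfolding N'_def adj_def using smodD(2)[OF M0] smodD(4)[OF M0] QM0 yR by blast
 define Y where "Y = adj Q y R"
 have Y: "smod R Y" "Y <= R" unfolding Y_def by (rule smod_adj[OF Qs RR], rule adj_subset[OF RR prime_inD(2)[OF Q] yR(1)])
 have N'Y: "N' <= Y" unfolding N'_def Y_def adj_def using M0R by blast
 note RB = smod_pw_restrict[OF RR]
 have "len (pw R) N' R = len (pw R) N' Y + len (pw R) Y R" by (rule len_add[OF B N' smod_pw_restrict[OF Y(1)] RB N'Y Y(2)])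
 moreover have "len (pw R) N' R = len (pw R) N' M0 + len (pw R) M0 R" by (rule len_add[OF B N' M0 RB N'M0 M0R])
 moreover have "len (pw R) N' Y = len (pw R) M0 R"
 proof -
  have "Y = adj N' y R"
  proof (intro equalityI subsetI)
   fix u assume "u \<in> Y"
   thus "u \<in> adj N' y R" using QN' by (auto simp: Y_def adj_def)
  next
   fix u assume "u \<in> adj N' y R"
   then obtain n a where u: "u = n + a * y" "n \<in> N'" "a \<in> R" by (auto simp: adj_def)
   have "n \<in> Y" "a * y \<in> Y" using u N'Y adj_mult_mem[OF smodD(1)[OF Qs]] by (auto simp: Y_def)
   thus "u \<in> Y" using u smodD(2)[OF Y(1)] by blast
  qed
  hence "len (pw R) N' Y = len (pw R) {a \<in> R. a * y \<in> N'} R" using len_cyclic[OF B N' RB, of y] by simp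
  also have "{a \<in> R. a * y \<in> N'} = M0"
  proof (intro equalityI subsetI)
   fix a assume "a \<in> {a \<in> R. a * y \<in> N'}"
   then obtain q u where a: "a \<in> R" "a * y = q + u * y" "q \<in> Q" "u \<in> M0" by (auto simp: N'_def adj_def)
   hence "(a - u) * y \<in> Q" by (simp add: algebra_simps)
   hence "a - u \<in> Q" using prime_inD(4)[OF Q, of "a - u" y] a M0R yR Rs(3)[of a u] by blast
   hence "(a - u) + u \<in> M0" using smodD(2)[OF M0] a QM0 by blast
   thus "a \<in> M0" by simp
  next
   fix a assume "a \<in> M0"
   thus "a \<in> {a \<in> R. a * y \<in> N'}" using M0R adj_mult_mem[OF smodD(1)[OF Qs]] by (auto simp: N'_def)
  qed
  finally show ?thesis .
 qed
 ultimately have eq: "len (pw R) Y R = len (pw R) N' M0" using M0fin by (simp add: add.commute enat_add_left_cancel)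
 define X where "X = adj Q x R"
 have X: "smod R X" "X <= R" unfolding X_def by (rule smod_adj[OF Qs RR], rule adj_subset[OF RR prime_inD(2)[OF Q] xR])
 have M0eq: "gens N' (pw R) G = M0"
 proof (intro equalityI subsetI)
  fix u assume "u \<in> gens N' (pw R) G"
  thus "u \<in> M0" using gens_subset[OF M0 N'M0 GM0] by blast
 next
  fix u assume "u \<in> M0"
  thus "u \<in> gens N' (pw R) G" using QN' by (auto simp: M0_def gens_def)
 qed
 have "len (pw R) N' (gens N' (pw R) G) = of_nat (card G) * len (pw R) (pw X) (pw R)"
 proof (rule len_gens[OF fG(1) B N' smod_pw[OF X(1)]])
  show "pw X <= pw R" using X(2) by (auto simp: pw_def)
  show "u * g \<in> N'" if g: "g \<in> G" "u \<in> pw X" for g u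
  proof -
   obtain q a where u: "u = (q + a * x) ^ p" "q \<in> Q" "a \<in> R" using g by (auto simp: pw_def X_def adj_def)
   have "u * g = q ^ p * g + (a ^ p * g) * y" using u by (simp add: fadd power_mult_distrib y_def algebra_simps)
   moreover have "q ^ p = q ^ (p - 1) * q" using p_gt1 by (cases p) auto
   moreover have "g * q ^ (p - 1) \<in> R" using u g fG Rs(4,7) prime_inD(2)[OF Q] by blast
   hence "(g * q ^ (p - 1)) * q \<in> Q" using u smodD(3)[OF Qs] by blast
   ultimately have "q ^ p * g \<in> Q" "u * g = q ^ p * g + (a ^ p * g) * y" by (simp_all add: ac_simps)
   moreover have "a ^ p * g \<in> M0" by (rule smodD(3)[OF M0]) (use u g GM0 in "auto simp: pw_def")
   ultimately show ?thesis unfolding N'_def adj_def by blast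
  qed
  fix c g
  assume c: "\<forall>g\<in>G. c g \<in> pw R" "(\<Sum>g\<in>G. c g * g) \<in> N'" "g \<in> G"
  obtain c' where c': "\<forall>g\<in>G. c' g \<in> R" "\<forall>g\<in>G. c g = c' g ^ p" using c(1) by (rule pw_choice)
  obtain q u where qu: "(\<Sum>g\<in>G. c g * g) = q + u * y" "q \<in> Q" "u \<in> M0" using c(2) by (auto simp: N'_def adj_def)
  obtain q' d where u: "u = q' + (\<Sum>g\<in>G. d g * g)" "q' \<in> Q" "\<forall>g\<in>G. d g \<in> pw R" using qu(3) by (auto simp: M0_def gens_def)
  obtain d' where d': "\<forall>g\<in>G. d' g \<in> R" "\<forall>g\<in>G. d g = d' g ^ p" using u(3) by (rule pw_choice)
  have "(\<Sum>g\<in>G. (c' g - x * d' g) ^ p * g) = (\<Sum>g\<in>G. c g * g - y * (d g * g))"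
   using c' d' by (intro sum.cong) (auto simp: fdiff power_mult_distrib y_def algebra_simps)
  also have "\<dots> = (\<Sum>g\<in>G. c g * g) - y * (\<Sum>g\<in>G. d g * g)" by (simp only: sum_subtractf sum_distrib_left)
  also have "\<dots> = q + y * q'" unfolding qu(1) u(1) by (simp add: algebra_simps)
  also have "\<dots> \<in> Q" using qu u smodD[OF Qs] yR by auto
  finally have "(\<Sum>g\<in>G. (c' g - x * d' g) ^ p * g) \<in> Q" .
  moreover have "\<forall>g\<in>G. c' g - x * d' g \<in> R" using c' d' xR Rs by auto
  ultimately have "c' g - x * d' g \<in> Q" using G(2)[unfolded pindep_def, rule_format, of "%g. c' g - x * d' g" g] c(3) by simp
  moreover have "c' g = (c' g - x * d' g) + d' g * x" by simp
  ultimately have "c' g \<in> X" unfolding X_def adj_def using d' c(3) by blast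
  thus "c g \<in> pw X" using c' c(3) by (auto simp: pw_def)
 qed
 hence "len (pw R) Y R = of_nat N * len R X R" unfolding eq M0eq using X(2) G(3) by (simp add: len_pw)
 moreover have "len (pw R) Y R = kap * (of_nat p * len R X R)"
  using len_pw_restrict[OF Y(1) RR Y(2)] adj_prime_power[OF Q xR x(2), of p] by (simp add: Y_def X_def y_def)
 ultimately have e: "of_nat N * len R X R = kap * (of_nat p * len R X R)" by simp
 have "len R X R ~= \<infinity>" unfolding X_def by (rule fin[OF xR x(2)])
 moreover have "1 <= len R X R"
 proof (rule len_pos[OF X(1) RR])
  have "X <= m" unfolding X_def by (rule adj_subset[OF m(1) prime_le_m[OF Q] x(1)])
  thus "X < R" using m(2) by blast
 qed
 ultimately obtain l where "len R X R = enat l" "l > 0" by (cases "len R X R") (auto simp: one_enat_def)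
 thus ?thesis using e k by (simp add: of_nat_eq_enat)
qed

lemma kunz_step:
 assumes Q: "prime_in R Q" and Q': "prime_in R Q'" and lt: "Q < Q'"
  and adjacent: "!!q. prime_in R q ==> Q < q ==> q <= Q' ==> q = Q'"
  and N: "pdegree p R Q N" "pdegree p R Q' N'"
 shows "N = p * N'"
proof -
 interpret A: fring p "ext R Q' R" "ext R Q' Q'" by (rule fring_loc[OF Q'])
 have le: "Q <= Q'" using lt by blast
 have "A.kap = enat N'" by (rule A.kap_pdegree[OF pdegree_loc[OF Q' Q' order_refl N(2)]])
 moreover have "enat N = of_nat p * A.kap"
 proof (rule A.kunz_dim1[OF prime_ext[OF R Q' Q le] _ _ pdegree_loc[OF Q Q' le N(1)]])
  show "ext R Q' Q ~= ext R Q' Q'" using contr_ext_prime[OF R Q' Q le] contr_ext_prime[OF R Q' Q' order_refl] lt by auto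
  fix q assume q: "prime_in (ext R Q' R) q" "ext R Q' Q < q"
  have qc: "ext R Q' (q \<inter> R) = q" by (rule ext_contr[OF R Q' prime_inD(1,2)[OF q(1)]])
  have "Q <= q \<inter> R" using q(2) contr_ext_prime[OF R Q' Q le] by blast
  moreover have "Q ~= q \<inter> R" using qc q(2) by auto
  ultimately have "q \<inter> R = Q'" using adjacent[OF prime_contr(1)[OF R Q' q(1)]] prime_contr(2)[OF R Q' q(1)] by blast
  thus "q = ext R Q' Q'" using qc by simp
 qed
 ultimately show ?thesis by (simp add: of_nat_eq_enat)
qed

end

section \<open>Coheight and Hilbert-Kunz bounds\<close>

definition chain_from :: "'k::field set => 'k set => nat => bool" where
 "chain_from R Q n \<longleftrightarrow> (\<exists>C. C 0 = Q & (\<forall>i\<le>n. prime_in R (C i)) & (\<forall>i<n. C i < C (Suc i)))"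

definition coht :: "'k::field set => 'k set => nat" where
 "coht R Q = (GREATEST n. chain_from R Q n)"

lemma krull_dim_prime_in: "subdom R ==> krull_dim (ring_of R) = chain_sup (prime_in R)"
 unfolding krull_dim_def using primeideal_ring_of[of R] by (intro arg_cong[of _ _ chain_sup]) auto

locale fdring = fring p R m for p :: nat and R m :: "'k::field set" +
 fixes d :: nat
 assumes dim: "krull_dim (ring_of R) = enat d"
begin

lemma chain_from_le: "chain_from R Q n ==> n <= d"
proof -
 assume "chain_from R Q n"
 hence "chain (prime_in R) n" unfolding chain_from_def chain_def by blast
 hence "enat n <= enat d" using dim unfolding krull_dim_prime_in[OF R] by (metis chain_sup_ge)
 thus ?thesis by simp
qed

lemma coht_attained: "prime_in R Q ==> chain_from R Q (coht R Q)" unfolding coht_def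
 by (rule GreatestI_nat[of _ 0 d]) (auto simp: chain_from_le, auto simp: chain_from_def)

lemma coht_ge: "chain_from R Q n ==> n <= coht R Q" unfolding coht_def by (rule Greatest_le_nat[of _ _ d]) (auto simp: chain_from_le)

lemma chain_from_Suc:
 assumes "prime_in R Q" "Q < Q'" "chain_from R Q' n"
 shows "chain_from R Q (Suc n)"
proof -
 obtain C where C: "C 0 = Q'" "\<forall>i\<le>n. prime_in R (C i)" "\<forall>i<n. C i < C (Suc i)" using assms(3) by (auto simp: chain_from_def)
 show ?thesis unfolding chain_from_def
 proof (intro exI[of _ "%i. if i = 0 then Q else C (i - 1)"] conjI allI impI)
  fix i assume "i < Suc n"
  thus "(if i = 0 then Q else C (i - 1)) < (if Suc i = 0 then Q else C (Suc i - 1))" using C assms(2) by (cases i) auto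
 qed (use C assms in auto)
qed

lemma coht_less: "prime_in R Q ==> prime_in R Q' ==> Q < Q' ==> coht R Q' < coht R Q"
 using coht_ge[OF chain_from_Suc[OF _ _ coht_attained], of Q Q'] by simp

lemma coht_zero: "coht R {0} = d"
proof (rule antisym)
 note z = zero_prime[OF R]
 show "coht R {0} <= d" by (rule chain_from_le[OF coht_attained[OF z]])
 have "enat d <= chain_sup (prime_in R)" using dim krull_dim_prime_in[OF R] by simp
 hence "d = 0 | (\<exists>C. (\<forall>i\<le>d. prime_in R (C i)) & (\<forall>i<d. C i < C (Suc i)))" unfolding chain_sup_ge chain_def .
 then consider "d = 0" | C where "\<forall>i\<le>d. prime_in R (C i)" "\<forall>i<d. C i < C (Suc i)" by (elim disjE exE conjE) auto
 thus "d <= coht R {0}"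
 proof cases
  case 2
  have "chain_from R {0} d" unfolding chain_from_def
  proof (intro exI[of _ "C(0 := {0})"] conjI allI impI)
   fix i assume i: "i < d"
   hence "C i < C (Suc i)" "0 \<in> C 0" using 2 smodD(1)[OF prime_inD(1)[of R "C 0"]] by auto
   have z: "{0} < C (Suc i)" if "i = 0"
   proof -
    have "C 0 < C (Suc i)" using \<open>C i < C (Suc i)\<close> that by simp
    hence u: "0 \<in> C (Suc i)" "{0} ~= C (Suc i)" using \<open>0 \<in> C 0\<close> by (auto dest: equalityD2)
    show ?thesis by (rule psubsetI) (use u in auto)
   qed
   show "(C(0 := {0})) i < (C(0 := {0})) (Suc i)" using \<open>C i < C (Suc i)\<close> z by (cases "i = 0") simp_all
  qed (use 2 z in auto)
  thus ?thesis by (rule coht_ge)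
 qed simp
qed

text \<open>Each step of a longest chain of primes multiplies the degree by \<open>p\<close>.\<close>

lemma pdegree_coht:
 assumes "prime_in R Q" "pdegree p R Q N"
 shows "enat N = of_nat (p ^ coht R Q) * kap" using assms
proof (induction "coht R Q" arbitrary: Q N)
 case 0
 have "Q = m"
 proof (rule ccontr)
  assume "Q ~= m"
  hence "coht R m < coht R Q" using coht_less[OF 0(2) prime_m] prime_le_m[OF 0(2)] by blast
  thus False using 0 by simp
 qed
 thus ?case using kap_pdegree 0 by simp
next
 case (Suc n)
 obtain C where C: "C 0 = Q" "\<forall>i\<le>Suc n. prime_in R (C i)" "\<forall>i<Suc n. C i < C (Suc i)"
  using coht_attained[OF Suc(3)] Suc(2) by (auto simp: chain_from_def)
 define Q' where "Q' = C 1"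
 have Q': "prime_in R Q'" "Q < Q'" using C unfolding Q'_def by auto
 have "chain_from R Q' n" unfolding chain_from_def by (intro exI[of _ "%i. C (Suc i)"]) (use C in "auto simp: Q'_def")
 hence "n <= coht R Q'" by (rule coht_ge)
 hence n: "n = coht R Q'" using coht_less[OF Suc(3) Q'] Suc(2) by simp
 obtain N' where N': "pdegree p R Q' N'" using pdegree_exists[OF Q'(1)] by blast
 have "N = p * N'"
 proof (rule kunz_step[OF Suc(3) Q' _ Suc(4) N'])
  fix q assume q: "prime_in R q" "Q < q" "q <= Q'"
  show "q = Q'"
  proof (rule ccontr)
   assume "q ~= Q'"
   hence "coht R Q' < coht R q" "coht R q < coht R Q" using coht_less q Q' Suc(3) by auto
   thus False using Suc(2) n by simp
  qed
 qed
 moreover have "enat N' = of_nat (p ^ n) * kap" using Suc.hyps(1)[OF n Q'(1) N'] n by simp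
 ultimately have "enat N = of_nat p * (of_nat (p ^ n) * kap)" by (metis of_nat_eq_enat times_enat_simps(1))
 thus ?case using Suc(2)[symmetric] by (simp add: mult.assoc)
qed

end

context fring
begin

definition lam :: "'k set => nat" where "lam J = the_enat (len R J R)"

text \<open>Splitting ideals of level \<open>e\<close> have this property, and it passes to larger ideals. It forces finite colength.\<close>

definition cof :: "nat => 'k set => bool" where
 "cof e J \<longleftrightarrow> smod R J & J <= R & (\<forall>x\<in>m. x ^ (p ^ e) \<in> J)"

lemma cofD: "cof e J ==> smod R J" "cof e J ==> J <= R" "cof e J ==> x \<in> m ==> x ^ (p ^ e) \<in> J" by (auto simp: cof_def)

lemma len_lam: "cof e J ==> len R J R = enat (lam J)"
proof -
 assume J: "cof e J"
 have "len R J R ~= \<infinity>"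
 proof (rule len_finite[OF cofD(1,2)[OF J]])
  fix Q assume Q: "prime_in R Q" "J <= Q"
  have "m <= Q"
  proof
   fix x assume "x \<in> m"
   hence "x ^ (p ^ e) \<in> Q" "x \<in> R" using cofD(3)[OF J] Q(2) m by auto
   thus "x \<in> Q" using prime_power_notin[OF R Q(1)] by blast
  qed
  thus "Q = m" using prime_le_m[OF Q(1)] by blast
 qed
 thus ?thesis by (auto simp: lam_def)
qed

lemma cof_superset: "cof e J ==> smod R J' ==> J <= J' ==> J' <= R ==> cof e J'" by (auto simp: cof_def)

lemma cof_adj: "cof e J ==> a \<in> R ==> cof e (adj J a R)"
 by (rule cof_superset[OF _ smod_adj[OF cofD(1) RR] adj_supset[OF Rs(2)] adj_subset[OF RR cofD(2)]])

lemma cof_colon: "cof e J ==> a \<in> R ==> cof e {x \<in> R. x * a \<in> J}"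
proof (rule cof_superset, assumption)
 assume J: "cof e J" and a: "a \<in> R"
 show "smod R {x \<in> R. x * a \<in> J}" using smodD[OF cofD(1)[OF J]] Rs by (auto simp: smod_def distrib_right mult.assoc)
 show "J <= {x \<in> R. x * a \<in> J}" using cofD(2)[OF J] smodD(4)[OF cofD(1)[OF J] a] by blast
qed auto

lemma lam_colon: "cof e J ==> a \<in> R ==> lam J = lam {x \<in> R. x * a \<in> J} + lam (adj J a R)"
 using len_colon[OF cofD(1,2), of e J e a] len_lam[of e J] len_lam[OF cof_adj[of e J a]] len_lam[OF cof_colon[of e J a]] by simp

lemma lam_mono: "cof e J ==> cof e' J' ==> J <= J' ==> lam J' <= lam J" using len_mono[of J J' R R R] len_lam[of e J] len_lam[of e' J'] by simp

lemma lam_R: "lam R = 0" by (simp add: lam_def len_refl zero_enat_def)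

text \<open>Comparing an ideal \<open>J\<close> with the ideal of the elements whose p-th power lies in \<open>J\<close>: away from a
 proper closed subset, \<open>R/Q\<close> is generated over its p-th powers by as many elements as the degree of
 its residue field.\<close>

lemma cof_root:
 assumes "cof (Suc e) J"
 shows "cof e {r \<in> R. r ^ p \<in> J}" unfolding cof_def
proof (intro conjI ballI)
 note J = cofD[OF assms]
 show "smod R {r \<in> R. r ^ p \<in> J}"
  using smodD[OF J(1)] Rs by (auto simp: smod_def fadd fzero power_mult_distrib simp del: power_eq_0_iff power_0_left)
 fix x assume "x \<in> m"
 thus "x ^ p ^ e \<in> {r \<in> R. r ^ p \<in> J}" using J(3)[of x] m Rs(7) by (auto simp: power_mult[symmetric] mult.commute)
qed auto

lemma frobenius_compare:
 assumes J: "cof (Suc e) J" and Q: "Q <= J" and G: "pgen p R Q G s"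
 shows "kap * enat (lam J) <= of_nat (card G) * enat (lam {r \<in> R. r ^ p \<in> J}) + kap * enat (lam (adj J (s ^ p) R))"
proof -
 let ?K = "{r \<in> R. r ^ p \<in> J}"
 have fG: "finite G" "G <= R" "s \<in> R" using G(1) by (auto simp: pgen_def)
 note B = subdom_pw[OF R] and Jd = cofD[OF J]
 note JB = smod_pw_restrict[OF Jd(1)]
 define M0 where "M0 = gens J (pw R) G"
 note M0 = pgen_gens[OF G Q Jd(1,2), folded M0_def]
 note JM0 = M0(2) and M0R = M0(3) and sub = M0(4) and M0 = M0(1)
 have sp: "s ^ p \<in> R" using fG Rs by auto
 have "kap * len R J R = len (pw R) J R" by (rule len_pw_restrict[symmetric, OF Jd(1) RR Jd(2)])
 also have "\<dots> = len (pw R) J M0 + len (pw R) M0 R" by (rule len_add[OF B JB M0 smod_pw_restrict[OF RR] JM0 M0R])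
 also have "len (pw R) J M0 <= of_nat (card G) * len (pw R) (pw ?K) (pw R)" unfolding M0_def
 proof (rule len_gens_le[OF fG(1) B JB smod_pw[OF cofD(1)[OF cof_root[OF J]]]])
  show "u * g \<in> J" if "g \<in> G" and "u \<in> pw ?K" for g u using that fG smodD(4)[OF Jd(1), of g u] unfolding pw_def by blast
  show "pw ?K <= pw R" by (auto simp: pw_def)
 qed
 also have "len (pw R) (pw ?K) (pw R) = len R ?K R" by (rule len_pw) auto
 also have "len (pw R) M0 R <= len (pw R) (adj J (s ^ p) R) R" by (rule len_mono[OF sub order_refl])
 also have "\<dots> = kap * len R (adj J (s ^ p) R) R" by (rule len_pw_restrict[OF cofD(1)[OF cof_adj[OF J sp]] RR cofD(2)[OF cof_adj[OF J sp]]])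
 finally show ?thesis using len_lam[OF J] len_lam[OF cof_root[OF J]] len_lam[OF cof_adj[OF J sp]] by (simp add: add_mono)
qed

end

context fdring
begin

lemma frobenius_compare_coht:
 assumes Q: "prime_in R Q"
 obtains s where "s \<in> R" "s ~: Q" "!!e J. cof (Suc e) J ==> Q <= J ==>
  lam J <= p ^ coht R Q * lam {r \<in> R. r ^ p \<in> J} + lam (adj J (s ^ p) R)"
proof -
 obtain N where N: "pdegree p R Q N" using pdegree_exists[OF Q] by blast
 obtain G s where G: "pgen p R Q G s" "card G = N" using N by (auto simp: pdegree_def)
 obtain k where k: "kap = enat k" "k > 0" by (rule kap_finite)
 have "enat N = enat (p ^ coht R Q * k)" using pdegree_coht[OF Q N] k by (simp add: of_nat_eq_enat)
 hence Nk: "N = p ^ coht R Q * k" by simp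
 show ?thesis
 proof (rule that[of s])
  fix e J assume J: "cof (Suc e) J" "Q <= J"
  have "k * lam J <= N * lam {r \<in> R. r ^ p \<in> J} + k * lam (adj J (s ^ p) R)"
   using frobenius_compare[OF J G(1)] k G(2) by (simp add: of_nat_eq_enat)
  hence "k * lam J <= k * (p ^ coht R Q * lam {r \<in> R. r ^ p \<in> J} + lam (adj J (s ^ p) R))" unfolding Nk by (simp add: algebra_simps)
  thus "lam J <= p ^ coht R Q * lam {r \<in> R. r ^ p \<in> J} + lam (adj J (s ^ p) R)" using k(2) by simp
 qed (use G(1) in "auto simp: pgen_def")
qed

text \<open>Colengths at level \<open>e\<close> of ideals containing \<open>I\<close> grow at most like \<open>p\<^sup>e\<close> to the dimension of \<open>R/I\<close>. Noetherian
 induction reduces this to a prime \<open>Q\<close>, where passing from level \<open>e\<close> to \<open>e+1\<close> multiplies the colength by at most \<open>p\<close> to the coheight of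
 \<open>Q\<close>, up to the colength of a larger ideal, for which the bound is smaller by a factor \<open>p\<^sup>e\<close>.\<close>

theorem hilbert_kunz_bound:
 assumes "smod R I" "I <= R" "!!Q. prime_in R Q ==> I <= Q ==> coht R Q + b <= c"
 obtains C :: real where "C >= 0" "!!e J. cof e J ==> I <= J ==> real (lam J) * real p ^ (e * b) <= C * real p ^ (e * c)"
proof -
 have "\<forall>b. (\<forall>Q. prime_in R Q --> I <= Q --> coht R Q + b <= c) -->
   (\<exists>C::real. C >= 0 & (\<forall>e J. cof e J --> I <= J --> real (lam J) * real p ^ (e * b) <= C * real p ^ (e * c)))"
  using R noeth assms(1,2)
 proof (induction rule: noeth_prime_induct)
  case whole
  have "lam J = 0" if "cof e J" "R <= J" for e J
  proof -
   have "J = R" using that cofD(2) by blast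
   thus ?thesis using lam_R by simp
  qed
  thus ?case by (intro allI impI exI[of _ 0]) auto
 next
  case (prime Q)
  show ?case
  proof (intro allI impI)
   fix b assume b: "\<forall>Q'. prime_in R Q' --> Q <= Q' --> coht R Q' + b <= c"
   obtain s where s: "s \<in> R" "s ~: Q" and fc: "!!e J. cof (Suc e) J ==> Q <= J ==>
     lam J <= p ^ coht R Q * lam {r \<in> R. r ^ p \<in> J} + lam (adj J (s ^ p) R)"
    by (rule frobenius_compare_coht[OF prime(1)]) (assumption | rule that)+
   let ?I = "adj Q (s ^ p) R"
   note Qs = prime_inD(1)[OF prime(1)]
   have sp: "s ^ p \<in> R" "s ^ p ~: Q" using s Rs(7) prime_power_notin[OF R prime(1)] by auto
   have I: "smod R ?I" "?I <= R" "Q < ?I" using smod_adj[OF Qs RR] adj_subset[OF RR prime_inD(2)[OF prime(1)] sp(1)]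
     adj_supset[OF Rs(2), of Q "s ^ p"] adj_mem[OF smodD(1)[OF Qs] Rs(1), of "s ^ p"] sp(2) by auto
   have "\<forall>Q'. prime_in R Q' --> ?I <= Q' --> coht R Q' + Suc b <= c"
   proof (intro allI impI)
    fix Q' assume Q': "prime_in R Q'" "?I <= Q'"
    hence "coht R Q' < coht R Q" using coht_less[OF prime(1) Q'(1)] I(3) by blast
    moreover have "coht R Q + b <= c" using b prime(1) by blast
    ultimately show "coht R Q' + Suc b <= c" by simp
   qed
   then obtain C :: real where C: "C >= 0" "!!e J. cof e J ==> ?I <= J ==>
     real (lam J) * real p ^ (e * Suc b) <= C * real p ^ (e * c)" using prime(2)[OF I] by blast
   have cb: "coht R Q + b <= c" using b prime(1) by blast
   \<comment> \<open>The errors at all levels up to \<open>e\<close> form a geometric series, bounded by \<open>2C(1 - p\<^sup>-\<^sup>e)\<close>.\<close>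
   have main: "real (lam J) * real p ^ (e * b) <= (1 + 2 * C * (1 - 1 / real p ^ e)) * real p ^ (e * c)"
    if "cof e J" "Q <= J" for e J using that
   proof (induction e arbitrary: J)
    case 0
    have "m <= J" using cofD(3)[OF 0(1)] by auto
    hence "len R J R <= 1" using len_mono[of m J R R R] len_m by simp
    thus ?case using len_lam[OF 0(1)] by (simp add: one_enat_def)
   next
    case (Suc e)
    let ?K = "{r \<in> R. r ^ p \<in> J}" and ?A = "adj J (s ^ p) R"
    define P where "P = real p"
    define q where "q = P ^ e"
    have P: "P >= 2" and q: "q > 0" using p_gt1 by (auto simp: P_def q_def)
    have "Q <= ?K"
    proof
     fix x assume x: "x \<in> Q"
     have "x ^ p = x ^ (p - 1) * x" using p_gt1 by (cases p) auto
     moreover have "x ^ (p - 1) * x \<in> Q" using x prime_inD(2)[OF prime(1)] Rs(7) smodD(3)[OF Qs] by blast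
     ultimately show "x \<in> ?K" using x Suc(3) prime_inD(2)[OF prime(1)] by auto
    qed
    hence IH: "real (lam ?K) * P ^ (e * b) <= (1 + 2 * C * (1 - 1 / q)) * P ^ (e * c)" using Suc.IH[OF cof_root[OF Suc(2)]] by (simp add: P_def q_def)
    have "?I <= ?A" using Suc(3) by (auto simp: adj_def)
    hence A: "real (lam ?A) * P ^ (Suc e * Suc b) <= C * P ^ (Suc e * c)" using C(2)[OF cof_adj[OF Suc(2) sp(1)]] by (simp only: P_def)
    have "P ^ (Suc e * Suc b) = P ^ (Suc e * b) * (P * q)" by (simp add: q_def power_add[symmetric] ac_simps)
    hence A': "real (lam ?A) * P ^ (Suc e * b) <= C * P ^ (Suc e * c) / (P * q)" using A P q by (simp add: pos_le_divide_eq ac_simps)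
    have "real (lam J) <= real (p ^ coht R Q * lam ?K + lam ?A)" using fc[OF Suc(2,3)] by (simp only: of_nat_le_iff)
    hence "real (lam J) <= P ^ coht R Q * real (lam ?K) + real (lam ?A)" by (simp add: P_def)
    hence "real (lam J) * P ^ (Suc e * b) <= (P ^ coht R Q * real (lam ?K) + real (lam ?A)) * P ^ (Suc e * b)" using P by (intro mult_right_mono) auto
    also have "\<dots> = P ^ (coht R Q + b) * (real (lam ?K) * P ^ (e * b)) + real (lam ?A) * P ^ (Suc e * b)" by (simp add: algebra_simps power_add)
    also have "\<dots> <= P ^ c * ((1 + 2 * C * (1 - 1 / q)) * P ^ (e * c)) + C * P ^ (Suc e * c) / (P * q)"
    proof (rule add_mono[OF mult_mono[OF _ IH] A'])
     show "P ^ (coht R Q + b) <= P ^ c" by (rule power_increasing[OF cb]) (use P in simp)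
    qed (use P in auto)
    also have "\<dots> = (1 + 2 * C * (1 - 1 / q) + C / (P * q)) * P ^ (Suc e * c)" by (simp add: power_add algebra_simps)
    also have "\<dots> <= (1 + 2 * C * (1 - 1 / (P * q))) * P ^ (Suc e * c)"
    proof (rule mult_right_mono)
     have "C * 3 / (P * q) <= C * 2 / q"
     proof -
      have "3 / (P * q) <= 2 / q" using P q by (simp add: divide_simps)
      thus ?thesis using C(1) by (metis mult_left_mono times_divide_eq_right)
     qed
     thus "1 + 2 * C * (1 - 1 / q) + C / (P * q) <= 1 + 2 * C * (1 - 1 / (P * q))" by (simp add: algebra_simps)
    qed (use P in simp)
    finally show ?case by (simp add: P_def q_def)
   qed
   show "\<exists>C::real. C >= 0 & (\<forall>e J. cof e J --> Q <= J --> real (lam J) * real p ^ (e * b) <= C * real p ^ (e * c))"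
   proof (intro exI[of _ "1 + 2 * C"] conjI allI impI)
    fix e J assume "cof e J" "Q <= J"
    hence "real (lam J) * real p ^ (e * b) <= (1 + 2 * C * (1 - 1 / real p ^ e)) * real p ^ (e * c)" by (rule main)
    also have "\<dots> <= (1 + 2 * C) * real p ^ (e * c)"
    proof (rule mult_right_mono)
     have "2 * C * (1 / real p ^ e) >= 0" using C(1) by simp
     thus "1 + 2 * C * (1 - 1 / real p ^ e) <= 1 + 2 * C" by (simp add: algebra_simps)
    qed simp
    finally show "real (lam J) * real p ^ (e * b) <= (1 + 2 * C) * real p ^ (e * c)" .
   qed (use C(1) in simp)
  qed
 next
  case (split I x y)
  show ?case
  proof (intro allI impI)
   fix b assume b: "\<forall>Q'. prime_in R Q' --> I <= Q' --> coht R Q' + b <= c"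
   have sup: "I <= adj I z R" for z by (rule adj_supset[OF Rs(2)])
   have bx: "\<forall>Q'. prime_in R Q' --> adj I z R <= Q' --> coht R Q' + b <= c" for z using b sup[of z] by blast
   obtain C1 :: real where C1: "C1 >= 0" "!!e J. cof e J ==> adj I x R <= J ==> real (lam J) * real p ^ (e * b) <= C1 * real p ^ (e * c)"
    using split(6)[rule_format, of b] bx[of x] by blast
   obtain C2 :: real where C2: "C2 >= 0" "!!e J. cof e J ==> adj I y R <= J ==> real (lam J) * real p ^ (e * b) <= C2 * real p ^ (e * c)"
    using split(7)[rule_format, of b] bx[of y] by blast
   show "\<exists>C::real. C >= 0 & (\<forall>e J. cof e J --> I <= J --> real (lam J) * real p ^ (e * b) <= C * real p ^ (e * c))"
   proof (intro exI[of _ "C1 + C2"] conjI allI impI)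
    fix e J assume J: "cof e J" "I <= J"
    let ?K = "{r \<in> R. r * x \<in> J}"
    have 1: "adj I x R <= adj J x R" using J(2) by (auto simp: adj_def)
    have 2: "adj I y R <= ?K"
    proof (rule adj_subset[OF cofD(1)[OF cof_colon[OF J(1) split(3)]]])
     show "I <= ?K" using J split(2,3) smodD(4)[OF cofD(1)[OF J(1)]] by blast
     show "y \<in> ?K" using J split by (auto simp: mult.commute)
    qed
    have "real (lam J) * real p ^ (e * b) = real (lam ?K) * real p ^ (e * b) + real (lam (adj J x R)) * real p ^ (e * b)"
     unfolding lam_colon[OF J(1) split(3)] by (simp add: distrib_right)
    also have "\<dots> <= C2 * real p ^ (e * c) + C1 * real p ^ (e * c)"
     by (rule add_mono[OF C2(2)[OF cof_colon[OF J(1) split(3)] 2] C1(2)[OF cof_adj[OF J(1) split(3)] 1]])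
    finally show "real (lam J) * real p ^ (e * b) <= (C1 + C2) * real p ^ (e * c)" by (simp add: algebra_simps)
   qed (use C1 C2 in simp)
  qed
 qed
 thus ?thesis using that assms(3) by blast
qed

end

section \<open>Valuations of a normal Noetherian domain\<close>

context fring
begin

text \<open>If the maximal ideal is generated by \<open>t\<close>, every element is a unit times a power of \<open>t\<close>: a
 counterexample \<open>x\<close> with maximal \<open>xR\<close> would be a multiple \<open>tx'\<close> of a counterexample \<open>x'\<close>.\<close>

lemma principal_max_factor:
 assumes t: "m = {t * x | x. x \<in> R}" "t ~= 0" and x: "x \<in> R" "x ~= 0"
 shows "\<exists>u k. u \<in> R & u ~: m & x = u * t ^ k"
proof (rule ccontr)
 let ?bad = "%x. x \<in> R & x ~= 0 & ~ (\<exists>u k. u \<in> R & u ~: m & x = u * t ^ k)"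
 let ?F = "{(%r. r * x) ` R | x. ?bad x}"
 assume "~ ?thesis"
 hence "?bad x" using x by blast
 hence ne: "?F ~= {}" by blast
 have sm: "smod R I & I <= R" if "I \<in> ?F" for I
 proof -
  from that
  obtain y where y: "I = (%r. r * y) ` R" "?bad y" by blast
  show "smod R I & I <= R" unfolding y(1) smod_def
  proof (intro conjI ballI)
   show "0 \<in> (%r. r * y) ` R" by (rule image_eqI[of _ _ 0]) (use Rs in auto)
  next
   fix u v assume "u \<in> (%r. r * y) ` R" "v \<in> (%r. r * y) ` R"
   then obtain a b where "u = a * y" "v = b * y" "a \<in> R" "b \<in> R" by blast
   thus "u + v \<in> (%r. r * y) ` R" by (intro image_eqI[of _ _ "a + b"]) (use Rs in "auto simp: algebra_simps")
  next
   fix c u assume "c \<in> R" "u \<in> (%r. r * y) ` R"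
   then obtain a where "u = a * y" "a \<in> R" by blast
   thus "c * u \<in> (%r. r * y) ` R" by (intro image_eqI[of _ _ "c * a"]) (use Rs \<open>c \<in> R\<close> in "auto simp: algebra_simps")
  qed (use y Rs in auto)
 qed
 obtain I where I: "I \<in> ?F" "!!J. J \<in> ?F ==> ~ I < J" using noethD[OF noeth ne sm] by blast
 then obtain y where y: "I = (%r. r * y) ` R" "?bad y" by blast
 have "y \<in> m"
 proof (rule ccontr)
  assume "y ~: m"
  hence "y \<in> R & y ~: m & y = y * t ^ 0" using y by simp
  thus False using y(2) by blast
 qed
 then obtain y' where y': "y = t * y'" "y' \<in> R" using t by blast
 have "?bad y'"
 proof -
  have "y' ~= 0" using y y' by auto
  moreover have False if "u \<in> R" "u ~: m" "y' = u * t ^ k" for u k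
  proof -
   have "y = u * t ^ Suc k" using that y' by simp
   thus False using y(2) that by blast
  qed
  ultimately show ?thesis using y'(2) by blast
 qed
 hence "(%r. r * y') ` R \<in> ?F" by blast
 hence "~ I < (%r. r * y') ` R" by (rule I(2))
 moreover have "I <= (%r. r * y') ` R"
 proof
  fix v assume "v \<in> I"
  then obtain r where "v = r * y" "r \<in> R" using y by blast
  moreover have "t \<in> m" using t(1) Rs(1) by force
  ultimately have "v = (r * t) * y'" "r * t \<in> R" using y' m(2) Rs(4) by auto
  thus "v \<in> (%r. r * y') ` R" by blast
 qed
 ultimately have "y' \<in> I" using Rs(1) by (metis image_eqI mult_1 psubsetI)
 then obtain r where r: "y' = r * y" "r \<in> R" using y by blast
 have "y' = r * (t * y')" using r(1) y'(1) by simp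
 hence "y' * 1 = y' * (t * r)" by (simp add: ac_simps)
 moreover have "y' ~= 0" using y y' by auto
 ultimately have "1 = t * r" by (metis mult_left_cancel)
 hence "1 \<in> m" using t r by blast
 thus False using one_notin_m by blast
qed

end

locale nring = fring p R m for p :: nat and R m :: "'k::field set" +
 assumes normal: "integral_closure R = R"
begin

text \<open>By the maximum condition, the powers of \<open>y\<close> multiplied by \<open>b\<close> span a finitely generated ideal, so some power is a
 combination of the smaller ones.\<close>

lemma integral_of_powers:
 assumes "b ~= 0" "!!n. b * y ^ n \<in> R"
 shows "y \<in> R"
proof -
 define I where "I = (%n. {(\<Sum>i<n. c i * (b * y ^ i)) | c. \<forall>i<n. c i \<in> R})"
 have sm: "smod R (I n) & I n <= R" for n
 proof (intro conjI)
  show "smod R (I n)" unfolding smod_def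
  proof (intro conjI ballI)
   show "0 \<in> I n" unfolding I_def by (intro CollectI exI[of _ "%_. 0"]) (use Rs in auto)
  next
   fix u v assume "u \<in> I n" "v \<in> I n"
   then obtain c d where "u = (\<Sum>i<n. c i * (b * y ^ i))" "v = (\<Sum>i<n. d i * (b * y ^ i))"
    "\<forall>i<n. c i \<in> R" "\<forall>i<n. d i \<in> R" by (auto simp: I_def)
   thus "u + v \<in> I n" unfolding I_def by (intro CollectI exI[of _ "%i. c i + d i"]) (use Rs in "auto simp: distrib_right sum.distrib")
  next
   fix r u assume r: "r \<in> R" "u \<in> I n"
   then obtain c where "u = (\<Sum>i<n. c i * (b * y ^ i))" "\<forall>i<n. c i \<in> R" by (auto simp: I_def)
   thus "r * u \<in> I n" unfolding I_def by (intro CollectI exI[of _ "%i. r * c i"]) (use Rs r in "auto simp: sum_distrib_left mult.assoc")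
  qed
  show "I n <= R"
  proof
   fix u assume "u \<in> I n"
   then obtain c where c: "u = (\<Sum>i<n. c i * (b * y ^ i))" "\<forall>i<n. c i \<in> R" by (auto simp: I_def)
   show "u \<in> R" unfolding c(1) by (rule subdom_sum[OF R], rule Rs(4)) (use c(2) assms(2) in auto)
  qed
 qed
 obtain J where J: "J \<in> range I" "!!K. K \<in> range I ==> ~ J < K" by (rule noethD[OF noeth, of "range I"]) (use sm in auto)
 then obtain n where n: "J = I n" by blast
 have "I n <= I (Suc n)"
 proof
  fix u assume "u \<in> I n"
  then obtain c where c: "u = (\<Sum>i<n. c i * (b * y ^ i))" "\<forall>i<n. c i \<in> R" by (auto simp: I_def)
  have "(\<Sum>i<n. (c(n := 0)) i * (b * y ^ i)) = (\<Sum>i<n. c i * (b * y ^ i))" by (intro sum.cong) auto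
  thus "u \<in> I (Suc n)" unfolding I_def using c by (intro CollectI exI[of _ "c(n := 0)"]) (use Rs in auto)
 qed
 hence "I n = I (Suc n)" using J(2)[of "I (Suc n)"] n by blast
 moreover have "b * y ^ n \<in> I (Suc n)" unfolding I_def
 proof (intro CollectI exI[of _ "%i. if i = n then 1 else 0"] conjI)
  have "(\<Sum>i<n. (if i = n then 1 else 0) * (b * y ^ i)) = (\<Sum>i<n. 0)" by (intro sum.cong) auto
  thus "b * y ^ n = (\<Sum>i<Suc n. (if i = n then 1 else 0) * (b * y ^ i))" by simp
 qed (use Rs in auto)
 ultimately have "b * y ^ n \<in> I n" by simp
 then obtain c where c: "b * y ^ n = (\<Sum>i<n. c i * (b * y ^ i))" "\<forall>i<n. c i \<in> R" unfolding I_def by blast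
 have "b * y ^ n = b * (\<Sum>i<n. c i * y ^ i)" unfolding c(1) by (simp add: sum_distrib_left ac_simps)
 hence "y ^ n + (\<Sum>i<n. - c i * y ^ i) = 0" using assms(1) by (simp add: sum_negf)
 hence "y \<in> integral_closure R" unfolding integral_closure_def using c(2) Rs(5) by (intro CollectI exI[of _ n] exI[of _ "%i. - c i"]) auto
 thus ?thesis using normal by simp
qed

definition ht1 :: "'k set => bool" where "ht1 Q \<longleftrightarrow> height_one_prime R Q"

lemma ht1_def': "ht1 Q \<longleftrightarrow> prime_in R Q & Q ~= {0} & (\<forall>q. prime_in R q & q <= Q --> q = {0} | q = Q)"
 unfolding ht1_def height_one_prime_def primeideal_ring_of[OF R] ..

lemma ht1_prime: "ht1 Q ==> prime_in R Q" by (simp add: ht1_def')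

lemma ht1_eq: "ht1 Q ==> prime_in R q ==> q <= Q ==> q ~= {0} ==> q = Q" unfolding ht1_def' by blast

text \<open>Denominator ideals. A prime denominator ideal \<open>Q\<close> of \<open>y\<close> becomes principal in the localization:
 if \<open>yQ\<close> were contained in \<open>Q\<close>, then \<open>y\<close> would be integral, and \<open>y\<pi> \<notin> Q\<close> makes \<open>\<pi>\<close> a generator.\<close>

definition den :: "'k => 'k set" where "den y = {x \<in> R. x * y \<in> R}"

lemma smod_den: "smod R (den y)" "den y <= R" using Rs by (auto simp: den_def smod_def distrib_right mult.assoc)

lemma den_nonzero: "\<exists>b\<in>den y. b ~= 0"
proof -
 obtain a b where "a \<in> R" "b \<in> R" "b ~= 0" "y = a / b" using frac by blast
 thus ?thesis by (intro bexI[of _ b]) (auto simp: den_def)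
qed

lemma den_mult: "s \<in> R ==> den y <= den (s * y)"
proof
 fix x assume "s \<in> R" "x \<in> den y"
 hence "s * (x * y) \<in> R" "x \<in> R" using Rs(4) by (auto simp: den_def)
 thus "x \<in> den (s * y)" by (simp add: den_def ac_simps)
qed

lemma den_prime_uniformizer:
 assumes Q: "prime_in R (den y)"
 shows "\<exists>t. t ~= 0 & t \<in> den y & uniformizer R (den y) t"
proof -
 let ?Q = "den y"
 have "y ~: R"
 proof
  assume "y \<in> R"
  hence "1 \<in> ?Q" using Rs by (auto simp: den_def)
  thus False using prime_one_notin[OF R Q] by simp
 qed
 have "\<exists>t\<in>?Q. t * y ~: ?Q"
 proof (rule ccontr)
  assume "~ ?thesis"
  hence st: "x * y \<in> ?Q" if "x \<in> ?Q" for x using that by blast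
  obtain b where b: "b \<in> ?Q" "b ~= 0" using den_nonzero by blast
  have "b * y ^ n \<in> ?Q" for n
  proof (induction n)
   case (Suc n) thus ?case using st[of "b * y ^ n"] by (simp add: ac_simps)
  qed (use b in simp)
  hence "y \<in> R" using integral_of_powers[OF b(2), of y] smod_den(2) by blast
  thus False using \<open>y ~: R\<close> by simp
 qed
 then obtain t where t: "t \<in> ?Q" "t * y ~: ?Q" by blast
 have u: "t * y \<in> R" using t by (auto simp: den_def)
 have t0: "t ~= 0" using t smodD(1)[OF smod_den(1), of y] by auto
 have y0: "y ~= 0" using t smodD(1)[OF smod_den(1), of y] by auto
 have "uniformizer R ?Q t" unfolding uniformizer_def localization_ext
 proof (intro equalityI subsetI)
  fix x assume "x \<in> ext R ?Q ?Q"
  then obtain a b where ab: "x = a / b" "a \<in> ?Q" "b \<in> R" "b ~: ?Q" by (rule extE)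
  have "x = t * ((a * y) / (b * (t * y)))" using ab t0 y0 by simp
  moreover have "(a * y) / (b * (t * y)) \<in> ext R ?Q R" by (rule extI) (use ab ext_denom(2)[OF R Q, of b "t * y"] u t in "auto simp: den_def")
  ultimately show "x \<in> {t * x |x. x \<in> ext R ?Q R}" by blast
 next
  fix x assume "x \<in> {t * x |x. x \<in> ext R ?Q R}"
  then obtain z where z: "x = t * z" "z \<in> ext R ?Q R" by blast
  have "z * t \<in> ext R ?Q ?Q" using ext_mult[OF R Q smod_den(1) z(2), of t] t ext_superset[OF R Q, of ?Q] by blast
  thus "x \<in> ext R ?Q ?Q" using z by (simp add: mult.commute)
 qed
 thus ?thesis using t t0 by blast
qed

lemma uniformizer_ht1:
 assumes Q: "prime_in R Q" and t: "uniformizer R Q t" "t ~= 0"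
 shows "ht1 Q" unfolding ht1_def'
proof (intro conjI allI impI Q)
 interpret A: fring p "ext R Q R" "ext R Q Q" by (rule fring_loc[OF Q])
 have tA: "ext R Q Q = {t * x |x. x \<in> ext R Q R}" using t(1) by (simp add: uniformizer_def localization_ext)
 hence tm: "t \<in> ext R Q Q" using A.Rs(1) by force
 show "Q ~= {0}"
 proof
  assume "Q = {0}"
  hence "ext R Q Q = {0}" using A.Rs(1) A.m by (auto simp: ext_def)
  thus False using tm t(2) by simp
 qed
 fix q assume q: "prime_in R q & q <= Q"
 show "q = {0} | q = Q"
 proof (cases "q = {0}")
  case False
  then obtain x where x: "x \<in> q" "x ~= 0" using smodD(1)[OF prime_inD(1)] q by blast
  have pq: "prime_in (ext R Q R) (ext R Q q)" using prime_ext[OF R Q] q by blast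
  have xe: "x \<in> ext R Q q" "x \<in> ext R Q R" using ext_superset[OF R Q] x prime_inD(2) q by blast+
  then obtain u k where u: "u \<in> ext R Q R" "u ~: ext R Q Q" "x = u * t ^ k" using A.principal_max_factor[OF tA t(2) _ x(2)] by blast
  have "u ~: ext R Q q" using u(2) ext_mono[of q Q R Q] q by blast
  hence "t ^ k \<in> ext R Q q" using prime_inD(4)[OF pq, of u "t ^ k"] u xe A.Rs(7) A.m(2) tm by blast
  hence "t \<in> ext R Q q" using prime_power_notin[OF A.R pq, of t k] A.m(2) tm by blast
  hence "ext R Q Q <= ext R Q q" unfolding tA using smodD(4)[OF prime_inD(1)[OF pq]] by auto
  hence "Q <= ext R Q q \<inter> R" using ext_superset[OF R Q, of Q] prime_inD(2)[OF Q] by blast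
  thus ?thesis using contr_ext_prime[OF R Q] q by blast
 qed simp
qed

text \<open>Every height one prime is a denominator ideal, namely a maximal one among those of the multiples
 of \<open>1/b\<close> contained in it, for any nonzero \<open>b\<close> in it.\<close>

lemma ht1_den:
 assumes "ht1 Q"
 shows "\<exists>y. Q = den y"
proof -
 note Q = ht1_prime[OF assms]
 obtain b where b: "b \<in> Q" "b ~= 0" using assms smodD(1)[OF prime_inD(1)[OF Q]] unfolding ht1_def' by blast
 have bR: "b \<in> R" using b prime_inD(2)[OF Q] by blast
 let ?F = "{den (a / b) | a. a \<in> R & den (a / b) <= Q}"
 have "den (1 / b) <= Q"
 proof
  fix x assume "x \<in> den (1 / b)"
  hence "x / b \<in> R" by (simp add: den_def)
  hence "(x / b) * b \<in> Q" using smodD(3)[OF prime_inD(1)[OF Q]] b by blast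
  thus "x \<in> Q" using b by simp
 qed
 hence ne: "?F ~= {}" using Rs(1) by blast
 have sm: "smod R I & I <= R" if "I \<in> ?F" for I using that smod_den by auto
 obtain J where J: "J \<in> ?F" "!!K. K \<in> ?F ==> ~ J < K" using noethD[OF noeth ne sm] by blast
 then obtain a where a: "J = den (a / b)" "a \<in> R" "den (a / b) <= Q" by blast
 have max: "den (a' / b) = J" if "a' \<in> R" "den (a' / b) <= Q" "J <= den (a' / b)" for a' using J(2)[of "den (a' / b)"] that by blast
 have up: "J <= den (a * s / b)" if "s \<in> R" for s using den_mult[OF that, of "a / b"] by (simp add: a(1) mult.commute)
 have "prime_in R J" unfolding prime_in_def
 proof (intro conjI ballI impI)
  show "smod R J" using a smod_den by simp
  show "J < R" using a prime_inD(2,3)[OF Q] by auto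
  fix x y assume xy: "x \<in> R" "y \<in> R" "x * y \<in> J"
  have yd: "y \<in> den (a * x / b)" using xy by (auto simp: den_def a(1) ac_simps)
  show "x \<in> J | y \<in> J"
  proof (cases "den (a * x / b) <= Q")
   case True
   thus ?thesis using max[of "a * x"] up[OF xy(1)] yd Rs a xy by auto
  next
   case False
   then obtain s where s: "s \<in> den (a * x / b)" "s ~: Q" by blast
   hence sR: "s \<in> R" by (simp add: den_def)
   have xd: "x \<in> den (a * s / b)" using s xy by (auto simp: den_def ac_simps)
   have "den (a * s / b) <= Q"
   proof
    fix r assume r: "r \<in> den (a * s / b)"
    hence "r \<in> R" by (simp add: den_def)
    have "r * s \<in> J" using r sR Rs by (auto simp: den_def a(1) ac_simps)
    hence "r * s \<in> Q" using a by blast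
    thus "r \<in> Q" using prime_inD(4)[OF Q \<open>r \<in> R\<close> sR] s by blast
   qed
   thus ?thesis using max[of "a * s"] up[OF sR] xd Rs a sR by auto
  qed
 qed
 moreover have "b \<in> J" using bR a b by (auto simp: den_def)
 ultimately have "J = Q" using ht1_eq[OF assms, of J] a b by blast
 thus ?thesis using a by blast
qed

lemma ht1_uniformizer: "ht1 Q ==> \<exists>t. t ~= 0 & t \<in> Q & uniformizer R Q t"
 using ht1_den[of Q] den_prime_uniformizer ht1_prime[of Q] by blast

lemma uniformizer_nonzero: "ht1 Q ==> uniformizer R Q t ==> t ~= 0"
proof
 assume "ht1 Q" "uniformizer R Q t" "t = 0"
 then obtain s where "s ~= 0" "s \<in> Q" using ht1_uniformizer by blast
 hence "s \<in> ext R Q Q" using ext_superset[OF R ht1_prime[OF \<open>ht1 Q\<close>]] by blast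
 thus False using \<open>uniformizer R Q t\<close> \<open>t = 0\<close> \<open>s ~= 0\<close> by (auto simp: uniformizer_def localization_ext)
qed

abbreviation "loc Q \<equiv> ext R Q R"
abbreviation "locm Q \<equiv> ext R Q Q"

context
 fixes Q assumes Q: "ht1 Q"
begin

interpretation A: fring p "loc Q" "locm Q" by (rule fring_loc[OF ht1_prime[OF Q]])

lemma unit_mult: "u \<in> loc Q - locm Q ==> v \<in> loc Q - locm Q ==> u * v \<in> loc Q - locm Q"
 using A.prime_m A.Rs(4) by (auto simp: prime_in_def)

lemma unit_inverse: "u \<in> loc Q - locm Q ==> 1 / u \<in> loc Q - locm Q"
proof -
 assume u: "u \<in> loc Q - locm Q"
 hence i: "1 / u \<in> loc Q" using A.units by blast
 have "u ~= 0" using u smodD(1)[OF A.m(1)] by auto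
 have "1 / u ~: locm Q"
 proof
  assume "1 / u \<in> locm Q"
  hence "u * (1 / u) \<in> locm Q" using smodD(3)[OF A.m(1)] u by blast
  thus False using A.one_notin_m \<open>u ~= 0\<close> by simp
 qed
 thus ?thesis using i by simp
qed

lemma unit_powi: "u \<in> loc Q - locm Q ==> u powi k \<in> loc Q - locm Q"
proof -
 have n: "v ^ n \<in> loc Q - locm Q" if "v \<in> loc Q - locm Q" for v n using prime_power_notin[OF A.R A.prime_m] A.Rs(7) that by blast
 assume u: "u \<in> loc Q - locm Q"
 show ?thesis
 proof (cases "k >= 0")
  case True thus ?thesis using n[OF u] by (simp add: power_int_def)
 next
  case False thus ?thesis using n[OF unit_inverse[OF u]] by (simp add: power_int_def inverse_eq_divide)
 qed
qed

lemma uniformizer_mem: "uniformizer R Q t ==> t \<in> locm Q" using A.Rs(1) by (force simp: uniformizer_def localization_ext)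

lemma uniformizer_ratio:
 assumes t: "uniformizer R Q t" and s: "uniformizer R Q s"
 obtains w where "w \<in> loc Q - locm Q" "s = w * t"
proof -
 have t0: "t ~= 0" "s ~= 0" using uniformizer_nonzero[OF Q] t s by auto
 obtain w where w: "s = t * w" "w \<in> loc Q" using uniformizer_mem[OF s] t by (auto simp: uniformizer_def localization_ext)
 obtain v where v: "t = s * v" "v \<in> loc Q" using uniformizer_mem[OF t] s by (auto simp: uniformizer_def localization_ext)
 have "v * w = 1" using w v t0 by (metis (no_types, opaque_lifting) mult.assoc mult.commute mult_cancel_left2)
 hence "w ~: locm Q" using smodD(3)[OF A.m(1), of v w] v A.one_notin_m by auto
 thus ?thesis using that[of w] w by (simp add: mult.commute)
qed

lemma ord_exists:
 assumes t: "uniformizer R Q t" and f: "f ~= 0"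
 shows "\<exists>u k. u \<in> loc Q - locm Q & f = u * t powi k"
proof -
 have tA: "locm Q = {t * x |x. x \<in> loc Q}" and t0: "t ~= 0" using t uniformizer_nonzero[OF Q t] by (auto simp: uniformizer_def localization_ext)
 obtain a b where ab: "a \<in> R" "b \<in> R" "b ~= 0" "f = a / b" using frac by blast
 have "a ~= 0" using ab f by auto
 obtain u k where u: "u \<in> loc Q" "u ~: locm Q" "a = u * t ^ k"
  using A.principal_max_factor[OF tA t0 _ \<open>a ~= 0\<close>] ab ext_superset[OF R ht1_prime[OF Q], of R] by blast
 obtain v l where v: "v \<in> loc Q" "v ~: locm Q" "b = v * t ^ l"
  using A.principal_max_factor[OF tA t0 _ \<open>b ~= 0\<close>] ab ext_superset[OF R ht1_prime[OF Q], of R] by blast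
 have "f = (u * (1 / v)) * t powi (int k - int l)" using ab u v t0 by (simp add: power_int_diff)
 moreover have "u * (1 / v) \<in> loc Q - locm Q" using unit_mult[of u "1 / v"] unit_inverse[of v] u v by blast
 ultimately show ?thesis by blast
qed

lemma uniformizer_powi_unit:
 assumes t: "uniformizer R Q t" and "t powi k \<in> loc Q - locm Q"
 shows "k = 0"
proof -
 have pos: "t ^ n \<in> locm Q" if "n > 0" for n using that uniformizer_mem[OF t] smodD(3)[OF A.m(1), of "t ^ (n - 1)" t] A.Rs(7)[of t "n - 1"] A.m(2)
  by (cases n) (auto simp: mult.commute)
 show ?thesis
 proof (cases k "0::int" rule: linorder_cases)
  case greater
  thus ?thesis using pos[of "nat k"] assms(2) by (simp add: power_int_def)
 next
  case less
  hence "t powi (- k) \<in> locm Q" using pos[of "nat (- k)"] by (simp add: power_int_def)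
  moreover have "t powi (- k) = 1 / (t powi k)" by (simp add: power_int_minus inverse_eq_divide)
  ultimately show ?thesis using unit_inverse[OF assms(2)] by simp
 qed simp
qed

lemma ord_eq:
 assumes t: "uniformizer R Q t" and u: "u \<in> loc Q - locm Q"
 shows "ord_at R Q (u * t powi k) = k" unfolding ord_at_def localization_ext
proof (rule the_equality)
 show "\<exists>t' u'. uniformizer R Q t' & u' \<in> loc Q - locm Q & u * t powi k = u' * t' powi k" using t u by blast
 fix l assume "\<exists>t' u'. uniformizer R Q t' & u' \<in> loc Q - locm Q & u * t powi k = u' * t' powi l"
 then obtain s v where s: "uniformizer R Q s" "v \<in> loc Q - locm Q" "u * t powi k = v * s powi l" by blast
 obtain w where w: "w \<in> loc Q - locm Q" "s = w * t" by (rule uniformizer_ratio[OF t s(1)])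
 have t0: "t ~= 0" by (rule uniformizer_nonzero[OF Q t])
 have u0: "u ~= 0" using u smodD(1)[OF A.m(1)] by auto
 have "u * t powi k = v * (w powi l * t powi l)" using s w by (simp add: power_int_mult_distrib)
 hence "t powi (k - l) = (v * w powi l) * (1 / u)" using t0 u0 by (simp add: power_int_diff field_simps)
 moreover have "(v * w powi l) * (1 / u) \<in> loc Q - locm Q" by (intro unit_mult unit_powi unit_inverse s w u)
 ultimately have "k - l = 0" using uniformizer_powi_unit[OF t] by metis
 thus "l = k" by simp
qed

lemma ord_factor:
 assumes "uniformizer R Q t" "f ~= 0"
 obtains u where "u \<in> loc Q - locm Q" "f = u * t powi (ord_at R Q f)" using ord_exists[OF assms] ord_eq[OF assms(1)] by metis

lemma ord_mult: "f ~= 0 ==> g ~= 0 ==> ord_at R Q (f * g) = ord_at R Q f + ord_at R Q g"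
proof -
 assume fg: "f ~= 0" "g ~= 0"
 obtain t where t: "uniformizer R Q t" using ht1_uniformizer[OF Q] by blast
 obtain u v where u: "u \<in> loc Q - locm Q" "f = u * t powi (ord_at R Q f)"
   and v: "v \<in> loc Q - locm Q" "g = v * t powi (ord_at R Q g)" using ord_factor[OF t] fg by metis
 have "f * g = (u * v) * t powi (ord_at R Q f + ord_at R Q g)" using uniformizer_nonzero[OF Q t] by (subst u(2), subst v(2)) (simp add: power_int_add)
 thus ?thesis using ord_eq[OF t unit_mult[OF u(1) v(1)]] by metis
qed

lemma ord_unit: "u \<in> loc Q - locm Q ==> ord_at R Q u = 0" using ord_eq[of _ u 0] ht1_uniformizer[OF Q] by auto

lemma ord_uniformizer: "uniformizer R Q t ==> ord_at R Q t = 1" using ord_eq[of t 1 1] A.Rs(1) A.one_notin_m by auto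

lemma ord_one: "ord_at R Q 1 = 0" using ord_unit[of 1] A.Rs(1) A.one_notin_m by auto

lemma ord_inverse: "f ~= 0 ==> ord_at R Q (1 / f) = - ord_at R Q f" using ord_mult[of f "1 / f"] ord_one by auto

lemma ord_divide: "f ~= 0 ==> g ~= 0 ==> ord_at R Q (f / g) = ord_at R Q f - ord_at R Q g" using ord_mult[of f "1 / g"] ord_inverse[of g] by auto

lemma ord_power: "f ~= 0 ==> ord_at R Q (f ^ n) = int n * ord_at R Q f" by (induction n) (auto simp: ord_one ord_mult algebra_simps)

lemma powi_mem: "t \<in> locm Q ==> k >= 0 ==> t powi k \<in> loc Q" using A.Rs(7)[of t "nat k"] A.m(2) by (auto simp: power_int_def)

lemma mem_loc_iff: "f ~= 0 ==> f \<in> loc Q \<longleftrightarrow> ord_at R Q f >= 0"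
 and mem_locm_iff: "f ~= 0 ==> f \<in> locm Q \<longleftrightarrow> ord_at R Q f >= 1"
proof -
 obtain t where t: "uniformizer R Q t" using ht1_uniformizer[OF Q] by blast
 note tm = uniformizer_mem[OF t] and t0 = uniformizer_nonzero[OF Q t]
 have ge0: "f \<in> loc Q" if f: "f ~= 0" "ord_at R Q f >= 0" for f
 proof -
  obtain u where u: "u \<in> loc Q - locm Q" "f = u * t powi (ord_at R Q f)" by (rule ord_factor[OF t f(1)])
  thus ?thesis using powi_mem[OF tm f(2)] A.Rs(4) by (metis DiffD1)
 qed
 have ge1: "f \<in> locm Q" if f: "f ~= 0" "ord_at R Q f >= 1" for f
 proof -
  have "ord_at R Q (f / t) >= 0" using ord_divide[OF f(1) t0] ord_uniformizer[OF t] f by simp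
  hence "f / t \<in> loc Q" using ge0[of "f / t"] f t0 by simp
  hence "(f / t) * t \<in> locm Q" using smodD(3)[OF A.m(1)] tm by blast
  thus ?thesis using t0 by simp
 qed
 have neg: "~ f \<in> loc Q" if f: "f ~= 0" "ord_at R Q f < 0" for f
 proof
  assume "f \<in> loc Q"
  have "1 / f \<in> locm Q" using ge1[of "1 / f"] ord_inverse[OF f(1)] f by auto
  hence "f * (1 / f) \<in> locm Q" using smodD(3)[OF A.m(1)] \<open>f \<in> loc Q\<close> by blast
  thus False using f A.one_notin_m by simp
 qed
 show 1: "f \<in> loc Q \<longleftrightarrow> ord_at R Q f >= 0" if "f ~= 0" for f using ge0 neg that by fastforce
 show "f \<in> locm Q \<longleftrightarrow> ord_at R Q f >= 1" if f: "f ~= 0" for f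
 proof
  assume "f \<in> locm Q"
  hence "f \<in> loc Q" using A.m(2) by blast
  hence "ord_at R Q f >= 0" using 1 f by simp
  moreover have "ord_at R Q f ~= 0"
  proof
   assume "ord_at R Q f = 0"
   hence "1 / f \<in> loc Q" using 1[of "1 / f"] ord_inverse[OF f] f by simp
   hence "(1 / f) * f \<in> locm Q" using smodD(3)[OF A.m(1)] \<open>f \<in> locm Q\<close> by blast
   thus False using f A.one_notin_m by simp
  qed
  ultimately show "ord_at R Q f >= 1" by simp
 qed (use ge1 f in blast)
qed

end

text \<open>Lower bounds for the valuation, with zero having infinite valuation; unlike the valuation itself they are
 compatible with sums.\<close>

definition vge :: "'k set => 'k => int => bool" where
 "vge Q f k \<longleftrightarrow> f = 0 | ord_at R Q f >= k"

lemma vge_zero [simp]: "vge Q 0 k" by (simp add: vge_def)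

lemma vge_mono: "vge Q f k ==> l <= k ==> vge Q f l" by (auto simp: vge_def)

lemma vge_ord: "vge Q f (ord_at R Q f)" by (simp add: vge_def)

lemma vge_loc: "ht1 Q ==> vge Q f 0 \<longleftrightarrow> f \<in> loc Q"
 using mem_loc_iff[of Q f] subdomD(2)[OF subdom_ext[OF R ht1_prime]] by (auto simp: vge_def)

lemma vge_locm: "ht1 Q ==> vge Q f 1 \<longleftrightarrow> f \<in> locm Q"
 using mem_locm_iff[of Q f] smodD(1)[OF smod_ext[OF R ht1_prime prime_inD(1)[OF ht1_prime]]] by (auto simp: vge_def)

lemma vge_mult: "ht1 Q ==> vge Q f k ==> vge Q g l ==> vge Q (f * g) (k + l)" by (cases "f = 0"; cases "g = 0") (auto simp: vge_def ord_mult)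

lemma vge_power: "ht1 Q ==> vge Q f k ==> vge Q (f ^ n) (int n * k)"
proof (induction n)
 case 0 thus ?case by (simp add: vge_def ord_one)
next
 case (Suc n) thus ?case using vge_mult[of Q f k "f ^ n" "int n * k"] by (simp add: algebra_simps)
qed

lemma vge_scale: "ht1 Q ==> c ~= 0 ==> vge Q (c * f) k \<longleftrightarrow> vge Q f (k - ord_at R Q c)"
 by (cases "f = 0") (auto simp: vge_def ord_mult)

lemma vge_add: assumes Q: "ht1 Q" and "vge Q f k" "vge Q g k" shows "vge Q (f + g) k"
proof -
 obtain t where t: "uniformizer R Q t" using ht1_uniformizer[OF Q] by blast
 let ?c = "t powi (- k)"
 have c: "?c ~= 0" "ord_at R Q ?c = - k" using uniformizer_nonzero[OF Q t] ord_eq[OF Q t, of 1 "- k"] subdomD(1)[OF subdom_ext[OF R ht1_prime[OF Q]]]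
   fring.one_notin_m[OF fring_loc[OF ht1_prime[OF Q]]] by auto
 have s: "vge Q h k \<longleftrightarrow> ?c * h \<in> loc Q" for h using vge_scale[OF Q c(1), of h 0] vge_loc[OF Q, of "?c * h"] c(2) by simp
 show ?thesis using assms(2,3) subdomD(6)[OF subdom_ext[OF R ht1_prime[OF Q]]] unfolding s by (simp add: distrib_left)
qed

lemma vge_R: "ht1 Q ==> f \<in> R ==> vge Q f 0" using vge_loc ext_superset[OF R ht1_prime, of Q R] by blast

lemma loc_Int: "ht1 Q ==> locm Q \<inter> R = Q" using contr_ext_prime[OF R ht1_prime ht1_prime] by blast

lemma vge_Q: "ht1 Q ==> f \<in> R ==> vge Q f 1 \<longleftrightarrow> f \<in> Q" using vge_locm loc_Int by blast

lemma ord_R: "ht1 Q ==> f \<in> R ==> f ~= 0 ==> ord_at R Q f >= 0" using vge_R by (auto simp: vge_def)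

lemma ord_R_notin: "ht1 Q ==> f \<in> R ==> f ~: Q ==> f ~= 0 & ord_at R Q f = 0" using vge_Q[of Q f] ord_R[of Q f] by (auto simp: vge_def)

text \<open>A normal Noetherian domain is the intersection of its valuation rings: a maximal denominator ideal
 of the multiples of an element outside \<open>R\<close> is a prime of height one.\<close>

lemma mem_R_iff: "x \<in> R \<longleftrightarrow> (\<forall>Q. ht1 Q --> vge Q x 0)"
proof
 assume all: "\<forall>Q. ht1 Q --> vge Q x 0"
 show "x \<in> R"
 proof (rule ccontr)
  assume x: "x ~: R"
  let ?F = "{den (r * x) | r. r \<in> R & r * x ~: R}"
  have "den (1 * x) \<in> ?F" using x Rs(1) by (intro CollectI exI[of _ 1]) auto
  hence ne: "?F ~= {}" by blast
  have sm: "smod R I & I <= R" if "I \<in> ?F" for I using that smod_den by auto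
  obtain J where J: "J \<in> ?F" "!!K. K \<in> ?F ==> ~ J < K" using noethD[OF noeth ne sm] by blast
  then obtain r where r: "J = den (r * x)" "r \<in> R" "r * x ~: R" by blast
  have "1 ~: J" using r by (simp add: den_def)
  have pJ: "prime_in R J" unfolding prime_in_def
  proof (intro conjI ballI impI)
   show "smod R J" "J < R" using r smod_den \<open>1 ~: J\<close> Rs(1) by auto
   fix a b assume ab: "a \<in> R" "b \<in> R" "a * b \<in> J"
   show "a \<in> J | b \<in> J"
   proof (cases "a \<in> J")
    case False
    hence "a * r * x ~: R" using r ab by (simp add: den_def mult.assoc)
    hence "den (a * r * x) \<in> ?F" using Rs(4) ab r by blast
    moreover have "J <= den (a * r * x)" using den_mult[OF ab(1), of "r * x"] r by (simp add: mult.assoc)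
    ultimately have "den (a * r * x) = J" using J(2) by blast
    moreover have "b \<in> den (a * r * x)" using ab r by (auto simp: den_def ac_simps)
    ultimately show ?thesis by simp
   qed simp
  qed
  then obtain t where t: "t ~= 0" "uniformizer R J t" using den_prime_uniformizer r by blast
  have h: "ht1 J" by (rule uniformizer_ht1[OF pJ t(2,1)])
  hence "x \<in> loc J" using all vge_loc by blast
  then obtain a s where as: "x = a / s" "a \<in> R" "s \<in> R" "s ~: J" by (rule extE)
  have "s ~= 0" using ext_denom(1)[OF R pJ as(3,4)] .
  hence "s * (r * x) = r * a" using as by simp
  hence "s \<in> J" using as r Rs(4) by (auto simp: den_def)
  thus False using as by simp
 qed
qed (use vge_R in blast)

lemma finite_ht1_containing:
 assumes "x \<in> R" "x ~= 0"
 shows "finite {Q. ht1 Q & x \<in> Q}"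
proof -
 let ?I = "adj {0} x R"
 have z: "smod R {0}" "{0} <= R" using Rs by (auto simp: smod_def)
 have xI: "x \<in> ?I" by (rule adj_mem) (use Rs in auto)
 have "?I ~= {0} --> finite {Q. ht1 Q & ?I <= Q}" using R noeth smod_adj[OF z(1) RR, of x] adj_subset[OF RR z(2) assms(1)]
 proof (induction rule: noeth_prime_induct)
  case whole
  have "{Q. ht1 Q & R <= Q} = {}" using ht1_prime prime_inD(2,3) by blast
  thus ?case by (simp only: finite.emptyI simp_thms)
 next
  case (prime q)
  show ?case
  proof
   assume "q ~= {0}"
   hence "{Q. ht1 Q & q <= Q} <= {q}" using ht1_eq prime(1) by blast
   thus "finite {Q. ht1 Q & q <= Q}" by (rule finite_subset) simp
  qed
 next
  case (split I a b)
  have sup: "I <= adj I z R" for z by (rule adj_supset[OF Rs(2)])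
  show ?case
  proof
   assume "I ~= {0}"
   hence "adj I a R ~= {0}" "adj I b R ~= {0}" using sup smodD(1)[OF split(1)] by (metis subset_singletonD empty_iff)+
   hence "finite ({Q. ht1 Q & adj I a R <= Q} \<union> {Q. ht1 Q & adj I b R <= Q})" using split by blast
   moreover have "{Q. ht1 Q & I <= Q} <= {Q. ht1 Q & adj I a R <= Q} \<union> {Q. ht1 Q & adj I b R <= Q}"
   proof
    fix Q assume "Q \<in> {Q. ht1 Q & I <= Q}"
    hence Q: "ht1 Q" "I <= Q" by auto
    note pQ = ht1_prime[OF Q(1)]
    have "a \<in> Q | b \<in> Q" using prime_inD(4)[OF pQ split(3,4)] split(5) Q(2) by blast
    hence "adj I a R <= Q | adj I b R <= Q" using adj_subset[OF prime_inD(1)[OF pQ] Q(2)] by blast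
    thus "Q \<in> {Q. ht1 Q & adj I a R <= Q} \<union> {Q. ht1 Q & adj I b R <= Q}" using Q(1) by blast
   qed
   ultimately show "finite {Q. ht1 Q & I <= Q}" by (rule finite_subset[rotated])
  qed
 qed
 moreover have "?I ~= {0}" using xI assms by blast
 ultimately have "finite {Q. ht1 Q & ?I <= Q}" by blast
 moreover have "{Q. ht1 Q & x \<in> Q} <= {Q. ht1 Q & ?I <= Q}"
 proof clarify
  fix Q u assume Q: "ht1 Q" "x \<in> Q" "u \<in> ?I"
  note s = prime_inD(1)[OF ht1_prime[OF Q(1)]]
  show "u \<in> Q" using Q adj_subset[OF s, of "{0}" x] smodD(1)[OF s] by blast
 qed
 ultimately show ?thesis by (rule finite_subset[rotated])
qed

lemma finite_ord:
 assumes "f ~= 0"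
 shows "finite {Q. ht1 Q & ord_at R Q f ~= 0}"
proof -
 obtain a b where ab: "a \<in> R" "b \<in> R" "b ~= 0" "f = a / b" using frac by blast
 have a: "a ~= 0" using ab assms by auto
 have "{Q. ht1 Q & ord_at R Q f ~= 0} <= {Q. ht1 Q & a \<in> Q} \<union> {Q. ht1 Q & b \<in> Q}"
 proof
  fix Q assume "Q \<in> {Q. ht1 Q & ord_at R Q f ~= 0}"
  hence Q: "ht1 Q" "ord_at R Q a - ord_at R Q b ~= 0" using ord_divide[OF _ a ab(3)] ab by auto
  have "a \<in> Q | b \<in> Q"
  proof (rule ccontr)
   assume "~ ?thesis"
   hence "ord_at R Q a = 0" "ord_at R Q b = 0" using ord_R_notin[OF Q(1)] ab by auto
   thus False using Q(2) by simp
  qed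
  thus "Q \<in> {Q. ht1 Q & a \<in> Q} \<union> {Q. ht1 Q & b \<in> Q}" using Q(1) by blast
 qed
 thus ?thesis using finite_ht1_containing[OF ab(1) a] finite_ht1_containing[OF ab(2,3)] by (meson finite_UnI finite_subset)
qed

text \<open>No height one prime lies in another one, so some element of each \<open>Q\<close> in \<open>F\<close> is outside \<open>P\<close>.\<close>

lemma exists_high_order:
 assumes F: "finite F" "!!Q. Q \<in> F ==> ht1 Q" and P: "ht1 P" "P ~: F"
 obtains w where "w \<in> R" "w ~: P" "!!Q. Q \<in> F ==> ord_at R Q w >= int N"
proof -
 have "\<exists>x. x \<in> Q & x ~: P" if "Q \<in> F" for Q
 proof (rule ccontr)
  assume "~ ?thesis"
  hence "Q <= P" by blast
  hence "Q = P" using ht1_eq[OF P(1) ht1_prime[OF F(2)[OF that]]] F(2)[OF that] ht1_def' by blast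
  thus False using that P by blast
 qed
 then obtain x where x: "!!Q. Q \<in> F ==> x Q \<in> Q" "!!Q. Q \<in> F ==> x Q ~: P" by metis
 have xR: "x Q \<in> R" if "Q \<in> F" for Q using x F(2) that ht1_prime prime_inD(2) by blast
 define w where "w = (\<Prod>Q\<in>F. x Q ^ N)"
 have wi: "w \<in> R - P" unfolding w_def
  by (rule prime_prod_notin[OF R ht1_prime[OF P(1)]]) (use xR x Rs(7) prime_power_notin[OF R ht1_prime[OF P(1)]] in auto)
 hence w0: "w ~= 0" using smodD(1)[OF prime_inD(1)[OF ht1_prime[OF P(1)]]] by auto
 have "ord_at R Q w >= int N" if Q: "Q \<in> F" for Q
 proof -
  have "w = x Q ^ N * (\<Prod>Q\<in>F - {Q}. x Q ^ N)" unfolding w_def using F(1) Q by (simp add: prod.remove)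
  moreover have "(\<Prod>Q\<in>F - {Q}. x Q ^ N) \<in> R - P"
   by (rule prime_prod_notin[OF R ht1_prime[OF P(1)]]) (use xR x Rs(7) prime_power_notin[OF R ht1_prime[OF P(1)]] in auto)
  ultimately have "vge Q w (int N * 1 + 0)" using vge_mult[OF F(2)[OF Q] vge_power[OF F(2)[OF Q], of "x Q" 1 N] vge_R[OF F(2)[OF Q]]]
    vge_Q[OF F(2)[OF Q] xR[OF Q]] x(1)[OF Q] by auto
  thus ?thesis using w0 by (simp add: vge_def)
 qed
 thus ?thesis using that wi by blast
qed

lemma exists_high_order_nonzero:
 assumes F: "finite F" "!!Q. Q \<in> F ==> ht1 Q"
 obtains w where "w \<in> R" "w ~= 0" "!!Q. Q \<in> F ==> ord_at R Q w >= int N"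
proof -
 have "\<exists>x. x \<in> Q & x ~= 0" if "Q \<in> F" for Q using F(2)[OF that] smodD(1)[OF prime_inD(1)] unfolding ht1_def' by blast
 then obtain x where x: "!!Q. Q \<in> F ==> x Q \<in> Q" "!!Q. Q \<in> F ==> x Q ~= 0" by metis
 have xR: "x Q \<in> R" if "Q \<in> F" for Q using x F(2) that ht1_prime prime_inD(2) by blast
 have z: "prime_in R {0}" by (rule zero_prime[OF R])
 define w where "w = (\<Prod>Q\<in>F. x Q ^ N)"
 have wi: "w \<in> R - {0}" unfolding w_def by (rule prime_prod_notin[OF R z]) (use xR x Rs(7) in auto)
 have "ord_at R Q w >= int N" if Q: "Q \<in> F" for Q
 proof -
  have "w = x Q ^ N * (\<Prod>Q\<in>F - {Q}. x Q ^ N)" unfolding w_def using F(1) Q by (simp add: prod.remove)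
  moreover have "(\<Prod>Q\<in>F - {Q}. x Q ^ N) \<in> R - {0}" by (rule prime_prod_notin[OF R z]) (use xR x Rs(7) in auto)
  ultimately have "vge Q w (int N * 1 + 0)" using vge_mult[OF F(2)[OF Q] vge_power[OF F(2)[OF Q], of "x Q" 1 N] vge_R[OF F(2)[OF Q]]]
    vge_Q[OF F(2)[OF Q] xR[OF Q]] x(1)[OF Q] by auto
  thus ?thesis using wi by (simp add: vge_def)
 qed
 thus ?thesis using that wi by blast
qed

end

section \<open>Derivations in characteristic p\<close>

abbreviation der :: "('k::field => 'k) => bool" where "der de \<equiv> de \<in> derivations UNIV"

lemma derI: "(!!x y. de (x + y) = de x + de y) ==> (!!x y. de (x * y) = x * de y + y * de x) ==> der de" by (simp add: derivations_def)

lemma derivations_iff: "de \<in> derivations A \<longleftrightarrow> der de & de ` A <= A" by (auto simp: derivations_def)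

lemma der_add: "der de ==> de (x + y) = de x + de y"
 and der_mult: "der de ==> de (x * y) = x * de y + y * de x" by (auto simp: derivations_def)

lemma der_0: "der de ==> de 0 = 0" using der_add[of de 0 0] by (metis add.right_neutral add_left_cancel)

lemma der_minus: "der de ==> de (- x) = - de x" using der_add[of de x "- x"] der_0[of de] by (simp add: eq_neg_iff_add_eq_0 add.commute)

lemma der_diff: "der de ==> de (x - y) = de x - de y" using der_add[of de x "- y"] der_minus[of de y] by simp

lemma der_1: "der de ==> de 1 = 0" using der_mult[of de 1 1] by (metis add.right_neutral add_left_cancel mult_1)

lemma der_sum: "der de ==> de (sum f A) = (\<Sum>i\<in>A. de (f i))" by (induction A rule: infinite_finite_induct) (auto simp: der_0 der_add)

lemma der_power: "der de ==> de (x ^ n) = of_nat n * x ^ (n - 1) * de x"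
proof (induction n)
 case 0 thus ?case by (simp add: der_1)
next
 case (Suc n) thus ?case by (cases n) (auto simp: der_mult algebra_simps)
qed

lemma der_power_Suc: "der de ==> de (x ^ Suc n) = of_nat (Suc n) * x ^ n * de x" using der_power[of de x "Suc n"] by (simp only: diff_Suc_1)

lemma der_of_nat: "der de ==> de (of_nat n) = 0" by (induction n) (auto simp: der_0 der_add der_1)

lemma der_const_mult: "der de ==> de c = 0 ==> de (c * f) = c * de f" by (simp add: der_mult)

lemma der_inverse: "der de ==> de c = 0 ==> de (1 / c) = 0"
proof (cases "c = 0")
 case True thus "der de ==> de (1 / c) = 0" by (simp add: der_0)
next
 case False
 assume "der de" "de c = 0"
 hence "de (c * (1 / c)) = c * de (1 / c)" by (rule der_const_mult)
 thus "de (1 / c) = 0" using False \<open>der de\<close> by (simp add: der_1)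
qed

lemma der_divide_const: "der de ==> de c = 0 ==> de (f / c) = de f / c" using der_const_mult[of de "1 / c" f] der_inverse[of de c] by simp

lemma der_scale: "der de ==> der (%f. c * de f)" by (rule derI) (auto simp: der_add der_mult algebra_simps)

lemma der_div: "der de ==> der (%f. de f / c)" using der_scale[of de "1 / c"] by simp

lemma der_sub: "der de ==> der \<epsilon> ==> der (%f. de f - \<epsilon> f)" by (rule derI) (auto simp: der_add der_mult algebra_simps)

lemma der_zero: "der (%_. 0)" by (rule derI) auto

lemma der_lsum: "(!!i. i \<in> I ==> der (de i)) ==> der (%f. \<Sum>i\<in>I. c i * de i f)"
 by (rule derI) (auto simp: der_add der_mult sum.distrib[symmetric] sum_distrib_left intro!: sum.cong simp: algebra_simps)

lemma der_commutator: "der de ==> der \<epsilon> ==> der (%f. de (\<epsilon> f) - \<epsilon> (de f))"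
 by (rule derI) (auto simp: der_add der_mult algebra_simps)

lemma der_pow_add: "der d ==> (d ^^ n) (x + y) = (d ^^ n) x + (d ^^ n) y" by (induction n) (auto simp: der_add)

lemma der_pow_0: "der d ==> (d ^^ n) 0 = 0" by (induction n) (auto simp: der_0)

lemma der_pow_sum: "der d ==> (d ^^ n) (sum f A) = (\<Sum>i\<in>A. (d ^^ n) (f i))"
 by (induction A rule: infinite_finite_induct) (auto simp: der_pow_0 der_pow_add)

lemma der_pow_const: "der d ==> d c = 0 ==> (d ^^ n) (c * f) = c * (d ^^ n) f" by (induction n) (auto simp: der_const_mult)

lemma der_pow_divide: "der d ==> d c = 0 ==> (d ^^ n) (f / c) = (d ^^ n) f / c" using der_pow_const[of d "1 / c" n f] der_inverse[of d c] by simp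

lemma leibniz: "der d ==> (d ^^ n) (x * y) = (\<Sum>k\<le>n. of_nat (n choose k) * (d ^^ k) x * (d ^^ (n - k)) y)"
proof (induction n)
 case 0 thus ?case by simp
next
 case (Suc n)
 let ?a = "%k. (d ^^ k) x" and ?b = "%k. (d ^^ k) y"
 have "(d ^^ Suc n) (x * y) = (\<Sum>k\<le>n. of_nat (n choose k) * (?a k * ?b (Suc (n - k)) + ?b (n - k) * ?a (Suc k)))"
  using Suc by (simp add: der_sum der_const_mult der_of_nat der_mult mult.assoc)
 also have "\<dots> = (\<Sum>k\<le>n. of_nat (n choose k) * ?a k * ?b (Suc n - k)) + (\<Sum>k\<le>n. of_nat (n choose k) * ?a (Suc k) * ?b (n - k))"
  unfolding sum.distrib[symmetric] by (intro sum.cong) (auto simp: algebra_simps Suc_diff_le simp del: funpow.simps)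
 also have "(\<Sum>k\<le>n. of_nat (n choose k) * ?a k * ?b (Suc n - k)) =
   ?a 0 * ?b (Suc n) + (\<Sum>k\<le>n. of_nat (n choose Suc k) * ?a (Suc k) * ?b (n - k))"
 proof -
  have "(\<Sum>k\<le>n. of_nat (n choose k) * ?a k * ?b (Suc n - k)) = (\<Sum>k\<le>Suc n. of_nat (n choose k) * ?a k * ?b (Suc n - k))"
   by (simp add: binomial_eq_0 del: funpow.simps)
  thus ?thesis unfolding sum.atMost_Suc_shift by simp
 qed
 also have "?a 0 * ?b (Suc n) + (\<Sum>k\<le>n. of_nat (n choose Suc k) * ?a (Suc k) * ?b (n - k)) +
   (\<Sum>k\<le>n. of_nat (n choose k) * ?a (Suc k) * ?b (n - k)) =
   ?a 0 * ?b (Suc n) + (\<Sum>k\<le>n. of_nat (Suc n choose Suc k) * ?a (Suc k) * ?b (n - k))"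
  by (simp add: sum.distrib[symmetric] distrib_right add.assoc add.commute del: funpow.simps)
 also have "\<dots> = (\<Sum>k\<le>Suc n. of_nat (Suc n choose k) * ?a k * ?b (Suc n - k))" unfolding sum.atMost_Suc_shift by simp
 finally show ?case .
qed

context pchar
begin

lemma of_nat_p: "of_nat p = (0::'k)" using char_p by (metis of_nat_CHAR)

lemma of_nat_nonzero: "0 < n ==> n < p ==> of_nat n ~= (0::'k)" using char_p by (metis of_nat_eq_0_iff_char_dvd nat_dvd_not_less)

lemma fact_nonzero: "n < p ==> of_nat (fact n) ~= (0::'k)"
proof -
 assume "n < p"
 hence "~ p dvd fact n" using prime_dvd_fact_iff[OF prime_p] by simp
 thus "of_nat (fact n) ~= (0::'k)" using char_p of_nat_eq_0_iff_char_dvd by blast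
qed

lemma choose_p: "0 < k ==> k < p ==> of_nat (p choose k) = (0::'k)"
proof -
 assume "0 < k" "k < p"
 hence "p dvd (p choose k)" using prime_p by (intro dvd_choose_prime) auto
 thus "of_nat (p choose k) = (0::'k)" using char_p of_nat_eq_0_iff_char_dvd by blast
qed

lemma of_nat_fermat: "(of_nat n :: 'k) ^ p = of_nat n" by (induction n) (auto simp: fadd fzero)

lemma der_pth: "der de ==> de ((x::'k) ^ p) = 0" by (simp add: der_power of_nat_p)

lemma der_pow_p: "der d ==> der (d ^^ p :: 'k => 'k)"
proof (rule derI)
 assume d: "der d"
 show "(d ^^ p) (x + y) = (d ^^ p) x + (d ^^ p) y" for x y by (rule der_pow_add[OF d])
 show "(d ^^ p) (x * y) = x * (d ^^ p) y + y * (d ^^ p) x" for x y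
 proof -
  have "(d ^^ p) (x * y) = (\<Sum>k\<le>p. of_nat (p choose k) * (d ^^ k) x * (d ^^ (p - k)) y)" by (rule leibniz[OF d])
  also have "\<dots> = (\<Sum>k\<in>{0,p}. of_nat (p choose k) * (d ^^ k) x * (d ^^ (p - k)) y)"
   by (rule sum.mono_neutral_right) (auto simp: choose_p)
  also have "\<dots> = x * (d ^^ p) y + y * (d ^^ p) x" using p_gt1 by (simp add: mult.commute)
  finally show ?thesis .
 qed
qed

text \<open>If \<open>d x = 1\<close> and \<open>d\<^sup>p = 0\<close>, the field is free over the constants of \<open>d\<close> on \<open>1, x, \<dots>, x\<^sup>p\<^sup>-\<^sup>1\<close>, and \<open>N d\<close> extracts the
 coefficient of \<open>x\<^sup>p\<^sup>-\<^sup>1\<close>. It generates the linear forms over the constants.\<close>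

definition N :: "('k => 'k) => 'k => 'k" where "N d f = (d ^^ (p - 1)) f / of_nat (fact (p - 1))"

lemma factp: "of_nat (fact (p - 1)) ~= (0::'k)" using fact_nonzero[of "p - 1"] p_gt1 by simp

lemma N_add: "der d ==> N d (f + g) = N d f + N d g" by (simp add: N_def der_pow_add add_divide_distrib)

lemma N_0: "der d ==> N d 0 = 0" by (simp add: N_def der_pow_0)

lemma N_sum: "der d ==> N d (sum f A) = (\<Sum>i\<in>A. N d (f i))" by (simp add: N_def der_pow_sum sum_divide_distrib)

lemma N_const: "der d ==> d c = 0 ==> N d (c * f) = c * N d f" by (simp add: N_def der_pow_const)

lemma pow_of_var_zero: "der d ==> d x = 1 ==> n < k ==> (d ^^ k) ((x::'k) ^ n) = 0"
proof (induction n arbitrary: k)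
 case 0
 then obtain j where "k = Suc j" by (cases k) auto
 thus ?case using 0 by (simp add: funpow_swap1 der_1 der_pow_0)
next
 case (Suc n)
 then obtain j where j: "k = Suc j" "n < j" by (cases k) auto
 have "(d ^^ k) (x ^ Suc n) = (d ^^ j) (of_nat (Suc n) * x ^ n)"
  unfolding j(1) funpow_Suc_right comp_def using der_power_Suc[OF Suc.prems(1), of x n] Suc.prems(2) by simp
 also have "\<dots> = 0" using Suc j der_of_nat[of d "Suc n"] by (simp add: der_pow_const del: of_nat_Suc)
 finally show ?case .
qed

lemma pow_of_var_fact: "der d ==> d x = 1 ==> (d ^^ n) ((x::'k) ^ n) = of_nat (fact n)"
proof (induction n)
 case (Suc n)
 have "(d ^^ Suc n) (x ^ Suc n) = (d ^^ n) (of_nat (Suc n) * x ^ n)"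
  unfolding funpow_Suc_right comp_def using der_power_Suc[OF Suc.prems(1), of x n] Suc.prems(2) by simp
 also have "\<dots> = of_nat (Suc n) * of_nat (fact n)" using Suc der_of_nat[of d "Suc n"] by (simp add: der_pow_const del: of_nat_Suc)
 finally show ?case by (simp only: fact_Suc of_nat_mult of_nat_id)
qed simp

lemma N_var:
 assumes d: "der d" "d x = 1" and "i < p" "j < p"
 shows "N d (x ^ (p - 1 - i) * (x::'k) ^ j) = (if i = j then 1 else 0)"
proof -
 consider "j < i" | "j = i" | "j > i" by linarith
 thus ?thesis
 proof cases
  case 1
  have "x ^ (p - 1 - i) * x ^ j = x ^ (p - 1 - i + j)" by (simp add: power_add)
  thus ?thesis using pow_of_var_zero[OF d, of "p - 1 - i + j" "p - 1"] 1 assms by (simp add: N_def)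
 next
  case 2
  have "x ^ (p - 1 - i) * x ^ j = x ^ (p - 1)" using 2 assms by (simp add: power_add[symmetric])
  thus ?thesis using pow_of_var_fact[OF d, of "p - 1"] 2 factp by (simp add: N_def)
 next
  case 3
  have "p - 1 - i + j = p + (j - i - 1)" using 3 assms by simp
  hence "x ^ (p - 1 - i) * x ^ j = x ^ p * x ^ (j - i - 1)" by (simp add: power_add[symmetric])
  moreover have "j - i - 1 < p - 1" using 3 assms by simp
  hence "N d (x ^ (j - i - 1)) = 0" using pow_of_var_zero[OF d] by (simp add: N_def)
  ultimately show ?thesis using N_const[OF d(1) der_pth[OF d(1), of x], of "x ^ (j - i - 1)"] 3 by simp
 qed
qed

lemma expansion_exists:
 assumes d: "der d" "d x = 1"
 shows "(d ^^ k) (f::'k) = 0 ==> k <= p ==> \<exists>c. (\<forall>i<k. d (c i) = 0) & f = (\<Sum>i<k. c i * x ^ i)"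
proof (induction k arbitrary: f)
 case 0 thus ?case by simp
next
 case (Suc k)
 define c0 where "c0 = (d ^^ k) f / of_nat (fact k)"
 have fk: "of_nat (fact k) ~= (0::'k)" using Suc fact_nonzero by simp
 have c0: "d c0 = 0" using der_divide_const[OF d(1), of "of_nat (fact k)" "(d ^^ k) f"] der_of_nat[OF d(1), of "fact k"] Suc by (simp add: c0_def)
 have "(d ^^ k) (f - c0 * x ^ k) = (d ^^ k) f - (d ^^ k) (c0 * x ^ k)" using der_pow_add[OF d(1), of k "f - c0 * x ^ k" "c0 * x ^ k"] by simp
 also have "\<dots> = 0" using der_pow_const[OF d(1) c0] pow_of_var_fact[OF d] fk by (simp add: c0_def)
 finally obtain c where c: "\<forall>i<k. d (c i) = 0" "f - c0 * x ^ k = (\<Sum>i<k. c i * x ^ i)" using Suc by auto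
 have "(\<Sum>i<k. (c(k := c0)) i * x ^ i) = (\<Sum>i<k. c i * x ^ i)" by (intro sum.cong) auto
 hence "f = (\<Sum>i<Suc k. (c(k := c0)) i * x ^ i)" using c(2) by (simp add: algebra_simps)
 thus ?case using c(1) c0 by (intro exI[of _ "c(k := c0)"]) auto
qed

lemma N_coefficient:
 assumes d: "der d" "d x = 1" and c: "\<forall>i<p. d (c i) = 0" and i: "i < p"
 shows "N d (x ^ (p - 1 - i) * (\<Sum>j<p. c j * (x::'k) ^ j)) = c i"
proof -
 have "N d (x ^ (p - 1 - i) * (\<Sum>j<p. c j * x ^ j)) = (\<Sum>j<p. N d (c j * (x ^ (p - 1 - i) * x ^ j)))"
  by (simp add: sum_distrib_left N_sum[OF d(1)] ac_simps)
 also have "\<dots> = (\<Sum>j<p. if i = j then c j else 0)" by (intro sum.cong) (use c N_const[OF d(1)] N_var[OF d i] in auto)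
 also have "\<dots> = c i" using i by simp
 finally show ?thesis .
qed

lemma expansion:
 assumes d: "der d" "d x = 1" "d ^^ p = (%_. 0)"
 shows "(f::'k) = (\<Sum>i<p. N d (x ^ (p - 1 - i) * f) * x ^ i)"
proof -
 obtain c where c: "\<forall>i<p. d (c i) = 0" "f = (\<Sum>i<p. c i * x ^ i)" using expansion_exists[OF d(1,2), of p f] d(3) by auto
 have "N d (x ^ (p - 1 - i) * f) = c i" if "i < p" for i unfolding c(2) by (rule N_coefficient[OF d(1,2) c(1) that])
 thus ?thesis using c(2) by simp
qed

text \<open>The identity \<open>d\<^sup>p\<^sup>-\<^sup>1(y\<^sup>p\<^sup>-\<^sup>1 dy) = (p-1)! (dy)\<^sup>p\<close> for \<open>d\<^sup>p = 0\<close>. It says that the Cartier operator fixes logarithmic forms.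
 The \<open>y\<close> satisfying it are closed under addition, since \<open>(a+b)\<^sup>p\<^sup>-\<^sup>1d(a+b) - a\<^sup>p\<^sup>-\<^sup>1da - b\<^sup>p\<^sup>-\<^sup>1db\<close> is the derivative
 of the reduction of \<open>((a+b)\<^sup>p - a\<^sup>p - b\<^sup>p)/p\<close>, and for \<open>y = cx\<^sup>i\<close> it is Fermat's little theorem.\<close>

lemma N_der: "d ^^ p = (%_. 0) ==> N d (d (f::'k)) = 0"
proof -
 assume "d ^^ p = (%_. 0)"
 moreover have "(d ^^ (p - 1)) (d f) = (d ^^ p) f" using p_gt1 by (cases p) (auto simp: funpow_swap1)
 ultimately show ?thesis by (simp add: N_def)
qed

lemma log_form_add:
 assumes d: "der d" "d ^^ p = (%_. 0)"
  and a: "N d (a ^ (p - 1) * d a) = d a ^ p" and b: "N d (b ^ (p - 1) * d b) = d (b::'k) ^ p"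
 shows "N d ((a + b) ^ (p - 1) * d (a + b)) = d (a + b) ^ p"
proof -
 define n where "n = p - 2"
 have n: "p = Suc (Suc n)" using p_gt1 by (simp add: n_def)
 define h where "h = (\<Sum>k\<le>n. of_nat ((p choose Suc k) div p) * (a ^ Suc k * b ^ (Suc n - k)))"
 have dv: "of_nat (Suc k) * of_nat ((p choose Suc k) div p) = (of_nat (Suc n choose k) :: 'k)" if "k <= n" for k
 proof -
  have "p dvd (p choose Suc k)" using dvd_choose_prime[of "Suc k" p] prime_p that n by auto
  then obtain r where r: "p choose Suc k = p * r" by (elim dvdE)
  have "Suc k * (Suc (Suc n) choose Suc k) = Suc (Suc n) * (Suc n choose k)" using Suc_times_binomial_eq[of "Suc n" k] by (simp only: mult.commute)
  hence "p * (Suc k * r) = p * (Suc n choose k)" using r n by (metis mult.left_commute)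
  hence "Suc k * r = (Suc n choose k)" using p_gt1 by simp
  thus ?thesis using r p_gt1 by (metis nonzero_mult_div_cancel_left of_nat_mult)
 qed
 have dv2: "of_nat (Suc n - k) * of_nat ((p choose Suc k) div p) = (of_nat (Suc n choose Suc k) :: 'k)" if "k <= n" for k
 proof -
  have "p choose Suc k = p choose (Suc (n - k))" using binomial_symmetric[of "Suc k" p] that n by (simp add: Suc_diff_le)
  hence "of_nat (Suc n - k) * of_nat ((p choose Suc k) div p) = (of_nat (Suc n choose (n - k)) :: 'k)"
   using dv[of "n - k"] that by (simp add: Suc_diff_le)
  also have "Suc n choose (n - k) = Suc n choose Suc k" using binomial_symmetric[of "Suc k" "Suc n"] that by simp
  finally show ?thesis .
 qed
 have "d h = (\<Sum>k\<le>n. of_nat ((p choose Suc k) div p) *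
   (a ^ Suc k * (of_nat (Suc n - k) * b ^ (n - k) * d b) + b ^ (Suc n - k) * (of_nat (Suc k) * a ^ k * d a)))" unfolding h_def using d(1)
  by (simp add: der_sum der_const_mult der_of_nat der_mult der_power del: power_Suc of_nat_Suc)
 also have "\<dots> = (\<Sum>k\<le>n. of_nat (Suc n choose k) * a ^ k * b ^ (Suc n - k)) * d a +
   (\<Sum>k\<le>n. of_nat (Suc n choose Suc k) * a ^ Suc k * b ^ (n - k)) * d b" unfolding sum_distrib_right sum.distrib[symmetric]
 proof (rule sum.cong)
  fix k assume "k \<in> {..n}"
  hence k: "k <= n" by simp
  show "of_nat ((p choose Suc k) div p) *
    (a ^ Suc k * (of_nat (Suc n - k) * b ^ (n - k) * d b) + b ^ (Suc n - k) * (of_nat (Suc k) * a ^ k * d a)) =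
    of_nat (Suc n choose k) * a ^ k * b ^ (Suc n - k) * d a +
    of_nat (Suc n choose Suc k) * a ^ Suc k * b ^ (n - k) * d b"
   unfolding dv[OF k, symmetric] dv2[OF k, symmetric] by (simp add: algebra_simps del: power_Suc of_nat_Suc binomial_Suc_Suc)
 qed simp
 also have "(\<Sum>k\<le>n. of_nat (Suc n choose k) * a ^ k * b ^ (Suc n - k)) = (a + b) ^ Suc n - a ^ Suc n"
  unfolding binomial_ring[of a b "Suc n"] by simp
 also have "(\<Sum>k\<le>n. of_nat (Suc n choose Suc k) * a ^ Suc k * b ^ (n - k)) = (a + b) ^ Suc n - b ^ Suc n"
  unfolding binomial_ring[of a b "Suc n"] sum.atMost_Suc_shift by simp
 finally have "(a + b) ^ (p - 1) * d (a + b) = d h + (a ^ (p - 1) * d a + b ^ (p - 1) * d b)" using d(1) n by (simp add: der_add algebra_simps)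
 thus ?thesis using a b d by (simp add: N_add N_der der_add fadd)
qed

lemma log_form:
 assumes d: "der d" "d ^^ p = (%_. 0)" "d x = 1"
 shows "N d ((y::'k) ^ (p - 1) * d y) = d y ^ p"
proof -
 have mono: "N d ((c * x ^ i) ^ (p - 1) * d (c * x ^ i)) = d (c * x ^ i) ^ p" if c: "d c = 0" for c i
 proof (cases i)
  case 0
  thus ?thesis using c d by (simp add: N_0 fzero)
 next
  case (Suc j)
  have dc: "d (c * x ^ i) = of_nat i * c * x ^ j" using der_power_Suc[OF d(1), of x j] Suc d c by (simp add: der_const_mult del: of_nat_Suc power_Suc)
  obtain r where r: "p = Suc r" using p_gt1 by (cases p) auto
  have "(c * x ^ i) ^ (p - 1) * d (c * x ^ i) = (of_nat i * c ^ p * (x ^ j) ^ p) * x ^ (p - 1)"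
  proof -
   have "i * r + j = j * p + r" unfolding Suc r by (simp add: algebra_simps)
   hence 1: "(x ^ i) ^ r * x ^ j = (x ^ j) ^ p * x ^ r" by (simp only: power_mult[symmetric] power_add[symmetric])
   have 2: "(c * x ^ i) ^ r * (of_nat i * c * x ^ j) = of_nat i * (c ^ r * c) * ((x ^ i) ^ r * x ^ j)" by (simp add: power_mult_distrib ac_simps)
   have 3: "c ^ r * c = c ^ p" unfolding r by simp
   have 4: "p - 1 = r" unfolding r by simp
   show ?thesis unfolding dc 4 2 unfolding 1 3 by (simp only: mult.assoc)
  qed
  moreover have "d (of_nat i * c ^ p * (x ^ j) ^ p) = 0"
   using der_mult[OF d(1), of "of_nat i" "c ^ p * (x ^ j) ^ p"] der_mult[OF d(1), of "c ^ p" "(x ^ j) ^ p"]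
    der_pth[OF d(1)] der_of_nat[OF d(1)] by (simp add: mult.assoc)
  ultimately have "N d ((c * x ^ i) ^ (p - 1) * d (c * x ^ i)) = of_nat i * c ^ p * (x ^ j) ^ p * N d (x ^ (p - 1))" using N_const[OF d(1)] by simp
  also have "N d (x ^ (p - 1)) = 1" using N_var[OF d(1,3), of 0 0] p_gt1 by simp
  finally show ?thesis unfolding dc by (simp add: power_mult_distrib of_nat_fermat)
 qed
 obtain c where c: "\<forall>i<p. d (c i) = 0" "y = (\<Sum>i<p. c i * x ^ i)" using expansion_exists[OF d(1,3), of p y] d(2) by auto
 have "N d ((\<Sum>i<k. c i * x ^ i) ^ (p - 1) * d (\<Sum>i<k. c i * x ^ i)) = d (\<Sum>i<k. c i * x ^ i) ^ p" if "k <= p" for k using that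
 proof (induction k)
  case 0
  thus ?case using d p_gt1 by (simp add: der_0 N_0)
 next
  case (Suc k)
  thus ?case using log_form_add[OF d(1,2) _ mono[of "c k" k]] c(1) by simp
 qed
 thus ?thesis using c(2) by simp
qed

text \<open>Replacing the coordinate \<open>x\<close> by \<open>y\<close>: on \<open>y\<^sup>i dy\<close> with \<open>i < p-1\<close>, which is exact, \<open>N d\<close> vanishes, and for \<open>i = p-1\<close> it is given by
 \<open>log_form\<close>.\<close>

lemma N_change:
 assumes d: "der d" "d ^^ p = (%_. 0)" "d x = 1" and g: "d y ~= 0"
  and d': "d' = (%f. d f / d y)" "d' ^^ p = (%_. 0)"
 shows "N d' (f::'k) = N d (f / d y ^ (p - 1))"
proof -
 have der': "der d'" "d' y = 1" using d(1) g by (auto simp: d' der_div)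
 obtain c where c: "\<forall>i<p. d' (c i) = 0" "f = (\<Sum>i<p. c i * y ^ i)" using expansion_exists[OF der', of p f] d'(2) by auto
 have dc: "d (c i) = 0" if "i < p" for i using c(1) that g by (auto simp: d')
 have "N d' f = c (p - 1)" using N_coefficient[OF der' c(1), of "p - 1"] p_gt1 c(2) by simp
 have "f / d y ^ (p - 1) = (\<Sum>i<p. c i * (1 / d y ^ p) * (y ^ i * d y))"
 proof -
  obtain r where r: "p = Suc r" using p_gt1 by (cases p) auto
  show ?thesis unfolding c(2) sum_divide_distrib r using g by (intro sum.cong) auto
 qed
 moreover have "N d (c i * (1 / d y ^ p) * (y ^ i * d y)) = (if i = p - 1 then c i else 0)" if i: "i < p" for i
 proof -
  have "d (c i * (1 / d y ^ p)) = 0" unfolding der_const_mult[OF d(1) dc[OF i]] der_inverse[OF d(1) der_pth[OF d(1), of "d y"]] by simp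
  hence "N d (c i * (1 / d y ^ p) * (y ^ i * d y)) = c i * (1 / d y ^ p) * N d (y ^ i * d y)" by (rule N_const[OF d(1)])
  also have "N d (y ^ i * d y) = (if i = p - 1 then d y ^ p else 0)"
  proof (cases "i = p - 1")
   case True thus ?thesis using log_form[OF d, of y] by simp
  next
   case False
   hence nz: "of_nat (Suc i) ~= (0::'k)" using i of_nat_nonzero[of "Suc i"] by simp
   have "d (y ^ Suc i / of_nat (Suc i)) = y ^ i * d y"
    using der_divide_const[OF d(1) der_of_nat[OF d(1), of "Suc i"]] der_power[OF d(1), of y "Suc i"] nz by (simp del: of_nat_Suc power_Suc)
   thus ?thesis using N_der[OF d(2)] False by metis
  qed
  finally show ?thesis using g by simp
 qed
 ultimately have "N d (f / d y ^ (p - 1)) = (\<Sum>i<p. if i = p - 1 then c i else 0)" by (simp only: N_sum[OF d(1)]) (intro sum.cong, auto)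
 thus ?thesis using \<open>N d' f = c (p - 1)\<close> p_gt1 by simp
qed

end

section \<open>Extending derivations\<close>

text \<open>A derivation defined on a subring containing all p-th powers, as the set of pairs \<open>(a, \<delta>a)\<close>.\<close>

context pchar
begin

definition partial_der :: "('k \<times> 'k) set => bool" where
 "partial_der G \<longleftrightarrow> (\<forall>a b a' b'. (a, b) \<in> G --> (a', b') \<in> G --> (a + a', b + b') \<in> G & (a * a', a * b' + b * a') \<in> G) &
  (\<forall>c. (c ^ p, 0) \<in> G) & (\<forall>b. (0, b) \<in> G --> b = 0)"

lemma partial_derD:
 assumes "partial_der G"
 shows "(a, b) \<in> G ==> (a', b') \<in> G ==> (a + a', b + b') \<in> G"
  "(a, b) \<in> G ==> (a', b') \<in> G ==> (a * a', a * b' + b * a') \<in> G"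
  "(c ^ p, 0) \<in> G" "(0, b) \<in> G ==> b = 0" "(0, 0) \<in> G" "(1, 0) \<in> G"
  "(a, b) \<in> G ==> (- a, - b) \<in> G" "(a, b) \<in> G ==> (a, b') \<in> G ==> b = b'"
  "(a, b) \<in> G ==> \<exists>b'. (1 / a, b') \<in> G"
proof -
 show 1: "(a, b) \<in> G ==> (a', b') \<in> G ==> (a + a', b + b') \<in> G" for a b a' b' using assms by (auto simp: partial_der_def)
 show 2: "(a, b) \<in> G ==> (a', b') \<in> G ==> (a * a', a * b' + b * a') \<in> G" for a b a' b' using assms by (auto simp: partial_der_def)
 show 3: "(c ^ p, 0) \<in> G" for c using assms by (auto simp: partial_der_def)
 show 4: "(0, b) \<in> G ==> b = 0" for b using assms by (auto simp: partial_der_def)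
 show "(0, 0) \<in> G" using 3[of 0] by (simp add: fzero)
 show 6: "(1, 0) \<in> G" using 3[of 1] by simp
 have "(- 1, 0) \<in> G" using 3[of "- 1"] fminus[of 1] by simp
 thus 7: "(a, b) \<in> G ==> (- a, - b) \<in> G" for a b using 2[of "- 1" 0 a b] by simp
 show "b = b'" if "(a, b) \<in> G" "(a, b') \<in> G" using 4[of "b + - b'"] 1[OF that(1) 7[OF that(2)]] by simp
 assume ab: "(a, b) \<in> G"
 have pow: "\<exists>b'. (a ^ n, b') \<in> G" for n by (induction n) (use 6 2 ab in "auto, blast")
 obtain b' where "(a ^ (p - 1), b') \<in> G" using pow by blast
 hence "((1 / a) ^ p * a ^ (p - 1), (1 / a) ^ p * b' + 0 * a ^ (p - 1)) \<in> G" using 2[OF 3] by blast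
 moreover have "(1 / a) ^ p * a ^ (p - 1) = 1 / a"
 proof -
  have "a ^ p = a ^ (p - 1) * a" using p_gt1 by (cases p) auto
  thus ?thesis by (cases "a = 0") (auto simp: power_divide fzero)
 qed
 ultimately show "\<exists>b'. (1 / a, b') \<in> G" by auto
qed

text \<open>Polynomials over the domain of the partial derivation, paired with the result of applying it to the coefficients. The
 second component is what must be controlled when the derivation is extended to a further element.\<close>

definition polys :: "('k \<times> 'k) set => ('k poly \<times> 'k poly) set" where
 "polys G = {(f, g). \<forall>i. (coeff f i, coeff g i) \<in> G}"

context
 fixes G assumes G: "partial_der G"
begin

lemma polys_sum: "(!!i. i \<in> I ==> (a i, b i) \<in> G) ==> (sum a I, sum b I) \<in> G"
 by (induction I rule: infinite_finite_induct) (auto simp: partial_derD[OF G])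

lemma polys_add: "(f, g) \<in> polys G ==> (f', g') \<in> polys G ==> (f + f', g + g') \<in> polys G" by (auto simp: polys_def partial_derD(1)[OF G])

lemma polys_minus: "(f, g) \<in> polys G ==> (- f, - g) \<in> polys G" by (auto simp: polys_def partial_derD(7)[OF G])

lemma polys_diff: "(f, g) \<in> polys G ==> (f', g') \<in> polys G ==> (f - f', g - g') \<in> polys G"
 using polys_add[of f g "- f'" "- g'"] polys_minus[of f' g'] by simp

lemma polys_mult: "(f, g) \<in> polys G ==> (f', g') \<in> polys G ==> (f * f', f * g' + g * f') \<in> polys G"
 by (auto simp: polys_def coeff_mult sum.distrib[symmetric] intro!: polys_sum partial_derD(2)[OF G])

lemma polys_monom: "(a, b) \<in> G ==> (monom a n, monom b n) \<in> polys G" by (auto simp: polys_def partial_derD(5)[OF G])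

lemma polys_0: "(0, 0) \<in> polys G" by (auto simp: polys_def partial_derD(5)[OF G])

lemma polys_lead:
 assumes "(r, r') \<in> polys G"
 shows "\<exists>b. (1 / lead_coeff r, b) \<in> G" using assms partial_derD(9)[OF G] by (auto simp: polys_def)

lemma polys_division:
 assumes r: "(r, r') \<in> polys G" "r ~= 0"
 shows "(f, f') \<in> polys G ==> \<exists>q q' s s'. (q, q') \<in> polys G & (s, s') \<in> polys G & f = q * r + s &
  f' = (q * r' + q' * r) + s' & (s = 0 | degree s < degree r)"
proof (induction "if f = 0 then 0 else Suc (degree f)" arbitrary: f f' rule: less_induct)
 case less
 show ?case
 proof (cases "f = 0 | degree f < degree r")
  case True
  thus ?thesis using less.prems polys_0 by (intro exI[of _ 0] exI[of _ 0] exI[of _ f] exI[of _ f']) auto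
 next
  case False
  obtain b where b: "(1 / lead_coeff r, b) \<in> G" using polys_lead[OF r(1)] by blast
  have "(lead_coeff f, coeff f' (degree f)) \<in> G" using less.prems by (auto simp: polys_def)
  from partial_derD(2)[OF G this b] obtain c where c: "(lead_coeff f / lead_coeff r, c) \<in> G" by auto
  define n where "n = degree f - degree r"
  let ?h = "monom (lead_coeff f / lead_coeff r) n" and ?h' = "monom c n"
  have h: "(?h, ?h') \<in> polys G" by (rule polys_monom[OF c])
  let ?f = "f - ?h * r" and ?f' = "f' - (?h * r' + ?h' * r)"
  have f: "(?f, ?f') \<in> polys G" by (rule polys_diff[OF less.prems polys_mult[OF h r(1)]])
  have "?f = 0 | degree ?f < degree f"
  proof (rule ccontr)
   assume a: "~ ?thesis"
   have l0: "lead_coeff f / lead_coeff r ~= 0" using False r by auto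
   have dh: "degree (?h * r) = degree f"
   proof -
    have "?h ~= 0" using l0 by (simp only: monom_eq_0_iff not_False_eq_True)
    moreover have "degree ?h = n" using l0 by (rule Polynomial.degree_monom_eq)
    ultimately have "degree (?h * r) = n + degree r" using degree_mult_eq[of ?h r] r(2) by presburger
    thus ?thesis using False by (simp add: n_def)
   qed
   hence "degree ?f = degree f" using a degree_diff_le[of f "degree f" "?h * r"] by auto
   moreover have "coeff ?f (degree f) = 0"
   proof -
    have "coeff (?h * r) (degree f) = lead_coeff (?h * r)" using dh by simp
    also have "\<dots> = (lead_coeff f / lead_coeff r) * lead_coeff r" by (simp only: lead_coeff_mult lead_coeff_monom)
    also have "\<dots> = lead_coeff f" using r(2) by simp
    finally show ?thesis by simp
   qed
   ultimately show False using a by (metis leading_coeff_0_iff)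
  qed
  hence "(if ?f = 0 then 0 else Suc (degree ?f)) < (if f = 0 then 0 else Suc (degree f))" using False by auto
  from less.hyps[OF this f] obtain q q' s s' where q: "(q, q') \<in> polys G" "(s, s') \<in> polys G" "?f = q * r + s"
   "?f' = (q * r' + q' * r) + s'" "s = 0 | degree s < degree r" by blast
  have "f = (q + ?h) * r + s" "f' = ((q + ?h) * r' + (q' + ?h') * r) + s'" using q(3,4) by (auto simp: algebra_simps)
  thus ?thesis using polys_add[OF q(1) h] q by blast
 qed
qed

lemma polys_frobenius: "(monom 1 p + [:- (y ^ p):], 0) \<in> polys G"
proof -
 have "(- (y ^ p), 0) \<in> G" using partial_derD(3,7)[OF G] by (metis minus_zero)
 thus ?thesis using polys_add[OF polys_monom[OF partial_derD(6)[OF G], of p] polys_monom, of "- (y ^ p)" 0 0] by (simp add: monom_0)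
qed

lemma frobenius_linear: "monom 1 p + [:- (y ^ p):] = [:- y, 1:] ^ p" for y :: 'k
proof -
 have "(monom 1 1 + [:- y:]) ^ p = monom 1 1 ^ p + [:- y:] ^ p" by (rule freshmans_dream) (use prime_p char_p in simp_all)
 moreover have "[:- y, 1:] = monom 1 1 + [:- y:]" by (simp add: monom_altdef)
 ultimately show ?thesis by (simp add: poly_const_pow fminus monom_power)
qed

text \<open>The minimal polynomial \<open>r\<close> of an element \<open>y\<close> outside the subring has degree \<open>p\<close>: it divides \<open>(X-y)\<^sup>p\<close>, hence it is
 \<open>(X-y)\<^sup>n\<close> up to a factor, and for \<open>n < p\<close> its coefficients \<open>1\<close> and \<open>-ny\<close> would show that \<open>y\<close> is in the subring.\<close>

lemma no_small_relation:
 assumes y: "!!b. (y, b) ~: G" and f: "(f, f') \<in> polys G" "poly f y = 0" "degree f < p"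
 shows "f = 0"
proof (rule ccontr)
 assume "f ~= 0"
 let ?A = "%f. (\<exists>f'. (f, f') \<in> polys G) & poly f y = 0 & f ~= 0"
 define n where "n = (LEAST n. \<exists>f. ?A f & degree f = n)"
 have ex: "\<exists>n f. ?A f & degree f = n" using f \<open>f ~= 0\<close> by blast
 obtain r where r: "?A r" "degree r = n" using LeastI_ex[OF ex] unfolding n_def by blast
 have least: "n <= degree h" if "?A h" for h unfolding n_def by (rule Least_le) (use that in blast)
 obtain r' where r': "(r, r') \<in> polys G" using r by blast
 have np: "n < p" using le_less_trans[OF least[of f] f(3)] f \<open>f ~= 0\<close> by blast
 have "n ~= 0"
 proof
  assume "n = 0"
  then obtain a where "r = [:a:]" using r(2) by (metis degree_eq_zeroE)
  thus False using r by simp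
 qed
 let ?F = "monom 1 p + [:- (y ^ p):]"
 obtain q q' s s' where q: "(q, q') \<in> polys G" "(s, s') \<in> polys G" "?F = q * r + s" "s = 0 | degree s < degree r"
  using polys_division[OF r' _ polys_frobenius] r(1) by blast
 have "poly s y = 0" using arg_cong[OF q(3), of "%f. poly f y"] r(1) by (simp add: poly_monom)
 hence "s = 0" using least[of s] q(2,4) r(2) by fastforce
 hence F: "[:- y, 1:] ^ p = q * r" using q(3) frobenius_linear by simp
 hence qr: "q * r ~= 0" by (metis pCons_eq_0_iff power_not_zero zero_neq_one)
 have "order y q + order y r = p" using order_mult[OF qr] order_power_n_n[of y p] F by metis
 moreover have "degree q + degree r = p" using F degree_linear_power[of "- y" p] degree_mult_eq[of q r] qr by auto
 moreover have "order y q <= degree q" "order y r <= degree r" using order_degree qr by auto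
 ultimately have "order y r = n" using r(2) by simp
 then obtain h where h: "r = [:- y, 1:] ^ n * h" using order_1[of y r] by (auto elim: dvdE)
 have "degree r = degree ([:- y, 1:] ^ n) + degree h" unfolding h by (rule degree_mult_eq) (use h r(1) in auto)
 hence "degree h = 0" using r(2) degree_linear_power[of "- y" n] by simp
 then obtain c where "h = [:c:]" using degree_eq_zeroE[of h] by auto
 hence rc: "r = smult c ([:- y, 1:] ^ n)" using h by (simp add: mult.commute)
 hence c0: "c ~= 0" using r(1) by auto
 have rG: "(coeff r i, coeff r' i) \<in> G" for i using r' by (simp add: polys_def)
 obtain k where k: "n = Suc k" using \<open>n ~= 0\<close> by (cases n) auto
 have "coeff r n = c" "coeff r k = c * (of_nat n * - y)"
  unfolding rc k coeff_smult coeff_linear_poly_power[OF le_SucI[OF order_refl]] coeff_linear_poly_power[OF order_refl] by simp_all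
 then obtain a b where ab: "(c, a) \<in> G" "(c * (of_nat n * - y), b) \<in> G" using rG[of n] rG[of k] by metis
 have nG: "(of_nat n, 0) \<in> G" using partial_derD(3)[OF G, of "of_nat n"] of_nat_fermat by simp
 obtain a' where "(1 / c, a') \<in> G" using partial_derD(9)[OF G ab(1)] by blast
 from partial_derD(2)[OF G this ab(2)] obtain b1 where b1: "(of_nat n * - y, b1) \<in> G" using c0 by auto
 obtain n' where "(1 / of_nat n, n') \<in> G" using partial_derD(9)[OF G nG] by blast
 from partial_derD(2)[OF G this b1] obtain b2 where "(- y, b2) \<in> G" using of_nat_nonzero[of n] np \<open>n ~= 0\<close> by auto
 from partial_derD(7)[OF G this] show False using y by simp
qed

lemma partial_der_extend:
 assumes y: "!!b. (y, b) ~: G"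
 shows "\<exists>G'. partial_der G' & G <= G' & (y, v) \<in> G'"
proof -
 let ?e = "%f g. poly g y + poly (pderiv f) y * v"
 define G' where "G' = {(poly f y, ?e f g) | f g. (f, g) \<in> polys G}"
 have const: "([:a:], [:b:]) \<in> polys G" if "(a, b) \<in> G" for a b using polys_monom[OF that, of 0] by (simp add: monom_0)
 have sub: "G <= G'"
 proof clarify
  fix a b assume "(a, b) \<in> G"
  thus "(a, b) \<in> G'" unfolding G'_def by (intro CollectI exI[of _ "[:a:]"] exI[of _ "[:b:]"]) (auto simp: const)
 qed
 moreover have "(y, v) \<in> G'" unfolding G'_def using polys_monom[OF partial_derD(6)[OF G], of 1]
  by (intro CollectI exI[of _ "monom 1 1"] exI[of _ "monom 0 1"]) (auto simp: poly_monom pderiv_monom)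
 moreover have "partial_der G'" unfolding partial_der_def
 proof (intro conjI allI impI)
  fix a b a' b' assume "(a, b) \<in> G'" "(a', b') \<in> G'"
  then obtain f g f' g' where f: "a = poly f y" "b = ?e f g" "(f, g) \<in> polys G"
   and f': "a' = poly f' y" "b' = ?e f' g'" "(f', g') \<in> polys G" by (auto simp: G'_def)
  show "(a + a', b + b') \<in> G'" unfolding G'_def by (intro CollectI exI[of _ "f + f'"] exI[of _ "g + g'"])
    (use f f' polys_add in "auto simp: pderiv_add algebra_simps")
  show "(a * a', a * b' + b * a') \<in> G'" unfolding G'_def
  proof (rule CollectI, rule exI[of _ "f * f'"], rule exI[of _ "f * g' + g * f'"], intro conjI)
   show "(f * f', f * g' + g * f') \<in> polys G" by (rule polys_mult[OF f(3) f'(3)])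
  qed (use f f' in "auto simp: pderiv_mult algebra_simps")
 next
  fix c show "(c ^ p, 0) \<in> G'" using sub partial_derD(3)[OF G] by blast
 next
  fix b assume "(0, b) \<in> G'"
  then obtain f g where f: "poly f y = 0" "b = ?e f g" "(f, g) \<in> polys G" by (auto simp: G'_def)
  define F where "F = monom 1 p + [:- (y ^ p):]"
  have FG: "(F, 0) \<in> polys G" unfolding F_def by (rule polys_frobenius)
  have Fy: "poly F y = 0" "pderiv F = 0" "degree F = p" unfolding F_def using p_gt1
   by (auto simp: poly_monom pderiv_add pderiv_monom pderiv_pCons of_nat_p degree_monom_eq degree_add_eq_left)
  hence "F ~= 0" using p_gt1 by auto
  then obtain q q' s s' where q: "(q, q') \<in> polys G" "(s, s') \<in> polys G" "f = q * F + s" "g = (q * 0 + q' * F) + s'"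
   "s = 0 | degree s < degree F" using polys_division[OF FG _ f(3)] by blast
  have "s = 0" using no_small_relation[OF y q(2)] q(3,5) f(1) Fy by auto
  hence "s' = 0" using q(2) partial_derD(4)[OF G] by (auto simp: polys_def poly_eq_iff)
  thus "b = 0" using f(2) q(3,4) \<open>s = 0\<close> Fy by (simp add: pderiv_mult)
 qed
 ultimately show ?thesis by blast
qed

end

text \<open>An element that is not a p-th power is not killed by all derivations. A derivation on
 \<open>K\<^sup>p(x)\<close> with value 1 at \<open>x\<close> extends to the field, by Zorn's lemma.\<close>

lemma exists_derivation:
 assumes x: "!!c. x ~= c ^ p"
 shows "\<exists>de. der de & de x = (1::'k)"
proof -
 define G0 where "G0 = {(c ^ p, 0 :: 'k) | c :: 'k. True}"
 have "partial_der G0" unfolding partial_der_def G0_def by (auto simp: fadd[symmetric] power_mult_distrib[symmetric])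
 moreover have "(x, b) ~: G0" for b using x by (auto simp: G0_def)
 ultimately obtain G1 where G1: "partial_der G1" "(x, 1) \<in> G1" using partial_der_extend by metis
 let ?F = "{G. partial_der G & G1 <= G}"
 have "\<exists>M\<in>?F. \<forall>X\<in>?F. M <= X --> X = M"
 proof (rule subset_Zorn_nonempty)
  show "?F ~= {}" using G1 by blast
  fix C assume ne: "C ~= {}" and C: "subset.chain ?F C"
  have C1: "partial_der X" "G1 <= X" if "X \<in> C" for X using C that by (auto simp: subset.chain_def)
  have two: "\<exists>X\<in>C. u \<in> X & w \<in> X" if "u \<in> \<Union>C" "w \<in> \<Union>C" for u w
  proof -
   from that obtain X Y where XY: "X \<in> C" "u \<in> X" "Y \<in> C" "w \<in> Y" by auto
   hence "X <= Y | Y <= X" using subset_chain_def[of ?F C] C by meson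
   thus ?thesis using XY by auto
  qed
  have "partial_der (\<Union>C)" unfolding partial_der_def
  proof (intro conjI allI impI)
   fix a b a' b' assume "(a, b) \<in> \<Union>C" "(a', b') \<in> \<Union>C"
   then obtain X where "X \<in> C" "(a, b) \<in> X" "(a', b') \<in> X" using two by blast
   thus "(a + a', b + b') \<in> \<Union>C" "(a * a', a * b' + b * a') \<in> \<Union>C" using partial_derD(1,2)[OF C1(1)] by blast+
  next
   fix c show "(c ^ p, 0) \<in> \<Union>C" using ne partial_derD(3)[OF C1(1)] by blast
  next
   fix b assume "(0, b) \<in> \<Union>C"
   thus "b = 0" using partial_derD(4)[OF C1(1)] by blast
  qed
  thus "\<Union>C \<in> ?F" using ne C1(2) by blast
 qed
 then obtain M where MF: "M \<in> ?F" and mx: "\<forall>X\<in>?F. M <= X --> X = M" by (rule bexE)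
 have M: "partial_der M" "G1 <= M" using MF by auto
 have max: "X = M" if "partial_der X" "M <= X" for X
 proof -
  have "X \<in> ?F" using that M(2) by auto
  thus ?thesis using mx that(2) by simp
 qed
 have total: "\<exists>b. (y, b) \<in> M" for y
 proof (rule ccontr)
  assume "\<nexists>b. (y, b) \<in> M"
  then obtain X where "partial_der X" "M <= X" "(y, 0) \<in> X" using partial_der_extend[OF M(1), of y 0] by blast
  thus False using max[of X] \<open>\<nexists>b. (y, b) \<in> M\<close> by blast
 qed
 then obtain de where de: "!!y. (y, de y) \<in> M" by metis
 have eq: "de y = b" if "(y, b) \<in> M" for y b using partial_derD(8)[OF M(1) de that] .
 have "der de"
 proof (rule derI)
  show "de (a + b) = de a + de b" for a b by (rule eq[OF partial_derD(1)[OF M(1) de de]])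
  show "de (a * b) = a * de b + b * de a" for a b using eq[OF partial_derD(2)[OF M(1) de de], of a b] by (simp add: mult.commute)
 qed
 moreover have "de x = 1" using eq G1(2) M(2) by blast
 ultimately show ?thesis by blast
qed

end

section \<open>Dual systems of derivations and the trace\<close>

context pchar
begin

text \<open>The elements \<open>xs\<close> form a p-basis and \<open>ds\<close> are the partial derivatives with respect to it.\<close>

definition dual :: "'k list => ('k => 'k) list => bool" where
 "dual xs ds \<longleftrightarrow> length ds = length xs & (\<forall>d\<in>set ds. der d) &
  (\<forall>i<length xs. \<forall>j<length xs. (ds ! i) (xs ! j) = (if i = j then 1 else 0)) &
  (\<forall>de. der de --> (\<forall>x\<in>set xs. de x = 0) --> de = (%_. 0))"

lemma dualD:
 assumes "dual xs ds"
 shows "length ds = length xs" "i < length xs ==> der (ds ! i)" "d \<in> set ds ==> der d"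
  "i < length xs ==> j < length xs ==> (ds ! i) (xs ! j) = (if i = j then 1 else 0)"
  "der de ==> (!!x. x \<in> set xs ==> de x = 0) ==> de = (%_. 0)" using assms unfolding dual_def by (auto simp del: One_nat_def)

lemma dual_eqI:
 assumes "dual xs ds" "der de" "der \<epsilon>" "!!x. x \<in> set xs ==> de x = \<epsilon> x"
 shows "de = \<epsilon>"
proof -
 have "(%f. de f - \<epsilon> f) = (%_. 0)" by (rule dualD(5)[OF assms(1) der_sub[OF assms(2,3)]]) (use assms(4) in simp)
 thus ?thesis by (metis eq_iff_diff_eq_0 ext)
qed

lemma dual_expand:
 assumes "dual xs ds" "der de"
 shows "de f = (\<Sum>i<length xs. de (xs ! i) * (ds ! i) f)"
proof -
 have d: "der (%f. \<Sum>i\<in>{..<length xs}. de (xs ! i) * (ds ! i) f)" by (rule der_lsum) (use dualD(2)[OF assms(1)] in auto)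
 have "de = (%f. \<Sum>i\<in>{..<length xs}. de (xs ! i) * (ds ! i) f)"
 proof (rule dual_eqI[OF assms d])
  fix x assume "x \<in> set xs"
  then obtain j where j: "j < length xs" "x = xs ! j" by (auto simp: in_set_conv_nth)
  have "(\<Sum>i\<in>{..<length xs}. de (xs ! i) * (ds ! i) x) = (\<Sum>i\<in>{..<length xs}. if i = j then de (xs ! i) else 0)"
   by (intro sum.cong) (use dualD(4)[OF assms(1) _ j(1)] j(2) in auto)
  thus "de x = (\<Sum>i\<in>{..<length xs}. de (xs ! i) * (ds ! i) x)" using j by simp
 qed
 thus ?thesis by metis
qed

lemma dual_commute:
 assumes "dual xs ds" "i < length xs" "j < length xs"
 shows "(ds ! i) ((ds ! j) f) = (ds ! j) ((ds ! i) f)"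
proof -
 note di = dualD(2)[OF assms(1,2)] and dj = dualD(2)[OF assms(1,3)]
 have "(%f. (ds ! i) ((ds ! j) f) - (ds ! j) ((ds ! i) f)) = (%_. 0)"
 proof (rule dualD(5)[OF assms(1) der_commutator[OF di dj]])
  fix x assume "x \<in> set xs"
  then obtain k where k: "k < length xs" "x = xs ! k" by (auto simp: in_set_conv_nth)
  show "(ds ! i) ((ds ! j) x) - (ds ! j) ((ds ! i) x) = 0"
   using dualD(4)[OF assms(1,2) k(1)] dualD(4)[OF assms(1,3) k(1)] di dj k(2) by (auto simp: der_0 der_1)
 qed
 thus ?thesis by (metis eq_iff_diff_eq_0)
qed

lemma dual_nilpotent:
 assumes "dual xs ds" "i < length xs"
 shows "(ds ! i) ^^ p = (%_. 0)"
proof (rule dualD(5)[OF assms(1) der_pow_p[OF dualD(2)[OF assms]]])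
 note d = dualD(2)[OF assms]
 fix x assume "x \<in> set xs"
 then obtain k where k: "k < length xs" "x = xs ! k" by (auto simp: in_set_conv_nth)
 obtain r where r: "p = Suc (Suc r)" using p_gt1 by (metis Suc_diff_Suc numeral_2_eq_2 Suc_le_D le_Suc_ex add_Suc)
 have "(ds ! i) ((ds ! i) x) = 0" using dualD(4)[OF assms k(1)] k(2) d by (auto simp: der_0 der_1)
 thus "((ds ! i) ^^ p) x = 0" unfolding r funpow_Suc_right comp_def using der_pow_0[OF d] by simp
qed

text \<open>An element killed by the partial derivatives is killed by all derivations, since these are combinations of them.\<close>

lemma dual_const:
 assumes "dual xs ds" "!!d. d \<in> set ds ==> d f = 0"
 shows "\<exists>c. f = c ^ p"
proof (rule ccontr)
 assume "\<nexists>c. f = c ^ p"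
 then obtain de where "der de" "de f = 1" using exists_derivation by blast
 moreover have "de f = 0"
  unfolding dual_expand[OF assms(1) \<open>der de\<close>, of f] using assms(2) dualD(1)[OF assms(1)] by (auto intro!: sum.neutral)
 ultimately show False by simp
qed

lemma differential_basis_iff: "differential_basis xs \<longleftrightarrow> (\<exists>ds. dual xs ds)"
proof
 assume "\<exists>ds. dual xs ds"
 then obtain ds where D: "dual xs ds" ..
 show "differential_basis xs" unfolding differential_basis_def
 proof (intro allI impI ex1I conjI)
  fix vs :: "'k list" assume l: "length vs = length xs"
  let ?d = "%f. \<Sum>i\<in>{..<length xs}. vs ! i * (ds ! i) f"
  show d: "der ?d" by (rule der_lsum) (use dualD(2)[OF D] in auto)
  have e: "?d (xs ! j) = vs ! j" if j: "j < length xs" for j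
  proof -
   have "?d (xs ! j) = (\<Sum>i\<in>{..<length xs}. if i = j then vs ! i else 0)" by (intro sum.cong) (use dualD(4)[OF D _ j] in auto)
   thus ?thesis using j by simp
  qed
  thus "map ?d xs = vs" using l by (auto intro: nth_equalityI)
  fix de assume a: "der de & map de xs = vs"
  show "de = ?d"
  proof (rule dual_eqI[OF D _ d])
   fix x assume "x \<in> set xs"
   then obtain k where k: "k < length xs" "x = xs ! k" by (auto simp: in_set_conv_nth)
   thus "de x = ?d x" using e[OF k(1)] a by auto
  qed (use a in simp)
 qed
next
 assume b: "differential_basis xs"
 have ex: "\<exists>de. der de & map de xs = vs" if "length vs = length xs" for vs using b that unfolding differential_basis_def by blast
 have un: "de = \<epsilon>" if "der de" "der \<epsilon>" "map de xs = map \<epsilon> xs" for de \<epsilon>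
  using b[unfolded differential_basis_def, rule_format, of "map de xs"] that by auto
 have "\<exists>de. der de & (\<forall>j<length xs. de (xs ! j) = (if i = j then 1 else 0))" for i
 proof -
  obtain de where de: "der de" "map de xs = map (%j. if i = j then 1 else 0) [0..<length xs]"
   using ex[of "map (%j. if i = j then 1 else 0) [0..<length xs]"] by auto
  have "de (xs ! j) = (if i = j then 1 else 0)" if "j < length xs" for j using arg_cong[OF de(2), of "%l. l ! j"] that by simp
  thus ?thesis using de(1) by blast
 qed
 then obtain D where D: "!!i. der (D i)" "!!i j. j < length xs ==> D i (xs ! j) = (if i = j then 1 else 0)" by metis
 have "dual xs (map D [0..<length xs])" unfolding dual_def
 proof (intro conjI allI impI)
  fix de assume "der de" "\<forall>x\<in>set xs. de x = 0"
  thus "de = (%_. 0)" using un[OF _ der_zero] by simp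
 qed (use D in auto)
 thus "\<exists>ds. dual xs ds" ..
qed

text \<open>The part of the notion of a dual system that is inherited by sublists, as needed for inductions.\<close>

definition csys :: "'k list => ('k => 'k) list => bool" where
 "csys xs ds \<longleftrightarrow> length ds = length xs & (\<forall>d\<in>set ds. der d & d ^^ p = (%_. 0)) &
  (\<forall>d\<in>set ds. \<forall>d'\<in>set ds. \<forall>f. d (d' f) = d' (d f)) &
  (\<forall>i<length xs. \<forall>j<length xs. (ds ! i) (xs ! j) = (if i = j then 1 else 0))"

lemma dual_csys: "dual xs ds ==> csys xs ds" unfolding csys_def by (auto simp: dualD in_set_conv_nth dual_nilpotent dual_commute)

lemma csys_Cons:
 assumes "csys (x # xs) (d # ds)"
 shows "csys xs ds" "der d" "d ^^ p = (%_. 0)" "d x = 1" "x' \<in> set xs ==> d x' = 0"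
  "d' \<in> set ds ==> d' x = 0" "d' \<in> set ds ==> d (d' f) = d' (d f)"
proof -
 have orth: "((d # ds) ! i) ((x # xs) ! j) = (if i = j then 1 else 0)" if "i <= length xs" "j <= length xs" for i j
  using assms that by (auto simp: csys_def)
 show "d x = 1" using orth[of 0 0] by simp
 have o: "(ds ! i) (xs ! j) = (if i = j then 1 else 0)" if "i < length xs" "j < length xs" for i j using orth[of "Suc i" "Suc j"] that by simp
 show "csys xs ds" using assms o by (auto simp: csys_def)
 show "der d" "d ^^ p = (%_. 0)" "d' \<in> set ds ==> d (d' f) = d' (d f)" using assms by (auto simp: csys_def)
 have l: "length ds = length xs" using assms by (simp add: csys_def)
 show "d x' = 0" if "x' \<in> set xs"
 proof -
  from that obtain j where "j < length xs" "x' = xs ! j" by (auto simp: in_set_conv_nth)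
  thus ?thesis using orth[of 0 "Suc j"] by simp
 qed
 show "d' x = 0" if "d' \<in> set ds"
 proof -
  from that obtain j where "j < length xs" "d' = ds ! j" using l by (auto simp: in_set_conv_nth)
  thus ?thesis using orth[of "Suc j" 0] by simp
 qed
qed

text \<open>The coefficient of \<open>x\<^sub>1\<^sup>p\<^sup>-\<^sup>1 \<cdots> x\<^sub>n\<^sup>p\<^sup>-\<^sup>1\<close>, a linear form over the p-th powers that generates all of them.\<close>

definition tau :: "('k => 'k) list => 'k => 'k" where "tau ds f = foldl (%f d. N d f) f ds"

lemma tau_simps [simp]: "tau [] f = f" "tau (d # ds) f = tau ds (N d f)" "tau (as @ bs) f = tau bs (tau as f)" by (auto simp: tau_def)

lemma tau_add: "(!!d. d \<in> set ds ==> der d) ==> tau ds (f + g) = tau ds f + tau ds g" by (induction ds arbitrary: f g) (auto simp: N_add)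

lemma tau_0: "(!!d. d \<in> set ds ==> der d) ==> tau ds 0 = 0" by (induction ds) (auto simp: N_0)

lemma tau_const: "(!!d. d \<in> set ds ==> der d & d c = 0) ==> tau ds (c * f) = c * tau ds f" by (induction ds arbitrary: f) (auto simp: N_const)

lemma N_commute:
 assumes "der d'" "!!f. d (d' f) = d' (d f)"
 shows "N d (d' f) = d' (N d f)"
proof -
 have "(d ^^ n) (d' f) = d' ((d ^^ n) f)" for n by (induction n) (auto simp: assms(2))
 thus ?thesis using der_divide_const[OF assms(1) der_of_nat[OF assms(1)]] by (simp add: N_def)
qed

lemma N_N_commute:
 assumes "der d" "der d'" "!!f. d (d' f) = d' (d f)"
 shows "N d (N d' f) = N d' (N d f)"
proof -
 have 1: "N d (d' f) = d' (N d f)" for f by (rule N_commute[OF assms(2)]) (rule assms(3))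
 have 2: "N d ((d' ^^ n) f) = (d' ^^ n) (N d f)" for n by (induction n) (auto simp: 1)
 have "N d (N d' f) = N d ((d' ^^ (p - 1)) f) / of_nat (fact (p - 1))"
  using der_pow_divide[OF assms(1) der_of_nat[OF assms(1)]] by (simp add: N_def divide_divide_eq_left)
 thus ?thesis unfolding 2 by (simp add: N_def[of d'])
qed

lemma tau_N_commute:
 assumes "der d" "!!d'. d' \<in> set ds ==> der d'" "!!d' f. d' \<in> set ds ==> d (d' f) = d' (d f)"
 shows "tau ds (N d f) = N d (tau ds f)" using assms(2,3)
proof (induction ds arbitrary: f)
 case (Cons e ds)
 have "N e (N d f) = N d (N e f)" by (rule N_N_commute[symmetric, OF assms(1)]) (use Cons.prems in auto)
 thus ?case using Cons by simp
qed simp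

lemma tau_der_commute:
 assumes "der d" "!!d' f. d' \<in> set ds ==> d' (d f) = d (d' f)"
 shows "d (tau ds f) = tau ds (d f)" using assms(2)
proof (induction ds arbitrary: f)
 case (Cons e ds)
 have "N e (d f) = d (N e f)" by (rule N_commute[OF assms(1)]) (use Cons.prems in auto)
 thus ?case using Cons by simp
qed simp

lemma tau_killed: "csys xs ds ==> d \<in> set ds ==> d (tau ds f) = 0"
proof (induction ds arbitrary: xs f)
 case (Cons e ds)
 then obtain x xs' where xs: "xs = x # xs'" by (cases xs) (auto simp: csys_def)
 note c = csys_Cons[OF Cons.prems(1)[unfolded xs]]
 show ?case
 proof (cases "d \<in> set ds")
  case True
  thus ?thesis using Cons.IH[OF c(1)] by simp
 next
  case False
  hence d: "d = e" using Cons.prems by simp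
  have "d (tau (e # ds) f) = tau ds (d (N e f))" using tau_der_commute[of d ds "N e f"] c(2,7) d by auto
  also have "d (N e f) = 0"
  proof -
   have "e ((e ^^ (p - 1)) f) = (e ^^ p) f" using p_gt1 by (cases p) auto
   thus ?thesis using der_divide_const[OF c(2) der_of_nat[OF c(2)]] c(3) d by (simp add: N_def)
  qed
  also have "tau ds 0 = 0" using c(1) by (intro tau_0) (auto simp: csys_def)
  finally show ?thesis .
 qed
qed simp

lemma sum_list_concat_map: "sum_list (map h (concat (map F l))) = sum_list (map (%x. sum_list (map h (F x))) l)" by (induction l) auto

text \<open>Every element is recovered from its traces: \<open>f\<close> is the sum of the \<open>\<tau>(gf)g'\<close> over a finite family
 of pairs \<open>(g, g')\<close> of monomials.\<close>

lemma tau_family: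
 assumes "csys xs ds" "1 \<in> B" "!!a b. a \<in> B ==> b \<in> B ==> a * b \<in> B" "set xs <= B"
 shows "\<exists>L. (\<forall>l\<in>set L. fst l \<in> B & snd l \<in> B & (\<forall>de. der de --> (\<forall>x\<in>set xs. de x = 0) --> de (fst l) = 0)) &
  (\<forall>f. f = (\<Sum>l\<leftarrow>L. tau ds (fst l * f) * snd l))" using assms(1,4)
proof (induction xs arbitrary: ds)
 case Nil
 hence "ds = []" by (simp add: csys_def)
 thus ?case using assms(2) by (intro exI[of _ "[(1, 1)]"]) (auto simp: der_1)
next
 case (Cons x xs)
 then obtain d ds' where ds: "ds = d # ds'" by (cases ds) (auto simp: csys_def)
 note c = csys_Cons[OF Cons.prems(1)[unfolded ds]]
 obtain L where L: "!!l. l \<in> set L ==> fst l \<in> B & snd l \<in> B & (\<forall>de. der de --> (\<forall>x\<in>set xs. de x = 0) --> de (fst l) = 0)"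
   "!!f. f = (\<Sum>l\<leftarrow>L. tau ds' (fst l * f) * snd l)"
 proof -
  have "set xs <= B" using Cons.prems(2) by simp
  from Cons.IH[OF c(1) this] obtain L where
   "\<forall>l\<in>set L. fst l \<in> B & snd l \<in> B & (\<forall>de. der de --> (\<forall>x\<in>set xs. de x = 0) --> de (fst l) = 0)"
   "\<forall>f. f = (\<Sum>l\<leftarrow>L. tau ds' (fst l * f) * snd l)" by (elim exE conjE)
  thus ?thesis by (intro that[of L]) (rule bspec, assumption+, rule spec)
 qed
 have xB: "x ^ n \<in> B" for n by (induction n) (use assms(2,3) Cons.prems(2) in auto)
 define L' where "L' = concat (map (%i. map (%l. (fst l * x ^ (p - 1 - i), snd l * x ^ i)) L) [0..<p])"
 show ?case
 proof (intro exI[of _ L'] conjI ballI allI)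
  fix l assume "l \<in> set L'"
  then obtain i k where l: "l = (fst k * x ^ (p - 1 - i), snd k * x ^ i)" "k \<in> set L" by (auto simp: L'_def)
  show "fst l \<in> B" "snd l \<in> B" using l L(1)[OF l(2)] xB assms(3) by auto
  show "der de --> (\<forall>x\<in>set (x # xs). de x = 0) --> de (fst l) = 0" for de using l(1) L(1)[OF l(2)] by (auto simp: der_mult der_power)
 next
  fix f
  have dk: "d (fst l) = 0" if "l \<in> set L" for l using L(1)[OF that] c(2,5) by blast
  have "f = (\<Sum>i<p. N d (x ^ (p - 1 - i) * f) * x ^ i)" by (rule expansion[OF c(2,4,3)])
  also have "\<dots> = (\<Sum>i<p. \<Sum>l\<leftarrow>L. tau ds (fst l * x ^ (p - 1 - i) * f) * (snd l * x ^ i))"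
  proof (rule sum.cong)
   fix i
   let ?u = "N d (x ^ (p - 1 - i) * f)"
   have "?u = (\<Sum>l\<leftarrow>L. tau ds' (fst l * ?u) * snd l)" by (rule L(2))
   also have "\<dots> = (\<Sum>l\<leftarrow>L. tau ds (fst l * x ^ (p - 1 - i) * f) * snd l)"
    using dk by (intro arg_cong[of _ _ sum_list] map_cong) (auto simp: ds N_const[OF c(2)] mult.assoc)
   finally have "?u * x ^ i = (\<Sum>l\<leftarrow>L. tau ds (fst l * x ^ (p - 1 - i) * f) * snd l) * x ^ i" by simp
   thus "?u * x ^ i = (\<Sum>l\<leftarrow>L. tau ds (fst l * x ^ (p - 1 - i) * f) * (snd l * x ^ i))"
    by (simp add: sum_list_mult_const[symmetric] mult.assoc)
  qed simp
  also have "\<dots> = (\<Sum>l\<leftarrow>L'. tau ds (fst l * f) * snd l)" unfolding L'_def sum_list_concat_map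
   by (simp add: interv_sum_list_conv_sum_set_nat atLeast0LessThan comp_def)
  finally show "f = (\<Sum>l\<leftarrow>L'. tau ds (fst l * f) * snd l)" .
 qed
qed

definition proot :: "'k => 'k" where "proot f = (THE c. c ^ p = f)"

lemma proot_pow: "proot (c ^ p) = c" unfolding proot_def by (rule the_equality) (auto simp: finj)

text \<open>The trace of the p-basis: the values of \<open>tau\<close> are p-th powers, and taking roots turns the \<open>e\<close>-th iterate into a map
 that is linear over the ring when it acts on its argument through the \<open>e\<close>-th Frobenius.\<close>

definition Tr :: "('k => 'k) list => 'k => 'k" where "Tr ds f = proot (tau ds f)"

context
 fixes xs ds assumes D: "dual xs ds"
begin

lemma Tr_pow: "Tr ds f ^ p = tau ds f"
proof -
 have "\<exists>c. tau ds f = c ^ p" by (rule dual_const[OF D]) (rule tau_killed[OF dual_csys[OF D]])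
 thus ?thesis by (auto simp: Tr_def proot_pow)
qed

lemma Tr_add: "Tr ds (f + g) = Tr ds f + Tr ds g" by (subst finj[symmetric]) (simp add: fadd Tr_pow tau_add dualD(3)[OF D])

lemma Tr_pmult: "Tr ds (a ^ p * f) = a * Tr ds f" by (subst finj[symmetric])
  (simp add: power_mult_distrib Tr_pow tau_const dualD(3)[OF D] der_pth)

lemma Tr_0: "Tr ds 0 = 0" using Tr_pmult[of 0 0] by (simp add: fzero)

lemma Te_add: "(Tr ds ^^ e) (f + g) = (Tr ds ^^ e) f + (Tr ds ^^ e) g" by (induction e) (auto simp: Tr_add)

lemma Te_0: "(Tr ds ^^ e) 0 = 0" by (induction e) (auto simp: Tr_0)

lemma Te_sum_list: "(Tr ds ^^ e) (sum_list (map h L)) = (\<Sum>l\<leftarrow>L. (Tr ds ^^ e) (h l))" by (induction L) (auto simp: Te_0 Te_add)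

lemma Te_qmult: "(Tr ds ^^ e) (a ^ (p ^ e) * f) = a * (Tr ds ^^ e) f"
proof (induction e arbitrary: f)
 case (Suc e)
 have "a ^ p ^ Suc e = (a ^ p ^ e) ^ p" by (simp add: power_mult[symmetric] mult.commute)
 hence "(Tr ds ^^ Suc e) (a ^ p ^ Suc e * f) = (Tr ds ^^ e) (a ^ p ^ e * Tr ds f)" unfolding funpow_Suc_right comp_def by (simp add: Tr_pmult)
 thus ?case using Suc by (simp add: funpow_swap1)
qed simp

lemma Te_family:
 assumes "1 \<in> B" "!!a b. a \<in> B ==> b \<in> B ==> a * b \<in> B" "set xs <= B"
 shows "\<exists>L. (\<forall>l\<in>set L. fst l \<in> B & snd l \<in> B) & (\<forall>f. f = (\<Sum>l\<leftarrow>L. (Tr ds ^^ e) (fst l * f) ^ (p ^ e) * snd l))"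
proof (induction e)
 case 0
 thus ?case using assms(1) by (intro exI[of _ "[(1, 1)]"]) auto
next
 case (Suc e)
 then obtain M where M: "!!l. l \<in> set M ==> fst l \<in> B & snd l \<in> B"
  "!!f. f = (\<Sum>l\<leftarrow>M. (Tr ds ^^ e) (fst l * f) ^ (p ^ e) * snd l)" by blast
 obtain L where L: "!!l. l \<in> set L ==> fst l \<in> B & snd l \<in> B" "!!f. f = (\<Sum>l\<leftarrow>L. tau ds (fst l * f) * snd l)"
  using tau_family[OF dual_csys[OF D] assms] by blast
 have Bp: "a ^ n \<in> B" if "a \<in> B" for a n by (induction n) (use assms(1,2) that in auto)
 define L' where "L' = concat (map (%l. map (%k. (fst k ^ p * fst l, snd k ^ p * snd l)) M) L)"
 show ?case
 proof (intro exI[of _ L'] conjI ballI allI)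
  fix l assume "l \<in> set L'"
  then obtain l' k where "l = (fst k ^ p * fst l', snd k ^ p * snd l')" "k \<in> set M" "l' \<in> set L" by (auto simp: L'_def)
  thus "fst l \<in> B" "snd l \<in> B" using L(1) M(1) Bp assms(2) by auto
 next
  fix f
  have lp: "(sum_list (map h l)) ^ p = (\<Sum>x\<leftarrow>l. h x ^ p)" for h :: "'k \<times> 'k => 'k" and l by (induction l) (auto simp: fadd fzero)
  have "tau ds (fst l * f) * snd l =
    (\<Sum>k\<leftarrow>M. (Tr ds ^^ Suc e) (fst k ^ p * fst l * f) ^ (p ^ Suc e) * (snd k ^ p * snd l))" for l :: "'k \<times> 'k"
  proof -
   have "tau ds (fst l * f) = (\<Sum>k\<leftarrow>M. (Tr ds ^^ e) (fst k * Tr ds (fst l * f)) ^ (p ^ e) * snd k) ^ p"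
    unfolding Tr_pow[symmetric] by (subst M(2)[of "Tr ds (fst l * f)"]) simp
   also have "\<dots> = (\<Sum>k\<leftarrow>M. (Tr ds ^^ Suc e) (fst k ^ p * fst l * f) ^ (p ^ Suc e) * snd k ^ p)" unfolding lp
    by (intro arg_cong[of _ _ sum_list] map_cong)
     (auto simp: power_mult_distrib power_mult[symmetric] mult.assoc Tr_pmult funpow_swap1 mult.commute[of _ p])
   finally show ?thesis by (simp add: sum_list_mult_const[symmetric] mult.assoc)
  qed
  hence "(\<Sum>l\<leftarrow>L. tau ds (fst l * f) * snd l) = (\<Sum>l\<leftarrow>L'. (Tr ds ^^ Suc e) (fst l * f) ^ (p ^ Suc e) * snd l)"
   unfolding L'_def sum_list_concat_map by (simp add: comp_def del: funpow.simps)
  thus "f = (\<Sum>l\<leftarrow>L'. (Tr ds ^^ Suc e) (fst l * f) ^ (p ^ Suc e) * snd l)" using L(2)[of f] by simp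
 qed
qed

text \<open>The trace generates all Frobenius linear maps, because elements are recovered from traces.\<close>

lemma Te_represent:
 assumes add: "!!f g. \<psi> (f + g) = \<psi> f + \<psi> g" and lin: "!!a f. \<psi> (a ^ (p ^ e) * f) = a * \<psi> f"
 shows "\<exists>h. \<forall>f. \<psi> f = (Tr ds ^^ e) (h * f)"
proof -
 obtain L where L: "!!f. f = (\<Sum>l\<leftarrow>L. (Tr ds ^^ e) (fst l * f) ^ (p ^ e) * snd l)" using Te_family[of UNIV e] by auto
 have "\<psi> 0 = 0" using add[of 0 0] by (metis add.right_neutral add_left_cancel)
 hence sl: "\<psi> (sum_list (map h l)) = (\<Sum>x\<leftarrow>l. \<psi> (h x))" for h :: "'k \<times> 'k => 'k" and l
  by (induction l) (auto simp: add)
 show ?thesis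
 proof (intro exI[of _ "\<Sum>l\<leftarrow>L. \<psi> (snd l) ^ (p ^ e) * fst l"] allI)
  fix f
  have "\<psi> f = (\<Sum>l\<leftarrow>L. (Tr ds ^^ e) (fst l * f) * \<psi> (snd l))" by (subst L[of f]) (simp add: sl lin)
  also have "\<dots> = (\<Sum>l\<leftarrow>L. (Tr ds ^^ e) (\<psi> (snd l) ^ (p ^ e) * (fst l * f)))" by (simp add: Te_qmult) (simp add: mult.commute)
  also have "\<dots> = (Tr ds ^^ e) ((\<Sum>l\<leftarrow>L. \<psi> (snd l) ^ (p ^ e) * fst l) * f)"
   by (simp add: Te_sum_list[symmetric] sum_list_mult_const[symmetric] mult.assoc)
  finally show "\<psi> f = (Tr ds ^^ e) ((\<Sum>l\<leftarrow>L. \<psi> (snd l) ^ (p ^ e) * fst l) * f)" .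
 qed
qed

end

section \<open>Changing the dual system\<close>

text \<open>For a valuation ring \<open>A\<close>, such a system is a basis of the differentials of \<open>A\<close> with its dual basis of derivations of \<open>A\<close>.\<close>

definition lbasis :: "'k set => 'k list => ('k => 'k) list => bool" where
 "lbasis A xs ds \<longleftrightarrow> dual xs ds & set xs <= A & (\<forall>d\<in>set ds. d ` A <= A)"

lemma lbasisD:
 assumes "lbasis A xs ds" "i < length xs"
 shows "a \<in> A ==> (ds ! i) a \<in> A" "xs ! i \<in> A"
proof -
 have "ds ! i \<in> set ds" "xs ! i \<in> set xs" using assms dualD(1)[of xs ds] by (auto simp: lbasis_def)
 thus "a \<in> A ==> (ds ! i) a \<in> A" "xs ! i \<in> A" using assms(1) by (auto simp: lbasis_def)
qed

lemma lbasis_UNIV: "lbasis UNIV xs ds \<longleftrightarrow> dual xs ds" by (simp add: lbasis_def)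

definition unit_in :: "'k set => 'k => bool" where
 "unit_in A a \<longleftrightarrow> a \<in> A & a ~= 0 & 1 / a \<in> A"

lemma unit_in_mult: "subdom A ==> unit_in A a ==> unit_in A b ==> unit_in A (a * b)"
 using subdomD(4)[of A "1 / a" "1 / b"] subdomD(4)[of A a b] by (auto simp: unit_in_def)

text \<open>Replacing \<open>x\<^sub>k\<close> by \<open>y\<close>, where \<open>\<partial>\<^sub>ky = g\<close> is a unit, multiplies the argument of the trace by \<open>g\<^sup>1\<^sup>-\<^sup>p\<close>.\<close>

lemma lbasis_replace:
 assumes A: "subdom A" and L: "lbasis A xs ds" and k: "k < length xs" and y: "y \<in> A" and g: "unit_in A ((ds ! k) y)"
 defines "g \<equiv> (ds ! k) y"
 defines "d' \<equiv> (%f. (ds ! k) f / g)"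
 defines "ds' \<equiv> (map (%d f. d f - d y * d' f) ds)[k := d']"
 shows "lbasis A (xs[k := y]) ds'" "tau ds' f = tau ds (f / g ^ (p - 1))"
  "j < length xs ==> j ~= k ==> (ds' ! j) f = (ds ! j) f - (ds ! j) y * ((ds ! k) f / g)"
proof -
 have D: "dual xs ds" using L by (simp add: lbasis_def)
 note Dd = dualD[OF D]
 let ?d = "ds ! k"
 let ?\<phi> = "%d f. d f - d y * d' f"
 have dk: "der ?d" using Dd(2) k by simp
 have g0: "g ~= 0" using g by (simp add: g_def unit_in_def)
 have d': "der d'" unfolding d'_def by (rule der_div[OF dk])
 have \<phi>: "der (?\<phi> d)" if "der d" for d by (rule der_sub[OF that der_scale[OF d']])
 have len: "length ds' = length xs" using Dd(1) by (simp add: ds'_def)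
 have nth: "ds' ! j = (if j = k then d' else ?\<phi> (ds ! j))" if "j < length xs" for j using that k Dd(1) by (simp add: ds'_def)
 show "(ds' ! j) f = (ds ! j) f - (ds ! j) y * ((ds ! k) f / g)" if "j < length xs" "j ~= k" using nth[OF that(1)] that(2) by (simp add: d'_def)
 have derds': "der (ds' ! j)" if "j < length xs" for j using nth[OF that] d' \<phi> Dd(2)[OF that] by auto
 have D': "dual (xs[k := y]) ds'" unfolding dual_def
 proof (intro conjI allI impI ballI)
  show "length ds' = length (xs[k := y])" using len by simp
  fix d assume "d \<in> set ds'"
  thus "der d" using derds' len by (auto simp: in_set_conv_nth)
 next
  fix i j assume ij: "i < length (xs[k := y])" "j < length (xs[k := y])"
  hence i: "i < length xs" "j < length xs" by auto
  have dkj: "?d (xs ! j) = (if k = j then 1 else 0)" by (rule Dd(4)[OF k i(2)])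
  show "(ds' ! i) (xs[k := y] ! j) = (if i = j then 1 else 0)" unfolding nth[OF i(1)] using i k dkj Dd(4)[OF i] g0
   by (auto simp: nth_list_update d'_def g_def)
 next
  fix de assume de: "der de" "\<forall>x\<in>set (xs[k := y]). de x = 0"
  have z: "de (xs ! j) = 0" if "j < length xs" "j ~= k" for j
  proof -
   have "xs[k := y] ! j \<in> set (xs[k := y])" using that by (intro nth_mem) simp
   thus ?thesis using de(2) that by simp
  qed
  have "de y = 0" using de(2) k by (simp add: set_update_memI)
  moreover have "de y = (\<Sum>i<length xs. if i = k then de (xs ! k) * g else 0)"
   unfolding dual_expand[OF D de(1), of y] by (intro sum.cong) (use z in "auto simp: g_def")
  ultimately have "de (xs ! k) = 0" using k g0 by simp
  hence "de (xs ! j) = 0" if "j < length xs" for j using z[OF that] by (cases "j = k") auto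
  thus "de = (%_. 0)" by (intro Dd(5)[OF de(1)]) (auto simp: in_set_conv_nth)
 qed
 show "lbasis A (xs[k := y]) ds'" unfolding lbasis_def
 proof (intro conjI ballI D')
  have "set (xs[k := y]) <= insert y (set xs)" by (rule set_update_subset_insert)
  thus "set (xs[k := y]) <= A" using L y by (auto simp: lbasis_def)
  fix d assume "d \<in> set ds'"
  then obtain j where j: "j < length xs" "d = ds' ! j" using len by (auto simp: in_set_conv_nth)
  have pres: "(ds ! i) a \<in> A" if "i < length xs" "a \<in> A" for i a using lbasisD(1)[OF L that] .
  have d'A: "d' a \<in> A" if "a \<in> A" for a using subdomD(4)[OF A pres[OF k that], of "1 / g"] g by (simp add: d'_def unit_in_def g_def)
  show "d ` A <= A"
  proof clarify
   fix a assume a: "a \<in> A"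
   show "d a \<in> A" unfolding j(2) nth[OF j(1)] using d'A[OF a] subdomD(3)[OF A pres[OF j(1) a] subdomD(4)[OF A pres[OF j(1) y] d'A[OF a]]] by simp
  qed
 qed
 define as where "as = take k ds"
 define bs where "bs = drop (Suc k) ds"
 have ds: "ds = as @ ?d # bs" unfolding as_def bs_def using k Dd(1) by (simp add: id_take_nth_drop)
 have ds'e: "ds' = map ?\<phi> as @ d' # map ?\<phi> bs"
  unfolding ds'_def as_def bs_def using k Dd(1) by (simp add: upd_conv_take_nth_drop take_map drop_map)
 have in_ds: "d \<in> set ds" if "d \<in> set as \<union> set bs" for d using that unfolding as_def bs_def by (auto dest: in_set_takeD in_set_dropD)
 have com: "?d (d f) = d (?d f)" if "d \<in> set ds" for d f
 proof -
  from that obtain j where "j < length xs" "d = ds ! j" using Dd(1) by (auto simp: in_set_conv_nth)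
  thus ?thesis using dual_commute[OF D k] by simp
 qed
 have kill: "tau (map ?\<phi> cs) c = tau cs c" if "set cs <= set ds" "?d c = 0" for cs c using that
 proof (induction cs arbitrary: c)
  case (Cons e cs)
  hence e: "e \<in> set ds" by simp
  hence de: "der e" by (rule Dd(3))
  have z: "?d ((e ^^ n) c) = 0" for n by (induction n) (use Cons.prems com[OF e] de in "auto simp: der_0")
  have "(?\<phi> e ^^ n) c = (e ^^ n) c" for n by (induction n) (use z in "auto simp: d'_def")
  hence "N (?\<phi> e) c = N e c" by (simp add: N_def)
  moreover have "?d (N e c) = 0" unfolding N_def using z der_divide_const[OF dk der_of_nat[OF dk]] by simp
  ultimately show ?case using Cons by simp
 qed simp
 have dN: "d' ^^ p = (%_. 0)" using dual_nilpotent[OF D', of k] nth[OF k] k by simp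
 have N1: "N d' f = N ?d (f / g ^ (p - 1))" unfolding g_def by (rule N_change[OF dk dual_nilpotent[OF D k] _ _ _ dN])
   (use Dd(4)[OF k k] g0 in "auto simp: d'_def g_def")
 have N2: "?d (N ?d h) = 0" for h
 proof -
  have "?d ((?d ^^ (p - 1)) h) = (?d ^^ p) h" using p_gt1 by (cases p) auto
  thus ?thesis using der_divide_const[OF dk der_of_nat[OF dk]] dual_nilpotent[OF D k] by (simp add: N_def)
 qed
 have swap: "tau (cs @ e # es) h = tau (cs @ es) (N e h)"
  if "!!d. d \<in> set cs ==> der d" "der e" "!!d f. d \<in> set cs ==> e (d f) = d (e f)" for cs e es h
  using tau_N_commute[OF that(2,1,3), of cs h] by simp
 have com': "d' (?\<phi> d f) = ?\<phi> d (d' f)" if d: "d \<in> set as" for d f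
 proof -
  from d obtain j where j: "j < k" "d = ds ! j" using k Dd(1) by (auto simp: as_def in_set_conv_nth)
  hence "(ds' ! j) = ?\<phi> d" "ds' ! k = d'" "j < length xs" using nth k by auto
  thus ?thesis using dual_commute[OF D', of k j f] k by simp
 qed
 have "tau ds' f = tau (map ?\<phi> as @ map ?\<phi> bs) (N d' f)" unfolding ds'e by (rule swap) (use \<phi> Dd(3) in_ds d' com' in auto)
 also have "\<dots> = tau (map ?\<phi> (as @ bs)) (N ?d (f / g ^ (p - 1)))" using N1 by simp
 also have "\<dots> = tau (as @ bs) (N ?d (f / g ^ (p - 1)))" by (rule kill) (use in_ds N2 in auto)
 also have "\<dots> = tau ds (f / g ^ (p - 1))" by (subst (2) ds, rule swap[symmetric]) (use dk Dd(3) in_ds com in auto)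
 finally show "tau ds' f = tau ds (f / g ^ (p - 1))" .
qed

lemma dwedge_self: "dual xs ds ==> dwedge xs ds = 1"
proof -
 assume D: "dual xs ds"
 have "mat (length xs) (length xs) (%(i, j). (ds ! i) (xs ! j)) = 1\<^sub>m (length xs)" by (rule eq_matI) (use dualD(4)[OF D] in auto)
 thus ?thesis by (simp add: dwedge_def)
qed

lemma dwedge_replace:
 assumes D: "dual xs ds" and k: "k < length xs"
 shows "dwedge (xs[k := y]) ds = (ds ! k) y"
proof -
 let ?n = "length xs"
 let ?x = "vec ?n (%i. (ds ! i) y)"
 have "mat ?n ?n (%(i, j). (ds ! i) (xs[k := y] ! j)) = replace_col (1\<^sub>m ?n) (1\<^sub>m ?n *\<^sub>v ?x) k"
  by (rule eq_matI) (use dualD(4)[OF D] k in "auto simp: replace_col_def nth_list_update")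
 hence "dwedge (xs[k := y]) ds = det (replace_col (1\<^sub>m ?n) (1\<^sub>m ?n *\<^sub>v ?x) k)" by (simp add: dwedge_def)
 also have "\<dots> = ?x $ k * det (1\<^sub>m ?n)" by (rule cramer_lemma_mat) (use k in auto)
 finally show ?thesis using k by simp
qed

lemma dwedge_chain:
 assumes D: "dual ys es" and l: "length zs = length ys" "length ds = length ys" and d: "!!d. d \<in> set ds ==> der d"
 shows "dwedge zs ds = dwedge ys ds * dwedge zs es"
proof -
 let ?n = "length ys"
 have "mat ?n ?n (%(i, j). (ds ! i) (zs ! j)) =
   mat ?n ?n (%(i, j). (ds ! i) (ys ! j)) * mat ?n ?n (%(i, j). (es ! i) (zs ! j))"
 proof (rule eq_matI)
  fix i j assume "i < dim_row (mat ?n ?n (%(i, j). (ds ! i) (ys ! j)) * mat ?n ?n (%(i, j). (es ! i) (zs ! j)))"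
   "j < dim_col (mat ?n ?n (%(i, j). (ds ! i) (ys ! j)) * mat ?n ?n (%(i, j). (es ! i) (zs ! j)))"
  hence ij: "i < ?n" "j < ?n" by auto
  have "der (ds ! i)" using d ij l by simp
  thus "mat ?n ?n (%(i, j). (ds ! i) (zs ! j)) $$ (i, j) =
    (mat ?n ?n (%(i, j). (ds ! i) (ys ! j)) * mat ?n ?n (%(i, j). (es ! i) (zs ! j))) $$ (i, j)"
   using ij dual_expand[OF D, of "ds ! i" "zs ! j"] by (simp add: scalar_prod_def atLeast0LessThan)
 qed auto
 thus ?thesis using l by (simp add: dwedge_def det_mult[of _ ?n])
qed

text \<open>The systems obtained from \<open>xs\<close> by replacements that are invertible over \<open>A\<close>; their Jacobian is a unit, and the trace
 changes by its power with exponent \<open>1-p\<close>.\<close>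

definition reach :: "'k set => 'k list => ('k => 'k) list => 'k list => ('k => 'k) list => bool" where
 "reach A xs ds xs' ds' \<longleftrightarrow> lbasis A xs' ds' & length xs' = length xs & unit_in A (dwedge xs' ds) &
  (\<forall>f. tau ds' f = tau ds (f / dwedge xs' ds ^ (p - 1)))"

lemma reach_step:
 assumes A: "subdom A" and D: "dual xs ds" and r: "reach A xs ds xs' ds'" and k: "k < length xs" and y: "y \<in> A"
  and g: "unit_in A ((ds' ! k) y)"
 shows "\<exists>ds''. reach A xs ds (xs'[k := y]) ds'' & (\<forall>j<length xs. j ~= k -->
  (\<forall>f. (ds'' ! j) f = (ds' ! j) f - (ds' ! j) y * ((ds' ! k) f / (ds' ! k) y)))"
proof -
 have L: "lbasis A xs' ds'" "length xs' = length xs" using r by (auto simp: reach_def)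
 hence D': "dual xs' ds'" by (simp add: lbasis_def)
 have k': "k < length xs'" using k L by simp
 note R = lbasis_replace[OF A L(1) k' y g]
 define ds'' where "ds'' = (map (%d f. d f - d y * ((ds' ! k) f / (ds' ! k) y)) ds')[k := %f. (ds' ! k) f / (ds' ! k) y]"
 have w: "dwedge (xs'[k := y]) ds = dwedge xs' ds * (ds' ! k) y"
  using dwedge_chain[OF D', of "xs'[k := y]" ds] dwedge_replace[OF D' k', of y] L(2) dualD(1,3)[OF D] by simp
 have "reach A xs ds (xs'[k := y]) ds''" unfolding reach_def
 proof (intro conjI allI)
  show "lbasis A (xs'[k := y]) ds''" unfolding ds''_def by (rule R(1))
  show "unit_in A (dwedge (xs'[k := y]) ds)" unfolding w by (rule unit_in_mult[OF A _ g]) (use r in "simp add: reach_def")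
  show "tau ds'' f = tau ds (f / dwedge (xs'[k := y]) ds ^ (p - 1))" for f
   using R(2)[of f] r unfolding w by (simp add: reach_def ds''_def power_mult_distrib divide_divide_eq_left mult.commute)
 qed (use L in simp)
 thus ?thesis using R(3) L(2) by (intro exI[of _ ds'']) (auto simp: ds''_def)
qed

text \<open>Exchange: the entries of a dual system can be replaced by those of a second one, one at a time. If the
 derivation in the required position is not a unit on the new entry \<open>y\<close>, but the one in a later position \<open>j\<close> is,
 then \<open>x\<^sub>j\<close> is first replaced by \<open>x\<^sub>j + x\<^sub>k\<close>, which subtracts \<open>\<partial>\<^sub>j\<close> from \<open>\<partial>\<^sub>k\<close>.\<close>

lemma exchange:
 assumes A: "subdom A" and loc: "!!a b. unit_in A a ==> b \<in> A ==> ~ unit_in A b ==> unit_in A (b - a)"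
  and L: "lbasis A xs ds" and ys: "set ys <= A" and start: "take k0 xs = take k0 ys"
  and cond: "!!xs' ds' k. lbasis A xs' ds' ==> length xs' = length xs ==> k0 <= k ==> k < length ys ==>
   k < length xs ==> take k xs' = take k ys ==> \<exists>j. k <= j & j < length xs & unit_in A ((ds' ! j) (ys ! k))"
  and k: "k0 <= k"
 shows "k <= length ys ==> k <= length xs ==> \<exists>xs' ds'. reach A xs ds xs' ds' & take k xs' = take k ys" using k
proof (induction k rule: dec_induct)
 case base
 have D: "dual xs ds" using L by (simp add: lbasis_def)
 have "reach A xs ds xs ds" using L dwedge_self[OF D] subdomD(1)[OF A] by (simp add: reach_def unit_in_def)
 thus ?case using start by blast
next
 case (step k)
 have D: "dual xs ds" using L by (simp add: lbasis_def)
 obtain xs' ds' where r: "reach A xs ds xs' ds'" "take k xs' = take k ys" using step by auto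
 have L': "lbasis A xs' ds'" "length xs' = length xs" using r by (auto simp: reach_def)
 hence D': "dual xs' ds'" by (simp add: lbasis_def)
 let ?y = "ys ! k"
 have k: "k < length xs" "k < length ys" using step by auto
 have yA: "?y \<in> A" using ys k by auto
 have fin: "\<exists>xs' ds'. reach A xs ds xs' ds' & take (Suc k) xs' = take (Suc k) ys"
  if r: "reach A xs ds xs' ds'" "take k xs' = take k ys" "unit_in A ((ds' ! k) ?y)" for xs' ds'
 proof -
  obtain ds'' where "reach A xs ds (xs'[k := ?y]) ds''" using reach_step[OF A D r(1) k(1) yA r(3)] by blast
  moreover have "take (Suc k) (xs'[k := ?y]) = take (Suc k) ys" using r(1,2) k by (simp add: reach_def take_Suc_conv_app_nth)
  ultimately show ?thesis by blast
 qed
 show ?case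
 proof (cases "unit_in A ((ds' ! k) ?y)")
  case True
  thus ?thesis using fin r by blast
 next
  case False
  obtain j where j: "k <= j" "j < length xs" "unit_in A ((ds' ! j) ?y)" using cond[OF L' _ k(2,1) r(2)] step by auto
  have jk: "k < j" using j False by (cases "j = k") auto
  let ?w = "xs' ! j + xs' ! k"
  have w: "(ds' ! j) ?w = 1" "(ds' ! k) ?w = 1"
   using dualD(4)[OF D', of j] dualD(4)[OF D', of k] dualD(2)[OF D', of j] dualD(2)[OF D', of k] j k jk L'(2) by (auto simp: der_add)
  have "?w \<in> A" using lbasisD(2)[OF L'(1)] L'(2) j k subdomD(6)[OF A] by simp
  moreover have "unit_in A ((ds' ! j) ?w)" using w subdomD(1)[OF A] by (simp add: unit_in_def)
  ultimately obtain ds2 where ds2: "reach A xs ds (xs'[j := ?w]) ds2"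
   "(ds2 ! k) ?y = (ds' ! k) ?y - (ds' ! k) ?w * ((ds' ! j) ?y / (ds' ! j) ?w)" using reach_step[OF A D r(1) j(2)] k(1) jk by blast
  have "(ds' ! k) ?y \<in> A" using lbasisD(1)[OF L'(1), of k] L'(2) k yA by simp
  hence "unit_in A ((ds2 ! k) ?y)" using loc[OF j(3) _ False] ds2(2) w by simp
  moreover have "take k (xs'[j := ?w]) = take k ys" using r(2) jk by simp
  ultimately show ?thesis using fin ds2(1) by blast
 qed
qed

lemma unit_in_UNIV: "unit_in UNIV a \<longleftrightarrow> a ~= 0" by (simp add: unit_in_def)

lemma dual_unique:
 assumes "dual xs ds" "dual xs es"
 shows "ds = es"
proof (rule nth_equalityI)
 show "length ds = length es" using dualD(1)[OF assms(1)] dualD(1)[OF assms(2)] by simp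
 fix i assume "i < length ds"
 hence i: "i < length xs" using dualD(1)[OF assms(1)] by simp
 show "ds ! i = es ! i" by (rule dual_eqI[OF assms(1) dualD(2)[OF assms(1) i] dualD(2)[OF assms(2) i]])
   (auto simp: in_set_conv_nth dualD(4)[OF assms(1) i] dualD(4)[OF assms(2) i])
qed

text \<open>The Cartier operator is intrinsic on top forms, so a change of p-basis multiplies the argument of the trace by the
 power of the Jacobian with exponent \<open>1-p\<close>. It is proved by exchanging one element at a time.\<close>

theorem dual_change:
 assumes D: "dual xs ds" and E: "dual ys es"
 shows "length xs = length ys" "dwedge ys ds ~= 0" "tau es f = tau ds (f / dwedge ys ds ^ (p - 1))"
proof -
 have S: "subdom (UNIV :: 'k set)" by (simp add: subdom_def)
 have ex: "\<exists>xs' ds'. reach UNIV xs ds xs' ds' & take k xs' = take k ys" if "k <= length ys" "k <= length xs" for k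
 proof (rule exchange[OF S, of xs ds ys 0])
  fix xs' ds' k assume a: "lbasis UNIV xs' ds'" "length xs' = length xs" "k < length ys" "k < length xs" "take k xs' = take k ys"
  hence D': "dual xs' ds'" by (simp add: lbasis_UNIV)
  have z: "(es ! k) (xs' ! j) = 0" if "j < k" for j
  proof -
   have "xs' ! j = ys ! j" using arg_cong[OF a(5), of "%l. l ! j"] that by simp
   thus ?thesis using dualD(4)[OF E a(3), of j] that a(3) by simp
  qed
  show "\<exists>j. k <= j & j < length xs & unit_in UNIV ((ds' ! j) (ys ! k))"
  proof (rule ccontr)
   assume n: "~ ?thesis"
   have "(es ! k) (xs' ! j) * (ds' ! j) (ys ! k) = 0" if "j < length xs'" for j using n z[of j] that a(2) by (cases "j < k") (auto simp: unit_in_UNIV)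
   hence "(es ! k) (ys ! k) = 0" unfolding dual_expand[OF D' dualD(2)[OF E a(3)], of "ys ! k"] by (intro sum.neutral) simp
   thus False using dualD(4)[OF E a(3,3)] by simp
  qed
 qed (use D that in "auto simp: lbasis_UNIV unit_in_UNIV")
 show len: "length xs = length ys"
 proof (rule ccontr)
  assume "length xs ~= length ys"
  then consider "length ys < length xs" | "length xs < length ys" by linarith
  thus False
  proof cases
   case 1
   then obtain xs' ds' where r: "reach UNIV xs ds xs' ds'" "take (length ys) xs' = ys" using ex[of "length ys"] by auto
   hence D': "dual xs' ds'" "length xs' = length xs" by (auto simp: reach_def lbasis_UNIV)
   have "(ds' ! length ys) = (%_. 0)"
   proof (rule dualD(5)[OF E dualD(2)[OF D'(1)]])
    fix y assume "y \<in> set ys"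
    then obtain j where j: "j < length ys" "y = ys ! j" by (auto simp: in_set_conv_nth)
    hence "y = xs' ! j" using arg_cong[OF r(2), of "%l. l ! j"] by simp
    thus "(ds' ! length ys) y = 0" using dualD(4)[OF D'(1), of "length ys" j] 1 j D'(2) by simp
   qed (use 1 D' in simp)
   thus False using dualD(4)[OF D'(1), of "length ys" "length ys"] 1 D'(2) by simp
  next
   case 2
   then obtain xs' ds' where r: "reach UNIV xs ds xs' ds'" "take (length xs) xs' = take (length xs) ys" using ex[of "length xs"] by auto
   hence D': "dual xs' ds'" "length xs' = length xs" by (auto simp: reach_def lbasis_UNIV)
   have "(es ! length xs) = (%_. 0)"
   proof (rule dualD(5)[OF D'(1) dualD(2)[OF E 2]])
    fix y assume "y \<in> set xs'"
    then obtain j where j: "j < length xs" "y = xs' ! j" using D'(2) by (auto simp: in_set_conv_nth)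
    hence "y = ys ! j" using arg_cong[OF r(2), of "%l. l ! j"] D'(2) by simp
    thus "(es ! length xs) y = 0" using dualD(4)[OF E 2, of j] 2 j by simp
   qed
   thus False using dualD(4)[OF E 2 2] by simp
  qed
 qed
 obtain xs' ds' where r: "reach UNIV xs ds xs' ds'" "take (length ys) xs' = take (length ys) ys" using ex[of "length ys"] len by auto
 hence "xs' = ys" using len by (simp add: reach_def)
 hence "ds' = es" using r dual_unique[OF _ E] by (simp add: reach_def lbasis_UNIV)
 thus "dwedge ys ds ~= 0" "tau es f = tau ds (f / dwedge ys ds ^ (p - 1))" using r \<open>xs' = ys\<close> by (auto simp: reach_def unit_in_UNIV)
qed

text \<open>A valuation ring that is finite over its p-th powers has a dual system of derivations preserving it:
 a derivation killing a partial system is scaled so that its least value on the generators becomes 1.\<close>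

lemma divides_all:
 assumes V: "!!x. x \<in> A | 1 / x \<in> A" "subdom A" and "finite S"
 shows "(\<exists>s\<in>S. s ~= 0) ==> \<exists>s\<in>S. s ~= 0 & (\<forall>x\<in>S. x / s \<in> A)" using assms(3)
proof (induction S rule: finite_induct)
 case (insert a S)
 show ?case
 proof (cases "\<exists>s\<in>S. s ~= 0")
  case True
  then obtain s where s: "s \<in> S" "s ~= 0" "\<forall>x\<in>S. x / s \<in> A" using insert by blast
  show ?thesis
  proof (cases "a / s \<in> A")
   case True
   thus ?thesis using s by blast
  next
   case False
   hence a: "s / a \<in> A" "a ~= 0" using V(1)[of "a / s"] subdomD(2)[OF V(2)] by auto
   have "x / a \<in> A" if "x \<in> S" for x using subdomD(4)[OF V(2), of "x / s" "s / a"] s(2,3) a that by simp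
   thus ?thesis using a subdomD(1)[OF V(2)] by auto
  qed
 next
  case False
  thus ?thesis using insert.prems subdomD(1,2)[OF V(2)] by auto
 qed
qed simp

lemma lbasis_exists:
 assumes V: "!!x. x \<in> A | 1 / x \<in> A" and A: "subdom A"
  and G: "finite G" "G <= A" "!!x. x \<in> A ==> \<exists>c. (\<forall>g\<in>G. c g \<in> A) & x = (\<Sum>g\<in>G. c g ^ p * g)"
 shows "\<exists>xs ds. lbasis A xs ds"
proof -
 let ?E = "%n. \<exists>xs ds. length xs = n & length ds = n & set xs <= G & (\<forall>d\<in>set ds. d \<in> derivations A) &
  (\<forall>i<n. \<forall>j<n. (ds ! i) (xs ! j) = (if i = j then 1 else 0))"
 have bound: "n <= card G" if "?E n" for n
 proof -
  from that obtain xs ds where x: "length xs = n" "set xs <= G" "\<forall>i<n. \<forall>j<n. (ds ! i) (xs ! j) = (if i = j then (1::'k) else 0)"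
   by blast
  have "distinct xs" unfolding distinct_conv_nth
  proof (intro allI impI notI)
   fix i j assume ij: "i < length xs" "j < length xs" "i ~= j" "xs ! i = xs ! j"
   hence "(ds ! i) (xs ! i) = 1" "(ds ! i) (xs ! j) = 0" using x(1) x(3)[rule_format, of i i] x(3)[rule_format, of i j] by simp_all
   thus False using ij by simp
  qed
  thus ?thesis using card_mono[OF G(1) x(2)] x(1) by (simp add: distinct_card)
 qed
 have "?E 0" by simp
 hence "?E (Greatest ?E)" by (rule GreatestI_nat) (rule bound)
 define n where "n = Greatest ?E"
 obtain xs ds where x: "length xs = n" "length ds = n" "set xs <= G" "\<forall>d\<in>set ds. d \<in> derivations A"
  "\<forall>i<n. \<forall>j<n. (ds ! i) (xs ! j) = (if i = j then 1 else 0)" using \<open>?E (Greatest ?E)\<close> unfolding n_def by blast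
 have nmax: "~ ?E (Suc n)"
 proof
  assume "?E (Suc n)"
  hence "Suc n <= Greatest ?E" by (rule Greatest_le_nat) (rule bound)
  thus False by (simp add: n_def)
 qed
 have "dual xs ds" unfolding dual_def
 proof (intro conjI allI impI)
  fix de assume de: "der de" "\<forall>x\<in>set xs. de x = 0"
  show "de = (%_. 0)"
  proof (rule ccontr)
   assume ne: "de ~= (%_. 0)"
   have val: "de a = (\<Sum>g\<in>G. c g ^ p * de g)" if "a = (\<Sum>g\<in>G. c g ^ p * g)" for a c
    unfolding that using de(1) by (simp add: der_sum der_const_mult der_pth)
   have "\<exists>s\<in>de ` G. s ~= 0"
   proof (rule ccontr)
    assume "~ ?thesis"
    hence z: "de a = 0" if "a \<in> A" for a using G(3)[OF that] val by (auto intro!: sum.neutral)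
    have "de f = 0" for f
    proof (cases "f \<in> A")
     case False
     hence "1 / f \<in> A" using V by blast
     hence "de (1 / (1 / f)) = 0" by (intro der_inverse[OF de(1)] z)
     thus ?thesis by simp
    qed (rule z)
    thus False using ne by blast
   qed
   then obtain g0 where g0: "g0 \<in> G" "de g0 ~= 0" "\<forall>x\<in>de ` G. x / de g0 \<in> A" using divides_all[OF V A, of "de ` G"] G(1) by blast
   define de' where "de' = (%f. de f / de g0)"
   have d': "der de'" unfolding de'_def by (rule der_div[OF de(1)])
   have d'A: "de' a \<in> A" if a: "a \<in> A" for a
   proof -
    obtain c where c: "\<forall>g\<in>G. c g \<in> A" "a = (\<Sum>g\<in>G. c g ^ p * g)" using G(3)[OF a] by blast
    have "de' a = (\<Sum>g\<in>G. c g ^ p * (de g / de g0))" unfolding de'_def val[OF c(2)] by (simp add: sum_divide_distrib)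
    also have "\<dots> \<in> A" by (rule subdom_sum[OF A], rule subdomD(4)[OF A]) (use c(1) g0(3) subdomD(7)[OF A] in auto)
    finally show ?thesis .
   qed
   have g0A: "g0 \<in> A" using g0 G(2) by blast
   define xs' where "xs' = xs @ [g0]"
   define ds' where "ds' = map (%d f. d f - d g0 * de' f) ds @ [de']"
   have "?E (Suc n)"
   proof (rule exI[of _ xs'], rule exI[of _ ds'], intro conjI)
    show "length xs' = Suc n" "length ds' = Suc n" "set xs' <= G" using x g0 by (auto simp: xs'_def ds'_def)
    show "\<forall>d\<in>set ds'. d \<in> derivations A"
    proof
     fix e assume "e \<in> set ds'"
     then consider "e = de'" | d where "d \<in> set ds" "e = (%f. d f - d g0 * de' f)" by (auto simp: ds'_def)
     thus "e \<in> derivations A"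
     proof cases
      case 1
      thus ?thesis using d' d'A by (auto simp: derivations_iff[of _ A])
     next
      case 2
      hence d: "der d" "!!a. a \<in> A ==> d a \<in> A" using x(4) derivations_iff[of d A] by auto
      show ?thesis unfolding 2(2) derivations_iff[of _ A] using der_sub[OF d(1) der_scale[OF d']] d(2) d'A g0A subdomD[OF A] by auto
     qed
    qed
    have d'x: "de' (xs ! j) = 0" if "j < n" for j using de(2) x(1) that by (simp add: de'_def)
    have d'g: "de' g0 = 1" using g0(2) by (simp add: de'_def)
    show "\<forall>i<Suc n. \<forall>j<Suc n. (ds' ! i) (xs' ! j) = (if i = j then 1 else 0)"
    proof (intro allI impI)
     fix i j assume "i < Suc n" "j < Suc n"
     then consider "i < n" "j < n" | "i < n" "j = n" | "i = n" "j < n" | "i = n" "j = n" by linarith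
     thus "(ds' ! i) (xs' ! j) = (if i = j then 1 else 0)" by cases (use x d'x d'g in "auto simp: ds'_def xs'_def nth_append")
    qed
   qed
   thus False using nmax by blast
  qed
 qed (use x derivations_iff[of _ A] in auto)
 hence "lbasis A xs ds" using x G(2) derivations_iff[of _ A] by (auto simp: lbasis_def)
 thus ?thesis by blast
qed

end

section \<open>Maps of Frobenius modules as twisted traces\<close>

lemma det_in_subdom:
 fixes A :: "'k::field set"
 assumes A: "subdom A" and M: "!!i j. i < n ==> j < n ==> f i j \<in> A"
 shows "det (mat n n (%(i, j). f i j)) \<in> A"
proof -
 have prodA: "prod g I \<in> A" if "!!i. i \<in> I ==> g i \<in> A" for g :: "nat => 'k" and I
  using that by (induction I rule: infinite_finite_induct) (auto simp: subdomD[OF A])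
 have "det (mat n n (%(i, j). f i j)) = (\<Sum>q\<in>{q. q permutes {0..<n}}. signof q * (\<Prod>i=0..<n. f i (q i)))"
  unfolding det_def by (auto intro!: sum.cong prod.cong simp: permutes_in_image)
 also have "\<dots> \<in> A"
 proof (rule subdom_sum[OF A])
  fix q assume "q \<in> {q. q permutes {0..<n}}"
  hence "f i (q i) \<in> A" if "i \<in> {0..<n}" for i using M that permutes_in_image[of q "{0..<n}" i] by auto
  hence 1: "(\<Prod>i=0..<n. f i (q i)) \<in> A" by (rule prodA)
  have "(signof q :: 'k) \<in> {1, - 1}" by (simp add: sign_def)
  hence 2: "(signof q :: 'k) \<in> A" using subdomD(1)[OF A] subdomD(5)[OF A subdomD(1)[OF A]] by auto
  show "signof q * (\<Prod>i=0..<n. f i (q i)) \<in> A" by (rule subdomD(4)[OF A 2 1])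
 qed
 finally show ?thesis .
qed

context fring
begin

lemma max_ideal_eq: "max_ideal R = m" unfolding max_ideal_def
proof (rule the_equality)
 show "maximalideal m (ring_of R)" unfolding maximalideal_ring_of[OF R]
 proof (intro conjI allI impI m)
  fix J assume J: "smod R J & J <= R & m <= J"
  show "J = m | J = R"
  proof (cases "1 \<in> J")
   case True thus ?thesis using one_in_imp J by blast
  next
   case False thus ?thesis using proper_le_m J by blast
  qed
 qed
 fix M assume "maximalideal M (ring_of R)"
 hence M: "smod R M" "M < R" "!!J. smod R J ==> J <= R ==> M <= J ==> J = M | J = R" unfolding maximalideal_ring_of[OF R] by auto
 have "1 ~: M" using one_in_imp[of M] M by blast
 hence "M <= m" using proper_le_m M by blast
 thus "M = m" using M(3)[of m] m by blast
qed

lemma UNIV_loc: "ext R {0} R = UNIV"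
proof -
 have "x \<in> ext R {0} R" for x
 proof -
  obtain a b where "a \<in> R" "b \<in> R" "b ~= 0" "x = a / b" using frac by blast
  thus ?thesis by (auto intro: extI)
 qed
 thus ?thesis by blast
qed

lemma dual_exists: "\<exists>xs ds. dual xs ds"
proof -
 interpret K: fring p "ext R {0} R" "ext R {0} {0}" by (rule fring_loc[OF zero_prime[OF R]])
 obtain G :: "'k set" where G: "finite G & G <= UNIV & (\<forall>x\<in>UNIV. \<exists>c. (\<forall>g\<in>G. c g \<in> UNIV) & x = (\<Sum>g\<in>G. c g ^ p * g))"
  using K.ffin unfolding UNIV_loc by (elim exE)
 have "\<exists>xs ds. lbasis UNIV xs ds"
 proof (rule lbasis_exists[of UNIV G])
  show "\<exists>c. (\<forall>g\<in>G. c g \<in> UNIV) & x = (\<Sum>g\<in>G. c g ^ p * g)" for x using G by blast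
 qed (use G in "auto simp: subdom_def")
 thus ?thesis by (simp add: lbasis_UNIV)
qed

end

context pchar
begin

lemma inverse_of_nat_mem: "subdom A ==> 1 / of_nat n \<in> (A :: 'k set)"
proof (cases "of_nat n = (0::'k)")
 case False
 assume A: "subdom A"
 have nA: "of_nat k \<in> A" for k by (induction k) (auto simp: subdomD[OF A])
 obtain r where r: "p = Suc (Suc r)" using p_gt1 by (metis Suc_diff_Suc numeral_2_eq_2 Suc_le_D le_Suc_ex add_Suc)
 have "(of_nat n :: 'k) * of_nat n ^ r * of_nat n = 1 * of_nat n" using of_nat_fermat[of n] unfolding r by (simp add: ac_simps)
 hence "(of_nat n :: 'k) * of_nat n ^ r = 1" using False by (metis mult_right_cancel)
 hence "1 / (of_nat n :: 'k) = of_nat n ^ r" using False by (simp add: field_simps)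
 thus ?thesis using subdomD(7)[OF A nA] by simp
qed (simp add: subdomD)

lemma tau_preserves:
 assumes A: "subdom A" and "!!d a. d \<in> set ds ==> a \<in> A ==> d a \<in> A"
 shows "f \<in> A ==> tau ds f \<in> A" using assms(2)
proof (induction ds arbitrary: f)
 case (Cons d ds)
 have "(d ^^ n) f \<in> A" for n by (induction n) (use Cons.prems in auto)
 hence "N d f \<in> A" using subdomD(4)[OF A _ inverse_of_nat_mem[OF A, of "fact (p - 1)"], of "(d ^^ (p - 1)) f"] by (simp add: N_def)
 thus ?case using Cons by simp
qed simp

lemma Tr_change:
 assumes D: "dual xs ds" and E: "dual ys es"
 shows "(Tr es ^^ e) f = (Tr ds ^^ e) (f / dwedge ys ds ^ (p ^ e - 1))"
proof (induction e arbitrary: f)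
 case (Suc e)
 let ?J = "dwedge ys ds"
 have J0: "?J ~= 0" by (rule dual_change(2)[OF D E])
 have T1: "Tr es f = Tr ds (f / ?J ^ (p - 1))" using dual_change(3)[OF D E, of f] by (simp add: Tr_def)
 have "(Tr es ^^ Suc e) f = (Tr ds ^^ e) (Tr ds (f / ?J ^ (p - 1)) / ?J ^ (p ^ e - 1))" unfolding funpow_Suc_right comp_def T1 by (rule Suc)
 also have "Tr ds (f / ?J ^ (p - 1)) / ?J ^ (p ^ e - 1) = Tr ds (f / ?J ^ (p ^ Suc e - 1))"
 proof -
  have "p ^ Suc e - 1 = p * (p ^ e - 1) + (p - 1)"
  proof -
   have "p ^ e >= 1" using p_gt1 by simp
   then obtain r where "p ^ e = Suc r" by (cases "p ^ e") auto
   thus ?thesis using p_gt1 by (cases p) (auto simp: algebra_simps)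
  qed
  hence "f / ?J ^ (p ^ Suc e - 1) = (1 / ?J ^ (p ^ e - 1)) ^ p * (f / ?J ^ (p - 1))"
   by (simp add: power_add power_mult[symmetric] power_divide mult.commute)
  thus ?thesis using Tr_pmult[OF D, of "1 / ?J ^ (p ^ e - 1)" "f / ?J ^ (p - 1)"] by (simp only: times_divide_eq_left mult_1_left)
 qed
 finally show ?case by (simp add: funpow_swap1)
qed simp

end

context nring
begin

lemma loc_subdom: "ht1 Q ==> subdom (loc Q)" by (rule subdom_ext[OF R ht1_prime])

lemma loc_valuation: "ht1 Q ==> x \<in> loc Q | 1 / x \<in> loc Q" by (cases "x = 0") (auto simp: mem_loc_iff ord_inverse subdomD[OF loc_subdom])

lemma loc_basis_exists: "ht1 Q ==> \<exists>xs ds. lbasis (loc Q) xs ds"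
proof -
 assume Q: "ht1 Q"
 interpret A: fring p "loc Q" "locm Q" by (rule fring_loc[OF ht1_prime[OF Q]])
 obtain G where "finite G" "G <= loc Q" "\<forall>x\<in>loc Q. \<exists>c. (\<forall>g\<in>G. c g \<in> loc Q) & x = (\<Sum>g\<in>G. c g ^ p * g)"
  using A.ffin by blast
 thus ?thesis by (intro lbasis_exists[of "loc Q" G] loc_valuation[OF Q] loc_subdom[OF Q]) auto
qed

text \<open>The values of the form on arbitrary derivations of the valuation ring are multiples of its value on a dual basis, so
 the infimum is attained there.\<close>

lemma ord_dwedge_eq:
 assumes Q: "ht1 Q" and L: "lbasis (loc Q) xs ds" and E: "dual ys es"
 shows "ord_dwedge R Q ys = ord_at R Q (dwedge ys ds)"
proof -
 have D: "dual xs ds" using L by (simp add: lbasis_def)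
 note J0 = dual_change(2)[OF D E] and len = dual_change(1)[OF D E]
 show ?thesis unfolding ord_dwedge_def localization_ext
 proof (rule cInf_eq_minimum)
  have "set ds <= derivations (loc Q)" using L dualD(3)[OF D] by (auto simp: lbasis_def derivations_iff[of _ "loc Q"])
  thus "ord_at R Q (dwedge ys ds) \<in> {ord_at R Q (dwedge ys des) |des. length des = length ys &
    set des <= derivations (loc Q) & dwedge ys des ~= 0}" using J0 len dualD(1)[OF D] by auto
  fix x assume "x \<in> {ord_at R Q (dwedge ys des) |des. length des = length ys &
    set des <= derivations (loc Q) & dwedge ys des ~= 0}"
  then obtain des where des: "x = ord_at R Q (dwedge ys des)" "length des = length ys"
   "set des <= derivations (loc Q)" "dwedge ys des ~= 0" by blast
  have c: "dwedge ys des = dwedge xs des * dwedge ys ds" by (rule dwedge_chain[OF D]) (use des len derivations_iff[of _ "loc Q"] in auto)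
  have "dwedge xs des \<in> loc Q" unfolding dwedge_def
  proof (rule det_in_subdom[OF loc_subdom[OF Q]])
   fix i j assume "i < length xs" "j < length xs"
   hence "des ! i \<in> derivations (loc Q)" "xs ! j \<in> loc Q" using des len lbasisD(2)[OF L] by auto
   thus "(des ! i) (xs ! j) \<in> loc Q" by (auto simp: derivations_iff[of _ "loc Q"])
  qed
  moreover have "dwedge xs des ~= 0" using c des(4) by auto
  ultimately have "ord_at R Q (dwedge xs des) >= 0" using mem_loc_iff[OF Q] by blast
  thus "ord_at R Q (dwedge ys ds) <= x" using des(1) c ord_mult[OF Q \<open>dwedge xs des ~= 0\<close> J0] by simp
 qed
qed

lemma loc_pth_root: "ht1 Q ==> f ^ p \<in> loc Q ==> f \<in> loc Q"
 by (cases "f = 0") (auto simp: mem_loc_iff ord_power zero_le_mult_iff p_gt1 subdomD[OF loc_subdom])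

lemma Te_loc:
 assumes Q: "ht1 Q" and L: "lbasis (loc Q) xs ds"
 shows "f \<in> loc Q ==> (Tr ds ^^ e) f \<in> loc Q"
proof (induction e)
 case (Suc e)
 have "tau ds ((Tr ds ^^ e) f) \<in> loc Q" by (rule tau_preserves[OF loc_subdom[OF Q]]) (use L Suc in "auto simp: lbasis_def")
 thus ?case using loc_pth_root[OF Q] Tr_pow[of xs ds] L by (simp add: lbasis_def)
qed simp

lemma Te_loc_conv:
 assumes Q: "ht1 Q" and L: "lbasis (loc Q) xs ds" and h: "!!a. a \<in> loc Q ==> (Tr ds ^^ e) (h * a) \<in> loc Q"
 shows "h \<in> loc Q"
proof -
 note A = subdomD[OF loc_subdom[OF Q]]
 obtain M where M: "!!l. l \<in> set M ==> fst l \<in> loc Q & snd l \<in> loc Q"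
  "!!f. f = (\<Sum>l\<leftarrow>M. (Tr ds ^^ e) (fst l * f) ^ (p ^ e) * snd l)"
  using Te_family[of xs ds "loc Q" e] L A(1,4) by (auto simp: lbasis_def)
 have "(\<Sum>l\<leftarrow>M'. (Tr ds ^^ e) (fst l * h) ^ (p ^ e) * snd l) \<in> loc Q" if "set M' <= set M" for M' using that
 proof (induction M')
  case (Cons l M')
  have "(Tr ds ^^ e) (fst l * h) \<in> loc Q" using h[of "fst l"] M(1)[of l] Cons by (simp add: mult.commute)
  thus ?case using Cons M(1)[of l] A(4,6,7) by simp
 qed (simp add: A)
 from this[OF order_refl] show ?thesis using M(2)[of h] by simp
qed

context
 fixes ys es assumes E: "dual ys es"
begin

text \<open>Over a valuation ring, the trace of a basis of its differentials maps the ring to itself and generates the maps that do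
 so. For another p-basis, the Jacobian shifts the orders by its own order.\<close>

lemma Te_vge:
 assumes Q: "ht1 Q" and f: "vge Q f (int (p ^ e - 1) * ord_dwedge R Q ys + int (p ^ e) * a)"
 shows "vge Q ((Tr es ^^ e) f) a"
proof -
 obtain xs ds where L: "lbasis (loc Q) xs ds" using loc_basis_exists[OF Q] by blast
 have D: "dual xs ds" using L by (simp add: lbasis_def)
 let ?J = "dwedge ys ds"
 have J: "?J ~= 0" "ord_at R Q ?J = ord_dwedge R Q ys" using dual_change(2)[OF D E] ord_dwedge_eq[OF Q L E] by auto
 obtain t where t: "uniformizer R Q t" using ht1_uniformizer[OF Q] by blast
 let ?c = "t powi a"
 have c: "?c ~= 0" "ord_at R Q ?c = a" using uniformizer_nonzero[OF Q t] ord_eq[OF Q t, of 1 a] subdomD(1)[OF loc_subdom[OF Q]]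
   fring.one_notin_m[OF fring_loc[OF ht1_prime[OF Q]]] by auto
 define u where "u = f / ?J ^ (p ^ e - 1) / ?c ^ (p ^ e)"
 have fu: "f = (?J ^ (p ^ e - 1) * ?c ^ (p ^ e)) * u" using J c by (simp add: u_def)
 have n0: "?J ^ (p ^ e - 1) * ?c ^ (p ^ e) ~= 0" using J c by simp
 have "vge Q u 0"
  using f vge_scale[OF Q n0, of u] fu ord_mult[OF Q, of "?J ^ (p ^ e - 1)" "?c ^ (p ^ e)"] ord_power[OF Q J(1)] ord_power[OF Q c(1)] J c by simp
 hence "u \<in> loc Q" using vge_loc[OF Q] by simp
 hence "(Tr ds ^^ e) u \<in> loc Q" by (rule Te_loc[OF Q L])
 hence "vge Q ((Tr ds ^^ e) u) 0" using vge_loc[OF Q] by simp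
 moreover have "(Tr es ^^ e) f = ?c * (Tr ds ^^ e) u"
 proof -
  have "f / ?J ^ (p ^ e - 1) = ?c ^ (p ^ e) * u" using c by (simp add: u_def)
  thus ?thesis using Tr_change[OF D E, of e f] Te_qmult[OF D] by simp
 qed
 ultimately show ?thesis using vge_scale[OF Q c(1), of "(Tr ds ^^ e) u" a] c(2) by simp
qed

lemma Te_vge_conv:
 assumes Q: "ht1 Q" and h: "!!a. a \<in> loc Q ==> (Tr es ^^ e) (h * a) \<in> loc Q"
 shows "vge Q h (int (p ^ e - 1) * ord_dwedge R Q ys)"
proof -
 obtain xs ds where L: "lbasis (loc Q) xs ds" using loc_basis_exists[OF Q] by blast
 have D: "dual xs ds" using L by (simp add: lbasis_def)
 let ?J = "dwedge ys ds"
 have J: "?J ~= 0" "ord_at R Q ?J = ord_dwedge R Q ys" using dual_change(2)[OF D E] ord_dwedge_eq[OF Q L E] by auto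
 let ?u = "h / ?J ^ (p ^ e - 1)"
 have "?u \<in> loc Q"
 proof (rule Te_loc_conv[OF Q L])
  fix a assume "a \<in> loc Q"
  hence "(Tr es ^^ e) (h * a) \<in> loc Q" by (rule h)
  thus "(Tr ds ^^ e) (?u * a) \<in> loc Q" using Tr_change[OF D E, of e "h * a"] by simp
 qed
 hence "vge Q ?u 0" using vge_loc[OF Q] by simp
 moreover have "h = ?J ^ (p ^ e - 1) * ?u" using J by simp
 ultimately show ?thesis using vge_scale[OF Q, of "?J ^ (p ^ e - 1)" ?u "int (p ^ e - 1) * ord_dwedge R Q ys"] J ord_power[OF Q J(1)] by simp
qed

text \<open>The multipliers \<open>h\<close> for which \<open>x \<mapsto> Tr\<^sup>e(hx)\<close> maps the module of \<open>F\<close> into \<open>R\<close>: they are sections of a multiple of an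
 anticanonical divisor, and the splitting ideals are defined by them.\<close>

definition Hm :: "nat => ('k set => int) => 'k set" where
 "Hm e F = {h. \<forall>Q. ht1 Q --> vge Q h (int (p ^ e - 1) * ord_dwedge R Q ys + F Q)}"

definition Sp :: "nat => ('k set => int) => 'k set" where
 "Sp e F = {r \<in> R. \<forall>h\<in>Hm e F. (Tr es ^^ e) (h * r) \<in> m}"

lemma HmD: "h \<in> Hm e F ==> ht1 Q ==> vge Q h (int (p ^ e - 1) * ord_dwedge R Q ys + F Q)" by (auto simp: Hm_def)

lemma div_module_iff: "f \<in> div_module R F \<longleftrightarrow> (\<forall>Q. ht1 Q --> vge Q f (- F Q))"
proof -
 have "(- F Q <= ord_at R Q f) = (ord_at R Q f + F Q >= 0)" for Q by auto
 thus ?thesis by (auto simp: div_module_def vge_def ht1_def)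
qed

lemma Hm_maps:
 assumes "h \<in> Hm e F" "x \<in> div_module R F"
 shows "(Tr es ^^ e) (h * x) \<in> R"
proof -
 have "vge Q ((Tr es ^^ e) (h * x)) 0" if Q: "ht1 Q" for Q
  using vge_mult[OF Q HmD[OF assms(1) Q], of x "- F Q"] assms(2) Q Te_vge[OF Q, of "h * x" e 0] by (simp add: div_module_iff)
 thus ?thesis using mem_R_iff by blast
qed

text \<open>Every element with the right order at one height one prime is brought into the module of a divisor
 by a factor that is a unit there.\<close>

lemma div_module_local:
 assumes Q: "ht1 Q" and F: "!!Q. ht1 Q ==> F Q >= 0" and x: "vge Q x (- F Q)"
 shows "\<exists>s. s \<in> R & s ~: Q & s ^ n * x \<in> div_module R F | x = 0 | n = 0"
proof (cases "x = 0 | n = 0")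
 case False
 hence x0: "x ~= 0" and n: "n >= 1" by auto
 let ?S = "{Q'. ht1 Q' & ord_at R Q' x ~= 0} - {Q}"
 have fS: "finite ?S" using finite_ord[OF x0] by simp
 define B where "B = (if ?S = {} then 0 else Max ((%Q'. nat \<bar>ord_at R Q' x\<bar>) ` ?S))"
 obtain s where s: "s \<in> R" "s ~: Q" "!!Q'. Q' \<in> ?S ==> ord_at R Q' s >= int B" using exists_high_order[OF fS _ Q, of B] by blast
 have s0: "s ~= 0" using s smodD(1)[OF prime_inD(1)[OF ht1_prime[OF Q]]] by auto
 have "vge Q' (s ^ n * x) (- F Q')" if Q': "ht1 Q'" for Q'
 proof (cases "Q' \<in> ?S")
  case True
  hence "nat \<bar>ord_at R Q' x\<bar> <= B" unfolding B_def using fS by (auto intro: Max_ge)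
  hence "- ord_at R Q' x <= int B" by linarith
  moreover have "int B <= int n * int B" using n by (simp add: mult_le_cancel_right1)
  moreover have "int n * int B <= int n * ord_at R Q' s" using s(3)[OF True] by (simp add: mult_left_mono)
  ultimately have "ord_at R Q' (s ^ n * x) >= 0" using ord_mult[OF Q', of "s ^ n" x] ord_power[OF Q' s0] s0 x0 by simp
  thus ?thesis using F[OF Q'] by (simp add: vge_def)
 next
  case False
  then consider "Q' = Q" | "ord_at R Q' x = 0" using Q' by blast
  thus ?thesis
  proof cases
   case 1
   thus ?thesis using vge_mult[OF Q vge_power[OF Q vge_R[OF Q s(1)]] x, of n] by simp
  next
   case 2
   hence "vge Q' x 0" by (simp add: vge_def)
   hence "vge Q' (s ^ n * x) 0" using vge_mult[OF Q' vge_power[OF Q' vge_R[OF Q' s(1)]], of x 0 n] by simp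
   thus ?thesis by (rule vge_mono) (use F[OF Q'] in simp)
  qed
 qed
 thus ?thesis using s div_module_iff by blast
qed blast

lemma Hm_conv:
 assumes F: "!!Q. ht1 Q ==> F Q >= 0" and h: "!!x. x \<in> div_module R F ==> (Tr es ^^ e) (h * x) \<in> R"
 shows "h \<in> Hm e F" unfolding Hm_def
proof (intro CollectI allI impI)
 fix Q assume Q: "ht1 Q"
 obtain t where t: "uniformizer R Q t" using ht1_uniformizer[OF Q] by blast
 let ?c = "t powi (- F Q)"
 have c: "?c ~= 0" "ord_at R Q ?c = - F Q" using uniformizer_nonzero[OF Q t] ord_eq[OF Q t, of 1 "- F Q"] subdomD(1)[OF loc_subdom[OF Q]]
   fring.one_notin_m[OF fring_loc[OF ht1_prime[OF Q]]] by auto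
 have "vge Q (h * ?c) (int (p ^ e - 1) * ord_dwedge R Q ys)"
 proof (rule Te_vge_conv[OF Q])
  fix a assume a: "a \<in> loc Q"
  show "(Tr es ^^ e) (h * ?c * a) \<in> loc Q"
  proof (cases "a = 0")
   case True
   thus ?thesis using Te_0[OF E] subdomD(2)[OF loc_subdom[OF Q]] by simp
  next
   case False
   have "vge Q (?c * a) (- F Q)" using vge_mult[OF Q vge_ord[of Q ?c], of a 0] vge_loc[OF Q] a c by simp
   hence "\<exists>s. s \<in> R & s ~: Q & s ^ (p ^ e) * (?c * a) \<in> div_module R F | ?c * a = 0 | p ^ e = 0" by (intro div_module_local Q F)
   then obtain s where s: "s \<in> R" "s ~: Q" "s ^ (p ^ e) * (?c * a) \<in> div_module R F" using False c(1) p_gt1 by auto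
   have "s * (Tr es ^^ e) (h * ?c * a) = (Tr es ^^ e) (h * (s ^ (p ^ e) * (?c * a)))" unfolding Te_qmult[OF E, symmetric] by (simp add: ac_simps)
   hence "s * (Tr es ^^ e) (h * ?c * a) \<in> R" using h[OF s(3)] by simp
   hence "s * (Tr es ^^ e) (h * ?c * a) / s \<in> loc Q" using s by (intro extI)
   thus ?thesis using ext_denom(1)[OF R ht1_prime[OF Q] s(1,2)] by simp
  qed
 qed
 thus "vge Q h (int (p ^ e - 1) * ord_dwedge R Q ys + F Q)"
  using vge_scale[OF Q c(1), of h "int (p ^ e - 1) * ord_dwedge R Q ys"] c(2) by (simp add: mult.commute)
qed

lemma R_div_module: "(!!Q. ht1 Q ==> F Q >= 0) ==> x \<in> R ==> x \<in> div_module R F"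
 unfolding div_module_iff using vge_R vge_mono by (metis neg_le_0_iff_le)

lemma smod_div_module: "smod R (div_module R F)" unfolding smod_def div_module_iff
proof (intro conjI ballI allI impI)
 fix a x Q assume "a \<in> R" "x \<in> div_module R F" "ht1 Q"
 thus "vge Q (a * x) (- F Q)" using vge_mult[of Q a 0 x "- F Q"] vge_R[of Q a] by (simp add: div_module_iff)
qed (auto simp: vge_add div_module_iff)

text \<open>Every Frobenius linear map on the module of an effective divisor extends to the field, where it is a
 multiple of the trace.\<close>

lemma frobenius_hom_trace:
 assumes F: "!!Q. ht1 Q ==> F Q >= 0" and \<phi>: "\<phi> \<in> frobenius_hom p e R (div_module R F)"
 shows "\<exists>h\<in>Hm e F. \<forall>x\<in>div_module R F. \<phi> x = (Tr es ^^ e) (h * x)"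
proof -
 let ?M = "div_module R F" and ?q = "p ^ e"
 note M = smodD[OF smod_div_module[of F]]
 have add: "\<phi> (x + y) = \<phi> x + \<phi> y" if "x \<in> ?M" "y \<in> ?M" for x y using \<phi> that by (auto simp: frobenius_hom_def)
 have lin: "\<phi> (r ^ ?q * x) = r * \<phi> x" if "r \<in> R" "x \<in> ?M" for r x using \<phi> that by (auto simp: frobenius_hom_def)
 have "\<exists>s. s \<in> R & s ~= 0 & s ^ ?q * x \<in> ?M" for x
 proof -
  obtain a b where ab: "a \<in> R" "b \<in> R" "b ~= 0" "x = a / b" using frac by blast
  have "b ^ ?q = b ^ (?q - 1) * b" using p_gt1 by (cases "p ^ e") auto
  hence "b ^ ?q * x = b ^ (?q - 1) * a" using ab by simp
  hence "b ^ ?q * x \<in> R" using ab Rs by simp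
  hence "b ^ ?q * x \<in> ?M" by (intro R_div_module F)
  thus ?thesis using ab by blast
 qed
 then obtain s where s: "!!x. s x \<in> R" "!!x. s x ~= 0" "!!x. s x ^ ?q * x \<in> ?M" by metis
 define \<psi> where "\<psi> x = \<phi> (s x ^ ?q * x) / s x" for x
 have \<psi>: "\<psi> x = \<phi> (r ^ ?q * x) / r" if "r \<in> R" "r ~= 0" "r ^ ?q * x \<in> ?M" for r x
 proof -
  have "r * \<phi> (s x ^ ?q * x) = \<phi> (r ^ ?q * (s x ^ ?q * x))" using lin s(3) that by simp
  also have "r ^ ?q * (s x ^ ?q * x) = s x ^ ?q * (r ^ ?q * x)" by (simp add: ac_simps)
  also have "\<phi> \<dots> = s x * \<phi> (r ^ ?q * x)" using lin s(1) that by simp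
  finally show ?thesis using that s(2)[of x] by (simp add: \<psi>_def field_simps)
 qed
 have "\<exists>h. \<forall>f. \<psi> f = (Tr es ^^ e) (h * f)"
 proof (rule Te_represent[OF E])
  fix x y
  let ?r = "s x * s y"
  have r: "?r \<in> R" "?r ~= 0" using s Rs by auto
  have rx: "?r ^ ?q * x = s y ^ ?q * (s x ^ ?q * x)" "?r ^ ?q * y = s x ^ ?q * (s y ^ ?q * y)" by (auto simp: power_mult_distrib ac_simps)
  have mem: "?r ^ ?q * x \<in> ?M" "?r ^ ?q * y \<in> ?M" unfolding rx using M(3) Rs(7) s by auto
  have "?r ^ ?q * (x + y) \<in> ?M" using M(2)[OF mem] by (simp add: distrib_left)
  thus "\<psi> (x + y) = \<psi> x + \<psi> y" using \<psi>[OF r mem(1)] \<psi>[OF r mem(2)] \<psi>[OF r, of "x + y"] add[OF mem]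
   by (simp add: distrib_left add_divide_distrib)
 next
  fix c x
  obtain a b where ab: "a \<in> R" "b \<in> R" "b ~= 0" "c = a / b" using frac by blast
  let ?r = "b * s x"
  have r: "?r \<in> R" "?r ~= 0" using s ab Rs by auto
  have e: "?r ^ ?q * (c ^ ?q * x) = a ^ ?q * (s x ^ ?q * x)" using ab by (simp add: power_mult_distrib power_divide)
  have mem: "?r ^ ?q * (c ^ ?q * x) \<in> ?M" unfolding e by (rule M(3)[OF Rs(7)[OF ab(1)] s(3)])
  have "\<psi> (c ^ ?q * x) = \<phi> (a ^ ?q * (s x ^ ?q * x)) / ?r" unfolding \<psi>[OF r mem] e ..
  also have "\<dots> = c * \<psi> x" using lin[OF ab(1) s(3)] ab by (simp add: \<psi>_def)
  finally show "\<psi> (c ^ ?q * x) = c * \<psi> x" .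
 qed
 then obtain h where h: "!!f. \<psi> f = (Tr es ^^ e) (h * f)" by blast
 have \<phi>h: "\<phi> x = (Tr es ^^ e) (h * x)" if "x \<in> ?M" for x using \<psi>[of 1 x] that Rs(1) h[of x] by simp
 have "h \<in> Hm e F"
 proof (rule Hm_conv[OF F])
  fix x assume "x \<in> ?M"
  thus "(Tr es ^^ e) (h * x) \<in> R" using \<phi>h \<phi> by (auto simp: frobenius_hom_def)
 qed
 thus ?thesis using \<phi>h by blast
qed

theorem splitting_ideal_eq:
 assumes "effective B"
 shows "splitting_ideal p e R B = Sp e (%Q. \<lceil>(real (p ^ e) - 1) * B Q\<rceil>)"
proof -
 define F where "F = (%Q. \<lceil>(real (p ^ e) - 1) * B Q\<rceil>)"
 have F: "F Q >= 0" for Q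
 proof -
  have "real (p ^ e) >= 1" using p_gt1 by simp
  hence "(real (p ^ e) - 1) * B Q >= 0" using assms by (simp add: effective_def)
  thus ?thesis unfolding F_def by linarith
 qed
 show ?thesis unfolding splitting_ideal_def max_ideal_eq Sp_def F_def[symmetric]
 proof (intro Collect_cong conj_cong refl iffI ballI)
  fix r h assume r: "r \<in> R" and a: "\<forall>\<phi>\<in>frobenius_hom p e R (div_module R F). \<phi> r \<in> m" and h: "h \<in> Hm e F"
  have "(%x. (Tr es ^^ e) (h * x)) \<in> frobenius_hom p e R (div_module R F)" unfolding frobenius_hom_def
  proof (intro CollectI conjI ballI)
   show "(%x. (Tr es ^^ e) (h * x)) ` div_module R F <= R" using Hm_maps[OF h] by blast
   show "(Tr es ^^ e) (h * (r ^ p ^ e * x)) = r * (Tr es ^^ e) (h * x)" for r x using Te_qmult[OF E, of e r "h * x"] by (simp add: ac_simps)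
  qed (simp add: distrib_left Te_add[OF E])
  thus "(Tr es ^^ e) (h * r) \<in> m" by (rule bspec[OF a])
 next
  fix r \<phi> assume r: "r \<in> R" and a: "\<forall>h\<in>Hm e F. (Tr es ^^ e) (h * r) \<in> m"
   and \<phi>: "\<phi> \<in> frobenius_hom p e R (div_module R F)"
  thus "\<phi> r \<in> m" using frobenius_hom_trace[OF _ \<phi>] F R_div_module[of F r] by fastforce
 qed
qed

end

end

section \<open>Splitting ideals\<close>

lemma (in pchar) null_geometric: "(%e. c / real p ^ e) \<longlonglongrightarrow> 0"
 using tendsto_mult[OF tendsto_const[of c] LIMSEQ_power_zero[of "1 / real p"]] p_gt1 by (simp add: power_divide)

lemma (in pchar) geometric_null:
 assumes "!!e. \<bar>a e\<bar> <= C / real p ^ e" shows "a \<longlonglongrightarrow> 0"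
proof (rule tendsto_0_le[OF null_geometric])
 show "\<forall>\<^sub>F e in sequentially. norm (a e) <= norm (C / real p ^ e) * 1"
  using order_trans[OF assms abs_ge_self] by (intro always_eventually) (simp only: real_norm_def mult_1_right simp_thms)
qed

context fdring
begin

text \<open>Modulo a nonzero element the dimension drops, so such colengths are negligible compared with \<open>p\<^sup>e\<^sup>d\<close>.\<close>

lemma small_bound:
 assumes v: "v \<in> R" "v ~= 0"
 obtains C :: real where "C >= 0" "!!e J. cof e J ==> v \<in> J ==> real (lam J) * real p ^ e <= C * real p ^ (e * d)"
proof -
 have z: "smod R {0}" "{0} <= R" using Rs by (auto simp: smod_def)
 have c: "coht R Q + 1 <= d" if Q: "prime_in R Q" "adj {0} v R <= Q" for Q
 proof -
  have "v \<in> Q" using Q(2) adj_mem[of "{0}" R v] Rs(1) by auto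
  hence "{0} < Q" using v smodD(1)[OF prime_inD(1)[OF Q(1)]] by auto
  thus ?thesis using coht_less[OF zero_prime[OF R] Q(1)] coht_zero by simp
 qed
 obtain C :: real where C: "C >= 0" "!!e J. cof e J ==> adj {0} v R <= J ==> real (lam J) * real p ^ (e * 1) <= C * real p ^ (e * d)"
  using hilbert_kunz_bound[OF smod_adj[OF z(1) RR] adj_subset[OF RR z(2) v(1)] c] by metis
 show ?thesis
 proof (rule that[OF C(1)])
  fix e J assume J: "cof e J" "v \<in> J"
  have "adj {0} v R <= J" by (rule adj_subset[OF cofD(1)[OF J(1)] _ J(2)]) (use smodD(1)[OF cofD(1)[OF J(1)]] in simp)
  thus "real (lam J) * real p ^ e <= C * real p ^ (e * d)" using C(2)[OF J(1)] by simp
 qed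
qed

end

locale nfdring = nring p R m + fdring p R m d for p :: nat and R m :: "'k::field set" and d :: nat

text \<open>The p-basis \<open>ys\<close> is fixed here; its form gives the canonical divisor \<open>kk\<close> used to describe all maps.\<close>

locale tring = nfdring p R m d for p :: nat and R m :: "'k::field set" and d :: nat +
 fixes ys es assumes E: "dual ys es"
begin

abbreviation "kk Q \<equiv> ord_dwedge R Q ys"
abbreviation "H e F \<equiv> Hm ys e F"
abbreviation "S e F \<equiv> Sp ys es e F"
abbreviation "T e \<equiv> Tr es ^^ e"

abbreviation eff :: "('k set => int) => bool" where "eff F \<equiv> \<forall>Q. ht1 Q --> F Q >= 0"

lemma HI: "(!!Q. ht1 Q ==> vge Q h (int (p ^ e - 1) * kk Q + F Q)) ==> h \<in> H e F" by (auto simp: Hm_def[OF E])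

lemma H_R: "eff F ==> h \<in> H e F ==> r \<in> R ==> T e (h * r) \<in> R" using Hm_maps[OF E, of h e F r] R_div_module[OF E, of F r] by blast

lemma H_mult: "h \<in> H e F ==> a \<in> R ==> h * a \<in> H e F"
proof (rule HI)
 fix Q assume "h \<in> H e F" "a \<in> R" "ht1 Q"
 thus "vge Q (h * a) (int (p ^ e - 1) * kk Q + F Q)" using vge_mult[OF _ HmD[OF E], of Q h e F a 0] vge_R[of Q a] by simp
qed

lemma S_iff: "r \<in> S e F \<longleftrightarrow> r \<in> R & (\<forall>h\<in>H e F. T e (h * r) \<in> m)" by (auto simp: Sp_def[OF E])

lemma S_subset: "S e F <= R" by (auto simp: S_iff)

lemma S_cof: "eff F ==> cof e (S e F)" unfolding cof_def
proof (intro conjI ballI)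
 assume F: "eff F"
 show "smod R (S e F)" unfolding smod_def
 proof (intro conjI ballI)
  show "0 \<in> S e F" using Rs(2) smodD(1)[OF m(1)] by (simp add: S_iff Te_0[OF E])
  show "x + y \<in> S e F" if "x \<in> S e F" "y \<in> S e F" for x y
   using that Rs(6) smodD(2)[OF m(1)] by (simp add: S_iff distrib_left Te_add[OF E])
  show "a * x \<in> S e F" if a: "a \<in> R" and x: "x \<in> S e F" for a x unfolding S_iff
  proof (intro conjI ballI)
   fix h assume "h \<in> H e F"
   hence "T e (h * a * x) \<in> m" using H_mult[OF _ a] x by (simp add: S_iff)
   thus "T e (h * (a * x)) \<in> m" by (simp add: mult.assoc)
  qed (use a x Rs(4) S_subset in blast)
 qed
 show "S e F <= R" by (rule S_subset)
 fix x assume x: "x \<in> m"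
 show "x ^ p ^ e \<in> S e F" unfolding S_iff
 proof (intro conjI ballI)
  show "x ^ p ^ e \<in> R" using x m(2) Rs(7) by blast
  fix h assume "h \<in> H e F"
  hence "T e (h * 1) \<in> R" using H_R[OF F] Rs(1) by blast
  thus "T e (h * x ^ p ^ e) \<in> m" using Te_qmult[OF E, of e x h] smodD(4)[OF m(1), of "T e h" x] x by (simp add: mult.commute)
 qed
qed

lemma H_mono: "(!!Q. ht1 Q ==> F Q <= F' Q) ==> H e F' <= H e F"
proof
 fix h assume a: "!!Q. ht1 Q ==> F Q <= F' Q" and h: "h \<in> H e F'"
 show "h \<in> H e F" by (rule HI, rule vge_mono[OF HmD[OF E h]]) (use a in auto)
qed

lemma S_mono: "(!!Q. ht1 Q ==> F Q <= F' Q) ==> S e F <= S e F'" unfolding subset_iff S_iff using subsetD[OF H_mono[of F F' e]] by blast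

text \<open>The trace maps the module at level \<open>e+1\<close> to the one at level \<open>e\<close>, up to a factor that absorbs the
 rounding of the divisor.\<close>

lemma S_frobenius:
 assumes w: "w \<in> R" "w ~= 0" and wF: "!!Q. ht1 Q ==> int p * F Q <= F' Q + ord_at R Q w" and r: "r \<in> S e F"
 shows "w * r ^ p \<in> S (Suc e) F'" unfolding S_iff
proof (intro conjI ballI)
 show "w * r ^ p \<in> R" using w r S_subset Rs by (blast intro: Rs)
 fix h assume h: "h \<in> H (Suc e) F'"
 have "Tr es (h * w) \<in> H e F"
 proof (rule HI)
  fix Q assume Q: "ht1 Q"
  have pe: "int (p ^ e) >= 1" using p_gt1 by simp
  have "vge Q (h * w) (int (p ^ Suc e - 1) * kk Q + F' Q + ord_at R Q w)" using vge_mult[OF Q HmD[OF E h Q] vge_ord] .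
  moreover have "int (p ^ 1 - 1) * kk Q + int (p ^ 1) * (int (p ^ e - 1) * kk Q + F Q) <=
    int (p ^ Suc e - 1) * kk Q + F' Q + ord_at R Q w"
  proof -
   have "int (p ^ 1 - 1) = int p - 1" "int (p ^ e - 1) = int (p ^ e) - 1" "int (p ^ Suc e - 1) = int p * int (p ^ e) - 1"
    using p_gt1 by (auto simp: of_nat_diff)
   thus ?thesis using wF[OF Q] by (simp add: algebra_simps)
  qed
  ultimately have "vge Q (h * w) (int (p ^ 1 - 1) * kk Q + int (p ^ 1) * (int (p ^ e - 1) * kk Q + F Q))" by (rule vge_mono)
  thus "vge Q (Tr es (h * w)) (int (p ^ e - 1) * kk Q + F Q)" using Te_vge[OF E Q, of "h * w" 1] by simp
 qed
 hence "T e (Tr es (h * w) * r) \<in> m" using r by (simp add: S_iff)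
 moreover have "T (Suc e) (h * (w * r ^ p)) = T e (Tr es (h * w) * r)"
  unfolding funpow_Suc_right comp_def using Tr_pmult[OF E, of r "h * w"] by (simp add: ac_simps)
 ultimately show "T (Suc e) (h * (w * r ^ p)) \<in> m" by simp
qed

text \<open>Multiplication by \<open>f\<close> identifies the multipliers for \<open>F\<close> with those for \<open>F + div f\<close>.\<close>

lemma S_colon:
 assumes f: "f \<in> R" "f ~= 0" and F: "!!Q. ht1 Q ==> F' Q = F Q + ord_at R Q f"
 shows "{x \<in> R. x * f \<in> S e F} = S e F'"
proof -
 have 1: "h * f \<in> H e F'" if "h \<in> H e F" for h
 proof (rule HI)
  fix Q assume Q: "ht1 Q"
  show "vge Q (h * f) (int (p ^ e - 1) * kk Q + F' Q)" using vge_mult[OF Q HmD[OF E that Q] vge_ord[of Q f]] F[OF Q] by (simp add: add.assoc)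
 qed
 have 2: "h / f \<in> H e F" if "h \<in> H e F'" for h
 proof (rule HI)
  fix Q assume Q: "ht1 Q"
  have "h = f * (h / f)" using f by simp
  hence "vge Q (f * (h / f)) (int (p ^ e - 1) * kk Q + F' Q)" using HmD[OF E that Q] by (rule subst)
  thus "vge Q (h / f) (int (p ^ e - 1) * kk Q + F Q)" unfolding vge_scale[OF Q f(2)] F[OF Q] by (simp add: algebra_simps)
 qed
 show ?thesis
 proof (intro equalityI subsetI)
  fix x assume x: "x \<in> {x \<in> R. x * f \<in> S e F}"
  show "x \<in> S e F'" unfolding S_iff
  proof (intro conjI ballI)
   fix h assume "h \<in> H e F'"
   from 2[OF this] have "T e (h / f * (x * f)) \<in> m" using x unfolding mem_Collect_eq S_iff by blast
   thus "T e (h * x) \<in> m" using f by simp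
  qed (use x in simp)
 next
  fix x assume x: "x \<in> S e F'"
  have "T e (h * (x * f)) \<in> m" if "h \<in> H e F" for h
  proof -
   have "T e (h * f * x) \<in> m" using 1[OF that] x unfolding S_iff by blast
   thus ?thesis by (simp add: ac_simps)
  qed
  thus "x \<in> {x \<in> R. x * f \<in> S e F}" using x f(1) Rs(4) by (auto simp: S_iff)
 qed
qed

section \<open>Existence of the F-signature\<close>

definition ratio :: "nat => 'k set => real" where "ratio e J = real (lam J) / real p ^ (e * d)"

lemma pp: "real p ^ n > 0" using p_gt1 by simp

lemma ratio_nonneg: "ratio e J >= 0" by (simp add: ratio_def)

lemma decreasing_up_to_geometric:
 fixes a :: "nat => real"
 assumes "!!e. 0 <= a e" "!!e. a (Suc e) <= a e + C / real p ^ e" "C >= 0"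
 shows "convergent a"
proof -
 let ?b = "%e. a e + 2 * C / real p ^ e"
 have p2: "real p >= 2" using p_gt1 by simp
 have "decseq ?b"
 proof (rule decseq_SucI)
  fix e
  have "2 * C / real p ^ Suc e <= C / real p ^ e" using mult_left_mono[OF p2 assms(3)] p2 by (simp add: divide_simps mult.commute)
  thus "?b (Suc e) <= ?b e" using assms(2)[of e] by simp
 qed
 moreover have "bdd_below (range ?b)" using assms by (intro bdd_belowI[of _ 0]) (auto intro!: add_nonneg_nonneg)
 ultimately have "convergent ?b" using LIMSEQ_decseq_INF convergentI by blast
 moreover have "convergent (%e. 2 * C / real p ^ e)" using null_geometric by (rule convergentI)
 ultimately have "convergent (%e. ?b e - 2 * C / real p ^ e)" by (rule convergent_diff)
 thus ?thesis by simp
qed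

text \<open>If \<open>I\<^sub>e\<^sup>[\<^sup>p\<^sup>]\<close>, up to a fixed factor, is contained in \<open>I\<^sub>e\<^sub>+\<^sub>1\<close>, the normalized lengths are decreasing up to a
 geometric error, hence convergent.\<close>

lemma frobenius_step:
 assumes w: "w \<in> R" and J: "cof (Suc e) J" and I: "cof e I" and IJ: "!!r. r \<in> I ==> w * r ^ p \<in> J"
  and fc: "!!e J. cof (Suc e) J ==> lam J <= p ^ d * lam {r \<in> R. r ^ p \<in> J} + lam (adj J (s ^ p) R)" and s: "s \<in> R"
 shows "\<exists>J'. cof (Suc e) J' & J <= J' & s ^ p \<in> J' & lam J <= p ^ d * lam I + lam J' + lam (adj J w R)"
proof -
 let ?K = "{x \<in> R. x * w \<in> J}"
 have K: "cof (Suc e) ?K" by (rule cof_colon[OF J w])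
 have sp: "s ^ p \<in> R" using s Rs by auto
 have IR: "I <= {r \<in> R. r ^ p \<in> ?K}" using IJ cofD(2)[OF I] Rs(7) by (auto simp: mult.commute)
 have "lam J = lam ?K + lam (adj J w R)" by (rule lam_colon[OF J w])
 also have "lam ?K <= p ^ d * lam {r \<in> R. r ^ p \<in> ?K} + lam (adj ?K (s ^ p) R)" by (rule fc[OF K])
 also have "lam {r \<in> R. r ^ p \<in> ?K} <= lam I" by (rule lam_mono[OF I cof_root[OF K] IR])
 finally have "lam J <= p ^ d * lam I + lam (adj ?K (s ^ p) R) + lam (adj J w R)" by simp
 moreover have "J <= ?K" using cofD(2)[OF J] smodD(4)[OF cofD(1)[OF J] w] by blast
 hence "J <= adj ?K (s ^ p) R" using adj_supset[OF Rs(2), of ?K "s ^ p"] by blast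
 moreover have "s ^ p \<in> adj ?K (s ^ p) R" by (rule adj_mem) (use smodD(1)[OF cofD(1)[OF K]] Rs(1) in auto)
 ultimately show ?thesis using cof_adj[OF K sp] by blast
qed

lemma ratio_convergent:
 assumes J: "!!e. cof e (J e)" and w: "w \<in> R" "w ~= 0" and step: "!!e r. r \<in> J e ==> w * r ^ p \<in> J (Suc e)"
 shows "convergent (%e. ratio e (J e))"
proof -
 obtain s where s: "s \<in> R" "s ~: {0}" and fc: "!!e J. cof (Suc e) J ==> {0} <= J ==>
   lam J <= p ^ coht R {0} * lam {r \<in> R. r ^ p \<in> J} + lam (adj J (s ^ p) R)"
  by (rule frobenius_compare_coht[OF zero_prime[OF R]]) (assumption | rule that)+
 have fc': "lam J <= p ^ d * lam {r \<in> R. r ^ p \<in> J} + lam (adj J (s ^ p) R)" if "cof (Suc e) J" for e J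
  using fc[OF that] smodD(1)[OF cofD(1)[OF that]] coht_zero by simp
 have sp: "s ^ p \<in> R" "s ^ p ~= 0" using s Rs(7) by auto
 obtain C1 where C1: "C1 >= 0" "!!e J. cof e J ==> s ^ p \<in> J ==> real (lam J) * real p ^ e <= C1 * real p ^ (e * d)"
  using small_bound[OF sp] by metis
 obtain C2 where C2: "C2 >= 0" "!!e J. cof e J ==> w \<in> J ==> real (lam J) * real p ^ e <= C2 * real p ^ (e * d)" using small_bound[OF w] by metis
 show ?thesis
 proof (rule decreasing_up_to_geometric[of _ "C1 + C2"])
  fix e
  obtain J' where J': "cof (Suc e) J'" "s ^ p \<in> J'" "lam (J (Suc e)) <= p ^ d * lam (J e) + lam J' + lam (adj (J (Suc e)) w R)"
  proof -
   have "\<exists>J'. cof (Suc e) J' & J (Suc e) <= J' & s ^ p \<in> J' & lam (J (Suc e)) <= p ^ d * lam (J e) + lam J' + lam (adj (J (Suc e)) w R)"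
    by (rule frobenius_step[OF w(1) J J step _ s(1)]) (auto intro: fc')
   thus ?thesis using that by blast
  qed
  have wm: "w \<in> adj (J (Suc e)) w R" by (rule adj_mem[OF smodD(1)[OF cofD(1)[OF J]] Rs(1)])
  let ?q = "real p ^ Suc e"
  have 1: "ratio (Suc e) J' <= C1 / ?q" "ratio (Suc e) (adj (J (Suc e)) w R) <= C2 / ?q"
   using C1(2)[OF J'(1,2)] C2(2)[OF cof_adj[OF J w(1)] wm] pp[of "Suc e"] pp[of "Suc e * d"]
   unfolding ratio_def by (simp_all add: divide_simps mult.commute del: power_Suc)
  have "real (lam (J (Suc e))) <= real p ^ d * real (lam (J e)) + real (lam J') + real (lam (adj (J (Suc e)) w R))"
   using J'(3) by (metis of_nat_add of_nat_le_iff of_nat_mult of_nat_power)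
  hence "ratio (Suc e) (J (Suc e)) <= (real p ^ d * real (lam (J e)) + real (lam J') + real (lam (adj (J (Suc e)) w R))) / real p ^ (Suc e * d)"
   unfolding ratio_def by (rule divide_right_mono) simp
  also have "\<dots> = real p ^ d * real (lam (J e)) / real p ^ (Suc e * d) + ratio (Suc e) J' + ratio (Suc e) (adj (J (Suc e)) w R)"
   by (simp add: ratio_def add_divide_distrib)
  also have "real p ^ d * real (lam (J e)) / real p ^ (Suc e * d) = ratio e (J e)" using p_gt1 by (simp add: ratio_def power_add)
  finally have "ratio (Suc e) (J (Suc e)) <= ratio e (J e) + (C1 / ?q + C2 / ?q)" using 1 by simp
  also have "C1 / ?q + C2 / ?q <= (C1 + C2) / real p ^ e"
  proof -
   have "(C1 + C2) / ?q <= (C1 + C2) / real p ^ e" using C1(1) C2(1) p_gt1 by (intro divide_left_mono) auto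
   thus ?thesis by (simp add: add_divide_distrib)
  qed
  finally show "ratio (Suc e) (J (Suc e)) <= ratio e (J e) + (C1 + C2) / real p ^ e" by simp
 qed (use C1 C2 ratio_nonneg in auto)
qed

definition rnd :: "nat => ('k set => real) => 'k set => int" where
 "rnd e B = (%Q. \<lceil>(real (p ^ e) - 1) * B Q\<rceil>)"

lemma pe_ge1: "real (p ^ e) - 1 >= 0" using p_gt1 by (simp add: Suc_leI)

lemma eff_rnd: "effective B ==> eff (rnd e B)"
proof (intro allI impI)
 fix Q assume "effective B"
 hence "(real (p ^ e) - 1) * B Q >= 0" using pe_ge1 by (simp add: effective_def)
 thus "rnd e B Q >= 0" unfolding rnd_def by linarith
qed

text \<open>Rounding up costs less than 1 at each level, hence less than \<open>p\<close> after multiplication by \<open>p\<close>.\<close>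

lemma rnd_step:
 assumes "B Q >= 0"
 shows "int p * rnd e B Q <= rnd (Suc e) B Q + (if B Q = 0 then 0 else int p)"
proof (cases "B Q = 0")
 case False
 have "real_of_int (rnd e B Q) < (real (p ^ e) - 1) * B Q + 1" unfolding rnd_def by linarith
 hence "real p * real_of_int (rnd e B Q) <= real p * ((real (p ^ e) - 1) * B Q + 1)" by (intro mult_left_mono) auto
 also have "\<dots> = (real (p ^ Suc e) - 1) * B Q - (real p - 1) * B Q + real p" by (simp add: algebra_simps)
 also have "\<dots> <= (real (p ^ Suc e) - 1) * B Q + real p" using assms p_gt1 by simp
 also have "(real (p ^ Suc e) - 1) * B Q <= real_of_int (rnd (Suc e) B Q)" unfolding rnd_def by linarith
 finally have "real_of_int (int p * rnd e B Q) <= real_of_int (rnd (Suc e) B Q + int p)" by simp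
 thus ?thesis using False by (simp only: of_int_le_iff) simp
qed (simp add: rnd_def)

theorem F_signature_LIMSEQ:
 assumes B: "real_divisor R B" "effective B"
 shows "(%e. ratio e (S e (rnd e B))) \<longlonglongrightarrow> F_signature p R B"
proof -
 let ?J = "%e. S e (rnd e B)"
 have J: "cof e (?J e)" for e by (rule S_cof[OF eff_rnd[OF B(2)]])
 have hB: "ht1 Q" if "B Q ~= 0" for Q using B(1) that by (auto simp: real_divisor_def ht1_def)
 obtain w where w: "w \<in> R" "w ~= 0" "!!Q. Q \<in> {Q. B Q ~= 0} ==> ord_at R Q w >= int p"
  using exists_high_order_nonzero[of "{Q. B Q ~= 0}" p] B(1) hB by (auto simp: real_divisor_def)
 have "convergent (%e. ratio e (?J e))"
 proof (rule ratio_convergent[OF J w(1,2)])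
  fix e r assume "r \<in> ?J e"
  thus "w * r ^ p \<in> ?J (Suc e)"
  proof (rule S_frobenius[OF w(1,2), rotated])
   fix Q assume Q: "ht1 Q"
   have "B Q >= 0" using B(2) by (simp add: effective_def)
   from rnd_step[of B Q e, OF this] show "int p * rnd e B Q <= rnd (Suc e) B Q + ord_at R Q w"
    using w(3)[of Q] ord_R[OF Q w(1,2)] by (auto split: if_splits)
  qed
 qed
 hence "(%e. ratio e (?J e)) \<longlonglongrightarrow> lim (%e. ratio e (?J e))" by (simp add: convergent_LIMSEQ_iff)
 moreover have "ratio e (?J e) = real (the_enat (ring_length (ring_of R Quot splitting_ideal p e R B)))
   / real p ^ (e * the_enat (krull_dim (ring_of R)))" for e
 proof -
  have "splitting_ideal p e R B = ?J e" using splitting_ideal_eq[OF E B(2), of e] by (simp add: rnd_def)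
  thus ?thesis using ring_length_Quot[OF R cofD(1)[OF J] cofD(2)[OF J], of e] dim by (simp add: ratio_def lam_def)
 qed
 ultimately show ?thesis by (simp add: F_signature_def)
qed

end

section \<open>Freeness over the p-th powers at a height one prime\<close>

lemma smod_gens_ideal: "finite G ==> smod B I ==> smod B X ==> smod B (gens X I G)"
 by (induction G rule: finite_induct) (auto simp: gens_empty gens_insert smod_adj)

text \<open>For submodules of a field the usual proof eliminates one generator at a time.\<close>

lemma nakayama:
 assumes "finite G" and B: "subdom B" "smod B I" "I <= B" and u: "!!a. a \<in> I ==> 1 - a ~= 0 & 1 / (1 - a) \<in> B"
  and X: "smod B X" and G: "!!g. g \<in> G ==> g \<in> gens X I G"
 shows "G <= X" using assms(1) G
proof (induction G rule: finite_induct)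
 case (insert h G)
 let ?Y = "gens X I G"
 have Y: "smod B ?Y" by (rule smod_gens_ideal[OF insert(1) B(2) X])
 have e: "gens X I (insert h G) = adj ?Y h I" by (rule gens_insert[OF insert(1,2)])
 obtain n a where na: "h = n + a * h" "n \<in> ?Y" "a \<in> I" using insert.prems[of h] e by (auto simp: adj_def)
 have "h = 1 / (1 - a) * n" using na(1) u[OF na(3)] by (simp add: field_simps)
 hence h: "h \<in> ?Y" using smodD(3)[OF Y _ na(2)] u[OF na(3)] by metis
 have "adj ?Y h I <= ?Y"
 proof
  fix y assume "y \<in> adj ?Y h I"
  then obtain n a where "y = n + a * h" "n \<in> ?Y" "a \<in> I" by (auto simp: adj_def)
  thus "y \<in> ?Y" using smodD(2)[OF Y _ smodD(3)[OF Y _ h]] B(3) by blast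
 qed
 hence GX: "G <= X" using insert.IH insert.prems e by blast
 have "?Y <= gens X B G" using B(3) unfolding gens_def by blast
 hence "?Y <= X" using gens_subset[OF X order_refl GX] by blast
 thus ?case using h GX by blast
qed simp

lemma (in pchar) sum_p_image:
 assumes "finite X"
 shows "(\<Sum>i\<in>X. (c i :: 'k) ^ p * \<phi> i) = (\<Sum>g\<in>\<phi> ` X. (\<Sum>i\<in>{i\<in>X. \<phi> i = g}. c i) ^ p * g)"
proof -
 have "(\<Sum>i\<in>X. c i ^ p * \<phi> i) = (\<Sum>g\<in>\<phi> ` X. \<Sum>i\<in>{i\<in>X. \<phi> i = g}. c i ^ p * \<phi> i)" by (rule sum.image_gen[OF assms])
 also have "\<dots> = (\<Sum>g\<in>\<phi> ` X. (\<Sum>i\<in>{i\<in>X. \<phi> i = g}. c i) ^ p * g)"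
  unfolding fsum sum_distrib_right by (intro sum.cong refl) auto
 finally show ?thesis .
qed

context nfdring
begin

lemma ht1_degrees:
 assumes Q: "ht1 Q" and n0: "pdegree p R {0} n0" "pdegree p R Q n1"
 shows "n0 = p * n1"
proof (rule kunz_step[OF zero_prime[OF R] ht1_prime[OF Q] _ _ n0])
 show "{0} < Q" using smodD(1)[OF prime_inD(1)[OF ht1_prime[OF Q]]] Q by (auto simp: ht1_def')
 show "q = Q" if "prime_in R q" "{0} < q" "q <= Q" for q using ht1_eq[OF Q] that by blast
qed

lemma coht_ht1: assumes Q: "ht1 Q" shows "Suc (coht R Q) = d"
proof -
 obtain n0 n1 where n0: "pdegree p R {0} n0" "pdegree p R Q n1" using pdegree_exists[OF zero_prime[OF R]] pdegree_exists[OF ht1_prime[OF Q]] by blast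
 obtain k where k: "kap = enat k" "k > 0" by (rule kap_finite)
 have "n0 = p ^ d * k" "n1 = p ^ coht R Q * k" using pdegree_coht[OF zero_prime[OF R] n0(1)] pdegree_coht[OF ht1_prime[OF Q] n0(2)] k coht_zero
  by (simp_all add: of_nat_eq_enat)
 hence "p ^ d * k = p ^ Suc (coht R Q) * k" using ht1_degrees[OF Q n0] by (metis mult.assoc power_Suc)
 hence "p ^ d = p ^ Suc (coht R Q)" using k(2) unfolding mult_cancel2 by blast
 thus ?thesis using p_gt1(1) power_inject_exp[of p d "Suc (coht R Q)"] by simp
qed

text \<open>The powers of a uniformizer up to \<open>p-1\<close>, times lifts of generators of the residue field over its p-th powers,
 generate modulo \<open>t\<^sup>p\<close>, and \<open>t\<^sup>p\<close> lies in the maximal ideal of the ring of p-th powers: Nakayama's lemma applies.\<close>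

lemma loc_generators:
 assumes Q: "ht1 Q" and G: "pgen p R Q G s" and t: "uniformizer R Q t" "t \<in> Q"
 defines "G' \<equiv> (%i. t ^ fst i * snd i) ` ({..<p} \<times> G)"
 shows "x \<in> loc Q ==> \<exists>c. (\<forall>g\<in>G'. c g \<in> loc Q) & x = (\<Sum>g\<in>G'. c g ^ p * g)"
proof -
 let ?A = "loc Q" and ?M = "locm Q"
 interpret A: fring p ?A ?M by (rule fring_loc[OF ht1_prime[OF Q]])
 have pG: "pgen p ?A ?M G s" by (rule pgen_loc[OF ht1_prime[OF Q] ht1_prime[OF Q] order_refl G])
 have s: "s ~= 0" "1 / s \<in> ?A" using pG A.units[of s] smodD(1)[OF A.m(1)] by (auto simp: pgen_def)
 note B = subdom_pw[OF A.R]
 have fG': "finite G'" using G by (auto simp: G'_def pgen_def)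
 define X where "X = gens {0} (pw ?A) G'"
 have X: "smod (pw ?A) X" unfolding X_def by (rule smod_gens[OF fG' B]) (auto simp: smod_def)
 have G'X: "G' <= X" unfolding X_def using gens_mem[OF fG' B] by blast
 have sumX: "(\<Sum>g\<in>F. c g ^ p * h g) \<in> X" if "!!g. g \<in> F ==> c g \<in> ?A & h g \<in> X" for F :: "'k set" and c h
  by (rule smod_sum[OF X]) (use smodD(3)[OF X] that in "auto simp: pw_def")
 have step: "\<exists>c y. (\<forall>g\<in>G. c g \<in> ?A) & y \<in> ?A & x = (\<Sum>g\<in>G. c g ^ p * g) + t * y" if x: "x \<in> ?A" for x
 proof -
  obtain c where c: "\<forall>g\<in>G. c g \<in> ?A" "s ^ p * x - (\<Sum>g\<in>G. c g ^ p * g) \<in> ?M" using pG x by (auto simp: pgen_def)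
  then obtain y where y: "y \<in> ?A" "s ^ p * x - (\<Sum>g\<in>G. c g ^ p * g) = t * y" using t(1) by (auto simp: uniformizer_def localization_ext)
  have "x = (1 / s) ^ p * ((\<Sum>g\<in>G. c g ^ p * g) + t * y)" using s y(2)[symmetric] by (simp add: power_divide)
  hence "x = (\<Sum>g\<in>G. (1 / s * c g) ^ p * g) + t * ((1 / s) ^ p * y)"
   unfolding distrib_left sum_distrib_left power_mult_distrib by (simp only: ac_simps)
  moreover have "1 / s * c g \<in> ?A" if "g \<in> G" for g using A.Rs(4)[OF s(2)] c(1) that by blast
  moreover have "(1 / s) ^ p * y \<in> ?A" by (rule A.Rs(4)[OF A.Rs(7)[OF s(2)] y(1)])
  ultimately show ?thesis by (intro exI[of _ "%g. 1 / s * c g"] exI[of _ "(1 / s) ^ p * y"]) blast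
 qed
 have iter: "k <= p ==> \<exists>n\<in>X. \<exists>y\<in>?A. x = n + t ^ k * y" if "x \<in> ?A" for x k
 proof (induction k)
  case 0
  show ?case using that smodD(1)[OF X] by (intro bexI[of _ 0] bexI[of _ x]) auto
 next
  case (Suc k)
  then obtain n y where n: "n \<in> X" "y \<in> ?A" "x = n + t ^ k * y" by auto
  obtain c y' where c: "\<forall>g\<in>G. c g \<in> ?A" "y' \<in> ?A" "y = (\<Sum>g\<in>G. c g ^ p * g) + t * y'" using step[OF n(2)] by blast
  have "(\<Sum>g\<in>G. c g ^ p * (t ^ k * g)) \<in> X"
  proof (rule sumX)
   fix g assume g: "g \<in> G"
   hence "t ^ k * g \<in> G'" unfolding G'_def using Suc(2) by (intro image_eqI[of _ _ "(k, g)"]) auto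
   thus "c g \<in> ?A & t ^ k * g \<in> X" using c(1) g G'X by blast
  qed
  moreover have "x = (n + (\<Sum>g\<in>G. c g ^ p * (t ^ k * g))) + t ^ Suc k * y'"
   unfolding n(3) c(3) by (simp add: distrib_left sum_distrib_left ac_simps)
  ultimately show ?case using smodD(2)[OF X n(1)] c(2) by blast
 qed
 obtain G0 where G0: "finite G0" "G0 <= ?A" "!!x. x \<in> ?A ==> \<exists>c. (\<forall>g\<in>G0. c g \<in> ?A) & x = (\<Sum>g\<in>G0. c g ^ p * g)"
  using A.ffin by blast
 have G0X: "G0 <= X"
 proof (rule nakayama[OF G0(1) B smod_pw[OF A.m(1)] _ _ X])
  show "pw ?M <= pw ?A" using A.m(2) by (auto simp: pw_def)
  fix a assume "a \<in> pw ?M"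
  then obtain b where b: "b \<in> ?M" "a = b ^ p" by (auto simp: pw_def)
  have n: "1 - b ~: ?M"
  proof
   assume "1 - b \<in> ?M"
   hence "1 - b + b \<in> ?M" using b(1) smodD(2)[OF A.m(1)] by blast
   thus False using A.one_notin_m by simp
  qed
  have "1 - b \<in> ?A" using b(1) A.m(2) A.Rs(1,3) by blast
  hence "1 / (1 - b) \<in> ?A" using A.units n by blast
  hence "(1 / (1 - b)) ^ p \<in> pw ?A" by (auto simp: pw_def)
  moreover have "(1 - b) ^ p = 1 - a" using fdiff[of 1 b] b(2) by simp
  moreover have "1 - b ~= 0" using n smodD(1)[OF A.m(1)] by metis
  ultimately show "1 - a ~= 0 & 1 / (1 - a) \<in> pw ?A" by (metis power_divide power_not_zero power_one)
 next
  fix g assume g: "g \<in> G0"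
  obtain n y where n: "n \<in> X" "y \<in> ?A" "g = n + t ^ p * y" using iter[of g p] g G0(2) by blast
  obtain c where c: "\<forall>g\<in>G0. c g \<in> ?A" "y = (\<Sum>g\<in>G0. c g ^ p * g)" using G0(3)[OF n(2)] by blast
  have "t ^ p * y = (\<Sum>h\<in>G0. (t * c h) ^ p * h)" unfolding c(2) by (simp add: sum_distrib_left power_mult_distrib ac_simps)
  moreover have "(t * c h) ^ p \<in> pw ?M" if "h \<in> G0" for h
  proof -
   have "t * c h \<in> ?M" using t(1) c(1) that by (auto simp: uniformizer_def localization_ext)
   thus ?thesis by (simp add: pw_def)
  qed
  ultimately show "g \<in> gens X (pw ?M) G0" unfolding gens_def n(3) by (intro CollectI exI[of _ n] exI[of _ "%h. (t * c h) ^ p"]) (simp add: n(1))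
 qed
 assume "x \<in> ?A"
 then obtain c where c: "\<forall>g\<in>G0. c g \<in> ?A" "x = (\<Sum>g\<in>G0. c g ^ p * g)" using G0(3) by blast
 hence "x \<in> X" using sumX[of G0 c "%g. g"] G0X by blast
 then obtain e where e: "\<forall>g\<in>G'. e g \<in> pw ?A" "x = (\<Sum>g\<in>G'. e g * g)" by (auto simp: X_def gens_def)
 obtain e' where e': "\<forall>g\<in>G'. e' g \<in> ?A" "\<forall>g\<in>G'. e g = e' g ^ p" using e(1) by (rule pw_choice)
 have "x = (\<Sum>g\<in>G'. e' g ^ p * g)" unfolding e(2) by (rule sum.cong) (use e' in auto)
 thus ?thesis using e'(1) by blast
qed

text \<open>The general comparison involves a denominator \<open>s\<close> in an uncontrolled position. At a height one prime \<open>Q\<close>, where the ring is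
 generated over its p-th powers by the generic number of elements, \<open>s\<close> can be taken outside \<open>Q\<close>.\<close>

lemma frobenius_compare_ht1:
 assumes Q: "ht1 Q"
 obtains s where "s \<in> R" "s ~: Q"
  "!!e J. cof (Suc e) J ==> lam J <= p ^ d * lam {r \<in> R. r ^ p \<in> J} + lam (adj J (s ^ p) R)"
proof -
 obtain n0 n1 where n0: "pdegree p R {0} n0" "pdegree p R Q n1" using pdegree_exists[OF zero_prime[OF R]] pdegree_exists[OF ht1_prime[OF Q]] by blast
 obtain G s1 where G: "pgen p R Q G s1" "card G = n1" using n0(2) by (auto simp: pdegree_def)
 have fG: "finite G" "G <= R" using G(1) by (auto simp: pgen_def)
 obtain t where t: "uniformizer R Q t" "t \<in> Q" using ht1_uniformizer[OF Q] by blast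
 have tR: "t \<in> R" using t(2) prime_inD(2)[OF ht1_prime[OF Q]] by blast
 let ?A = "loc Q" and ?G = "(%i. t ^ fst i * snd i) ` ({..<p} \<times> G)"
 have fX: "finite ({..<p} \<times> G)" "finite ?G" using fG by auto
 obtain G0 where G0: "finite G0" "G0 <= R" "!!x. x \<in> R ==> \<exists>c. (\<forall>g\<in>G0. c g \<in> R) & x = (\<Sum>g\<in>G0. c g ^ p * g)"
  using ffin by blast
 have "\<forall>h\<in>G0. \<exists>c. (\<forall>g\<in>?G. c g \<in> ?A) & h = (\<Sum>g\<in>?G. c g ^ p * g)"
  using loc_generators[OF Q G(1) t] G0(2) ext_superset[OF R ht1_prime[OF Q], of R] by blast
 from bchoice[OF this] obtain C where C: "\<forall>h\<in>G0. (\<forall>g\<in>?G. C h g \<in> ?A) & h = (\<Sum>g\<in>?G. C h g ^ p * g)" ..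
 have fz: "finite (G0 \<times> ?G)" using G0 fX by simp
 have Cz: "\<forall>z\<in>G0\<times>?G. C (fst z) (snd z) \<in> ?A"
 proof
  fix z assume "z \<in> G0\<times>?G"
  hence "fst z \<in> G0" "snd z \<in> ?G" by (simp_all add: mem_Times_iff)
  thus "C (fst z) (snd z) \<in> ?A" using C by blast
 qed
 obtain s where s: "s \<in> R" "s ~: Q" "\<forall>z\<in>G0\<times>?G. s * C (fst z) (snd z) \<in> R"
  using common_denominator[OF ht1_prime[OF Q] fz Cz] by blast
 have "pgen p R {0} ?G s" unfolding pgen_def
 proof (intro conjI ballI)
  show "?G <= R" using fG tR Rs(4,7) by auto
  show "s ~: {0}" using s(2) smodD(1)[OF prime_inD(1)[OF ht1_prime[OF Q]]] by auto
  fix x assume "x \<in> R"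
  then obtain r where r: "\<forall>h\<in>G0. r h \<in> R" "x = (\<Sum>h\<in>G0. r h ^ p * h)" using G0(3) by blast
  define c where "c g = (\<Sum>h\<in>G0. r h * (s * C h g))" for g
  have cR: "\<forall>g\<in>?G. c g \<in> R"
  proof
   fix g assume g: "g \<in> ?G"
   show "c g \<in> R" unfolding c_def
   proof (rule subdom_sum[OF R])
    fix h assume "h \<in> G0"
    hence "r h \<in> R" "s * C h g \<in> R" using r(1) bspec[OF s(3), of "(h, g)"] g by auto
    thus "r h * (s * C h g) \<in> R" by (rule Rs(4))
   qed
  qed
  have "s ^ p * x = (\<Sum>h\<in>G0. \<Sum>g\<in>?G. (r h * (s * C h g)) ^ p * g)" unfolding r(2) sum_distrib_left[of _ _ G0]
  proof (rule sum.cong[OF refl])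
   fix h assume "h \<in> G0"
   hence "h = (\<Sum>g\<in>?G. C h g ^ p * g)" using C by blast
   hence "s ^ p * (r h ^ p * h) = s ^ p * (r h ^ p * (\<Sum>g\<in>?G. C h g ^ p * g))" by (rule arg_cong[of _ _ "%z. s ^ p * (r h ^ p * z)"])
   also have "\<dots> = (\<Sum>g\<in>?G. (r h * (s * C h g)) ^ p * g)"
    unfolding sum_distrib_left power_mult_distrib by (intro sum.cong refl) (simp only: ac_simps)
   finally show "s ^ p * (r h ^ p * h) = (\<Sum>g\<in>?G. (r h * (s * C h g)) ^ p * g)" .
  qed
  also have "\<dots> = (\<Sum>g\<in>?G. c g ^ p * g)" unfolding sum.swap[of _ ?G G0] c_def fsum sum_distrib_right ..
  finally have "s ^ p * x - (\<Sum>g\<in>?G. c g ^ p * g) \<in> {0}" by simp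
  thus "\<exists>c. (\<forall>g\<in>?G. c g \<in> R) & s ^ p * x - (\<Sum>g\<in>?G. c g ^ p * g) \<in> {0}" using cR by blast
 qed (use s fX in auto)
 note cmp = frobenius_compare[OF _ _ this]
 obtain k where k: "kap = enat k" "k > 0" by (rule kap_finite)
 have "card ?G <= card ({..<p} \<times> G)" by (rule card_image_le[OF fX(1)])
 also have "\<dots> = p ^ d * k" using ht1_degrees[OF Q n0] pdegree_coht[OF zero_prime[OF R] n0(1)] k coht_zero G(2)
  by (simp add: of_nat_eq_enat card_cartesian_product)
 finally have cG: "card ?G <= p ^ d * k" .
 show ?thesis
 proof (rule that[OF s(1,2)])
  fix e J assume J: "cof (Suc e) J"
  have "k * lam J <= card ?G * lam {r \<in> R. r ^ p \<in> J} + k * lam (adj J (s ^ p) R)"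
   using cmp[OF J] smodD(1)[OF cofD(1)[OF J]] k by (simp add: of_nat_eq_enat)
  also have "\<dots> <= k * (p ^ d * lam {r \<in> R. r ^ p \<in> J} + lam (adj J (s ^ p) R))"
   using mult_right_mono[OF cG, of "lam {r \<in> R. r ^ p \<in> J}"] by (simp add: algebra_simps)
  finally show "lam J <= p ^ d * lam {r \<in> R. r ^ p \<in> J} + lam (adj J (s ^ p) R)" using k(2) by simp
 qed
qed

end

section \<open>The F-signature of a pair along a prime divisor\<close>

text \<open>The element \<open>f\<close> has divisor \<open>rP\<close>.\<close>

locale pring = tring p R m d ys es for p :: nat and R m :: "'k::field set" and d ys es +
 fixes P :: "'k set" and \<Delta> :: "'k set => real" and f :: 'k and r :: nat
 assumes P: "ht1 P" and \<Delta>: "real_divisor R \<Delta>" "effective \<Delta>" and \<Delta>P: "\<Delta> P = 0"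
  and f: "f ~= 0" and r: "r >= 1" and fr: "!!Q. ht1 Q ==> ord_at R Q f = (if Q = P then int r else 0)"
begin

text \<open>The divisors \<open>\<lceil>(p\<^sup>e-1)\<Delta>\<rceil> + jP\<close>. As \<open>P\<close> is not a component of \<open>\<Delta>\<close>, those with \<open>j = \<lceil>(p\<^sup>e-1)t\<rceil>\<close> are the ones that
 belong to \<open>\<Delta> + tP\<close>.\<close>

definition FF :: "nat => nat => 'k set => int" where "FF e j = (%Q. rnd e \<Delta> Q + (if Q = P then int j else 0))"
abbreviation "J e j \<equiv> S e (FF e j)"
definition "la e j = lam (J e j)"

lemma rnd_P: "rnd e \<Delta> P = 0" by (simp add: rnd_def \<Delta>P)

lemma eff_FF: "eff (FF e j)" using eff_rnd[OF \<Delta>(2)] by (auto simp: FF_def)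

lemma cof_J: "cof e (J e j)" by (rule S_cof[OF eff_FF])

lemma J_mono: "j <= j' ==> J e j <= J e j'" by (rule S_mono) (auto simp: FF_def)

lemma la_anti: "j <= j' ==> la e j' <= la e j" unfolding la_def by (rule lam_mono[OF cof_J cof_J J_mono])

lemma P_le_m: "P <= m" by (rule prime_le_m[OF ht1_prime[OF P]])

lemma f_R: "f \<in> R" unfolding mem_R_iff using fr by (auto simp: vge_def)

lemma f_P: "f \<in> P" using vge_Q[OF P f_R] fr[OF P] r by (simp add: vge_def)

text \<open>For such \<open>x\<close> all values of the maps have positive order at \<open>P\<close>, and \<open>P \<subseteq> m\<close>.\<close>

lemma mem_J: assumes x: "x \<in> R" "vge P x (int (p ^ e) - int j)" shows "x \<in> J e j" unfolding S_iff
proof (intro conjI ballI)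
 fix h assume h: "h \<in> H e (FF e j)"
 have R1: "T e (h * x) \<in> R" by (rule H_R[OF eff_FF h x(1)])
 have "vge P (h * x) (int (p ^ e - 1) * kk P + int (p ^ e) * 1)" using vge_mult[OF P HmD[OF E h P] x(2)] by (rule vge_mono) (simp add: FF_def rnd_P)
 hence "vge P (T e (h * x)) 1" by (rule Te_vge[OF E P])
 thus "T e (h * x) \<in> m" using vge_Q[OF P R1] P_le_m by blast
qed (rule x)

lemma J_full: "j >= p ^ e ==> J e j = R"
proof (rule one_in_imp[OF cofD(1,2)[OF cof_J]])
 assume "j >= p ^ e"
 hence "int (p ^ e) <= int j" unfolding of_nat_le_iff .
 thus "1 \<in> J e j" by (intro mem_J Rs(1)) (simp add: vge_def ord_one[OF P])
qed

lemma la_full: "j >= p ^ e ==> la e j = 0" by (simp add: la_def J_full lam_R)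

lemma P_J: "P <= J e (p ^ e - 1)"
proof
 fix x assume x: "x \<in> P"
 hence xR: "x \<in> R" using prime_inD(2)[OF ht1_prime[OF P]] by blast
 have "vge P x 1" using vge_Q[OF P xR] x by simp
 hence "vge P x (int (p ^ e) - int (p ^ e - 1))" using p_gt1 by (auto simp: of_nat_diff)
 thus "x \<in> J e (p ^ e - 1)" by (rule mem_J[OF xR])
qed

definition sg :: "real => real" where "sg t = F_signature p R (%q. \<Delta> q + t * prime_divisor P q)"
definition "jt e t = nat \<lceil>(real (p ^ e) - 1) * t\<rceil>"

lemma jt_bounds: "t >= 0 ==> real (jt e t) >= (real (p ^ e) - 1) * t" "t >= 0 ==> real (jt e t) <= (real (p ^ e) - 1) * t + 1"
proof -
 assume "t >= 0"
 hence "(real (p ^ e) - 1) * t >= 0" using pe_ge1 by simp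
 thus "real (jt e t) >= (real (p ^ e) - 1) * t" "real (jt e t) <= (real (p ^ e) - 1) * t + 1" unfolding jt_def by linarith+
qed

lemma sg_LIMSEQ:
 assumes t: "t >= 0"
 shows "(%e. real (la e (jt e t)) / real p ^ (e * d)) \<longlonglongrightarrow> sg t"
proof -
 let ?B = "%q. \<Delta> q + t * prime_divisor P q"
 have B: "real_divisor R ?B" unfolding real_divisor_def
 proof (intro conjI allI impI)
  have "{q. ?B q ~= 0} <= insert P {q. \<Delta> q ~= 0}" by (auto simp: prime_divisor_def)
  thus "finite {q. ?B q ~= 0}" using \<Delta>(1) finite_subset by (auto simp: real_divisor_def)
  fix q assume "?B q ~= 0"
  thus "height_one_prime R q" using P \<Delta>(1) by (cases "q = P") (auto simp: prime_divisor_def ht1_def real_divisor_def)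
 qed
 have eB: "effective ?B" using \<Delta>(2) t by (auto simp: effective_def prime_divisor_def)
 have "rnd e ?B = FF e (jt e t)" for e
 proof
  fix Q
  have "(real (p ^ e) - 1) * t >= 0" using t pe_ge1 by simp
  hence "\<lceil>(real (p ^ e) - 1) * t\<rceil> >= 0" by linarith
  thus "rnd e ?B Q = FF e (jt e t) Q" using \<Delta>P by (simp add: rnd_def FF_def jt_def prime_divisor_def)
 qed
 thus ?thesis using F_signature_LIMSEQ[OF B eB] by (simp add: sg_def la_def ratio_def)
qed

text \<open>Ideals containing \<open>f\<close> and an element outside \<open>P\<close> live in codimension two.\<close>

lemma codim2_bound:
 assumes w: "w \<in> R" "w ~: P"
 obtains C :: real where "C >= 0" "!!e J. cof e J ==> f \<in> J ==> w \<in> J ==> real (lam J) * real p ^ (e * 2) <= C * real p ^ (e * d)"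
proof -
 let ?I = "adj (adj {0} f R) w R"
 have z: "smod R {0}" "{0} <= R" using Rs by (auto simp: smod_def)
 note I1 = smod_adj[OF z(1) RR] adj_subset[OF RR z(2) f_R]
 note I = smod_adj[OF I1(1) RR] adj_subset[OF RR I1(2) w(1)]
 have c: "coht R Q + 2 <= d" if Q: "prime_in R Q" "?I <= Q" for Q
 proof -
  have "f \<in> adj {0} f R" "w \<in> ?I" using adj_mem[of "{0}" R f] adj_mem[of "adj {0} f R" R w] Rs(1) smodD(1)[OF I1(1)] by auto
  hence fw: "f \<in> Q" "w \<in> Q" using Q(2) adj_supset[OF Rs(2), of "adj {0} f R" w] by auto
  have "x \<in> Q" if x: "x \<in> P" for x
  proof -
   have xR: "x \<in> R" using x prime_inD(2)[OF ht1_prime[OF P]] by blast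
   have "x ^ r / f \<in> R" unfolding mem_R_iff
   proof (intro allI impI)
    fix Q' assume Q': "ht1 Q'"
    have "vge Q' x (if Q' = P then 1 else 0)" using vge_Q[OF P xR] x vge_R[OF Q' xR] by simp
    from vge_power[OF Q' this, of r] have "vge Q' (f * (x ^ r / f)) (int r * (if Q' = P then 1 else 0))" using f by simp
    thus "vge Q' (x ^ r / f) 0" unfolding vge_scale[OF Q' f] fr[OF Q'] by (simp split: if_splits)
   qed
   hence "x ^ r / f * f \<in> Q" using smodD(3)[OF prime_inD(1)[OF Q(1)] _ fw(1)] by blast
   thus "x \<in> Q" using f prime_power_notin[OF R Q(1) xR] by (auto simp: )
  qed
  hence "P < Q" using fw w by blast
  thus ?thesis using coht_less[OF ht1_prime[OF P] Q(1)] coht_ht1[OF P] by simp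
 qed
 obtain C :: real where C: "C >= 0" "!!e J. cof e J ==> ?I <= J ==> real (lam J) * real p ^ (e * 2) <= C * real p ^ (e * d)"
  using hilbert_kunz_bound[OF I c] by metis
 show ?thesis
 proof (rule that[OF C(1)])
  fix e J assume J: "cof e J" "f \<in> J" "w \<in> J"
  have "?I <= J" by (intro adj_subset[OF cofD(1)[OF J(1)]] J) (use smodD(1)[OF cofD(1)[OF J(1)]] in simp)
  thus "real (lam J) * real p ^ (e * 2) <= C * real p ^ (e * d)" using C(2)[OF J(1)] by simp
 qed
qed

definition "dl e j = lam (adj (J e j) f R)"

text \<open>The differences of \<open>la\<close> at distance \<open>r\<close> are themselves colengths, of ideals that increase with \<open>j\<close>. This is the convexity of \<open>la\<close>.\<close>

lemma la_dl: "la e j = la e (j + r) + dl e j"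
proof -
 have "{x \<in> R. x * f \<in> J e j} = J e (j + r)" by (rule S_colon[OF f_R f]) (simp add: FF_def fr)
 thus ?thesis using lam_colon[OF cof_J f_R, of e j] by (simp add: la_def dl_def)
qed

lemma dl_anti: "j <= j' ==> dl e j' <= dl e j"
 unfolding dl_def by (rule lam_mono[OF cof_adj[OF cof_J f_R] cof_adj[OF cof_J f_R]]) (use J_mono[of j j' e] in "auto simp: adj_def")

lemma la_multiple: "n * r <= p ^ e ==> n * la e (p ^ e - r) <= la e (p ^ e - n * r)"
proof (induction n)
 case (Suc n)
 have "dl e (p ^ e - r) = la e (p ^ e - r)" using la_dl[of e "p ^ e - r"] la_full[of e "p ^ e - r + r"] Suc by simp
 moreover have "dl e (p ^ e - r) <= dl e (p ^ e - Suc n * r)" by (rule dl_anti) (use Suc in simp)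
 moreover have "p ^ e - Suc n * r + r = p ^ e - n * r" using Suc(2) by simp
 ultimately show ?case using la_dl[of e "p ^ e - Suc n * r"] Suc by simp
qed simp

text \<open>A convex sequence that vanishes at \<open>n\<close> lies below the chord.\<close>

lemma la_convex: "n * r >= p ^ e ==> a <= n ==> n * la e (a * r) <= (n - a) * la e 0"
proof -
 assume n: "n * r >= p ^ e" "a <= n"
 let ?D = "dl e (a * r)"
 have 1: "a * ?D <= la e 0 - la e (a * r) & la e (a * r) <= la e 0"
 proof -
  have "k <= a ==> k * ?D + la e (k * r) <= la e 0" for k
  proof (induction k)
   case (Suc k)
   have "?D <= dl e (k * r)" by (rule dl_anti) (use Suc in simp)
   thus ?case using la_dl[of e "k * r"] Suc by (simp add: add.commute)
  qed simp
  from this[of a] show ?thesis by simp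
 qed
 have "la e (a * r) <= k * ?D + la e ((a + k) * r)" for k
 proof (induction k)
  case (Suc k)
  have "dl e ((a + k) * r) <= ?D" by (rule dl_anti) simp
  thus ?case using la_dl[of e "(a + k) * r"] Suc by (simp add: algebra_simps)
 qed simp
 from this[of "n - a"] have 2: "la e (a * r) <= (n - a) * ?D" using n la_full[of e "n * r"] by simp
 have "a * la e (a * r) <= (n - a) * (a * ?D)" using mult_left_mono[OF 2, of a] by (simp add: ac_simps)
 also have "\<dots> <= (n - a) * (la e 0 - la e (a * r))" using 1 by (intro mult_left_mono) auto
 finally have "a * la e (a * r) + (n - a) * la e (a * r) <= (n - a) * la e 0"
  using 1 by (simp add: diff_mult_distrib2) (metis le_diff_conv2 mult_le_mono2)
 thus ?thesis using n(2) by (metis add_mult_distrib le_add_diff_inverse)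
qed

text \<open>A uniformizer \<open>t\<close> at \<open>P\<close> has \<open>f\<close> as its \<open>r\<close>-th power up to factors outside \<open>P\<close>. So \<open>\<lambda>(q-r)\<close> is, up to an error in
 codimension two, \<open>r\<close> times \<open>\<lambda>(q-1)\<close>.\<close>

lemma la_steps:
 obtains C :: real where "C >= 0" "!!e. r <= p ^ e ==> \<exists>L. r * la e (p ^ e - 1) <= la e (p ^ e - r) + r * L &
  real L * real p ^ (e * 2) <= C * real p ^ (e * d)"
proof -
 obtain t where t: "t ~= 0" "t \<in> P" "uniformizer R P t" using ht1_uniformizer[OF P] by blast
 have tR: "t \<in> R" using t(2) prime_inD(2)[OF ht1_prime[OF P]] by blast
 let ?F = "{Q. ht1 Q & ord_at R Q t ~= 0} - {P}"
 have fF: "finite ?F" using finite_ord[OF t(1)] by simp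
 hence "finite ((%Q. r * nat (ord_at R Q t)) ` ?F)" by simp
 then obtain M where M: "\<forall>n\<in>(%Q. r * nat (ord_at R Q t)) ` ?F. n <= M" unfolding finite_nat_set_iff_bounded_le ..
 obtain w where w: "w \<in> R" "w ~: P" "!!Q. Q \<in> ?F ==> ord_at R Q w >= int M" using exists_high_order[OF fF _ P, of M] by blast
 have w0: "w ~= 0" "ord_at R P w = 0" using ord_R_notin[OF P w(1,2)] by auto
 obtain C :: real where C: "C >= 0" "!!e J. cof e J ==> f \<in> J ==> w \<in> J ==> real (lam J) * real p ^ (e * 2) <= C * real p ^ (e * d)"
  using codim2_bound[OF w(1,2)] by metis
 show ?thesis
 proof (rule that[OF C(1)])
  fix e assume re: "r <= p ^ e"
  let ?q = "p ^ e" and ?A = "adj (J e (p ^ e - 1)) w R"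
  have A: "cof e ?A" by (rule cof_adj[OF cof_J w(1)])
  have "w \<in> ?A" by (rule adj_mem[OF smodD(1)[OF cofD(1)[OF cof_J]] Rs(1)])
  moreover have "f \<in> ?A" using f_P P_J[of e] adj_supset[OF Rs(2), of "J e (p ^ e - 1)" w] by blast
  ultimately have L: "real (lam ?A) * real p ^ (e * 2) <= C * real p ^ (e * d)" using C(2)[OF A] by blast
  \<comment> \<open>Compare \<open>J(q-i-1)\<close> with its colon by \<open>t\<^sup>i\<close>, which is \<open>J(q-1)\<close> up to the factor \<open>w\<close>, and with \<open>J(q-i)\<close>, which contains \<open>t\<^sup>i\<close>.\<close>
  have "i <= r ==> i * la e (?q - 1) <= la e (?q - i) + i * lam ?A" for i
  proof (induction i)
   case (Suc i)
   let ?j = "?q - Suc i" and ?x = "t ^ i"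
   have j: "Suc ?j = ?q - i" "?j + i = ?q - 1" using Suc(2) re by auto
   have x: "?x \<in> R" "?x ~= 0" using tR Rs(7) t(1) by auto
   define F' where "F' = (%Q. FF e ?j Q + ord_at R Q ?x)"
   have K: "{y \<in> R. y * ?x \<in> J e ?j} = S e F'" by (rule S_colon[OF x]) (simp add: F'_def)
   have cK: "cof e (S e F')" using cof_colon[OF cof_J x(1), of e ?j] K by simp
   have W: "{y \<in> R. y * w \<in> J e (?q - 1)} = S e (%Q. FF e (?q - 1) Q + ord_at R Q w)" by (rule S_colon[OF w(1) w0(1)]) simp
   have "S e F' <= {y \<in> R. y * w \<in> J e (?q - 1)}" unfolding W
   proof (rule S_mono)
    fix Q assume Q: "ht1 Q"
    have o: "ord_at R Q ?x = int i * ord_at R Q t" by (rule ord_power[OF Q t(1)])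
    show "F' Q <= FF e (?q - 1) Q + ord_at R Q w"
    proof (cases "Q = P")
     case True
     thus ?thesis unfolding F'_def o using ord_uniformizer[OF P t(3)] w0(2) j(2) by (simp add: FF_def)
    next
     case False
     have ot: "ord_at R Q t >= 0" by (rule ord_R[OF Q tR t(1)])
     have "int i * ord_at R Q t <= ord_at R Q w"
     proof (cases "ord_at R Q t = 0")
      case True
      thus ?thesis using ord_R[OF Q w(1) w0(1)] by simp
     next
      case F: False
      hence "r * nat (ord_at R Q t) <= M" using M Q False by blast
      hence "int r * ord_at R Q t <= int M" using ot by (metis nat_0_le of_nat_le_iff of_nat_mult)
      moreover have "int i * ord_at R Q t <= int r * ord_at R Q t" using Suc(2) ot by (intro mult_right_mono) auto
      ultimately show ?thesis using w(3)[of Q] Q F False by fastforce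
     qed
     thus ?thesis unfolding F'_def o using False by (simp add: FF_def)
    qed
   qed
   hence 1: "lam {y \<in> R. y * w \<in> J e (?q - 1)} <= lam (S e F')" by (rule lam_mono[OF cK cof_colon[OF cof_J w(1)]])
   have "?x \<in> J e (?q - i)"
   proof (rule mem_J[OF x(1)])
    have "i <= ?q" using Suc(2) re by simp
    hence "int ?q - int (?q - i) = int i" by (simp only: of_nat_diff)
    thus "vge P ?x (int ?q - int (?q - i))" using ord_power[OF P t(1), of i] ord_uniformizer[OF P t(3)] by (simp add: vge_def)
   qed
   hence "adj (J e ?j) ?x R <= J e (?q - i)" using j(1) by (intro adj_subset[OF cofD(1)[OF cof_J] J_mono]) auto
   hence "la e (?q - i) <= lam (adj (J e ?j) ?x R)" unfolding la_def by (rule lam_mono[OF cof_adj[OF cof_J x(1)] cof_J])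
   thus ?case using 1 Suc lam_colon[OF cof_J x(1), of e ?j] lam_colon[OF cof_J w(1), of e "?q - 1"] K by (simp add: la_def)
  qed simp
  from this[of r] show "\<exists>L. r * la e (?q - 1) <= la e (?q - r) + r * L & real L * real p ^ (e * 2) <= C * real p ^ (e * d)" using L by blast
 qed
qed

lemma d_pos: "d = Suc (d - 1)" using coht_ht1[OF P] by simp

text \<open>Together with \<open>sg_upper\<close>, this puts \<open>s(R, \<Delta> + tP)\<close> between two linear functions that vanish at \<open>t = 1\<close>.\<close>
lemma sg_lower:
 assumes A: "(%e. real (la e (p ^ e - 1)) / real p ^ (e * (d - 1))) \<longlonglongrightarrow> A" and t: "0 <= t" "t <= 1"
 shows "(1 - t) * A <= sg t"
proof -
 obtain C :: real where C: "C >= 0" "!!e. r <= p ^ e ==> \<exists>L. r * la e (p ^ e - 1) <= la e (p ^ e - r) + r * L &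
  real L * real p ^ (e * 2) <= C * real p ^ (e * d)" using la_steps by metis
 let ?Q = "%e. real p ^ e" and ?a = "%e. real (la e (p ^ e - 1)) / real p ^ (e * (d - 1))"
 let ?b = "%e. ((1 - t) - ((1 - t) + real r) / ?Q e) * ?a e - C / ?Q e"
 note Q = null_geometric
 have "?b \<longlonglongrightarrow> ((1 - t) - 0) * A - 0" by (intro tendsto_intros A Q)
 hence "?b \<longlonglongrightarrow> (1 - t) * A" by simp
 moreover have bnd: "?b e <= real (la e (jt e t)) / real p ^ (e * d)" if re: "r <= p ^ e" for e
 proof -
  obtain L where L: "r * la e (p ^ e - 1) <= la e (p ^ e - r) + r * L" "real L * real p ^ (e * 2) <= C * real p ^ (e * d)" using C(2)[OF re] by blast
  let ?q = "p ^ e" and ?j = "jt e t"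
  have jq: "?j <= ?q"
  proof -
   have "real ?j <= (real ?q - 1) * t + 1" "(real ?q - 1) * t <= real ?q - 1"
    using jt_bounds(2)[OF t(1), of e] mult_left_mono[OF t(2) pe_ge1[of e]] by auto
   thus ?thesis by linarith
  qed
  define n where "n = (?q - ?j) div r"
  have n: "n * r <= ?q - ?j" "?q - ?j <= n * r + r"
   unfolding n_def using r div_times_less_eq_dividend[of "?q - ?j" r] dividend_less_div_times[of r "?q - ?j"] by (auto simp: add.commute)
  have nq: "n * r <= ?q" "?j <= ?q - n * r" using n(1) jq by auto
  have "n * r * la e (?q - 1) <= n * (la e (?q - r) + r * L)" using mult_left_mono[OF L(1), of n] by (simp add: mult.assoc)
  also have "\<dots> <= la e ?j + n * r * L" using la_multiple[OF nq(1)] la_anti[OF nq(2), of e] by (simp add: algebra_simps)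
  also have "\<dots> <= la e ?j + ?q * L" using nq(1) by (simp add: mult_right_mono)
  finally have 1: "real (n * r) * real (la e (?q - 1)) <= real (la e ?j) + ?Q e * real L" by (metis of_nat_add of_nat_le_iff of_nat_mult of_nat_power)
  have "(?Q e - 1) * (1 - t) - real r <= real (n * r)"
  proof -
   have "real ?q <= real ?j + real (n * r) + real r" using n(2) jq by linarith
   thus ?thesis using jt_bounds(2)[OF t(1), of e] by (simp add: algebra_simps)
  qed
  hence "((?Q e - 1) * (1 - t) - real r) * real (la e (?q - 1)) <= real (n * r) * real (la e (?q - 1))" by (rule mult_right_mono) simp
  hence 2: "((?Q e - 1) * (1 - t) - real r) * real (la e (?q - 1)) - ?Q e * real L <= real (la e ?j)" using 1 by linarith
  have pd: "real p ^ (e * d) = ?Q e * real p ^ (e * (d - 1))" using d_pos by (metis mult_Suc_right power_add)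
  have 3: "?Q e * real L / real p ^ (e * d) <= C / ?Q e"
   using L(2) pp[of e] pp[of "e * d"] by (simp add: divide_simps power_mult power2_eq_square mult.assoc mult.commute mult.left_commute)
  have "?b e <= (((?Q e - 1) * (1 - t) - real r) * real (la e (?q - 1)) - ?Q e * real L) / real p ^ (e * d)"
  proof -
   have "((?Q e - 1) * (1 - t) - real r) * real (la e (?q - 1)) / real p ^ (e * d) = ((1 - t) - ((1 - t) + real r) / ?Q e) * ?a e"
    unfolding pd using pp[of e] by (simp add: field_simps)
   thus ?thesis using 3 by (simp add: diff_divide_distrib)
  qed
  also have "\<dots> <= real (la e ?j) / real p ^ (e * d)" by (rule divide_right_mono[OF 2]) simp
  finally show ?thesis .
 qed
 hence "\<exists>N. \<forall>e\<ge>N. ?b e <= real (la e (jt e t)) / real p ^ (e * d)"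
 proof -
  have "r <= p ^ e" if "e >= r" for e using that less_exp[of e] power_mono[OF p_gt1(2), of e] by linarith
  thus ?thesis using bnd by blast
 qed
 ultimately show ?thesis using LIMSEQ_le sg_LIMSEQ[OF t(1)] by blast
qed

lemma sg_upper:
 assumes t: "0 <= t" "t <= 1"
 shows "sg t <= (1 - t) * sg 0"
proof -
 let ?Q = "%e. real p ^ e" and ?u = "%j e. real (la e j) / real p ^ (e * d)"
 let ?b = "%e. ((1 - t) + (2 * real r + t) / ?Q e) * ?u (jt e 0) e"
 note Q = null_geometric
 have "?b \<longlonglongrightarrow> ((1 - t) + 0) * sg 0" by (intro tendsto_intros sg_LIMSEQ Q) simp
 hence "?b \<longlonglongrightarrow> (1 - t) * sg 0" by simp
 moreover have "?u (jt e t) e <= ?b e" for e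
 proof -
  let ?q = "p ^ e" and ?j = "jt e t"
  define n a where "n = Suc (?q div r)" and "a = ?j div r"
  have n: "?q <= n * r" "real n * real r <= ?Q e + real r"
   unfolding n_def using r dividend_less_div_times[of r ?q] div_times_less_eq_dividend[of ?q r]
   by (auto simp: distrib_right add.commute simp flip: of_nat_mult of_nat_power)
  have jr: "a * r <= ?j" "real ?j <= real a * real r + real r"
   unfolding a_def using r dividend_less_div_times[of r ?j] div_times_less_eq_dividend[of ?j r] by (auto simp flip: of_nat_mult of_nat_add)
  have jq: "?j <= ?q"
  proof -
   have "real ?j <= (real ?q - 1) * t + 1" "(real ?q - 1) * t <= real ?q - 1"
    using jt_bounds(2)[OF t(1), of e] mult_left_mono[OF t(2) pe_ge1[of e]] by auto
   thus ?thesis by linarith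
  qed
  have an: "a <= n" unfolding n_def a_def using div_le_mono[OF jq, of r] by simp
  have "n * la e ?j <= n * la e (a * r)" using la_anti[OF jr(1)] by simp
  also have "\<dots> <= (n - a) * la e 0" by (rule la_convex[OF n(1) an])
  finally have 1: "real n * real (la e ?j) <= (real n - real a) * real (la e 0)" using an by (metis of_nat_diff of_nat_le_iff of_nat_mult)
  have "?Q e * real (la e ?j) <= real n * real r * real (la e ?j)" using n(1) by (intro mult_right_mono) (auto simp flip: of_nat_mult of_nat_power)
  also have "\<dots> <= (real n * real r - real a * real r) * real (la e 0)" using mult_left_mono[OF 1, of "real r"] by (simp add: algebra_simps)
  also have "\<dots> <= (?Q e * (1 - t) + t + 2 * real r) * real (la e 0)"
  proof (rule mult_right_mono)
   show "real n * real r - real a * real r <= ?Q e * (1 - t) + t + 2 * real r"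
    using n(2) jr(2) jt_bounds(1)[OF t(1), of e] by (simp add: algebra_simps)
  qed simp
  finally have 2: "real (la e ?j) <= ((1 - t) + (2 * real r + t) / ?Q e) * real (la e 0)" using pp[of e] by (simp add: field_simps)
  have "jt e 0 = 0" by (simp add: jt_def)
  thus ?thesis using divide_right_mono[OF 2, of "real p ^ (e * d)"] by simp
 qed
 ultimately show ?thesis using LIMSEQ_le[OF sg_LIMSEQ[OF t(1)]] by blast
qed

lemma power_bound:
 assumes "!!J'. cof e J' ==> I <= J' ==> f \<in> J' ==> lam J' <= b"
 shows "cof e I ==> f ^ a \<in> I ==> lam I <= a * b" using assms
proof (induction a arbitrary: I)
 case 0
 hence "I = R" using one_in_imp[OF cofD(1,2)[OF 0(1)]] by simp
 thus ?case using lam_R by simp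
next
 case (Suc a)
 let ?K = "{x \<in> R. x * f \<in> I}"
 have K: "cof e ?K" by (rule cof_colon[OF Suc(2) f_R])
 have JK: "I <= ?K" using cofD(2)[OF Suc(2)] smodD(4)[OF cofD(1)[OF Suc(2)] f_R] by blast
 have "lam ?K <= a * b"
 proof (rule Suc.IH[OF K])
  show "f ^ a \<in> ?K" using Suc(3) Rs(7)[OF f_R] by (simp add: mult.commute)
  show "lam J' <= b" if "cof e J'" "?K <= J'" "f \<in> J'" for J' using Suc(4)[OF that(1) _ that(3)] JK that(2) by blast
 qed
 moreover have "f \<in> adj I f R" by (rule adj_mem[OF smodD(1)[OF cofD(1)[OF Suc(2)]] Rs(1)])
 hence "lam (adj I f R) <= b" by (intro Suc(4) cof_adj[OF Suc(2) f_R] adj_supset[OF Rs(2)])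
 ultimately show ?case using lam_colon[OF Suc(2) f_R] by simp
qed

text \<open>At \<open>t = 1 - p\<^sup>-\<^sup>e\<^sup>0\<close> the divisors of the levels \<open>e0 + i\<close> are exactly \<open>p\<^sup>i(p\<^sup>e\<^sup>0-1)P\<close> at \<open>P\<close>, so that Frobenius maps the ideal of
 one level into that of the next up to a factor outside \<open>P\<close>. The errors concern ideals that contain an element outside \<open>P\<close> and
 the \<open>p\<^sup>i\<close>-th power of \<open>f\<close>; being of codimension two, they sum up to a constant times \<open>p\<^sup>-\<^sup>2\<^sup>e\<^sup>0\<close>, independently of \<open>e0\<close>.\<close>

lemma sg_near_1:
 obtains C :: real where "C >= 0"
  "!!e0. sg (1 - 1 / real p ^ e0) <= real (la e0 (p ^ e0 - 1)) / real p ^ (e0 * d) + C / real p ^ (2 * e0)"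
proof -
 obtain s where s: "s \<in> R" "s ~: P" and fc: "!!e J. cof (Suc e) J ==>
   lam J <= p ^ d * lam {r \<in> R. r ^ p \<in> J} + lam (adj J (s ^ p) R)" by (rule frobenius_compare_ht1[OF P]) (assumption | rule that)+
 have sp: "s ^ p \<in> R" "s ^ p ~: P" using s Rs(7) prime_power_notin[OF R ht1_prime[OF P]] by auto
 have "ht1 Q" if "\<Delta> Q ~= 0" for Q using \<Delta>(1) that by (auto simp: real_divisor_def ht1_def)
 \<comment> \<open>At the components of \<open>\<Delta>\<close>, the factor \<open>w\<close> absorbs the rounding between consecutive levels.\<close>
 then obtain w where w: "w \<in> R" "w ~: P" "!!Q. Q \<in> {Q. \<Delta> Q ~= 0} ==> ord_at R Q w >= int p"
  using exists_high_order[of "{Q. \<Delta> Q ~= 0}" P p] \<Delta>(1) P \<Delta>P by (auto simp: real_divisor_def)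
 have w0: "w ~= 0" using ord_R_notin[OF P w(1,2)] by simp
 obtain C1 :: real where C1: "C1 >= 0" "!!e J. cof e J ==> f \<in> J ==> s ^ p \<in> J ==> real (lam J) * real p ^ (e * 2) <= C1 * real p ^ (e * d)"
  using codim2_bound[OF sp] by metis
 obtain C2 :: real where C2: "C2 >= 0" "!!e J. cof e J ==> f \<in> J ==> w \<in> J ==> real (lam J) * real p ^ (e * 2) <= C2 * real p ^ (e * d)"
  using codim2_bound[OF w(1,2)] by metis
 \<comment> \<open>The bounds in codimension two are for ideals containing \<open>f\<close>; with \<open>f\<^sup>a\<close> instead, the colength is at most \<open>a\<close> times as large.\<close>
 have small: "real (lam J) / real p ^ (e * d) <= C * real a / real p ^ (e * 2)"
  if C: "C >= 0" "!!e J. cof e J ==> f \<in> J ==> v \<in> J ==> real (lam J) * real p ^ (e * 2) <= C * real p ^ (e * d)"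
   and J: "cof e J" "v \<in> J" "f ^ a \<in> J" for C v e J a
 proof -
  define b where "b = nat \<lfloor>C * real p ^ (e * d) / real p ^ (e * 2)\<rfloor>"
  have b: "real b <= C * real p ^ (e * d) / real p ^ (e * 2)" unfolding b_def using C(1) by simp
  have "lam J <= a * b"
  proof (rule power_bound[OF _ J(1,3)])
   fix J' assume "cof e J'" "J <= J'" "f \<in> J'"
   hence "real (lam J') <= C * real p ^ (e * d) / real p ^ (e * 2)" using C(2)[of e J'] J(2) pp[of "e * 2"] by (auto simp: pos_le_divide_eq)
   thus "lam J' <= b" unfolding b_def by linarith
  qed
  hence "real (lam J) <= real a * real b" by (metis of_nat_le_iff of_nat_mult)
  also have "\<dots> <= real a * (C * real p ^ (e * d) / real p ^ (e * 2))" using b by (rule mult_left_mono) simp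
  finally show ?thesis using pp[of "e * d"] pp[of "e * 2"] by (simp add: field_simps)
 qed
 show ?thesis
 proof (rule that[of "C1 + C2"])
  fix e0
  let ?q0 = "p ^ e0" and ?t = "1 - 1 / real p ^ e0"
  define I where "I i = J (e0 + i) (p ^ i * (?q0 - 1))" for i
  define b where "b i = real (lam (I i)) / real p ^ ((e0 + i) * d)" for i
  have jt: "jt (e0 + i) ?t = p ^ i * (?q0 - 1)" for i
  proof -
   have q: "real ?q0 >= 1" "real (?q0 - 1) = real ?q0 - 1" using p_gt1 by (auto simp: of_nat_diff Suc_leI)
   have "(real (p ^ (e0 + i)) - 1) * ?t = real (p ^ i) * (real ?q0 - 1) - (1 - 1 / real ?q0)" using q p_gt1 by (simp add: power_add field_simps)
   also have "\<lceil>\<dots>\<rceil> = int (p ^ i * (?q0 - 1))"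
   proof (rule ceiling_unique)
    have "1 / real ?q0 > 0" "1 / real ?q0 <= 1" using q(1) le_divide_eq_1[of 1 "real ?q0"] by (auto simp only: divide_le_eq_1 zero_less_divide_1_iff)
    thus "real_of_int (int (p ^ i * (?q0 - 1))) - 1 < real (p ^ i) * (real ?q0 - 1) - (1 - 1 / real ?q0)"
     "real (p ^ i) * (real ?q0 - 1) - (1 - 1 / real ?q0) <= real_of_int (int (p ^ i * (?q0 - 1)))" using q(2) by auto
   qed
   finally show ?thesis unfolding jt_def by (simp only: nat_int)
  qed
  have t0: "?t >= 0" using p_gt1 by simp
  have lim: "b \<longlonglongrightarrow> sg ?t"
   using LIMSEQ_ignore_initial_segment[OF sg_LIMSEQ[OF t0], of e0] jt unfolding b_def I_def la_def by (simp add: add.commute)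
  have step: "b (Suc i) <= b i + (C1 + C2) / real p ^ (2 * e0) * (1 / real p ^ i - 1 / real p ^ Suc i)" for i
  proof -
   let ?e = "Suc (e0 + i)"
   have cI: "cof ?e (I (Suc i))" "cof (e0 + i) (I i)" using cof_J[of ?e] cof_J[of "e0 + i"] by (auto simp: I_def)
   have fI: "f ^ (p ^ Suc i) \<in> I (Suc i)" unfolding I_def
   proof (rule mem_J[OF Rs(7)[OF f_R]])
    have "p ^ Suc i * p ^ e0 = p ^ (e0 + Suc i)" by (simp add: power_add)
    hence "int (p ^ (e0 + Suc i)) - int (p ^ Suc i * (?q0 - 1)) = int (p ^ Suc i)"
     using p_gt1 by (simp add: diff_mult_distrib2 of_nat_diff del: power_Suc)
    moreover have "int (p ^ Suc i) <= int (p ^ Suc i) * int r" using mult_left_mono[of 1 "int r" "int (p ^ Suc i)"] r by simp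
    ultimately show "vge P (f ^ p ^ Suc i) (int (p ^ (e0 + Suc i)) - int (p ^ Suc i * (?q0 - 1)))"
     using ord_power[OF P f, of "p ^ Suc i"] fr[OF P] by (simp add: vge_def del: power_Suc)
   qed
   have "w * x ^ p \<in> I (Suc i)" if "x \<in> I i" for x
   proof -
    have "w * x ^ p \<in> S (Suc (e0 + i)) (FF (Suc (e0 + i)) (p ^ Suc i * (?q0 - 1)))"
    proof (rule S_frobenius[OF w(1) w0 _ that[unfolded I_def]])
     fix Q assume Q: "ht1 Q"
     have "\<Delta> Q >= 0" using \<Delta>(2) by (simp add: effective_def)
     from rnd_step[of \<Delta> Q "e0 + i", OF this] show "int p * FF (e0 + i) (p ^ i * (?q0 - 1)) Q <=
       FF (Suc (e0 + i)) (p ^ Suc i * (?q0 - 1)) Q + ord_at R Q w"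
      using w(3)[of Q] ord_R[OF Q w(1) w0] rnd_P by (auto simp: FF_def mult.assoc split: if_splits)
    qed
    thus ?thesis by (simp add: I_def)
   qed
   hence "\<exists>J'. cof ?e J' & I (Suc i) <= J' & s ^ p \<in> J' & lam (I (Suc i)) <= p ^ d * lam (I i) + lam J' + lam (adj (I (Suc i)) w R)"
    by (intro frobenius_step[OF w(1) cI _ _ s(1)] fc)
   then obtain J' where J': "cof ?e J'" "I (Suc i) <= J'" "s ^ p \<in> J'"
    "lam (I (Suc i)) <= p ^ d * lam (I i) + lam J' + lam (adj (I (Suc i)) w R)" by blast
   let ?A = "adj (I (Suc i)) w R"
   have wA: "w \<in> ?A" "f ^ (p ^ Suc i) \<in> ?A"
    using adj_mem[OF smodD(1)[OF cofD(1)[OF cI(1)]] Rs(1)] adj_supset[OF Rs(2), of "I (Suc i)" w] fI by auto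
   have A: "real (lam ?A) / real p ^ (?e * d) <= C2 * real (p ^ Suc i) / real p ^ (?e * 2)" by (rule small[OF C2 cof_adj[OF cI(1) w(1)] wA])
   have B: "real (lam J') / real p ^ (?e * d) <= C1 * real (p ^ Suc i) / real p ^ (?e * 2)" by (rule small[OF C1 J'(1,3) subsetD[OF J'(2) fI]])
   have "real (lam (I (Suc i))) <= real p ^ d * real (lam (I i)) + real (lam J') + real (lam ?A)"
    using J'(4) by (metis of_nat_add of_nat_le_iff of_nat_mult of_nat_power)
   hence "b (Suc i) <= (real p ^ d * real (lam (I i)) + real (lam J') + real (lam ?A)) / real p ^ (?e * d)"
    unfolding b_def add_Suc_right by (rule divide_right_mono) simp
   also have "\<dots> = b i + real (lam J') / real p ^ (?e * d) + real (lam ?A) / real p ^ (?e * d)"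
    using p_gt1 by (simp add: b_def add_divide_distrib power_add)
   also have "\<dots> <= b i + (C1 + C2) * real (p ^ Suc i) / real p ^ (?e * 2)"
    using A B by (simp add: add_divide_distrib distrib_right del: power_Suc mult_Suc)
   also have "real p ^ (?e * 2) = real p ^ (2 * e0) * real (p ^ Suc i) * real p ^ Suc i"
   proof -
    have "?e * 2 = 2 * e0 + Suc i + Suc i" by simp
    thus ?thesis by (simp only: power_add of_nat_power)
   qed
   also have "(C1 + C2) * real (p ^ Suc i) / (real p ^ (2 * e0) * real (p ^ Suc i) * real p ^ Suc i) = (C1 + C2) / real p ^ (2 * e0) * (1 / real p ^ Suc i)"
    using p_gt1 by simp
   also have "\<dots> <= (C1 + C2) / real p ^ (2 * e0) * (1 / real p ^ i - 1 / real p ^ Suc i)"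
   proof (rule mult_left_mono)
    show "1 / real p ^ Suc i <= 1 / real p ^ i - 1 / real p ^ Suc i" using p_gt1(2) pp[of i] by (simp add: divide_simps)
   qed (use C1 C2 in simp)
   finally show ?thesis by simp
  qed
  have "b i <= b 0 + (C1 + C2) / real p ^ (2 * e0) * (1 - 1 / real p ^ i)" for i
  proof (induction i)
   case (Suc i)
   thus ?case using step[of i] by (simp add: right_diff_distrib)
  qed simp
  moreover have "(C1 + C2) / real p ^ (2 * e0) * (1 - 1 / real p ^ i) <= (C1 + C2) / real p ^ (2 * e0) * 1" for i
   by (rule mult_left_mono) (use C1 C2 in auto)
  ultimately have "b i <= b 0 + (C1 + C2) / real p ^ (2 * e0)" for i unfolding mult_1_right by (rule order_trans[OF _ add_left_mono])
  hence "sg ?t <= b 0 + (C1 + C2) / real p ^ (2 * e0)" using LIMSEQ_le_const2[OF lim] by blast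
  thus "sg ?t <= real (la e0 (?q0 - 1)) / real p ^ (e0 * d) + (C1 + C2) / real p ^ (2 * e0)" by (simp add: b_def I_def la_def)
 qed (use C1 C2 in simp)
qed

theorem sg_comparison:
 assumes A: "(%e. real (la e (p ^ e - 1)) / real p ^ (e * (d - 1))) \<longlonglongrightarrow> A"
 shows "sg 0 >= A & (sg 0 = A \<longleftrightarrow> (\<exists>c. \<forall>t\<in>{0..1}. sg t = c + (- sg 0) * t))"
proof (intro conjI iffI)
 show le: "A <= sg 0" using sg_lower[OF A, of 0] by simp
 show "\<exists>c. \<forall>t\<in>{0..1}. sg t = c + - sg 0 * t" if "sg 0 = A"
 proof (intro exI[of _ "sg 0"] ballI)
  fix t :: real assume "t \<in> {0..1}"
  hence "sg t = (1 - t) * sg 0" using sg_lower[OF A, of t] sg_upper[of t] that by auto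
  thus "sg t = sg 0 + - sg 0 * t" by (simp add: algebra_simps)
 qed
 assume "\<exists>c. \<forall>t\<in>{0..1}. sg t = c + - sg 0 * t"
 then obtain c where c: "\<forall>t\<in>{0..1}. sg t = c + - sg 0 * t" by blast
 have "c = sg 0" using c[rule_format, of 0] by simp
 have lin: "sg t = sg 0 * (1 - t)" if "0 <= t" "t <= 1" for t
  using c[rule_format, of t] that unfolding right_diff_distrib \<open>c = sg 0\<close> by simp
 obtain C :: real where C: "C >= 0"
  "!!e. sg (1 - 1 / real p ^ e) <= real (la e (p ^ e - 1)) / real p ^ (e * d) + C / real p ^ (2 * e)" using sg_near_1 by metis
 have "sg 0 <= real (la e (p ^ e - 1)) / real p ^ (e * (d - 1)) + C / real p ^ e" for e
 proof -
  have "sg (1 - 1 / real p ^ e) = sg 0 * (1 / real p ^ e)" using lin[of "1 - 1 / real p ^ e"] p_gt1 by simp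
  hence "sg 0 / real p ^ e * real p ^ e <= (real (la e (p ^ e - 1)) / real p ^ (e * d) + C / real p ^ (2 * e)) * real p ^ e"
   using C(2)[of e] by (intro mult_right_mono) auto
  moreover have "real p ^ (e * d) = real p ^ e * real p ^ (e * (d - 1))" using d_pos by (metis mult_Suc_right power_add)
  moreover have "real p ^ (2 * e) = real p ^ e * real p ^ e" by (simp add: power_add[symmetric] mult_2)
  ultimately show ?thesis using pp[of e] p_gt1 by (simp add: distrib_right)
 qed
 moreover have "(%e. real (la e (p ^ e - 1)) / real p ^ (e * (d - 1)) + C / real p ^ e) \<longlonglongrightarrow> A + 0" by (intro tendsto_add A null_geometric)
 ultimately have "sg 0 <= A" using LIMSEQ_le_const[of _ "A + 0" "sg 0"] by simp
 thus "sg 0 = A" using le by simp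
qed

end

section \<open>The residue ring at a height one prime\<close>

locale resid = nfdring p R m d for p :: nat and R m :: "'k::field set" and d :: nat +
 fixes P :: "'k set" and \<pi> :: "'k => 'l::field"
 assumes P: "ht1 P" and \<pi>: "residue_map R P \<pi>"
begin

abbreviation "A \<equiv> loc P"
abbreviation "M \<equiv> locm P"
abbreviation "D \<equiv> \<pi> ` R"

lemmas PP = ht1_prime[OF P]

sublocale A: fring p "ext R P R" "ext R P P" by (rule fring_loc[OF PP])

lemma R_A: "R <= A" by (rule ext_superset[OF R PP])

lemma \<pi>_add: "x \<in> A ==> y \<in> A ==> \<pi> (x + y) = \<pi> x + \<pi> y"
 and \<pi>_mult: "x \<in> A ==> y \<in> A ==> \<pi> (x * y) = \<pi> x * \<pi> y"
 and \<pi>_1: "\<pi> 1 = 1"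
 and \<pi>_ker: "x \<in> A ==> \<pi> x = 0 \<longleftrightarrow> x \<in> M"
 and \<pi>_surj: "\<exists>x\<in>A. \<pi> x = z"
proof -
 have h: "\<pi> \<in> Ring.ring_hom (ring_of A) (ring_of UNIV)" "\<pi> ` A = UNIV" "{x \<in> A. \<pi> x = 0} = M"
  using \<pi> by (simp_all add: residue_map_def localization_ext)
 show "x \<in> A ==> y \<in> A ==> \<pi> (x + y) = \<pi> x + \<pi> y" "x \<in> A ==> y \<in> A ==> \<pi> (x * y) = \<pi> x * \<pi> y" "\<pi> 1 = 1"
  using ring_hom_add[OF h(1), of x y] ring_hom_mult[OF h(1), of x y] ring_hom_one[OF h(1)] by auto
 show "x \<in> A ==> \<pi> x = 0 \<longleftrightarrow> x \<in> M" using h(3) by blast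
 have "z \<in> \<pi> ` A" using h(2) by simp
 thus "\<exists>x\<in>A. \<pi> x = z" by blast
qed

lemma \<pi>_0: "\<pi> 0 = 0" using \<pi>_ker[OF A.Rs(2)] smodD(1)[OF A.m(1)] by blast

lemma \<pi>_minus: "x \<in> A ==> \<pi> (- x) = - \<pi> x" using \<pi>_add[of x "- x"] A.Rs(5) \<pi>_0 by (simp add: eq_neg_iff_add_eq_0 add.commute)

lemma \<pi>_diff: "x \<in> A ==> y \<in> A ==> \<pi> (x - y) = \<pi> x - \<pi> y" using \<pi>_add[of x "- y"] \<pi>_minus[of y] A.Rs(5) by simp

lemma \<pi>_power: "x \<in> A ==> \<pi> (x ^ n) = \<pi> x ^ n" by (induction n) (auto simp: \<pi>_1 \<pi>_mult A.Rs(7))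

lemma \<pi>_sum: "(!!i. i \<in> I ==> f i \<in> A) ==> \<pi> (sum f I) = (\<Sum>i\<in>I. \<pi> (f i))"
proof (induction I rule: infinite_finite_induct)
 case (insert i I)
 thus ?case using \<pi>_add[of "f i" "sum f I"] subdom_sum[OF A.R, of I f] by auto
qed (auto simp: \<pi>_0)

lemma \<pi>_of_nat: "\<pi> (of_nat n) = of_nat n"
proof (induction n)
 case (Suc n)
 have "(of_nat n :: 'k) \<in> A" by (induction n) (auto simp: A.Rs)
 thus ?case using Suc \<pi>_add[of 1 "of_nat n"] A.Rs(1) \<pi>_1 by simp
qed (simp add: \<pi>_0)

lemma \<pi>_div: assumes "a \<in> A" "b \<in> A" "\<pi> b ~= 0" shows "a / b \<in> A" "\<pi> (a / b) = \<pi> a / \<pi> b"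
proof -
 have b: "1 / b \<in> A" "b ~= 0" using A.units[OF assms(2)] \<pi>_ker[OF assms(2)] assms(3) \<pi>_0 by auto
 thus a: "a / b \<in> A" using A.Rs(4)[OF assms(1) b(1)] by simp
 show "\<pi> (a / b) = \<pi> a / \<pi> b" using \<pi>_mult[OF a assms(2)] b assms(3) by (simp add: field_simps)
qed

lemma \<pi>R: "x \<in> R ==> y \<in> R ==> \<pi> (x + y) = \<pi> x + \<pi> y" "x \<in> R ==> y \<in> R ==> \<pi> (x - y) = \<pi> x - \<pi> y"
 "x \<in> R ==> y \<in> R ==> \<pi> (x * y) = \<pi> x * \<pi> y"
 using \<pi>_add[of x y] \<pi>_diff[of x y] \<pi>_mult[of x y] subsetD[OF R_A, of x] subsetD[OF R_A, of y] by simp_all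

lemma \<pi>_R: "x \<in> R ==> \<pi> x = 0 \<longleftrightarrow> x \<in> P" using \<pi>_ker[of x] R_A loc_Int[OF P] by blast

lemma \<pi>_frac: "\<exists>a\<in>R. \<exists>b\<in>R. b ~: P & y = \<pi> a / \<pi> b"
proof -
 obtain x where x: "x \<in> A" "\<pi> x = y" using \<pi>_surj by blast
 obtain a b where ab: "x = a / b" "a \<in> R" "b \<in> R" "b ~: P" using x(1) by (rule extE)
 hence "y = \<pi> a / \<pi> b" using \<pi>_div[of a b] R_A \<pi>_R x(2) by auto
 thus ?thesis using ab by blast
qed

lemma P_m: "P <= m" by (rule prime_le_m[OF PP])

text \<open>Ideals of the residue ring correspond to the ideals containing \<open>P\<close>, with the same lengths.\<close>

definition pre :: "'l set => 'k set" where "pre I = {x \<in> R. \<pi> x \<in> I}"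

lemma subdom_D: "subdom D" unfolding subdom_def
proof (intro conjI ballI)
 show "1 \<in> D" using \<pi>_1 Rs(1) by (metis imageI)
 fix x y assume "x \<in> D" "y \<in> D"
 then obtain a b where "a \<in> R" "b \<in> R" "x = \<pi> a" "y = \<pi> b" by blast
 thus "x - y \<in> D" "x * y \<in> D" using Rs(3,4)[of a b] by (simp_all flip: \<pi>R)
qed

lemma smod_image: assumes "smod R J" "J <= R" shows "smod D (\<pi> ` J)" unfolding smod_def
proof (intro conjI ballI)
 show "0 \<in> \<pi> ` J" using smodD(1)[OF assms(1)] \<pi>_0 by (metis imageI)
 fix x y assume "x \<in> \<pi> ` J" "y \<in> \<pi> ` J"
 then obtain a b where "a \<in> J" "b \<in> J" "x = \<pi> a" "y = \<pi> b" by blast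
 moreover from this have "a \<in> R" "b \<in> R" using assms(2) by blast+
 ultimately show "x + y \<in> \<pi> ` J" using smodD(2)[OF assms(1)] by (simp flip: \<pi>R)
next
 fix x y assume "x \<in> D" "y \<in> \<pi> ` J"
 then obtain a b where "a \<in> R" "b \<in> J" "x = \<pi> a" "y = \<pi> b" by blast
 moreover from this have "b \<in> R" using assms(2) by blast
 ultimately show "x * y \<in> \<pi> ` J" using smodD(3)[OF assms(1)] by (simp flip: \<pi>R)
qed

lemma smod_pre: assumes "smod D I" shows "smod R (pre I)" "P <= pre I" "pre I <= R"
proof -
 show "smod R (pre I)" unfolding smod_def
 proof (intro conjI ballI)
  show "0 \<in> pre I" using Rs(2) smodD(1)[OF assms] \<pi>_0 by (simp add: pre_def)
  show "x + y \<in> pre I" if "x \<in> pre I" "y \<in> pre I" for x y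
   using that Rs(6)[of x y] smodD(2)[OF assms, of "\<pi> x" "\<pi> y"] by (simp add: pre_def \<pi>R)
  show "x * y \<in> pre I" if "x \<in> R" "y \<in> pre I" for x y
   using that Rs(4)[of x y] smodD(3)[OF assms, of "\<pi> x" "\<pi> y"] by (simp add: pre_def \<pi>R)
 qed
 show "P <= pre I"
 proof
  fix x assume x: "x \<in> P"
  hence "x \<in> R" "\<pi> x = 0" using prime_inD(2)[OF PP] \<pi>_R[of x] by auto
  thus "x \<in> pre I" using smodD(1)[OF assms] by (simp add: pre_def)
 qed
qed (auto simp: pre_def)

lemma image_pre: "I <= D ==> \<pi> ` pre I = I" by (auto simp: pre_def)

lemma pre_image:
 assumes "smod R J" "J <= R" "P <= J" shows "pre (\<pi> ` J) = J"
proof (intro equalityI subsetI)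
 fix x assume "x \<in> pre (\<pi> ` J)"
 then obtain y where y: "x \<in> R" "y \<in> J" "\<pi> x = \<pi> y" by (auto simp: pre_def)
 hence "y \<in> R" using assms(2) by blast
 hence "x - y \<in> R" "\<pi> (x - y) = 0" using y Rs(3) by (auto simp: \<pi>R)
 hence "x - y \<in> J" using \<pi>_R assms(3) by blast
 thus "x \<in> J" using smodD(2)[OF assms(1) _ y(2), of "x - y"] by simp
next
 fix x assume "x \<in> J"
 thus "x \<in> pre (\<pi> ` J)" using assms(2) unfolding pre_def by blast
qed

lemma pre_mono: "I <= D ==> I' <= D ==> I < I' ==> pre I < pre I'"
proof (rule psubsetI)
 assume I: "I <= D" "I' <= D" "I < I'"
 show "pre I <= pre I'" using I(3) by (auto simp: pre_def)
 show "pre I ~= pre I'" using image_pre[OF I(1)] image_pre[OF I(2)] I(3) by (metis psubsetE)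
qed

lemma image_mono': "smod R J ==> J <= R ==> P <= J ==> smod R J' ==> J' <= R ==> P <= J' ==> J < J' ==> \<pi> ` J < \<pi> ` J'"
 using pre_image[of J] pre_image[of J'] by (metis image_mono psubset_eq)

lemma len_D:
 assumes J: "smod R J" "J <= R" "P <= J"
 shows "len D (\<pi> ` J) D = len R J R" unfolding len_def
proof (rule antisym)
 show "chain_sup (%I. smod D I & \<pi> ` J <= I & I <= D) <= chain_sup (%I. smod R I & J <= I & I <= R)"
 proof (rule chain_sup_map[of _ _ pre])
  show "smod R (pre I) & J <= pre I & pre I <= R" if "smod D I & \<pi> ` J <= I & I <= D" for I using smod_pre[of I] that J by (auto simp: pre_def)
  fix I I' assume "smod D I & \<pi> ` J <= I & I <= D" "smod D I' & \<pi> ` J <= I' & I' <= D" "I < I'"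
  thus "pre I < pre I'" by (intro pre_mono) auto
 qed
 show "chain_sup (%I. smod R I & J <= I & I <= R) <= chain_sup (%I. smod D I & \<pi> ` J <= I & I <= D)"
 proof (rule chain_sup_map[of _ _ "(`) \<pi>"])
  show "smod D (\<pi> ` I) & \<pi> ` J <= \<pi> ` I & \<pi> ` I <= D" if "smod R I & J <= I & I <= R" for I using smod_image that by blast
  fix I I' assume "smod R I & J <= I & I <= R" "smod R I' & J <= I' & I' <= R" "I < I'"
  thus "\<pi> ` I < \<pi> ` I'" using J(3) by (intro image_mono') auto
 qed
qed

lemma one_notin_image: "smod R J ==> J < R ==> P <= J ==> 1 ~: \<pi> ` J"
proof
 assume J: "smod R J" "J < R" "P <= J" and "1 \<in> \<pi> ` J"
 hence "1 \<in> pre (\<pi> ` J)" using \<pi>_1 Rs(1) by (simp add: pre_def)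
 hence "1 \<in> J" using pre_image[of J] J by auto
 thus False using one_in_imp[of J] J by blast
qed

lemma prime_pre: assumes "prime_in D I" shows "prime_in R (pre I)" unfolding prime_in_def
proof (intro conjI ballI impI)
 show "smod R (pre I)" by (rule smod_pre[OF prime_inD(1)[OF assms]])
 have "1 ~: pre I" using prime_one_notin[OF subdom_D assms] \<pi>_1 by (simp add: pre_def)
 thus "pre I < R" using Rs(1) by (auto simp: pre_def)
 fix x y assume xy: "x \<in> R" "y \<in> R" "x * y \<in> pre I"
 hence "\<pi> x * \<pi> y \<in> I" by (simp add: pre_def \<pi>R)
 thus "x \<in> pre I | y \<in> pre I" using prime_inD(4)[OF assms, of "\<pi> x" "\<pi> y"] xy by (auto simp: pre_def)
qed

lemma prime_image: assumes Q: "prime_in R Q" "P <= Q" shows "prime_in D (\<pi> ` Q)" unfolding prime_in_def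
proof (intro conjI ballI impI)
 note q = prime_inD(1,2)[OF Q(1)]
 show "smod D (\<pi> ` Q)" by (rule smod_image[OF q])
 have "1 ~: \<pi> ` Q" by (rule one_notin_image[OF q(1) _ Q(2)]) (use Q(1) in "auto simp: prime_in_def")
 thus "\<pi> ` Q < D" using q subdomD(1)[OF subdom_D] by blast
 fix x y assume "x \<in> D" "y \<in> D" "x * y \<in> \<pi> ` Q"
 then obtain a b where ab: "a \<in> R" "b \<in> R" "x = \<pi> a" "y = \<pi> b" "\<pi> a * \<pi> b \<in> \<pi> ` Q" by auto
 hence "\<pi> (a * b) \<in> \<pi> ` Q" by (simp add: \<pi>R)
 hence "a * b \<in> pre (\<pi> ` Q)" using Rs(4)[OF ab(1,2)] by (simp add: pre_def)
 hence "a * b \<in> Q" using pre_image[OF q Q(2)] by simp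
 thus "x \<in> \<pi> ` Q | y \<in> \<pi> ` Q" using prime_inD(4)[OF Q(1) ab(1,2)] ab by blast
qed

text \<open>The coheight of \<open>P\<close> is \<open>d-1\<close> because the degrees of residue fields over their p-th powers determine coheights, by
Kunz's formula.\<close>

lemma krull_dim_D: "krull_dim (ring_of D) = enat (d - 1)"
proof -
 have d: "d - 1 = coht R P" using coht_ht1[OF P] by simp
 show ?thesis unfolding krull_dim_prime_in[OF subdom_D] d
 proof (rule antisym)
  obtain C where C: "C 0 = P" "\<forall>i\<le>coht R P. prime_in R (C i)" "\<forall>i<coht R P. C i < C (Suc i)"
   using coht_attained[OF PP] by (auto simp: chain_from_def)
  have CP: "i <= coht R P ==> P <= C i" for i by (induction i) (use C in "auto simp: Suc_le_eq")
  have "chain (prime_in D) (coht R P)" unfolding chain_def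
  proof (intro exI[of _ "%i. \<pi> ` C i"] conjI allI impI)
   show "prime_in D (\<pi> ` C i)" if "i <= coht R P" for i using C(2) CP that by (intro prime_image) auto
   show "\<pi> ` C i < \<pi> ` C (Suc i)" if "i < coht R P" for i
    using C CP[of i] CP[of "Suc i"] that prime_inD(1,2)[of R "C i"] prime_inD(1,2)[of R "C (Suc i)"] by (intro image_mono') auto
  qed
  thus "enat (coht R P) <= chain_sup (prime_in D)" by (simp add: chain_sup_ge)
  show "chain_sup (prime_in D) <= enat (coht R P)"
  proof (rule chain_sup_leI)
   fix n assume "chain (prime_in D) n"
   then obtain C where C: "\<forall>i\<le>n. prime_in D (C i)" "\<forall>i<n. C i < C (Suc i)" by (auto simp: chain_def)
   have "chain_from R (pre (C 0)) n" unfolding chain_from_def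
   proof (intro exI[of _ "%i. pre (C i)"] conjI allI impI)
    show "prime_in R (pre (C i))" if "i <= n" for i using C that prime_pre by blast
    show "pre (C i) < pre (C (Suc i))" if "i < n" for i
     using C(1)[rule_format, of i] C(1)[rule_format, of "Suc i"] C(2) that prime_inD(2)[of D "C i"] prime_inD(2)[of D "C (Suc i)"] by (intro pre_mono) auto
   qed simp
   hence 1: "n <= coht R (pre (C 0))" by (rule coht_ge)
   have 0: "prime_in R (pre (C 0))" "P <= pre (C 0)" using C prime_pre smod_pre(2)[OF prime_inD(1)] by auto
   have "coht R (pre (C 0)) <= coht R P"
   proof (cases "P = pre (C 0)")
    case False
    thus ?thesis using coht_less[OF PP 0(1) psubsetI[OF 0(2) False]] by simp
   qed simp
   thus "enat n <= enat (coht R P)" using 1 by simp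
  qed
 qed
qed

sublocale L: pchar p "TYPE('l)"
proof
 have "of_nat p = (0::'l)" using \<pi>_of_nat[of p] \<pi>_0 char_p of_nat_CHAR[where 'a='k] by simp
 hence "CHAR('l) dvd p" by (simp add: of_nat_eq_0_iff_char_dvd)
 moreover have "CHAR('l) ~= 1" by simp
 ultimately show "CHAR('l) = p" using prime_p by (auto simp: prime_nat_iff)
qed (rule prime_p)

sublocale B: fdring p "\<pi> ` R" "\<pi> ` m" "d - 1"
proof
 show "subdom D" by (rule subdom_D)
 show "\<exists>a\<in>D. \<exists>b\<in>D. b ~= 0 & x = a / b" for x using \<pi>_frac[of x] \<pi>_R by blast
 show "noeth D" unfolding noeth_def
 proof (intro allI impI)
  fix F assume F: "F ~= {} & (\<forall>I\<in>F. smod D I & I <= D)"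
  have ne: "pre ` F ~= {}" using F by simp
  have sm: "smod R J & J <= R" if "J \<in> pre ` F" for J
  proof -
   from that obtain I where "J = pre I" "I \<in> F" by blast
   thus ?thesis using smod_pre(1,3)[of I] F by simp
  qed
  obtain J where J: "J \<in> pre ` F" "!!K. K \<in> pre ` F ==> ~ J < K" using noethD[OF noeth ne sm] by blast
  obtain I where I: "I \<in> F" "J = pre I" using J(1) by blast
  show "\<exists>I\<in>F. \<forall>J\<in>F. ~ I < J"
  proof (intro bexI[OF _ I(1)] ballI notI)
   fix I' assume I': "I' \<in> F" "I < I'"
   hence "J < pre I'" using pre_mono[of I I'] F I by simp
   thus False using J(2) I'(1) by blast
  qed
 qed
 show "smod D (\<pi> ` m)" by (rule smod_image) (use m in auto)
 show "\<pi> ` m < D" using one_notin_image[OF m P_m] subdomD(1)[OF subdom_D] m(2) by blast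
 fix x assume "x \<in> D" "x ~: \<pi> ` m"
 then obtain a where a: "a \<in> R" "a ~: m" "x = \<pi> a" by blast
 have "\<pi> a ~= 0" using a \<pi>_R P_m by blast
 hence "\<pi> (1 / a) = 1 / x" using \<pi>_div[of 1 a] a R_A A.Rs(1) \<pi>_1 by auto
 thus "1 / x \<in> D" using units[OF a(1,2)] by (metis imageI)
next
 obtain G where G: "finite G" "G <= R" "!!x. x \<in> R ==> \<exists>c. (\<forall>g\<in>G. c g \<in> R) & x = (\<Sum>g\<in>G. c g ^ p * g)"
  using ffin by blast
 show "\<exists>G. finite G & G <= D & (\<forall>x\<in>D. \<exists>c. (\<forall>g\<in>G. c g \<in> D) & x = (\<Sum>g\<in>G. c g ^ p * g))"
 proof (intro exI[of _ "\<pi> ` G"] conjI ballI)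
  fix x assume "x \<in> D"
  then obtain y where y: "y \<in> R" "x = \<pi> y" by blast
  obtain c where c: "\<forall>g\<in>G. c g \<in> R" "y = (\<Sum>g\<in>G. c g ^ p * g)" using G(3)[OF y(1)] by blast
  have "c g ^ p * g \<in> A & \<pi> (c g ^ p * g) = \<pi> (c g) ^ p * \<pi> g" if "g \<in> G" for g
  proof -
   have "c g \<in> A" "g \<in> A" using c(1) G(2) R_A that by auto
   thus ?thesis using A.Rs(4,7) by (simp add: \<pi>_mult \<pi>_power)
  qed
  hence "x = (\<Sum>g\<in>G. \<pi> (c g) ^ p * \<pi> g)" unfolding y(2) c(2) by (subst \<pi>_sum) auto
  also have "\<dots> = (\<Sum>g\<in>\<pi> ` G. (\<Sum>i\<in>{i\<in>G. \<pi> i = g}. \<pi> (c i)) ^ p * g)" by (rule L.sum_p_image[OF G(1)])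
  finally show "\<exists>c. (\<forall>g\<in>\<pi> ` G. c g \<in> D) & x = (\<Sum>g\<in>\<pi> ` G. c g ^ p * g)"
   using c(1) by (intro exI[of _ "%g. \<Sum>i\<in>{i\<in>G. \<pi> i = g}. \<pi> (c i)"] conjI ballI subdom_sum[OF subdom_D]) auto
 qed (use G in auto)
qed (rule krull_dim_D)

lemma cof_D: assumes "cof e J" "P <= J" shows "B.cof e (\<pi> ` J)" "B.lam (\<pi> ` J) = lam J"
proof -
 have "\<pi> x ^ p ^ e \<in> \<pi> ` J" if "x \<in> m" for x
  using cofD(3)[OF assms(1) that] \<pi>_power[of x "p ^ e"] that m(2) R_A by (metis imageI psubset_imp_subset subsetD)
 thus "B.cof e (\<pi> ` J)" unfolding B.cof_def using smod_image[OF cofD(1,2)[OF assms(1)]] cofD(2)[OF assms(1)] by auto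
 show "B.lam (\<pi> ` J) = lam J" unfolding B.lam_def lam_def using len_D[OF cofD(1,2)[OF assms(1)] assms(2)] by simp
qed

end

section \<open>Residues of traces\<close>

context resid
begin

lemma unit_A: "unit_in A a \<longleftrightarrow> a \<in> A & \<pi> a ~= 0"
proof
 assume "unit_in A a"
 hence a: "a \<in> A" "a ~= 0" "1 / a \<in> A" by (auto simp: unit_in_def)
 hence "\<pi> a * \<pi> (1 / a) = 1" using \<pi>_mult[of a "1 / a"] \<pi>_1 by simp
 thus "a \<in> A & \<pi> a ~= 0" using a by auto
next
 assume "a \<in> A & \<pi> a ~= 0"
 thus "unit_in A a" using A.units[of a] \<pi>_ker[of a] \<pi>_0 by (auto simp: unit_in_def)
qed

lemma M_uniformizer: "uniformizer R P t ==> x \<in> M \<longleftrightarrow> (\<exists>y\<in>A. x = t * y)"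
 by (auto simp: uniformizer_def localization_ext)

lemma uniformizer_A: "uniformizer R P t ==> t \<in> A & t ~= 0 & \<pi> t = 0"
 using M_uniformizer[of t t] A.Rs(1) A.m(2) \<pi>_ker[of t] uniformizer_nonzero[OF P, of t] by force

lemma der_M:
 assumes t: "uniformizer R P t" and dv: "der dv" "dv ` A <= A" "dv t \<in> M"
 shows "dv ` M <= M"
proof
 fix x assume "x \<in> dv ` M"
 then obtain z where z: "z \<in> M" "x = dv z" by blast
 then obtain y where y: "y \<in> A" "x = dv (t * y)" using M_uniformizer[OF t, of z] by auto
 have "dv y \<in> A" using dv(2) y(1) by blast
 hence "t * dv y \<in> M" using M_uniformizer[OF t] by blast
 thus "x \<in> M" unfolding y(2) der_mult[OF dv(1)] using smodD(2)[OF A.m(1)] smodD(3)[OF A.m(1) y(1) dv(3)] by blast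
qed

lemma N_M: "dv ` M <= M ==> f \<in> M ==> N dv f \<in> M"
proof -
 assume dv: "dv ` M <= M" and "f \<in> M"
 hence "(dv ^^ n) f \<in> M" for n by (induction n) auto
 thus ?thesis using smodD(3)[OF A.m(1) inverse_of_nat_mem[OF A.R, of "fact (p - 1)"]] unfolding N_def by fastforce
qed

text \<open>Some coordinate derivation takes a unit value at a uniformizer: otherwise the trace, from which all elements can be
 recovered, would map multiples of \<open>t\<close> to multiples of \<open>t\<close>, so that \<open>t\<close> would be divisible by \<open>t\<^sup>p\<close>.\<close>

lemma uniformizer_derivative:
 assumes t: "uniformizer R P t" and L: "lbasis A xs ds"
 shows "\<exists>k<length xs. unit_in A ((ds ! k) t)"
proof (rule ccontr)
 assume neg: "~ (\<exists>k<length xs. unit_in A ((ds ! k) t))"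
 have Du: "dual xs ds" and dA: "!!dv. dv \<in> set ds ==> dv ` A <= A" using L by (auto simp: lbasis_def)
 note tA = uniformizer_A[OF t]
 have dM: "dv ` M <= M" if "dv \<in> set ds" for dv
 proof (rule der_M[OF t dualD(3)[OF Du that] dA[OF that]])
  from that dualD(1)[OF Du] obtain k where "k < length xs" "dv = ds ! k" by (auto simp: in_set_conv_nth)
  moreover have "dv t \<in> A" using dA[OF that] tA by blast
  ultimately show "dv t \<in> M" using neg unit_A[of "dv t"] \<pi>_ker[of "dv t"] by auto
 qed
 have "f \<in> M ==> tau ds f \<in> M" for f using dM by (induction ds arbitrary: f) (auto simp: N_M)
 hence TM: "f \<in> M ==> Tr ds f \<in> M" for f
 proof -
  assume "f \<in> M" and tM: "!!f. f \<in> M ==> tau ds f \<in> M"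
  hence T: "Tr ds f ^ p \<in> M" using Tr_pow[OF Du] by simp
  hence TA: "Tr ds f \<in> A" using loc_pth_root[OF P] A.m(2) by blast
  show "Tr ds f \<in> M" using T prime_power_notin[OF A.R A.prime_m TA] by blast
 qed
 have xsA: "set xs <= A" using L by (simp add: lbasis_def)
 obtain G where G: "\<forall>l\<in>set G. fst l \<in> A & snd l \<in> A" "\<forall>f. f = (\<Sum>l\<leftarrow>G. (Tr ds ^^ 1) (fst l * f) ^ (p ^ 1) * snd l)"
  using Te_family[OF Du A.Rs(1,4) xsA, of 1] by blast
 have "vge P (\<Sum>l\<leftarrow>G'. (Tr ds ^^ 1) (fst l * t) ^ (p ^ 1) * snd l) (int p)" if "set G' <= set G" for G' using that
 proof (induction G')
  case (Cons l G')
  hence l: "fst l \<in> A" "snd l \<in> A" using G(1) by auto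
  have "t * fst l \<in> M" using M_uniformizer[OF t] l(1) by blast
  hence "vge P (Tr ds (fst l * t)) 1" unfolding vge_locm[OF P] using TM by (simp add: mult.commute)
  from vge_mult[OF P vge_power[OF P this, of p]] have "vge P (Tr ds (fst l * t) ^ p * snd l) (int p)" using vge_loc[OF P] l(2) by fastforce
  thus ?case using Cons vge_add[OF P] by simp
 qed simp
 from this[OF order_refl] have "vge P t (int p)" using G(2)[rule_format, of t] by simp
 thus False using ord_uniformizer[OF P t] tA p_gt1 by (auto simp: vge_def)
qed

lemma unit_shift: "unit_in A a ==> b \<in> A ==> ~ unit_in A b ==> unit_in A (b - a)" using \<pi>_diff[of b a] A.Rs(3) by (auto simp: unit_A)

text \<open>A derivation preserving \<open>A\<close> and its maximal ideal induces a derivation of the residue field.\<close>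

definition ind :: "('k => 'k) => 'l => 'l" where "ind dv y = \<pi> (dv (SOME x. x \<in> A & \<pi> x = y))"

lemma ind_\<pi>:
 assumes dv: "der dv" "dv ` A <= A" "dv ` M <= M" and x: "x \<in> A"
 shows "ind dv (\<pi> x) = \<pi> (dv x)"
proof -
 define y where "y = (SOME y. y \<in> A & \<pi> y = \<pi> x)"
 have y: "y \<in> A" "\<pi> y = \<pi> x" unfolding y_def using someI[of "%y. y \<in> A & \<pi> y = \<pi> x" x] x by auto
 have "y - x \<in> M" using \<pi>_ker[OF A.Rs(3)[OF y(1) x]] \<pi>_diff[OF y(1) x] y(2) by simp
 hence "dv (y - x) \<in> M" using dv(3) by blast
 moreover have "dv y \<in> A" "dv x \<in> A" using dv(2) x y by auto
 ultimately have "\<pi> (dv y) = \<pi> (dv x)" using \<pi>_ker[of "dv (y - x)"] der_diff[OF dv(1), of y x] \<pi>_diff[of "dv y" "dv x"] A.Rs(3) by auto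
 thus ?thesis by (simp add: ind_def y_def)
qed

lemma der_ind: assumes dv: "der dv" "dv ` A <= A" "dv ` M <= M" shows "der (ind dv)"
proof (rule derI)
 fix x y
 obtain a b where ab: "a \<in> A" "\<pi> a = x" "b \<in> A" "\<pi> b = y" using \<pi>_surj by metis
 have dab: "dv a \<in> A" "dv b \<in> A" using dv(2) ab by auto
 note i = ind_\<pi>[OF dv]
 show "ind dv (x + y) = ind dv x + ind dv y" using i[of "a + b"] i[OF ab(1)] i[OF ab(3)] ab dab by (simp add: A.Rs(6) \<pi>_add der_add[OF dv(1)])
 show "ind dv (x * y) = x * ind dv y + y * ind dv x"
  using i[of "a * b"] i[OF ab(1)] i[OF ab(3)] ab dab by (simp add: A.Rs(4) \<pi>_add \<pi>_mult der_mult[OF dv(1)])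
qed

lemma tail_M:
 assumes t: "uniformizer R P t" and L: "lbasis A (t # xs) (d0 # ds)" and dv: "dv \<in> set ds"
 shows "der dv" "dv ` A <= A" "dv ` M <= M"
proof -
 have Du: "dual (t # xs) (d0 # ds)" using L by (simp add: lbasis_def)
 show 1: "der dv" "dv ` A <= A" using L dv dualD(3)[OF Du] by (auto simp: lbasis_def)
 obtain i where i: "i < length xs" "dv = ds ! i" using dv dualD(1)[OF Du] by (auto simp: in_set_conv_nth)
 have "dv t = 0" using dualD(4)[OF Du, of "Suc i" 0] i by simp
 thus "dv ` M <= M" using der_M[OF t 1] smodD(1)[OF A.m(1)] by simp
qed

text \<open>An element of the valuation ring is a combination, with p-th powers as coefficients, of monomials in \<open>t\<close> and \<open>xs\<close>. So a
 derivation killing the residues of \<open>xs\<close> is zero.\<close>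

lemma residue_dual:
 assumes t: "uniformizer R P t" and L: "lbasis A (t # xs) (d0 # ds)"
 shows "L.dual (map \<pi> xs) (map ind ds)" unfolding L.dual_def
proof (intro conjI allI impI ballI)
 have Du: "dual (t # xs) (d0 # ds)" and xsA: "set (t # xs) <= A" using L by (auto simp: lbasis_def)
 have l: "length ds = length xs" using dualD(1)[OF Du] by simp
 thus "length (map ind ds) = length (map \<pi> xs)" by simp
 note tl = tail_M[OF t L]
 show "der dv" if "dv \<in> set (map ind ds)" for dv using that der_ind tl by auto
 show "(map ind ds ! i) (map \<pi> xs ! j) = (if i = j then 1 else 0)" if "i < length (map \<pi> xs)" "j < length (map \<pi> xs)" for i j
 proof -
  have "xs ! j \<in> A" "ds ! i \<in> set ds" using xsA that l by auto
  hence "(map ind ds ! i) (map \<pi> xs ! j) = \<pi> ((ds ! i) (xs ! j))" using that l ind_\<pi>[OF tl] by simp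
  thus ?thesis using dualD(4)[OF Du, of "Suc i" "Suc j"] that \<pi>_1 \<pi>_0 by simp
 qed
 fix de :: "'l => 'l" assume de: "der de" "\<forall>x\<in>set (map \<pi> xs). de x = 0"
 let ?B = "{b \<in> A. de (\<pi> b) = 0}"
 have 1: "1 \<in> ?B" using A.Rs(1) \<pi>_1 der_1[OF de(1)] by simp
 have 2: "a * b \<in> ?B" if "a \<in> ?B" "b \<in> ?B" for a b using that by (auto simp: \<pi>_mult der_mult[OF de(1)] A.Rs(4))
 have 3: "set (t # xs) <= ?B" using xsA de(2) uniformizer_A[OF t] der_0[OF de(1)] by auto
 obtain G where G: "\<forall>l\<in>set G. fst l \<in> ?B & snd l \<in> ?B"
  "\<forall>f. f = (\<Sum>l\<leftarrow>G. (Tr (d0 # ds) ^^ 1) (fst l * f) ^ (p ^ 1) * snd l)" using Te_family[OF Du 1 2 3, of 1] by blast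
 show "de = (%_. 0)"
 proof
  fix y
  obtain f where f: "f \<in> A" "\<pi> f = y" using \<pi>_surj by blast
  let ?h = "%l. (Tr (d0 # ds) ^^ 1) (fst l * f) ^ (p ^ 1) * snd l"
  have "sum_list (map ?h G') \<in> ?B" if "set G' <= set G" for G' using that
  proof (induction G')
   case Nil thus ?case using A.Rs(2) \<pi>_0 der_0[OF de(1)] by simp
  next
   case (Cons l G')
   hence lB: "fst l \<in> A" "snd l \<in> A" "de (\<pi> (snd l)) = 0" using G(1) by auto
   have T: "(Tr (d0 # ds) ^^ 1) (fst l * f) \<in> A" (is "?T \<in> A") by (rule Te_loc[OF P L]) (use A.Rs(4) lB f in blast)
   have h: "?h l \<in> A" using T lB A.Rs(4,7) by simp
   have "de (\<pi> (?h l)) = 0"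
    using \<pi>_mult[of "?T ^ p" "snd l"] \<pi>_power[OF T, of p] T lB A.Rs(7) L.der_pth[OF de(1), of "\<pi> ?T"] der_mult[OF de(1)] by simp
   moreover have IH: "sum_list (map ?h G') \<in> ?B" using Cons by simp
   ultimately show ?case using h by (simp add: \<pi>_add der_add[OF de(1)] A.Rs(6))
  qed
  from this[OF order_refl] have "f \<in> ?B" using G(2)[rule_format, of f] by simp
  thus "de y = 0" using f by simp
 qed
qed

text \<open>Modulo \<open>t\<close>, a derivation \<open>dv\<close> with \<open>dv t = 1\<close> satisfies \<open>dv\<^sup>k(t\<^sup>k f) = k! f\<close>. So multiplying by \<open>t\<^sup>p\<^sup>-\<^sup>1\<close> removes the
 uniformizer from the trace.\<close>

lemma der_power_uniformizer:
 assumes t: "uniformizer R P t" and dv: "der dv" "dv ` A <= A" "dv t = 1"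
 shows "f \<in> A ==> (dv ^^ k) (t ^ k * f) \<in> A & \<pi> ((dv ^^ k) (t ^ k * f)) = of_nat (fact k) * \<pi> f"
proof (induction k arbitrary: f)
 case (Suc k)
 note tA = uniformizer_A[OF t]
 have df: "dv f \<in> A" using dv(2) Suc(2) by blast
 have nA: "(of_nat n :: 'k) \<in> A" for n by (induction n) (auto simp: A.Rs)
 define g where "g = of_nat (Suc k) * f + t * dv f"
 have g: "g \<in> A" "\<pi> g = of_nat (Suc k) * \<pi> f"
  unfolding g_def using A.Rs(4,6) nA Suc(2) df tA by (auto simp: \<pi>_add \<pi>_mult \<pi>_of_nat simp del: of_nat_Suc)
 have "dv (t ^ Suc k * f) = t ^ k * g" unfolding g_def
  unfolding der_mult[OF dv(1)] der_power_Suc[OF dv(1), of t k] dv(3) by (simp add: algebra_simps del: of_nat_Suc)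
 hence "(dv ^^ Suc k) (t ^ Suc k * f) = (dv ^^ k) (t ^ k * g)" by (simp add: funpow_swap1)
 thus ?case using Suc.IH[OF g(1)] g(2) by (simp only:) (simp add: algebra_simps)
qed simp

lemma N_residue:
 assumes dv: "der dv" "dv ` A <= A" "dv ` M <= M" and f: "f \<in> A"
 shows "N dv f \<in> A" "\<pi> (N dv f) = L.N (ind dv) (\<pi> f)"
proof -
 have nA: "(of_nat n :: 'k) \<in> A" for n by (induction n) (auto simp: A.Rs)
 have i: "(dv ^^ n) f \<in> A & \<pi> ((dv ^^ n) f) = (ind dv ^^ n) (\<pi> f)" for n
 proof (induction n)
  case (Suc n)
  hence "(ind dv ^^ Suc n) (\<pi> f) = ind dv (\<pi> ((dv ^^ n) f))" by simp
  thus ?case using ind_\<pi>[OF dv, of "(dv ^^ n) f"] dv(2) Suc by auto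
 qed (use f in simp)
 show "N dv f \<in> A" "\<pi> (N dv f) = L.N (ind dv) (\<pi> f)"
  using \<pi>_div[of "(dv ^^ (p - 1)) f" "of_nat (fact (p - 1))"] i nA \<pi>_of_nat L.factp by (auto simp: N_def L.N_def)
qed

lemma residue_trace_step:
 assumes t: "uniformizer R P t" and L: "lbasis A (t # xs) (d0 # ds)" and f: "f \<in> A"
 shows "\<pi> (Tr (d0 # ds) (t ^ (p - 1) * f)) = L.Tr (map ind ds) (\<pi> f)"
proof -
 have Du: "dual (t # xs) (d0 # ds)" using L by (simp add: lbasis_def)
 note tl = tail_M[OF t L]
 have d0: "der d0" "d0 ` A <= A" "d0 t = 1" using L dualD(3)[OF Du] dualD(4)[OF Du, of 0 0] by (auto simp: lbasis_def)
 have nA: "(of_nat n :: 'k) \<in> A" for n by (induction n) (auto simp: A.Rs)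
 let ?g = "N d0 (t ^ (p - 1) * f)"
 have g: "?g \<in> A" "\<pi> ?g = \<pi> f"
  using der_power_uniformizer[OF t d0 f, of "p - 1"] \<pi>_div[of "(d0 ^^ (p - 1)) (t ^ (p - 1) * f)" "of_nat (fact (p - 1))"]
   nA \<pi>_of_nat L.factp by (auto simp: N_def)
 have "g \<in> A ==> tau ds g \<in> A & \<pi> (tau ds g) = L.tau (map ind ds) (\<pi> g)" for g using tl
 proof (induction ds arbitrary: g)
  case (Cons dv ds)
  thus ?case using N_residue[of dv g] by simp
 qed simp
 from this[OF g(1)] have tau: "tau (d0 # ds) (t ^ (p - 1) * f) \<in> A" "\<pi> (tau (d0 # ds) (t ^ (p - 1) * f)) = L.tau (map ind ds) (\<pi> f)"
  using g(2) by auto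
 have "Tr (d0 # ds) (t ^ (p - 1) * f) \<in> A" using loc_pth_root[OF P] tau(1) Tr_pow[OF Du] by simp
 hence "\<pi> (Tr (d0 # ds) (t ^ (p - 1) * f)) ^ p = L.Tr (map ind ds) (\<pi> f) ^ p"
  using \<pi>_power Tr_pow[OF Du] tau(2) L.Tr_pow[OF residue_dual[OF t L]] by metis
 thus ?thesis by (simp only: L.finj)
qed

text \<open>Lifts of a differential basis of the residue field form, together with a uniformizer, a basis of the
 differentials at \<open>P\<close>.\<close>

text \<open>A basis at \<open>P\<close> is transformed by exchange, first to make \<open>t\<close> its initial element. If no later derivation took a unit value
 at the next \<open>y\<close>, the residue of \<open>y\<close> would be dependent on the previous ones.\<close>

lemma lift_basis:
 assumes t: "uniformizer R P t" and ys: "set ys <= A" "differential_basis (map \<pi> ys)"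
 shows "\<exists>d0 ds. lbasis A (t # ys) (d0 # ds)"
proof -
 obtain zs where zs: "L.dual (map \<pi> ys) zs" using ys(2) L.differential_basis_iff by blast
 obtain xs ds where L: "lbasis A xs ds" using loc_basis_exists[OF P] by blast
 note tA = uniformizer_A[OF t]
 have x1: "1 <= length xs" using uniformizer_derivative[OF t L] by auto
 have "\<exists>xs' ds'. reach A xs ds xs' ds' & take 1 xs' = take 1 [t]"
 proof (rule exchange[OF A.R unit_shift L, of "[t]" 0])
  fix xs' ds' k assume "lbasis A xs' ds'" "length xs' = length xs" "k < length [t]"
  thus "\<exists>j\<ge>k. j < length xs & unit_in A ((ds' ! j) ([t] ! k))" using uniformizer_derivative[OF t, of xs' ds'] by auto
 qed (use tA x1 in auto)
 then obtain xs1 ds1 where L1: "lbasis A xs1 ds1" "length xs1 = length xs" "take 1 xs1 = [t]" by (auto simp: reach_def)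
 hence h1: "take 1 xs1 = take 1 (t # ys)" by simp
 have split: "\<exists>d0 ds'. ds = d0 # ds'" if "lbasis A (t # xs) ds" for xs ds
  using that dualD(1)[of "t # xs" ds] by (cases ds) (auto simp: lbasis_def)
 have rd: "\<exists>d0 ds'. ds = d0 # ds' & L.dual (map \<pi> xs) (map ind ds') & length xs = length ys" if "lbasis A (t # xs) ds" for xs ds
 proof -
  from split[OF that] obtain d0 ds' where dv: "ds = d0 # ds'" by blast
  have "L.dual (map \<pi> xs) (map ind ds')" by (rule residue_dual[OF t that[unfolded dv]])
  thus ?thesis using dv L.dual_change(1)[OF _ zs] by fastforce
 qed
 obtain x1' where x1': "xs1 = t # x1'" using L1(3) by (cases xs1) auto
 hence len: "length xs1 = length (t # ys)" using rd[of x1' ds1] L1(1) by auto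
 have "\<exists>xs' ds'. reach A xs1 ds1 xs' ds' & take (length (t # ys)) xs' = take (length (t # ys)) (t # ys)"
 proof (rule exchange[OF A.R unit_shift L1(1) _ h1])
  fix xs' ds' k assume L': "lbasis A xs' ds'" "length xs' = length xs1" and k: "1 <= k" "k < length (t # ys)" "k < length xs1"
   and tk: "take k xs' = take k (t # ys)"
  have xk: "xs' ! i = (t # ys) ! i" if "i < k" for i using tk that by (metis nth_take)
  obtain x' where x': "xs' = t # x'" using xk[of 0] k L'(2) by (cases xs') auto
  obtain d0 ds2 where dv: "ds' = d0 # ds2" "L.dual (map \<pi> x') (map ind ds2)" "length x' = length ys" using rd[of x' ds'] L'(1) x' by blast
  obtain k' where k': "k = Suc k'" "k' < length ys" using k by (cases k) auto
  let ?y = "ys ! k'"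
  have yA: "?y \<in> A" using ys(1) k'(2) by auto
  note tl = tail_M[OF t L'(1)[unfolded x' dv(1)]]
  have ld: "length ds2 = length ys" using L.dualD(1)[OF dv(2)] dv(3) by simp
  show "\<exists>j\<ge>k. j < length xs1 & unit_in A ((ds' ! j) ((t # ys) ! k))"
  proof (rule ccontr)
   assume neg: "~ (\<exists>j\<ge>k. j < length xs1 & unit_in A ((ds' ! j) ((t # ys) ! k)))"
   have z: "(map ind ds2 ! j) (\<pi> ?y) = 0" if "k' <= j" "j < length ys" for j
   proof -
    have dj: "ds2 ! j \<in> set ds2" using ld that by simp
    have "(ds2 ! j) ?y \<in> A" using tl(2)[OF dj] yA by blast
    moreover have "~ unit_in A ((ds2 ! j) ?y)" using neg[simplified, rule_format, of "Suc j"] that len k' dv(1) by simp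
    ultimately show ?thesis using ind_\<pi>[OF tl[OF dj] yA] that ld by (simp add: unit_A)
   qed
   let ?\<epsilon> = "zs ! k'"
   have e: "der ?\<epsilon>" using L.dualD(2)[OF zs] k' by simp
   have "?\<epsilon> (\<pi> ?y) = (\<Sum>i<length (map \<pi> x'). ?\<epsilon> (map \<pi> x' ! i) * (map ind ds2 ! i) (\<pi> ?y))"
    by (rule L.dual_expand[OF dv(2) e])
   also have "\<dots> = 0"
   proof (rule sum.neutral, intro ballI)
    fix i assume i: "i \<in> {..<length (map \<pi> x')}"
    show "?\<epsilon> (map \<pi> x' ! i) * (map ind ds2 ! i) (\<pi> ?y) = 0"
    proof (cases "i < k'")
     case True
     hence "x' ! i = ys ! i" using xk[of "Suc i"] k' x' by simp
     thus ?thesis using L.dualD(4)[OF zs, of k' i] k' True i by simp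
    next
     case False
     thus ?thesis using z[of i] i dv(3) by simp
    qed
   qed
   finally show False using L.dualD(4)[OF zs, of k' k'] k' by simp
  qed
 qed (use tA ys(1) len in auto)
 then obtain xs' ds' where "lbasis A xs' ds'" "length xs' = length (t # ys)" "take (length (t # ys)) xs' = t # ys" using len by (auto simp: reach_def)
 hence "lbasis A (t # ys) ds'" by simp
 thus ?thesis using split by blast
qed

text \<open>Since \<open>p\<^sup>e\<^sup>+\<^sup>1-1 = p(p\<^sup>e-1) + (p-1)\<close>, the factor \<open>t\<^sup>q\<^sup>-\<^sup>1\<close> is absorbed one level at a time. The form of \<open>t\<close> and \<open>ys\<close> has no zero or
 pole at \<open>P\<close>.\<close>

theorem residue_trace:
 assumes t: "uniformizer R P t" and ys: "set ys <= A" "differential_basis (map \<pi> ys)" and E: "dual (t # ys) es" and z: "L.dual (map \<pi> ys) zs"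
 shows "lbasis A (t # ys) es" "f \<in> A ==> \<pi> ((Tr es ^^ e) (t ^ (p ^ e - 1) * f)) = (L.Tr zs ^^ e) (\<pi> f)" "ord_dwedge R P (t # ys) = 0"
proof -
 obtain d0 ds where L0: "lbasis A (t # ys) (d0 # ds)" using lift_basis[OF t ys] by blast
 have es: "es = d0 # ds" by (rule dual_unique[OF E]) (use L0 in "simp add: lbasis_def")
 have zs: "zs = map ind ds" by (rule L.dual_unique[OF z residue_dual[OF t L0]])
 show L: "lbasis A (t # ys) es" using L0 es by simp
 show "ord_dwedge R P (t # ys) = 0" using ord_dwedge_eq[OF P L E] dwedge_self[OF E] ord_one[OF P] by simp
 note tA = uniformizer_A[OF t]
 show "f \<in> A ==> \<pi> ((Tr es ^^ e) (t ^ (p ^ e - 1) * f)) = (L.Tr zs ^^ e) (\<pi> f)"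
 proof (induction e arbitrary: f)
  case (Suc e)
  let ?g = "Tr es (t ^ (p - 1) * f)"
  have "t ^ (p - 1) * f \<in> A" using tA Suc(2) A.Rs(4,7) by blast
  hence g: "?g \<in> A" using Te_loc[OF P L, of _ 1] by simp
  have "p ^ Suc e - 1 = p * (p ^ e - 1) + (p - 1)"
  proof -
   obtain r where "p ^ e = Suc r" using p_gt1 by (cases "p ^ e") auto
   thus ?thesis using p_gt1 by (cases p) (auto simp: algebra_simps)
  qed
  hence "t ^ (p ^ Suc e - 1) * f = (t ^ (p ^ e - 1)) ^ p * (t ^ (p - 1) * f)"
   by (simp add: power_add power_mult[symmetric] mult.commute mult.left_commute)
  hence "Tr es (t ^ (p ^ Suc e - 1) * f) = t ^ (p ^ e - 1) * ?g" by (simp only: Tr_pmult[OF E])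
  hence "\<pi> ((Tr es ^^ Suc e) (t ^ (p ^ Suc e - 1) * f)) = (L.Tr zs ^^ e) (\<pi> ?g)"
   using Suc.IH[OF g] unfolding funpow_Suc_right comp_def by simp
  also have "\<pi> ?g = L.Tr zs (\<pi> f)" unfolding es zs by (rule residue_trace_step[OF t L0 Suc(2)])
  finally show ?case unfolding funpow_Suc_right comp_def .
 qed simp
qed

end

section \<open>Comparison of splitting ideals\<close>

text \<open>Ideals that a fixed nonzero element multiplies into each other have the same asymptotic length.\<close>

lemma (in fdring) ratio_transfer:
 assumes I: "!!e. cof e (I e)" and J: "!!e. cof e (J e)" and w: "w \<in> R" "w ~= 0"
  and IJ: "!!e x. x \<in> I e ==> x * w \<in> J e" and JI: "!!e x. x \<in> J e ==> x * w \<in> I e"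
  and lim: "(%e. real (lam (I e)) / real p ^ (e * d)) \<longlonglongrightarrow> l"
 shows "(%e. real (lam (J e)) / real p ^ (e * d)) \<longlonglongrightarrow> l"
proof -
 obtain C :: real where C: "C >= 0" "!!e J. cof e J ==> w \<in> J ==> real (lam J) * real p ^ e <= C * real p ^ (e * d)"
  using small_bound[OF w] by metis
 have one: "real (lam I) <= real (lam J) + C * real p ^ (e * d) / real p ^ e"
  if "cof e I" "cof e J" "!!x. x \<in> J ==> x * w \<in> I" for e I J
 proof -
  have "J <= {x \<in> R. x * w \<in> I}" using that(3) cofD(2)[OF that(2)] by blast
  hence "lam {x \<in> R. x * w \<in> I} <= lam J" by (rule lam_mono[OF that(2) cof_colon[OF that(1) w(1)]])
  hence "lam I <= lam J + lam (adj I w R)" using lam_colon[OF that(1) w(1)] by simp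
  moreover have "w \<in> adj I w R" by (rule adj_mem[OF smodD(1)[OF cofD(1)[OF that(1)]] Rs(1)])
  hence "real (lam (adj I w R)) <= C * real p ^ (e * d) / real p ^ e" using C(2)[OF cof_adj[OF that(1) w(1)]] p_gt1 by (simp add: pos_le_divide_eq)
  ultimately show ?thesis by linarith
 qed
 have "\<bar>real (lam (J e)) / real p ^ (e * d) - real (lam (I e)) / real p ^ (e * d)\<bar> <= C / real p ^ e" for e
 proof -
  have "\<bar>real (lam (J e)) - real (lam (I e))\<bar> <= C * real p ^ (e * d) / real p ^ e"
   using one[OF I J JI, of e] one[OF J I IJ, of e] by linarith
  hence "\<bar>real (lam (J e)) - real (lam (I e))\<bar> / real p ^ (e * d) <= C * real p ^ (e * d) / real p ^ e / real p ^ (e * d)"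
   by (rule divide_right_mono) simp
  thus ?thesis using p_gt1 by (simp add: abs_divide flip: diff_divide_distrib)
 qed
 hence "(%e. real (lam (J e)) / real p ^ (e * d) - real (lam (I e)) / real p ^ (e * d)) \<longlonglongrightarrow> 0" by (rule geometric_null)
 from tendsto_add[OF this lim] show ?thesis by simp
qed

text \<open>Bookkeeping for the rational divisor \<open>x = -(a - nb + nk)/n\<close>: replacing \<open>N/n\<close> by its integral part changes the multiple
 \<open>(N/n) a\<close> by at most \<open>|a|\<close>.\<close>

lemma round_bound:
 fixes x :: real and a b k :: int and N n :: nat
 assumes "n >= 1" "real n * x = - real_of_int (a - int n * b + int n * k)"
 defines "u \<equiv> N div n"
 shows "real_of_int (int N * b - int u * a) - \<bar>real_of_int a\<bar> <= real N * x + real N * real_of_int k"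
  "real N * x + real N * real_of_int k <= real_of_int (int N * b - int u * a) + \<bar>real_of_int a\<bar>"
  "int N * b - int u * a - \<bar>a\<bar> <= int N * k + \<lceil>real N * x\<rceil>"
  "int N * k + \<lceil>real N * x\<rceil> <= int N * b - int u * a + \<bar>a\<bar> + (if x = 0 then 0 else 1)"
proof -
 have N: "real N = real n * real u + real (N mod n)" unfolding u_def by (metis mult_div_mod_eq of_nat_add of_nat_mult)
 have xe: "x + real_of_int k = real_of_int b - real_of_int a / real n" using assms(1,2) by (simp add: field_simps)
 have "real N * x + real N * real_of_int k = real N * (real_of_int b - real_of_int a / real n)" by (simp only: xe flip: distrib_left)
 also have "\<dots> = real_of_int (int N * b - int u * a) - real (N mod n) / real n * real_of_int a" using assms(1) N by (simp add: field_simps)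
 finally have e: "real N * x + real N * real_of_int k = real_of_int (int N * b - int u * a) - real (N mod n) / real n * real_of_int a" .
 have "real (N mod n) / real n <= 1" using assms(1) by simp
 hence "\<bar>real (N mod n) / real n * real_of_int a\<bar> <= 1 * \<bar>real_of_int a\<bar>" unfolding abs_mult by (intro mult_right_mono) auto
 thus 1: "real_of_int (int N * b - int u * a) - \<bar>real_of_int a\<bar> <= real N * x + real N * real_of_int k"
  "real N * x + real N * real_of_int k <= real_of_int (int N * b - int u * a) + \<bar>real_of_int a\<bar>" using e by linarith+
 have "real_of_int (int N * b - int u * a - \<bar>a\<bar>) <= real_of_int (int N * k + \<lceil>real N * x\<rceil>)"
  using 1(1) le_of_int_ceiling[of "real N * x"] unfolding of_int_add of_int_diff of_int_mult of_int_abs of_int_of_nat_eq by linarith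
 thus "int N * b - int u * a - \<bar>a\<bar> <= int N * k + \<lceil>real N * x\<rceil>" by (simp only: of_int_le_iff)
 have "real_of_int \<lceil>real N * x\<rceil> < real N * x + (if x = 0 then 1 else 2)" by (auto, linarith)
 hence "real_of_int (int N * k + \<lceil>real N * x\<rceil>) < real_of_int (int N * b - int u * a + \<bar>a\<bar> + (if x = 0 then 0 else 1) + 1)"
  using 1(2) by (auto split: if_splits) 
 thus "int N * k + \<lceil>real N * x\<rceil> <= int N * b - int u * a + \<bar>a\<bar> + (if x = 0 then 0 else 1)" by (simp only: of_int_less_iff)
qed

context nring
begin

lemma ord_dwedge_change:
 assumes Q: "ht1 Q" and E: "dual ys es" "dual ys' es'"
 shows "ord_dwedge R Q ys' = ord_dwedge R Q ys + ord_at R Q (dwedge ys' es)"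
proof -
 obtain xs ds where L: "lbasis (loc Q) xs ds" using loc_basis_exists[OF Q] by blast
 have D: "dual xs ds" using L by (simp add: lbasis_def)
 note n = dual_change(1,2)[OF D E(1)] dual_change(1,2)[OF E(1) E(2)]
 have "dwedge ys' ds = dwedge ys ds * dwedge ys' es" by (rule dwedge_chain[OF E(1)]) (use n dualD(1,3)[OF D] in auto)
 thus ?thesis using ord_dwedge_eq[OF Q L E(1)] ord_dwedge_eq[OF Q L E(2)] ord_mult[OF Q n(2,4)] by simp
qed

text \<open>At almost all height one primes the p-basis and its dual derivations preserve the local ring.\<close>

lemma finite_ord_dwedge:
 assumes E: "dual ys es"
 shows "finite {Q. ht1 Q & ord_dwedge R Q ys ~= 0}"
proof -
 obtain G where G: "finite G" "G <= R" "!!x. x \<in> R ==> \<exists>c. (\<forall>g\<in>G. c g \<in> R) & x = (\<Sum>g\<in>G. c g ^ p * g)"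
  using ffin by blast
 let ?X = "set ys \<union> (\<Union>e\<in>set es. e ` G)"
 let ?B = "\<Union>x\<in>?X - {0}. {Q. ht1 Q & ord_at R Q x ~= 0}"
 have fB: "finite ?B" using G(1) finite_ord by auto
 have "ord_dwedge R Q ys = 0" if Q: "ht1 Q" "Q ~: ?B" for Q
 proof -
  interpret A: fring p "loc Q" "locm Q" by (rule fring_loc[OF ht1_prime[OF Q(1)]])
  have X: "x \<in> loc Q" if "x \<in> ?X" for x
  proof (cases "x = 0")
   case False
   hence "ord_at R Q x = 0" using Q that by blast
   thus ?thesis using mem_loc_iff[OF Q(1) False] by simp
  qed (use A.Rs(2) in simp)
  have "e x \<in> loc Q" if e: "e \<in> set es" and x: "x \<in> loc Q" for e x
  proof -
   have de: "der e" by (rule dualD(3)[OF E e])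
   have eR: "e y \<in> loc Q" if y: "y \<in> R" for y
   proof -
    obtain c where c: "\<forall>g\<in>G. c g \<in> R" "y = (\<Sum>g\<in>G. c g ^ p * g)" using G(3)[OF y] by blast
    have "e y = (\<Sum>g\<in>G. c g ^ p * e g)" unfolding c(2) der_sum[OF de] by (simp add: der_mult[OF de] der_pth[OF de])
    also have "\<dots> \<in> loc Q"
    proof (rule subdom_sum[OF A.R])
     fix g assume g: "g \<in> G"
     hence "c g ^ p \<in> loc Q" using c(1) Rs(7) ext_superset[OF R ht1_prime[OF Q(1)], of R] by blast
     moreover have "e g \<in> loc Q" by (rule X) (use e g in blast)
     ultimately show "c g ^ p * e g \<in> loc Q" by (rule A.Rs(4))
    qed
    finally show ?thesis .
   qed
   obtain a b where ab: "x = a / b" "a \<in> R" "b \<in> R" "b ~: Q" using x by (rule extE)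
   have b0: "b ~= 0" using ab ext_denom(1)[OF R ht1_prime[OF Q(1)]] by blast
   have "b ^ p = b * b ^ (p - 1)" using p_gt1 by (cases p) auto
   hence xe: "x = a * b ^ (p - 1) / b ^ p" using ab b0 by simp
   have eb: "e (y / b ^ p) = e y / b ^ p" for y by (rule der_divide_const[OF de der_pth[OF de]])
   have bp: "1 / b ^ p \<in> loc Q" using Rs(1,7) ab prime_power_notin[OF R ht1_prime[OF Q(1)]] by (intro extI) auto
   have "e (a * b ^ (p - 1)) \<in> loc Q" by (rule eR) (use ab Rs(4,7) in blast)
   from A.Rs(4)[OF this bp] show ?thesis unfolding xe eb by simp
  qed
  hence "lbasis (loc Q) ys es" using E X by (auto simp: lbasis_def)
  thus ?thesis using ord_dwedge_eq[OF Q(1) _ E] dwedge_self[OF E] ord_one[OF Q(1)] by simp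
 qed
 hence "{Q. ht1 Q & ord_dwedge R Q ys ~= 0} <= ?B" by blast
 thus ?thesis by (rule finite_subset[OF _ fB])
qed

lemma exists_order_bound:
 assumes "finite F" "!!Q. Q \<in> F ==> ht1 Q" "P = {0} | ht1 P & P ~: F"
 obtains w where "w \<in> R" "w ~: P" "!!Q. Q \<in> F ==> ord_at R Q w >= \<bar>ord_at R Q c\<bar> + 1"
proof -
 have "finite ((%Q. nat \<bar>ord_at R Q c\<bar>) ` F)" using assms(1) by simp
 then obtain M where M: "\<forall>n\<in>(%Q. nat \<bar>ord_at R Q c\<bar>) ` F. n <= M" unfolding finite_nat_set_iff_bounded_le ..
 obtain w where w: "w \<in> R" "w ~: P" "!!Q. Q \<in> F ==> ord_at R Q w >= int (Suc M)"
  using exists_high_order_nonzero[OF assms(1,2), of "Suc M"] exists_high_order[OF assms(1,2) _ _, of P "Suc M"] assms(3) by (metis singletonD)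
 show ?thesis
 proof (rule that[OF w(1,2)])
  fix Q assume Q: "Q \<in> F"
  hence "nat \<bar>ord_at R Q c\<bar> <= M" using M by blast
  thus "ord_at R Q w >= \<bar>ord_at R Q c\<bar> + 1" using w(3)[OF Q] by linarith
 qed
qed

end

lemma (in pchar) trace_nondegenerate:
 assumes D: "dual xs ds" and "!!y. Tr ds (y * a) = 0"
 shows "a = 0"
proof -
 obtain G where "\<forall>f. f = (\<Sum>l\<leftarrow>G. (Tr ds ^^ 1) (fst l * f) ^ (p ^ 1) * snd l)" using Te_family[OF D, of UNIV 1] by auto
 from spec[OF this, of a] show ?thesis using assms(2) p_gt1 by (simp add: fzero)
qed

section \<open>Adjunction\<close>

text \<open>The data defining the different: the section \<open>(c/t\<^sup>n)(dt \<and> dy)\<^sup>n\<close> generates the n-th power of the log canonical sheaf.\<close>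

locale adjun = resid p R m d P \<pi> for p :: nat and R m :: "'k::field set" and d :: nat and P and \<pi> :: "'k => 'l::field" +
 fixes \<Delta> :: "'k set => real" and f :: 'k and r :: nat and t c :: 'k and ys es zs and n :: nat
 assumes t: "uniformizer R P t" and ys: "set ys <= A" "differential_basis (map \<pi> ys)"
  and E: "dual (t # ys) es" and zs: "L.dual (map \<pi> ys) zs"
  and \<Delta>: "real_divisor R \<Delta>" "effective \<Delta>" and \<Delta>P: "\<Delta> P = 0"
  and f: "f ~= 0" and r: "r >= 1" and fr: "!!Q. ht1 Q ==> ord_at R Q f = (if Q = P then int r else 0)"
  and n: "n >= 1" and c: "c \<in> A" "c ~= 0"
  and form: "!!q. form_divisor R n (c / t ^ n) (t # ys) q = - real n * (prime_divisor P q + \<Delta> q)"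
begin

sublocale pring p R m d "t # ys" es P \<Delta> f r by unfold_locales (rule E P \<Delta> \<Delta>P f r fr | assumption)+

lemmas tA = uniformizer_A[OF t]

lemma form_ord:
 assumes "c' ~= 0" "t' ~= 0" "!!q. form_divisor R n' (c' / t' ^ n') ys' q = - real n' * (prime_divisor P q + \<Delta> q)" and Q: "ht1 Q"
 shows "real n' * (\<Delta> Q + prime_divisor P Q) = - real_of_int (ord_at R Q c' - int n' * ord_at R Q t' + int n' * ord_dwedge R Q ys')"
proof -
 have o: "ord_at R Q (c' / t' ^ n') = ord_at R Q c' - int n' * ord_at R Q t'"
  using ord_divide[OF Q assms(1), of "t' ^ n'"] ord_power[OF Q assms(2)] assms(2) by simp
 show ?thesis using assms(3)[of Q] Q unfolding form_divisor_def ht1_def o by (simp add: algebra_simps)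
qed

lemma \<pi>_c:
 assumes "c' \<in> A" "c' ~= 0" "uniformizer R P t'" "ord_dwedge R P ys' = 0" "!!q. form_divisor R n' (c' / t' ^ n') ys' q = - real n' * (prime_divisor P q + \<Delta> q)"
 shows "ord_at R P c' = 0" "\<pi> c' ~= 0"
proof -
 have "real n' = real n' - real_of_int (ord_at R P c')"
  using form_ord[OF assms(2) _ assms(5) P] ord_uniformizer[OF P assms(3)] uniformizer_nonzero[OF P assms(3)] \<Delta>P assms(4)
  by (simp add: prime_divisor_def)
 thus 1: "ord_at R P c' = 0" by simp
 thus "\<pi> c' ~= 0" using \<pi>_ker[OF assms(1)] mem_locm_iff[OF P assms(2)] by simp
qed

lemmas kkP = residue_trace(3)[OF t ys E zs]
lemmas cP = \<pi>_c[OF c t kkP form]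

text \<open>The different computed from the fixed choice of \<open>n\<close>, \<open>t\<close>, \<open>c\<close> and \<open>ys\<close>.\<close>

definition Diff :: "'l set => real" where "Diff = (%Q. - form_divisor D n (\<pi> c) (map \<pi> ys) Q / real n)"

abbreviation "qe e \<equiv> p ^ e - 1"
abbreviation "u e \<equiv> qe e div n"

text \<open>The generator of the n-th power determines the multipliers up to rounding: up to a factor independent of \<open>e\<close>, they are the
 multiples of \<open>t\<^sup>q\<^sup>-\<^sup>1/c\<^sup>u\<close> with \<open>u = \<lfloor>(q-1)/n\<rfloor>\<close>.\<close>

lemma sandwich:
 obtains w where "w \<in> R" "w ~: P" "!!e. w * t ^ qe e / c ^ u e \<in> H e (FF e (qe e))"
  "!!e h. h \<in> H e (FF e (qe e)) ==> w * h * c ^ u e / t ^ qe e \<in> R"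
proof -
 let ?F = "({Q. ht1 Q & ord_at R Q c ~= 0} \<union> {Q. \<Delta> Q ~= 0}) - {P}"
 have fF: "finite ?F" using finite_ord[OF c(2)] \<Delta>(1) by (auto simp: real_divisor_def)
 have hF: "ht1 Q" if "Q \<in> ?F" for Q using that \<Delta>(1) by (auto simp: real_divisor_def ht1_def)
 have PF: "P = {0} | ht1 P & P ~: ?F" using P by simp
 obtain w where w: "w \<in> R" "w ~: P" "!!Q. Q \<in> ?F ==> ord_at R Q w >= \<bar>ord_at R Q c\<bar> + 1"
  by (rule exists_order_bound[OF fF hF PF, of c]) (assumption | rule that)+
 have w0: "w ~= 0" "ord_at R P w = 0" using ord_R_notin[OF P w(1,2)] by auto
 have wQ: "ord_at R Q w >= \<bar>ord_at R Q c\<bar> + (if \<Delta> Q = 0 then 0 else 1)" if Q: "ht1 Q" "Q ~= P" for Q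
  using w(3)[of Q] ord_R[OF Q(1) w(1) w0(1)] Q by (cases "Q \<in> ?F") (auto split: if_splits)
 note t0 = conjunct1[OF conjunct2[OF tA]]
 have FQ: "FF e j Q = \<lceil>real (qe e) * \<Delta> Q\<rceil> + (if Q = P then int j else 0)" for e j Q
  using p_gt1 by (simp add: FF_def rnd_def of_nat_diff Suc_leI)
 have rb: "int N * ord_at R Q t - int (N div n) * ord_at R Q c - \<bar>ord_at R Q c\<bar> <= int N * kk Q + \<lceil>real N * \<Delta> Q\<rceil>"
  "int N * kk Q + \<lceil>real N * \<Delta> Q\<rceil> <= int N * ord_at R Q t - int (N div n) * ord_at R Q c + \<bar>ord_at R Q c\<bar> + (if \<Delta> Q = 0 then 0 else 1)"
  if "ht1 Q" "Q ~= P" for Q N by (rule round_bound(3,4)[OF n]; use form_ord[OF c(2) t0 form that(1)] that(2) in "simp add: prime_divisor_def")+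
 show ?thesis
 proof (rule that[OF w(1,2)])
  fix e
  show "w * t ^ qe e / c ^ u e \<in> H e (FF e (qe e))"
  proof (rule HI)
   fix Q assume Q: "ht1 Q"
   have o: "ord_at R Q (w * t ^ qe e / c ^ u e) = ord_at R Q w + int (qe e) * ord_at R Q t - int (u e) * ord_at R Q c"
    using ord_divide[OF Q, of "w * t ^ qe e" "c ^ u e"] ord_mult[OF Q w0(1), of "t ^ qe e"] ord_power[OF Q t0] ord_power[OF Q c(2)] w0 t0 c(2) by simp
   have "int (qe e) * kk Q + FF e (qe e) Q <= ord_at R Q (w * t ^ qe e / c ^ u e)"
    using rb(2)[OF Q, of "qe e"] wQ[OF Q] kkP cP(1) ord_uniformizer[OF P t] w0 \<Delta>P unfolding o FQ by (cases "Q = P") (auto split: if_splits)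
   thus "vge Q (w * t ^ qe e / c ^ u e) (int (qe e) * kk Q + FF e (qe e) Q)" by (simp add: vge_def)
  qed
  fix h assume h: "h \<in> H e (FF e (qe e))"
  show "w * h * c ^ u e / t ^ qe e \<in> R" unfolding mem_R_iff
  proof (intro allI impI)
   fix Q assume Q: "ht1 Q"
   let ?s = "w * c ^ u e / t ^ qe e"
   have s: "?s ~= 0" "ord_at R Q ?s = ord_at R Q w + int (u e) * ord_at R Q c - int (qe e) * ord_at R Q t"
    using ord_divide[OF Q, of "w * c ^ u e" "t ^ qe e"] ord_mult[OF Q w0(1), of "c ^ u e"] ord_power[OF Q t0] ord_power[OF Q c(2)] w0 t0 c(2) by auto
   have "0 <= ord_at R Q ?s + (int (qe e) * kk Q + FF e (qe e) Q)"
    using rb(1)[OF Q, of "qe e"] wQ[OF Q] kkP cP(1) ord_uniformizer[OF P t] w0 \<Delta>P unfolding s FQ by (cases "Q = P") (auto split: if_splits)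
   hence "vge Q (?s * h) 0" using vge_mono[OF vge_mult[OF Q vge_ord HmD[OF E h Q]]] by blast
   thus "vge Q (w * h * c ^ u e / t ^ qe e) 0" by (simp add: ac_simps)
  qed
 qed
qed

lemma residue_T: "x \<in> A ==> \<pi> (T e (t ^ qe e * x)) = (L.Tr zs ^^ e) (\<pi> x)" by (rule residue_trace(2)[OF t ys E zs])

abbreviation "JJ e \<equiv> \<pi> ` J e (qe e)"

lemma JJ: "B.cof e (JJ e)" "B.lam (JJ e) = la e (qe e)" using cof_D[OF cof_J P_J] by (auto simp: la_def)

lemma mem_JJ: "x \<in> R ==> (!!h. h \<in> H e (FF e (qe e)) ==> \<pi> (T e (h * x)) \<in> \<pi> ` m) ==> \<pi> x \<in> JJ e"
proof (rule imageI, unfold S_iff, intro conjI ballI)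
 fix h assume x: "x \<in> R" and a: "!!h. h \<in> H e (FF e (qe e)) ==> \<pi> (T e (h * x)) \<in> \<pi> ` m" and h: "h \<in> H e (FF e (qe e))"
 have "T e (h * x) \<in> R" by (rule H_R[OF eff_FF h x])
 hence "T e (h * x) \<in> pre (\<pi> ` m)" using a[OF h] by (simp add: pre_def)
 thus "T e (h * x) \<in> m" using pre_image[OF m(1) _ P_m] m(2) by auto
qed

lemma H_divided: "h \<in> H e (FF e (qe e)) ==> \<exists>g\<in>A. h = t ^ qe e * g"
proof -
 assume h: "h \<in> H e (FF e (qe e))"
 note t0 = conjunct1[OF conjunct2[OF tA]]
 have he: "h = t ^ qe e * (h / t ^ qe e)" using t0 by simp
 have "vge P h (int (qe e))" using HmD[OF E h P] kkP by (simp add: FF_def rnd_P)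
 hence "vge P (t ^ qe e * (h / t ^ qe e)) (int (qe e))" using he by simp
 hence "vge P (h / t ^ qe e) (int (qe e) - ord_at R P (t ^ qe e))" unfolding vge_scale[OF P power_not_zero[OF t0]] .
 hence "vge P (h / t ^ qe e) 0" unfolding ord_power[OF P t0] ord_uniformizer[OF P t] by simp
 thus ?thesis using he vge_loc[OF P] by blast
qed

text \<open>If the residue ring is not normal, its maps obtained from \<open>R\<close> preserve the conductor of an integral
 element, so the splitting ideals contain a fixed nonzero element.\<close>

lemma lim_not_normal:
 assumes "~ normal_domain D"
 shows "(%e. real (la e (qe e)) / real p ^ (e * (d - 1))) \<longlonglongrightarrow> 0"
proof -
 have "x \<in> integral_closure D" if "x \<in> D" for x unfolding integral_closure_def
  by (intro CollectI exI[of _ 1] exI[of _ "%_. - x"]) (use that B.Rs(5)[OF that] in simp)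
 then obtain x where x: "x \<in> integral_closure D" "x ~: D" using assms by (auto simp: normal_domain_def)
 obtain N a where a: "\<forall>i<N. a i \<in> D" "x ^ N + (\<Sum>i<N. a i * x ^ i) = 0" using x(1) by (auto simp: integral_closure_def)
 \<comment> \<open>The conductor of \<open>D[x]\<close>. A Frobenius linear map \<open>\<phi>\<close> of level \<open>e\<close> preserves it, as \<open>\<phi>(b)x\<^sup>i = \<phi>(bx\<^sup>i\<^sup>q)\<close>.\<close>
 define I where "I = {b \<in> D. \<forall>i. b * x ^ i \<in> D}"
 have "\<exists>b\<in>D. b ~= 0 & (\<forall>i<k. b * x ^ i \<in> D)" for k
 proof (induction k)
  case 0 thus ?case using B.Rs(1) by (intro bexI[of _ 1]) auto
 next
  case (Suc k)
  then obtain b where b: "b \<in> D" "b ~= 0" "\<forall>i<k. b * x ^ i \<in> D" by blast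
  obtain g h where gh: "g \<in> D" "h \<in> D" "h ~= 0" "x ^ k = g / h" using B.frac by blast
  have "b * h * x ^ i \<in> D" if "i < Suc k" for i
  proof (cases "i = k")
   case True thus ?thesis using gh b B.Rs(4) by simp
  next
   case False
   hence "h * (b * x ^ i) \<in> D" using B.Rs(4) gh b that by simp
   thus ?thesis by (simp add: ac_simps)
  qed
  thus ?case using b gh B.Rs(4) by (intro bexI[of _ "b * h"]) auto
 qed
 then obtain b where b: "b \<in> D" "b ~= 0" "\<forall>i<N. b * x ^ i \<in> D" by blast
 have "b * x ^ i \<in> D" for i
 proof (induction i rule: less_induct)
  case (less i)
  show ?case
  proof (cases "i < N")
   case False
   then obtain j where j: "i = N + j" using le_Suc_ex by (metis not_less)
   have "x ^ N = - (\<Sum>k<N. a k * x ^ k)" using a(2) by (simp add: eq_neg_iff_add_eq_0)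
   hence "b * x ^ i = - (\<Sum>k<N. a k * (b * x ^ (k + j)))" unfolding j power_add by (simp add: sum_distrib_left sum_distrib_right ac_simps)
   moreover have "(\<Sum>k<N. a k * (b * x ^ (k + j))) \<in> D" by (rule subdom_sum[OF subdom_D], rule B.Rs(4)) (use a(1) less j in auto)
   ultimately show ?thesis using B.Rs(5) by simp
  qed (use b in blast)
 qed
 hence bI: "b \<in> I" using b by (simp add: I_def)
 have sI: "smod D I" "I <= D" "1 ~: I" unfolding I_def smod_def
 proof (intro conjI ballI)
  show "1 ~: {b \<in> D. \<forall>i. b * x ^ i \<in> D}"
  proof
   assume "1 \<in> {b \<in> D. \<forall>i. b * x ^ i \<in> D}"
   hence "1 * x ^ 1 \<in> D" by blast
   thus False using x(2) by simp
  qed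
 qed (use B.Rs in "auto simp: distrib_right mult.assoc")
 have In: "I <= \<pi> ` m" by (rule B.proper_le_m[OF sI])
 obtain v where v: "v \<in> R" "b = \<pi> v" using b by blast
 have bJ: "b \<in> JJ e" for e unfolding v(2)
 proof (rule mem_JJ[OF v(1)])
  fix h assume h: "h \<in> H e (FF e (qe e))"
  obtain g where g: "g \<in> A" "h = t ^ qe e * g" using H_divided[OF h] by blast
  have hD: "(L.Tr zs ^^ e) (\<pi> g * y) \<in> D" if "y \<in> D" for y
  proof -
   from that obtain y' where y': "y' \<in> R" "y = \<pi> y'" by blast
   have "T e (h * y') \<in> R" by (rule H_R[OF eff_FF h y'(1)])
   moreover have "\<pi> (T e (h * y')) = (L.Tr zs ^^ e) (\<pi> g * y)"
    using residue_T[of "g * y'" e] g y' R_A A.Rs(4) \<pi>_mult[of g y'] by (auto simp: mult.assoc)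
   ultimately show ?thesis by (metis imageI)
  qed
  have "(L.Tr zs ^^ e) (\<pi> g * b) * x ^ i \<in> D" for i
  proof -
   have "b * x ^ (i * p ^ e) \<in> D" using bI by (simp add: I_def)
   from hD[OF this] show ?thesis using L.Te_qmult[OF zs, of e "x ^ i" "\<pi> g * b"] by (simp add: power_mult[symmetric] ac_simps)
  qed
  hence "(L.Tr zs ^^ e) (\<pi> g * b) \<in> I" unfolding I_def using hD[OF b(1)] by blast
  moreover have "\<pi> (T e (h * v)) = (L.Tr zs ^^ e) (\<pi> g * b)"
   using residue_T[of "g * v" e] g v R_A A.Rs(4) \<pi>_mult[of g v] by (auto simp: mult.assoc)
  ultimately show "\<pi> (T e (h * v)) \<in> \<pi> ` m" using In by auto
 qed
 obtain C :: real where C: "C >= 0" "!!e J. B.cof e J ==> b \<in> J ==> real (B.lam J) * real p ^ e <= C * real p ^ (e * (d - 1))"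
  using B.small_bound[OF b(1,2)] by metis
 show ?thesis
 proof (rule geometric_null[of _ C])
  fix e show "\<bar>real (la e (qe e)) / real p ^ (e * (d - 1))\<bar> <= C / real p ^ e"
  using C(2)[OF JJ(1)[of e] bJ[of e]] JJ(2)[of e] pp[of e] pp[of "e * (d - 1)"] by (simp add: field_simps)
 qed
qed

end

locale nadjun = adjun +
 assumes nD: "normal_domain (\<pi> ` R)"
begin

sublocale N: tring p "\<pi> ` R" "\<pi> ` m" "d - 1" "map \<pi> ys" zs by unfold_locales (use nD zs in "simp_all add: normal_domain_def")

lemma Diff_form: "N.ht1 Q ==> real n * Diff Q = - real_of_int (ord_at D Q (\<pi> c) - int n * 0 + int n * N.kk Q)"
 using n by (simp add: Diff_def form_divisor_def N.ht1_def)

lemma Diff_0: "~ N.ht1 Q ==> Diff Q = 0" by (simp add: Diff_def form_divisor_def N.ht1_def)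

lemma real_divisor_Diff: "real_divisor D Diff" unfolding real_divisor_def
proof (intro conjI allI impI)
 have "{Q. Diff Q ~= 0} <= {Q. N.ht1 Q & ord_at D Q (\<pi> c) ~= 0} \<union> {Q. N.ht1 Q & N.kk Q ~= 0}"
 proof
  fix Q assume Q: "Q \<in> {Q. Diff Q ~= 0}"
  hence "N.ht1 Q" using Diff_0 by blast
  thus "Q \<in> {Q. N.ht1 Q & ord_at D Q (\<pi> c) ~= 0} \<union> {Q. N.ht1 Q & N.kk Q ~= 0}" using Diff_form[of Q] Q n by auto
 qed
 thus "finite {Q. Diff Q ~= 0}" by (rule finite_subset) (use N.finite_ord[OF cP(2)] N.finite_ord_dwedge[OF zs] in simp)
 fix Q assume "Diff Q ~= 0"
 thus "height_one_prime D Q" using Diff_0[of Q] by (auto simp: N.ht1_def)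
qed

lemma \<pi>_cdiv: "x \<in> A ==> x / c ^ k \<in> A & \<pi> (x / c ^ k) = \<pi> x / \<pi> c ^ k"
 using \<pi>_div[of x "c ^ k"] \<pi>_power[OF c(1)] A.Rs(7)[OF c(1)] cP(2) by simp

text \<open>The multiplier \<open>wt\<^sup>q\<^sup>-\<^sup>1/c\<^sup>u\<close> induces a map of the residue ring, so its residue has the order of a section of the anticanonical
 multiple at every \<open>Q\<close>. For \<open>e \<rightarrow> \<infinity>\<close> the fixed factor \<open>w\<close> does not matter.\<close>

lemma effective_Diff: "effective Diff" unfolding effective_def
proof (intro allI, rule ccontr)
 fix Q assume neg: "~ Diff Q >= 0"
 hence Q: "N.ht1 Q" using Diff_0[of Q] by auto
 obtain w where w: "w \<in> R" "w ~: P" "!!e. w * t ^ qe e / c ^ u e \<in> H e (FF e (qe e))" using sandwich by metis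
 have wA: "w \<in> A" "\<pi> w ~= 0" using w R_A \<pi>_R by auto
 let ?o = "ord_at D Q (\<pi> c)" and ?K = "real_of_int (ord_at D Q (\<pi> w) + \<bar>ord_at D Q (\<pi> c)\<bar>)"
 have b: "real (qe e) * Diff Q >= - ?K" for e
 proof -
  have "\<pi> w / \<pi> c ^ u e \<in> N.H e (%_. 0)"
  proof (rule N.Hm_conv[OF zs])
   fix x assume "x \<in> div_module D (%_. 0)"
   hence "x \<in> D" unfolding N.div_module_iff[OF zs] N.mem_R_iff by simp
   then obtain y where y: "y \<in> R" "x = \<pi> y" by blast
   have "T e (w * t ^ qe e / c ^ u e * y) \<in> R" by (rule H_R[OF eff_FF w(3) y(1)])
   moreover have "w * t ^ qe e / c ^ u e * y = t ^ qe e * ((w * y) / c ^ u e)" by simp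
   moreover have wy: "w * y \<in> A" using wA y R_A A.Rs(4) by blast
   ultimately have "(L.Tr zs ^^ e) (\<pi> ((w * y) / c ^ u e)) \<in> D" using residue_T[of "(w * y) / c ^ u e" e] \<pi>_cdiv[OF wy, of "u e"] by (metis imageI)
   thus "(L.Tr zs ^^ e) (\<pi> w / \<pi> c ^ u e * x) \<in> D" using \<pi>_cdiv[OF wy, of "u e"] \<pi>R(3)[OF w(1) y(1)] y(2) by simp
  qed simp
  hence "N.vge Q (\<pi> w / \<pi> c ^ u e) (int (qe e) * N.kk Q + 0)" by (rule N.HmD[OF zs _ Q])
  hence "ord_at D Q (\<pi> w) - int (u e) * ?o >= int (qe e) * N.kk Q"
   using N.ord_divide[OF Q wA(2), of "\<pi> c ^ u e"] N.ord_power[OF Q cP(2)] wA cP(2) by (simp add: N.vge_def)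
  hence "real_of_int (ord_at D Q (\<pi> w) - int (u e) * ?o) >= real_of_int (int (qe e) * N.kk Q)" by (simp only: of_int_le_iff)
  thus ?thesis using round_bound(1)[OF n Diff_form[OF Q], of "qe e"] by simp
 qed
 obtain k :: nat where k: "?K < real k * (- Diff Q)" using reals_Archimedean3[of "- Diff Q"] neg by auto
 have "k < 2 ^ k" by simp
 also have "(2 :: nat) ^ k <= p ^ k" using p_gt1 by (intro power_mono) auto
 finally have "k <= qe k" by simp
 hence "real k <= real (qe k)" by (simp only: of_nat_le_iff)
 hence "real k * (- Diff Q) <= real (qe k) * (- Diff Q)" using neg by (intro mult_right_mono) auto
 thus False using k b[of k] by linarith
qed

text \<open>The splitting ideals of the different and the images of those at \<open>P\<close> differ by a fixed factor.\<close>

lemma lim_normal: "(%e. real (la e (qe e)) / real p ^ (e * (d - 1))) \<longlonglongrightarrow> F_signature p D Diff"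
proof -
 obtain w where w: "w \<in> R" "w ~: P" "!!e. w * t ^ qe e / c ^ u e \<in> H e (FF e (qe e))"
  "!!e h. h \<in> H e (FF e (qe e)) ==> w * h * c ^ u e / t ^ qe e \<in> R" using sandwich by metis
 have wA: "w \<in> A" "\<pi> w ~= 0" "\<pi> w \<in> D" using w R_A \<pi>_R by auto
 let ?o = "%Q. ord_at D Q (\<pi> c)"
 let ?F = "{Q. N.ht1 Q & ?o Q ~= 0} \<union> {Q. Diff Q ~= 0}"
 have fF: "finite ?F" using N.finite_ord[OF cP(2)] real_divisor_Diff by (auto simp: real_divisor_def)
 have hF: "N.ht1 Q" if "Q \<in> ?F" for Q using that Diff_0 by blast
 have PF: "X = {0} | N.ht1 X & X ~: ?F" if "X = {0}" for X using that by simp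
 obtain v where v: "v \<in> D" "v ~: {0}" "!!Q. Q \<in> ?F ==> ord_at D Q v >= \<bar>?o Q\<bar> + 1"
  by (rule N.exists_order_bound[OF fF hF PF[OF refl], of "\<pi> c"]) (assumption | rule that)+
 have v0: "v ~= 0" using v(2) by simp
 obtain v' where v': "v' \<in> R" "v = \<pi> v'" using v(1) by blast
 have vQ: "ord_at D Q v >= \<bar>?o Q\<bar> + (if Diff Q = 0 then 0 else 1)" if Q: "N.ht1 Q" for Q
  using v(3)[of Q] N.ord_R[OF Q v(1) v0] Q by (cases "Q \<in> ?F") (auto split: if_splits)
 have FQ: "N.rnd e Diff Q = \<lceil>real (qe e) * Diff Q\<rceil>" for e Q using p_gt1 by (simp add: N.rnd_def of_nat_diff Suc_leI)
 note rb = round_bound(3,4)[OF n Diff_form]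
 let ?I = "%e. N.S e (N.rnd e Diff)"
 have cI: "B.cof e (?I e)" for e by (rule N.S_cof[OF N.eff_rnd[OF effective_Diff]])
 have JI: "x * (\<pi> w * v) \<in> ?I e" if x: "x \<in> JJ e" for e x unfolding N.S_iff
 proof (intro conjI ballI)
  obtain y where y: "y \<in> J e (qe e)" "x = \<pi> y" using x by blast
  hence yR: "y \<in> R" using S_subset by blast
  thus "x * (\<pi> w * v) \<in> D" using y wA(3) v(1) B.Rs(4) by blast
  fix h assume h: "h \<in> N.H e (N.rnd e Diff)"
  have "v * h * \<pi> c ^ u e \<in> D" unfolding N.mem_R_iff
  proof (intro allI impI)
   fix Q assume Q: "N.ht1 Q"
   let ?s = "v * \<pi> c ^ u e"
   have s: "?s ~= 0" "ord_at D Q ?s = ord_at D Q v + int (u e) * ?o Q"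
    using N.ord_mult[OF Q v0, of "\<pi> c ^ u e"] N.ord_power[OF Q cP(2)] v0 cP(2) by auto
   have "0 <= ord_at D Q ?s + (int (qe e) * N.kk Q + N.rnd e Diff Q)" using rb(1)[OF Q, of "qe e"] vQ[OF Q] unfolding s FQ by (auto split: if_splits)
   hence "N.vge Q (?s * h) 0" using N.vge_mono[OF N.vge_mult[OF Q N.vge_ord N.HmD[OF zs h Q]]] by blast
   thus "N.vge Q (v * h * \<pi> c ^ u e) 0" by (simp add: ac_simps)
  qed
  then obtain a where a: "a \<in> R" "v * h * \<pi> c ^ u e = \<pi> a" by blast
  have "w * t ^ qe e / c ^ u e * a \<in> H e (FF e (qe e))" by (rule H_mult[OF w(3) a(1)])
  hence m1: "T e (w * t ^ qe e / c ^ u e * a * y) \<in> m" using y(1) unfolding S_iff by blast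
  have way: "w * a * y \<in> A" using wA a yR R_A A.Rs(4) by blast
  have "w * t ^ qe e / c ^ u e * a * y = t ^ qe e * ((w * a * y) / c ^ u e)" by simp
  hence "(L.Tr zs ^^ e) (\<pi> (w * a * y) / \<pi> c ^ u e) \<in> \<pi> ` m"
   using m1 residue_T[of "(w * a * y) / c ^ u e" e] \<pi>_cdiv[OF way, of "u e"] by (metis imageI)
  moreover have "\<pi> (w * a * y) / \<pi> c ^ u e = h * (x * (\<pi> w * v))" using w(1) a yR Rs(4) y(2) cP(2) by (simp add: \<pi>R(3) flip: a(2))
  ultimately show "(L.Tr zs ^^ e) (h * (x * (\<pi> w * v))) \<in> \<pi> ` m" by simp
 qed
 have IJ: "x * (\<pi> w * v) \<in> JJ e" if x: "x \<in> ?I e" for e x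
 proof -
  have "x \<in> D" using x N.S_subset by blast
  then obtain y where y: "y \<in> R" "x = \<pi> y" by blast
  have W: "y * (w * v') \<in> R" "\<pi> (y * (w * v')) = x * (\<pi> w * v)" using y w(1) v' Rs(4) by (auto simp: \<pi>R(3))
  show ?thesis unfolding W(2)[symmetric]
  proof (rule mem_JJ[OF W(1)])
   fix h assume h: "h \<in> H e (FF e (qe e))"
   note b = w(4)[OF h]
   let ?b = "w * h * c ^ u e / t ^ qe e"
   have "\<pi> ?b * v / \<pi> c ^ u e \<in> N.H e (N.rnd e Diff)"
   proof (rule N.HI)
    fix Q assume Q: "N.ht1 Q"
    let ?s = "v / \<pi> c ^ u e"
    have s: "?s ~= 0" "ord_at D Q ?s = ord_at D Q v - int (u e) * ?o Q"
     using N.ord_divide[OF Q v0, of "\<pi> c ^ u e"] N.ord_power[OF Q cP(2)] v0 cP(2) by auto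
    have "int (qe e) * N.kk Q + N.rnd e Diff Q <= ord_at D Q ?s + 0" using rb(2)[OF Q, of "qe e"] vQ[OF Q] unfolding s FQ by (auto split: if_splits)
    moreover have "N.vge Q (?s * \<pi> ?b) (ord_at D Q ?s + 0)" by (rule N.vge_mult[OF Q N.vge_ord N.vge_R[OF Q imageI[OF b]]])
    ultimately show "N.vge Q (\<pi> ?b * v / \<pi> c ^ u e) (int (qe e) * N.kk Q + N.rnd e Diff Q)" using N.vge_mono by (simp add: mult.commute)
   qed
   hence 1: "(L.Tr zs ^^ e) (\<pi> ?b * v / \<pi> c ^ u e * x) \<in> \<pi> ` m" using x unfolding N.S_iff by blast
   have bvy: "?b * v' * y \<in> R" using b v' y Rs(4) by blast
   have t0: "t ~= 0" using tA by blast
   have he: "h * (y * (w * v')) = t ^ qe e * ((?b * v' * y) / c ^ u e)" using t0 c(2) by simp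
   have "\<pi> ((?b * v' * y) / c ^ u e) = \<pi> ?b * v / \<pi> c ^ u e * x"
    using \<pi>_cdiv[of "?b * v' * y" "u e"] bvy R_A \<pi>R(3)[OF Rs(4)[OF b v'(1)] y(1)] \<pi>R(3)[OF b v'(1)] v'(2) y(2) by auto
   thus "\<pi> (T e (h * (y * (w * v')))) \<in> \<pi> ` m"
    unfolding he using 1 residue_T[of "(?b * v' * y) / c ^ u e" e] \<pi>_cdiv[of "?b * v' * y" "u e"] bvy R_A by auto
  qed
 qed
 have W: "\<pi> w * v \<in> D" "\<pi> w * v ~= 0" using B.Rs(4)[OF wA(3) v(1)] wA(2) v0 by auto
 have "(%e. real (B.lam (?I e)) / real p ^ (e * (d - 1))) \<longlonglongrightarrow> F_signature p D Diff"
  using N.F_signature_LIMSEQ[OF real_divisor_Diff effective_Diff] unfolding N.ratio_def .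
 from B.ratio_transfer[OF cI JJ(1) W IJ JI this] show ?thesis unfolding JJ(2) .
qed

text \<open>The different does not depend on the choices: two choices of a uniformizer and of a basis change the trace by
 \<open>p-1\<close>-st powers, which determine orders.\<close>

lemma different_eq: "different R \<Delta> P \<pi> = Diff" unfolding different_def
proof (rule the_equality, goal_cases)
 case 1
 have ic: "integral_closure D = D" using nD by (simp add: normal_domain_def)
 show ?case unfolding ic localization_ext Diff_def using n t c ys form by blast
next
 case (2 B)
 have ic: "integral_closure D = D" using nD by (simp add: normal_domain_def)
 from 2 obtain n' t' c' ys' where n': "n' >= 1" and t': "uniformizer R P t'" and c': "c' \<in> A" "c' ~= 0"
  and ys': "set ys' <= A" "differential_basis (map \<pi> ys')"
  and form': "!!q. form_divisor R n' (c' / t' ^ n') (t' # ys') q = - real n' * (prime_divisor P q + \<Delta> q)"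
  and B: "B = (%Q. - form_divisor D n' (\<pi> c') (map \<pi> ys') Q / real n')" unfolding ic localization_ext by blast
 obtain es' where E': "dual (t' # ys') es'" using lift_basis[OF t' ys'] by (auto simp: lbasis_def)
 obtain zs' where zs': "L.dual (map \<pi> ys') zs'" using ys'(2) L.differential_basis_iff by blast
 note rt' = residue_trace[OF t' ys' E' zs']
 note cP' = \<pi>_c[OF c' t' rt'(3) form']
 have t0: "t ~= 0" "t' ~= 0" using tA uniformizer_A[OF t'] by auto
 define j where "j = dwedge (t' # ys') es"
 define jz where "jz = dwedge (map \<pi> ys') zs"
 have j0: "j ~= 0" unfolding j_def by (rule dual_change(2)[OF E E'])
 have jz0: "jz ~= 0" unfolding jz_def by (rule L.dual_change(2)[OF zs zs'])
 have jP: "ord_at R P j = 0" using ord_dwedge_change[OF P E E'] rt'(3) kkP by (simp add: j_def)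
 define v where "v = j * t / t'"
 have v0: "v ~= 0" using j0 t0 by (simp add: v_def)
 have "ord_at R P v = 0" unfolding v_def
  using ord_divide[OF P, of "j * t" t'] ord_mult[OF P j0 t0(1)] jP ord_uniformizer[OF P t] ord_uniformizer[OF P t'] j0 t0 by simp
 hence v: "v \<in> A" "\<pi> v ~= 0" using mem_loc_iff[OF P v0] mem_locm_iff[OF P v0] \<pi>_ker[of v] by auto
 have vp: "v ^ (p - 1) \<in> A" "\<pi> (v ^ (p - 1)) = \<pi> v ^ (p - 1)" using A.Rs(7)[OF v(1)] \<pi>_power[OF v(1)] by auto
 \<comment> \<open>Both sides describe the change of the trace of the residue field, once through \<open>P\<close> and once directly.\<close>
 have "1 / \<pi> v ^ (p - 1) - 1 / jz ^ (p - 1) = 0"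
 proof (rule L.trace_nondegenerate[OF zs])
  fix y
  obtain x where x: "x \<in> A" "\<pi> x = y" using \<pi>_surj by blast
  have xv: "x / v ^ (p - 1) \<in> A" "\<pi> (x / v ^ (p - 1)) = y / \<pi> v ^ (p - 1)" using \<pi>_div[OF x(1) vp(1)] vp(2) v(2) x(2) by auto
  have "L.Tr zs (y / jz ^ (p - 1)) = L.Tr zs' y" using L.Tr_change[OF zs zs', of 1 y] by (simp add: jz_def)
  also have "\<dots> = \<pi> (Tr es' (t' ^ (p - 1) * x))" using rt'(2)[OF x(1), of 1] x(2) by simp
  also have "Tr es' (t' ^ (p - 1) * x) = Tr es (t' ^ (p - 1) * x / j ^ (p - 1))" using Tr_change[OF E E', of 1 "t' ^ (p - 1) * x"] by (simp add: j_def)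
  also have "t' ^ (p - 1) * x / j ^ (p - 1) = t ^ (p - 1) * (x / v ^ (p - 1))" using j0 t0 by (simp add: v_def power_mult_distrib power_divide)
  also have "\<pi> (Tr es \<dots>) = L.Tr zs (y / \<pi> v ^ (p - 1))" using residue_T[OF xv(1), of 1] xv(2) by simp
  finally have e: "L.Tr zs (y / jz ^ (p - 1)) = L.Tr zs (y / \<pi> v ^ (p - 1))" .
  have "y * (1 / \<pi> v ^ (p - 1) - 1 / jz ^ (p - 1)) + y / jz ^ (p - 1) = y / \<pi> v ^ (p - 1)" by (simp add: right_diff_distrib)
  from this[symmetric] e show "L.Tr zs (y * (1 / \<pi> v ^ (p - 1) - 1 / jz ^ (p - 1))) = 0"
   using L.Tr_add[OF zs, of "y * (1 / \<pi> v ^ (p - 1) - 1 / jz ^ (p - 1))" "y / jz ^ (p - 1)"] by simp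
 qed
 hence vj: "\<pi> v ^ (p - 1) = jz ^ (p - 1)" using v(2) jz0 by (simp add: field_simps)
 define a where "a = c ^ n'"
 define b where "b = c' ^ n * v ^ (n * n')"
 have ab: "a \<in> A" "b \<in> A" "a ~= 0" "b ~= 0" "\<pi> a = \<pi> c ^ n'" "\<pi> b = \<pi> c' ^ n * \<pi> v ^ (n * n')"
  unfolding a_def b_def using A.Rs(4,7) c c' v v0 by (auto simp: \<pi>_mult \<pi>_power)
 have ord_ab: "ord_at R Q a = ord_at R Q b" if Q: "ht1 Q" for Q
 proof -
  have ov: "ord_at R Q v = ord_at R Q j + ord_at R Q t - ord_at R Q t'" unfolding v_def
   using ord_divide[OF Q, of "j * t" t'] ord_mult[OF Q j0 t0(1)] j0 t0 by simp
  have oa: "ord_at R Q a = int n' * ord_at R Q c" unfolding a_def by (rule ord_power[OF Q c(2)])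
  have ob: "ord_at R Q b = int n * ord_at R Q c' + int (n * n') * (ord_at R Q j + ord_at R Q t - ord_at R Q t')" unfolding b_def
   using ord_mult[OF Q, of "c' ^ n" "v ^ (n * n')"] ord_power[OF Q c'(2)] ord_power[OF Q v0] c'(2) v0 ov by simp
  note F = form_ord[OF c(2) t0(1) form Q] form_ord[OF c'(2) t0(2) form' Q, unfolded ord_dwedge_change[OF Q E E', folded j_def]]
  have "real n' * (real n * (\<Delta> Q + prime_divisor P Q)) = real n * (real n' * (\<Delta> Q + prime_divisor P Q))" by simp
  hence "real_of_int (ord_at R Q a) = real_of_int (ord_at R Q b)" unfolding F oa ob by (simp add: algebra_simps)
  thus ?thesis by simp
 qed
 have "a / b \<in> R" "b / a \<in> R" unfolding mem_R_iff using ord_ab ord_divide[OF _ ab(3,4)] ord_divide[OF _ ab(4,3)] by (auto simp: vge_def)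
 hence u: "\<pi> (a / b) \<in> D" "\<pi> (b / a) \<in> D" by auto
 have ab0: "\<pi> a ~= 0" "\<pi> b ~= 0" using ab(5,6) cP(2) cP'(2) v(2) by auto
 have ord_\<pi>: "ord_at D Q (\<pi> a) = ord_at D Q (\<pi> b)" if Q: "N.ht1 Q" for Q
  using N.ord_R[OF Q u(1)] N.ord_R[OF Q u(2)] \<pi>_div[OF ab(1,2) ab0(2)] \<pi>_div[OF ab(2,1) ab0(1)]
   N.ord_divide[OF Q ab0] N.ord_divide[OF Q ab0(2,1)] ab0 by simp
 show "B = Diff"
 proof
  fix Q
  show "B Q = Diff Q"
  proof (cases "N.ht1 Q")
   case True
   have "int (p - 1) * ord_at D Q (\<pi> v) = int (p - 1) * ord_at D Q jz"
    using vj N.ord_power[OF True v(2), of "p - 1"] N.ord_power[OF True jz0, of "p - 1"] by simp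
   hence ov: "ord_at D Q (\<pi> v) = ord_at D Q jz" using p_gt1 by simp
   have "int n' * ord_at D Q (\<pi> c) = int n * ord_at D Q (\<pi> c') + int (n * n') * ord_at D Q jz"
    using ord_\<pi>[OF True] N.ord_mult[OF True, of "\<pi> c' ^ n" "\<pi> v ^ (n * n')"] N.ord_power[OF True cP(2)]
     N.ord_power[OF True cP'(2)] N.ord_power[OF True v(2)] cP'(2) v(2) unfolding ab(5,6) ov by simp
   hence "real_of_int (int n' * ord_at D Q (\<pi> c)) = real_of_int (int n * ord_at D Q (\<pi> c') + int (n * n') * ord_at D Q jz)" by (simp only:)
   hence "real n' * real_of_int (ord_at D Q (\<pi> c)) = real n * real_of_int (ord_at D Q (\<pi> c')) + real n * real n' * real_of_int (ord_at D Q jz)" by simp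
   hence "(real_of_int (ord_at D Q (\<pi> c')) + real n' * real_of_int (N.kk Q + ord_at D Q jz)) / real n'
    = (real_of_int (ord_at D Q (\<pi> c)) + real n * real_of_int (N.kk Q)) / real n" using n n' by (simp add: field_simps)
   thus ?thesis using True N.ord_dwedge_change[OF True zs zs', folded jz_def] by (simp add: B Diff_def form_divisor_def N.ht1_def)
  next
   case False
   thus ?thesis by (simp add: B Diff_def form_divisor_def N.ht1_def)
  qed
 qed
qed

end

lemma (in adjun) comparison:
 "F_signature p R \<Delta> >= F_signature_different p R \<Delta> P \<pi> &
  (F_signature p R \<Delta> = F_signature_different p R \<Delta> P \<pi> \<longleftrightarrow>
   (\<exists>c. \<forall>t\<in>{0..1::real}.
    F_signature p R (%q. \<Delta> q + t * prime_divisor P q) = c + (- F_signature p R \<Delta>) * t))"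
proof -
 have "(%e. real (la e (qe e)) / real p ^ (e * (d - 1))) \<longlonglongrightarrow> F_signature_different p R \<Delta> P \<pi>"
 proof (cases "normal_domain D")
  case True
  interpret nadjun p R m d P \<pi> \<Delta> f r t c ys es zs n by unfold_locales (rule True)
  show ?thesis using lim_normal True by (simp add: F_signature_different_def different_eq)
 qed (use lim_not_normal in "simp add: F_signature_different_def")
 from sg_comparison[OF this] show ?thesis by (simp add: sg_def)
qed

context resid
begin

lemma Cartier_function:
 assumes "Cartier R F"
 obtains g where "g ~= 0" "!!Q. ht1 Q ==> F Q = of_int (ord_at R Q g)"
proof -
 have "primeideal m (ring_of R)" using prime_m primeideal_ring_of[OF R] by blast
 then obtain g where "g ~= 0" "\<forall>q. height_one_prime R q & q <= m --> F q = of_int (ord_at R q g)" using assms unfolding Cartier_def by blast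
 thus ?thesis using that[of g] prime_le_m[OF ht1_prime] by (auto simp: ht1_def)
qed

lemma adjunction_data:
 assumes \<Delta>: "real_divisor R \<Delta>" "effective \<Delta>" "\<Delta> P = 0" and PC: "Q_Cartier R (prime_divisor P)"
  and G: "log_Q_Gorenstein R (%q. \<Delta> q + prime_divisor P q)"
 shows "\<exists>f r t c ys es zs n. adjun p R m d P \<pi> \<Delta> f r t c ys es zs n"
proof -
 obtain r where r: "r >= 1" "Cartier R (%q. real r * prime_divisor P q)" using PC by (auto simp: Q_Cartier_def)
 obtain f where f: "f ~= 0" "!!Q. ht1 Q ==> real r * prime_divisor P Q = of_int (ord_at R Q f)" by (rule Cartier_function[OF r(2)]) (assumption | rule that)+
 have fr: "ord_at R Q f = (if Q = P then int r else 0)" if "ht1 Q" for Q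
 proof -
  have "real_of_int (ord_at R Q f) = real_of_int (if Q = P then int r else 0)" using f(2)[OF that]
   unfolding prime_divisor_def by (cases "Q = P") (simp_all del: of_int_eq_iff of_int_eq_0_iff)
  thus ?thesis by (simp only: of_int_eq_iff)
 qed
 obtain a ys1 n where K: "a ~= 0" "differential_basis ys1" "n >= 1"
  "Cartier R (%q. real n * (form_divisor R 1 a ys1 q + (\<Delta> q + prime_divisor P q)))"
  using G by (auto simp: log_Q_Gorenstein_def canonical_divisor_def Q_Cartier_def)
 obtain g where g: "g ~= 0" "!!Q. ht1 Q ==> real n * (form_divisor R 1 a ys1 Q + (\<Delta> Q + prime_divisor P Q)) = of_int (ord_at R Q g)"
  by (rule Cartier_function[OF K(4)]) (assumption | rule that)+
 obtain t where t: "uniformizer R P t" using ht1_uniformizer[OF P] by blast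
 obtain xs zs where zs: "L.dual xs zs" using B.dual_exists by blast
 define ys where "ys = map (%y. SOME x. x \<in> A & \<pi> x = y) xs"
 have s: "(SOME x. x \<in> A & \<pi> x = y) \<in> A & \<pi> (SOME x. x \<in> A & \<pi> x = y) = y" for y by (rule someI_ex) (use \<pi>_surj in blast)
 have ys: "set ys <= A" "map \<pi> ys = xs" unfolding ys_def using s by (auto simp: comp_def)
 hence bs: "differential_basis (map \<pi> ys)" using L.differential_basis_iff zs by blast
 have z: "L.dual (map \<pi> ys) zs" using ys zs by simp
 obtain es where E: "dual (t # ys) es" using lift_basis[OF t ys(1) bs] by (auto simp: lbasis_def)
 obtain es1 where E1: "dual ys1 es1" using K(2) differential_basis_iff by blast
 define j where "j = dwedge ys1 es"
 have j0: "j ~= 0" unfolding j_def by (rule dual_change(2)[OF E E1])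
 have t0: "t ~= 0" using uniformizer_A[OF t] by blast
 \<comment> \<open>The canonical divisor given by the form of \<open>a\<close> and \<open>ys1\<close> is rewritten in terms of \<open>t\<close> and \<open>ys\<close>; \<open>j\<close> is the Jacobian.\<close>
 define c where "c = t ^ n * (a ^ n * j ^ n / g)"
 have c0: "c ~= 0" "c / t ^ n = a ^ n * j ^ n / g" unfolding c_def using t0 K(1) j0 g(1) by auto
 have form: "form_divisor R n (c / t ^ n) (t # ys) Q = - real n * (prime_divisor P Q + \<Delta> Q)" for Q
 proof (cases "ht1 Q")
  case True
  have o: "ord_at R Q (a ^ n * j ^ n / g) = int n * ord_at R Q a + int n * ord_at R Q j - ord_at R Q g"
   using ord_divide[OF True, of "a ^ n * j ^ n" g] ord_mult[OF True, of "a ^ n" "j ^ n"] ord_power[OF True K(1)] ord_power[OF True j0] K(1) j0 g(1) by simp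
  show ?thesis using g(2)[OF True] True ord_dwedge_change[OF True E E1] unfolding c0(2) form_divisor_def o by (simp add: ht1_def j_def algebra_simps)
 next
  case False
  hence "\<Delta> Q = 0" "Q ~= P" using \<Delta>(1) P by (auto simp: real_divisor_def ht1_def)
  thus ?thesis using False by (simp add: form_divisor_def ht1_def prime_divisor_def)
 qed
 have "c \<in> A"
 proof -
  have "ord_at R P c = int n + ord_at R P (c / t ^ n)"
   using ord_mult[OF P, of "t ^ n" "c / t ^ n"] ord_power[OF P t0] ord_uniformizer[OF P t] t0 c0(1) by simp
  moreover have "real_of_int (ord_at R P (c / t ^ n)) = - real n"
   using form[of P] P \<Delta>(3) residue_trace(3)[OF t ys(1) bs E z] by (simp add: form_divisor_def ht1_def prime_divisor_def)
  ultimately show ?thesis using mem_loc_iff[OF P c0(1)] by linarith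
 qed
 hence "adjun p R m d P \<pi> \<Delta> f r t c ys es zs n" by unfold_locales (rule t ys bs E z \<Delta> f(1) r(1) fr K(3) c0(1) form | assumption)+
 thus ?thesis by blast
qed

end

theorem corollary1p2:
  fixes R :: "'k::field set" and \<Delta> :: "'k set \<Rightarrow> real" and P :: "'k set"
    and \<pi> :: "'k \<Rightarrow> 'l::field" and p d :: nat
  assumes "Factorial_Ring.prime p" and "CHAR('k) = p"
    and "noetherian_domain (ring_of R)" and "has_fraction_field_UNIV R"
    and "local_ring R" and "normal_domain R" and "F_finite p R"
    and "krull_dim (ring_of R) = enat d"
    and "Q_divisor R \<Delta>" and "effective \<Delta>"
    and "height_one_prime R P" and "Q_Cartier R (prime_divisor P)" and "\<Delta> P = 0"
    and "log_Q_Gorenstein R (\<lambda>q. \<Delta> q + prime_divisor P q)"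
    and "residue_map R P \<pi>"
  shows "F_signature p R \<Delta> \<ge> F_signature_different p R \<Delta> P \<pi> \<and>
    (F_signature p R \<Delta> = F_signature_different p R \<Delta> P \<pi> \<longleftrightarrow>
      (\<exists>c. \<forall>t\<in>{0..1::real}.
         F_signature p R (\<lambda>q. \<Delta> q + t * prime_divisor P q) = c + (- F_signature p R \<Delta>) * t))"
proof -
 have nr: "noetherian_ring (ring_of R)" "domain (ring_of R)" using assms(3) by (simp_all add: noetherian_domain_def)
 have R: "subdom R" by (rule ring_imp_subdom) (use nr(2) in "simp add: domain_def cring_def")
 have noeth: "noeth R" by (rule noetherian_imp_noeth[OF nr(1)])
 obtain m where m: "maximalideal m (ring_of R)" "!!M. maximalideal M (ring_of R) ==> M = m" using assms(5) by (auto simp: local_ring_def)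
 note Rs = subdomD[OF R]
 have mi: "smod R m" "m < R" using m(1) unfolding maximalideal_ring_of[OF R] by auto
 \<comment> \<open>A nonunit lies in a maximal proper ideal, hence in \<open>m\<close>.\<close>
 have units: "1 / x \<in> R" if x: "x \<in> R" "x ~: m" for x
 proof (rule ccontr)
  assume n: "1 / x ~: R"
  have x0: "x ~= 0" using x smodD(1)[OF mi(1)] by auto
  let ?F = "{I. smod R I & I < R & x \<in> I}"
  have z: "smod R {0}" "{0} <= R" using Rs by (auto simp: smod_def)
  have "1 ~: adj {0} x R"
  proof
   assume "1 \<in> adj {0} x R"
   then obtain a where "a \<in> R" "1 = a * x" by (auto simp: adj_def)
   thus False using n x0 nonzero_divide_eq_eq[of x 1 a] by simp
  qed
  hence "adj {0} x R \<in> ?F"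
   using smod_adj[OF z(1) subdom_smod[OF R], of x] adj_subset[OF subdom_smod[OF R] z(2) x(1)] adj_mem[of "{0}" R x] Rs(1) by auto
  hence ne: "?F ~= {}" by blast
  have sm: "smod R I & I <= R" if "I \<in> ?F" for I using that by blast
  obtain I where I: "I \<in> ?F" "!!J. J \<in> ?F ==> ~ I < J" using noethD[OF noeth ne sm] by blast
  have "maximalideal I (ring_of R)" unfolding maximalideal_ring_of[OF R]
  proof (intro conjI allI impI)
   fix J assume J: "smod R J & J <= R & I <= J"
   show "J = I | J = R"
   proof (cases "J = R")
    case False
    hence "J \<in> ?F" using J I(1) by blast
    thus ?thesis using I(2) J by blast
   qed simp
  qed (use I(1) in auto)
  thus False using m(2) I(1) x(2) by blast
 qed
 have frac: "\<exists>a\<in>R. \<exists>b\<in>R. b ~= 0 & x = a / b" for x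
 proof -
  have "x \<in> localization R {0}" using assms(4) by (simp add: has_fraction_field_UNIV_def)
  thus ?thesis by (auto simp: localization_def)
 qed
 interpret nfdring p R m d
 proof
  obtain G where "finite G" "G <= R" "\<forall>x\<in>R. \<exists>c. c ` G <= R & x = (\<Sum>g\<in>G. c g ^ p * g)" using assms(7) by (auto simp: F_finite_def)
  thus "\<exists>G. finite G & G <= R & (\<forall>x\<in>R. \<exists>c. (\<forall>g\<in>G. c g \<in> R) & x = (\<Sum>g\<in>G. c g ^ p * g))"
   by (intro exI[of _ G]) (simp add: image_subset_iff)
  show "integral_closure R = R" using assms(6) by (simp add: normal_domain_def)
 qed (rule assms R frac noeth mi units | assumption)+
 interpret resid p R m d P \<pi> by unfold_locales (simp_all add: ht1_def assms)
 have "real_divisor R \<Delta>" using assms(9) by (simp add: Q_divisor_def)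
 from adjunction_data[OF this assms(10,13,12,14)] obtain f r t c ys es zs n where "adjun p R m d P \<pi> \<Delta> f r t c ys es zs n" by blast
 thus ?thesis by (rule adjun.comparison)
qed

end
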